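(* Suppose $E$ is a Neumann interior weight on $\Omega$, with associated set $K$. (i) For $u\in C_c^{0,1}(\overline\Omega\setminus K)$ and $v:=E^{-1/2}u$ we have $$\int_\Omega|\nabla u|_A^2\,dx+\frac12\int_\Omega u^2\,dx\ \ge\ \frac14\int_\Omega\frac{|\nabla E|_A^2}{E^2}u^2\,dx+\int_\Omega E|\nabla v|_A^2\,dx.$$ (ii) The inequality $$\int_\Omega|\nabla u|_A^2\,dx+\frac12\int_\Omega u^2\,dx\ \ge\ \frac14\int_\Omega\frac{|\nabla E|_A^2}{E^2}u^2\,dx$$ holds for all $u\in H^1(\Omega)$. Moreover $\frac14$ and $\frac12$ are optimal in the sense that if one fixes $\frac14$ then $\frac12$ cannot be replaced by a smaller constant, and if one fixes $\frac12$ then $\frac14$ cannot be replaced by a larger constant. Also the inequality is not attained (equality does not hold for any nonzero $u\in H^1(\Omega)$).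
   Context: $\Omega\subset\mathbb{R}^n$ is a bounded connected domain with smooth boundary. $A(x)=(a^{i,j}(x))$ is an $n\times n$ symmetric, uniformly positive definite matrix with $a^{i,j}\in C^\infty(\overline\Omega)$. For $\xi\in\mathbb{R}^n$, $|\xi|_A^2:=A(x)\xi\cdot\xi$, and $\mathcal L_A(E):=-\mathrm{div}(A\nabla E)$ (in the distributional sense). $E$ is called a Neumann interior weight on $\Omega$ if there exists some compact $K\subset\Omega$ with $\dim_{box}(K)<n-2$ such that $E\in C^\infty(\overline\Omega\setminus K)$, $\inf_\Omega E>0$, $\mathcal L_A(E)+E$ is a nonnegative nonzero measure $\mu$ whose support is $K$, $E=\infty$ on $K$, and $A\nabla E\cdot\nu=0$ on $\partial\Omega$, where $\nu(x)$ denotes the outward normal vector at $x\in\partial\Omega$. For compact $K\subset\mathbb{R}^n$, $\dim_{box}(K):=n-\lim_{r\searrow0}\frac{\log(\mathcal H^n(K_r))}{\log r}$ provided the limit exists, where $K_r:=\{x\in\Omega:\mathrm{dist}(x,K)<r\}$ and $\mathcal H^n$ is $n$-dimensional Hausdorff measure. $C_c^{0,1}(\overline\Omega\setminus K)$ denotes Lipschitz functions with compact support in $\overline\Omega\setminus K$ (not required to vanish on $\partial\Omega$). *)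

theory Defs
  imports "HOL-Analysis.Analysis"
begin

subsection \<open>Smooth functions\<close>

definition grad :: "(real^'n \<Rightarrow> real) \<Rightarrow> real^'n \<Rightarrow> real^'n" where
  "grad f x = (\<chi> i. frechet_derivative f (at x) (axis i 1))"

definition divergence :: "(real^'n \<Rightarrow> real^'n) \<Rightarrow> real^'n \<Rightarrow> real" where
  "divergence F x = (\<Sum>i\<in>UNIV. grad (\<lambda>y. F y $ i) x $ i)"

fun Ck_on :: "nat \<Rightarrow> (real^'n) set \<Rightarrow> (real^'n \<Rightarrow> real) \<Rightarrow> bool" where
  "Ck_on 0 U f \<longleftrightarrow> continuous_on U f"
| "Ck_on (Suc k) U f \<longleftrightarrow> (\<forall>x\<in>U. f differentiable (at x)) \<and> (\<forall>i. Ck_on k U (\<lambda>x. grad f x $ i))"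

text \<open>This and \<open>Ck_on\<close> are meant for open sets \<open>U\<close>.\<close>

definition smooth_on :: "(real^'n) set \<Rightarrow> (real^'n \<Rightarrow> real) \<Rightarrow> bool" where
  "smooth_on U f \<longleftrightarrow> (\<forall>k. Ck_on k U f)"

text \<open>Smoothness on a set that need not be open, such as the closure of \<open>\<Omega>\<close>, possibly
  with a compact subset of \<open>\<Omega>\<close> removed: restriction of a smooth function on an open superset.
  Values of \<open>f\<close> outside \<open>S\<close> play no role.\<close>

definition smooth_upto :: "(real^'n) set \<Rightarrow> (real^'n \<Rightarrow> real) \<Rightarrow> bool" where
  "smooth_upto S f \<longleftrightarrow> (\<exists>U g. open U \<and> S \<subseteq> U \<and> smooth_on U g \<and> (\<forall>x\<in>S. f x = g x))"

definition test_functions :: "(real^'n) set \<Rightarrow> (real^'n \<Rightarrow> real) set" where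
  "test_functions \<Omega> = {\<phi>. smooth_on UNIV \<phi> \<and> compact (closure {x. \<phi> x \<noteq> 0})
     \<and> closure {x. \<phi> x \<noteq> 0} \<subseteq> \<Omega>}"


subsection \<open>Domains with smooth boundary\<close>

definition local_defining_function ::
    "(real^'n) set \<Rightarrow> real^'n \<Rightarrow> (real^'n) set \<Rightarrow> (real^'n \<Rightarrow> real) \<Rightarrow> bool" where
  "local_defining_function \<Omega> x U \<rho> \<longleftrightarrow>
     open U \<and> x \<in> U \<and> smooth_on U \<rho> \<and>
     \<Omega> \<inter> U = {y\<in>U. \<rho> y < 0} \<and> frontier \<Omega> \<inter> U = {y\<in>U. \<rho> y = 0} \<and>
     (\<forall>y\<in>frontier \<Omega> \<inter> U. grad \<rho> y \<noteq> 0)"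

definition smooth_bounded_domain :: "(real^'n) set \<Rightarrow> bool" where
  "smooth_bounded_domain \<Omega> \<longleftrightarrow>
     open \<Omega> \<and> connected \<Omega> \<and> bounded \<Omega> \<and> \<Omega> \<noteq> {} \<and>
     (\<forall>x\<in>frontier \<Omega>. \<exists>U \<rho>. local_defining_function \<Omega> x U \<rho>)"

definition outward_unit_normal :: "(real^'n) set \<Rightarrow> real^'n \<Rightarrow> real^'n \<Rightarrow> bool" where
  "outward_unit_normal \<Omega> x \<nu> \<longleftrightarrow>
     (\<exists>U \<rho>. local_defining_function \<Omega> x U \<rho> \<and> \<nu> = grad \<rho> x /\<^sub>R norm (grad \<rho> x))"


subsection \<open>The elliptic operator\<close>

definition elliptic_coefficients :: "(real^'n) set \<Rightarrow> (real^'n \<Rightarrow> real^'n^'n) \<Rightarrow> bool" where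
  "elliptic_coefficients \<Omega> A \<longleftrightarrow>
     (\<forall>i j. smooth_upto (closure \<Omega>) (\<lambda>x. A x $ i $ j)) \<and>
     (\<forall>x\<in>closure \<Omega>. transpose (A x) = A x) \<and>
     (\<exists>c>0. \<forall>x\<in>closure \<Omega>. \<forall>\<xi>. (A x *v \<xi>) \<bullet> \<xi> \<ge> c * (norm \<xi>)\<^sup>2)"

definition norm_sq :: "(real^'n \<Rightarrow> real^'n^'n) \<Rightarrow> real^'n \<Rightarrow> real^'n \<Rightarrow> real" where
  "norm_sq A x \<xi> = (A x *v \<xi>) \<bullet> \<xi>"

definition elliptic_op :: "(real^'n \<Rightarrow> real^'n^'n) \<Rightarrow> (real^'n \<Rightarrow> real) \<Rightarrow> real^'n \<Rightarrow> real" where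
  "elliptic_op A \<phi> x = - divergence (\<lambda>y. A y *v grad \<phi> y) x"

definition locally_integrable :: "(real^'n) set \<Rightarrow> (real^'n \<Rightarrow> 'b::{banach, second_countable_topology}) \<Rightarrow> bool"
  where "locally_integrable \<Omega> f \<longleftrightarrow> (\<forall>C. compact C \<and> C \<subseteq> \<Omega> \<longrightarrow> set_integrable lebesgue C f)"

text \<open>\<open>- div (A \<nabla>f) + f = \<mu>\<close> as distributions on \<open>\<Omega>\<close>, for a nonnegative Borel measure \<open>\<mu>\<close>
  that is finite on compact subsets of \<open>\<Omega>\<close>.  The matrix \<open>A\<close> is symmetric, so the operator
  is its own formal adjoint.\<close>

definition distributional_eq ::
    "(real^'n) set \<Rightarrow> (real^'n \<Rightarrow> real^'n^'n) \<Rightarrow> (real^'n \<Rightarrow> real) \<Rightarrow> (real^'n) measure \<Rightarrow> bool" where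
  "distributional_eq \<Omega> A f \<mu> \<longleftrightarrow>
     locally_integrable \<Omega> f \<and> sets \<mu> = sets borel \<and>
     (\<forall>C. compact C \<and> C \<subseteq> \<Omega> \<longrightarrow> emeasure \<mu> C < \<infinity>) \<and>
     (\<forall>\<phi>\<in>test_functions \<Omega>.
        (LINT x:\<Omega>|lebesgue. f x * (elliptic_op A \<phi> x + \<phi> x)) = (LINT x|\<mu>. \<phi> x))"

definition measure_support :: "(real^'n) measure \<Rightarrow> (real^'n) set" where
  "measure_support \<mu> = {x. \<forall>U. open U \<and> x \<in> U \<longrightarrow> emeasure \<mu> U > 0}"


subsection \<open>Box dimension\<close>

text \<open>Hausdorff measure of integer dimension \<open>m > 0\<close>, with the usual normalisation that makes
  it agree with Lebesgue measure when \<open>m\<close> is the dimension of the space.\<close>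

definition hausdorff_content :: "nat \<Rightarrow> real \<Rightarrow> (real^'n) set \<Rightarrow> ennreal" where
  "hausdorff_content m \<delta> X =
     (INF U\<in>{U :: nat \<Rightarrow> (real^'n) set. X \<subseteq> (\<Union>i. U i) \<and> (\<forall>i. bounded (U i) \<and> diameter (U i) \<le> \<delta>)}.
        (\<Sum>i. ennreal (unit_ball_vol (real m) * (diameter (U i) / 2) ^ m)))"

definition hausdorff_measure :: "nat \<Rightarrow> (real^'n) set \<Rightarrow> ennreal" where
  "hausdorff_measure m X = (SUP \<delta>\<in>{0<..}. hausdorff_content m \<delta> X)"

definition has_box_dim :: "(real^'n) set \<Rightarrow> (real^'n) set \<Rightarrow> real \<Rightarrow> bool" where
  "has_box_dim \<Omega> K d \<longleftrightarrow>
     ((\<lambda>r. ln (enn2real (hausdorff_measure CARD('n) {x\<in>\<Omega>. infdist x K < r})) / ln r)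
        \<longlongrightarrow> real CARD('n) - d) (at_right 0)"


subsection \<open>Neumann interior weights\<close>

text \<open>A weight takes the value \<open>\<infinity>\<close> on \<open>K\<close> and is real elsewhere on the closure of \<open>\<Omega>\<close>;
  its gradient and its integrals are those of \<open>real_of_ereal \<circ> E\<close>.  On the boundary the gradient is
  the derivative relative to the closure of \<open>\<Omega>\<close>; this exists and is unique there, as is the normal.\<close>

definition neumann_interior_weight ::
    "(real^'n) set \<Rightarrow> (real^'n \<Rightarrow> real^'n^'n) \<Rightarrow> (real^'n) set \<Rightarrow> (real^'n \<Rightarrow> ereal) \<Rightarrow> bool" where
  "neumann_interior_weight \<Omega> A K E \<longleftrightarrow>
     compact K \<and> K \<subseteq> \<Omega> \<and> (\<exists>d. has_box_dim \<Omega> K d \<and> d < real CARD('n) - 2) \<and>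
     (\<forall>x\<in>closure \<Omega> - K. \<bar>E x\<bar> \<noteq> \<infinity>) \<and>
     smooth_upto (closure \<Omega> - K) (\<lambda>x. real_of_ereal (E x)) \<and>
     (INF x\<in>\<Omega>. E x) > 0 \<and>
     (\<exists>\<mu>. distributional_eq \<Omega> A (\<lambda>x. real_of_ereal (E x)) \<mu> \<and>
          emeasure \<mu> (space \<mu>) \<noteq> 0 \<and> measure_support \<mu> = K) \<and>
     (\<forall>x\<in>K. E x = \<infinity>) \<and>
     (\<forall>x\<in>frontier \<Omega>. \<forall>p \<nu>.
        ((\<lambda>y. real_of_ereal (E y)) has_derivative (\<lambda>h. p \<bullet> h)) (at x within closure \<Omega>) \<and>
        outward_unit_normal \<Omega> x \<nu> \<longrightarrow> (A x *v p) \<bullet> \<nu> = 0)"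


subsection \<open>Function spaces and integrals\<close>

definition lipschitz_compact_support :: "(real^'n) set \<Rightarrow> (real^'n) set \<Rightarrow> (real^'n \<Rightarrow> real) set" where
  "lipschitz_compact_support \<Omega> K =
     {u. (\<exists>L. L-lipschitz_on (closure \<Omega> - K) u) \<and>
         compact (closure {x\<in>closure \<Omega> - K. u x \<noteq> 0}) \<and>
         closure {x\<in>closure \<Omega> - K. u x \<noteq> 0} \<subseteq> closure \<Omega> - K}"

definition has_weak_gradient ::
    "(real^'n) set \<Rightarrow> (real^'n \<Rightarrow> real) \<Rightarrow> (real^'n \<Rightarrow> real^'n) \<Rightarrow> bool" where
  "has_weak_gradient \<Omega> u g \<longleftrightarrow>
     locally_integrable \<Omega> u \<and> locally_integrable \<Omega> g \<and>
     (\<forall>\<phi>\<in>test_functions \<Omega>. \<forall>i.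
        (LINT x:\<Omega>|lebesgue. u x * grad \<phi> x $ i) = - (LINT x:\<Omega>|lebesgue. g x $ i * \<phi> x))"

text \<open>Determined up to a null set.  For locally Lipschitz functions this is the classical
  gradient, which exists almost everywhere.\<close>

definition weak_gradient :: "(real^'n) set \<Rightarrow> (real^'n \<Rightarrow> real) \<Rightarrow> real^'n \<Rightarrow> real^'n" where
  "weak_gradient \<Omega> u = (SOME g. has_weak_gradient \<Omega> u g)"

definition square_integrable :: "(real^'n) set \<Rightarrow> (real^'n \<Rightarrow> 'b::euclidean_space) \<Rightarrow> bool" where
  "square_integrable \<Omega> f \<longleftrightarrow>
     set_borel_measurable lebesgue \<Omega> f \<and> set_integrable lebesgue \<Omega> (\<lambda>x. (norm (f x))\<^sup>2)"

definition H1 :: "(real^'n) set \<Rightarrow> (real^'n \<Rightarrow> real) set" where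
  "H1 \<Omega> = {u. square_integrable \<Omega> u \<and> (\<exists>g. has_weak_gradient \<Omega> u g \<and> square_integrable \<Omega> g)}"

definition dirichlet_integral ::
    "(real^'n) set \<Rightarrow> (real^'n \<Rightarrow> real^'n^'n) \<Rightarrow> (real^'n \<Rightarrow> real) \<Rightarrow> real" where
  "dirichlet_integral \<Omega> A u = (LINT x:\<Omega>|lebesgue. norm_sq A x (weak_gradient \<Omega> u x))"

definition hardy_integrand ::
    "(real^'n \<Rightarrow> real^'n^'n) \<Rightarrow> (real^'n \<Rightarrow> ereal) \<Rightarrow> (real^'n \<Rightarrow> real) \<Rightarrow> real^'n \<Rightarrow> real" where
  "hardy_integrand A E u x =
     norm_sq A x (grad (\<lambda>y. real_of_ereal (E y)) x) / (real_of_ereal (E x))\<^sup>2 * (u x)\<^sup>2"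

end

theory Submission
  imports Defs "HOL-Real_Asymp.Real_Asymp"
begin

text \<open>
  Off \<open>K\<close> the weight satisfies \<open>- div (A \<nabla>E) + E = 0\<close>.  Testing this with \<open>u\<^sup>2 / E\<close> gives
    \<open>2 \<integral> u A \<nabla>E \<bullet> \<nabla>u / E = \<integral> |\<nabla>E|\<^sub>A\<^sup>2 u\<^sup>2 / E\<^sup>2 - \<integral> u\<^sup>2\<close>,
  and completing the square turns this into the identity
    \<open>\<integral> |\<nabla>u|\<^sub>A\<^sup>2 + 1/2 \<integral> u\<^sup>2 = 1/4 \<integral> |\<nabla>E|\<^sub>A\<^sup>2 u\<^sup>2 / E\<^sup>2 + \<integral> E |\<nabla>v|\<^sub>A\<^sup>2\<close>.
  The test function is admissible for every \<open>u\<close> in \<open>H\<^sup>1\<close> because a set of box dimension below \<open>n - 2\<close>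
  has zero capacity: there are cutoffs vanishing near \<open>K\<close> with small Dirichlet energy, and once
  \<open>u\<^sup>2\<close> is truncated the error they cause is absorbed into the Hardy term.

  Equality forces \<open>\<nabla>u = u \<nabla>E / (2 E)\<close>, and the first identity then gives \<open>\<integral> u\<^sup>2 = 0\<close>.  For
  \<open>0 < s < 1/2\<close> the power \<open>E\<^sup>s\<close> lies in \<open>H\<^sup>1\<close>; with \<open>I = \<integral> |\<nabla>E|\<^sub>A\<^sup>2 E\<^sup>2\<^sup>s / E\<^sup>2\<close> its Dirichlet energy is
  \<open>s\<^sup>2 I\<close> and its \<open>L\<^sup>2\<close> norm squared \<open>(1 - 2 s) I\<close>, so \<open>s \<rightarrow> 1/2\<close> shows that both constants are optimal.
\<close>

subsection \<open>Gradients and finite order smoothness\<close>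

text \<open>The test function \<open>u\<^sup>2 / E\<close> does not vanish on the boundary and is
  only a Sobolev function, so the divergence theorem does not apply to it directly. The Neumann
  condition enters as a rate instead: near a boundary point the normal component of the flux is
  smooth and vanishes on the boundary, hence is at most a constant times the depth, and this cancels
  the blow-up of the gradient of a cutoff of vanishing width. The second obstacle is that the Hardy
  integral is not known to be finite, and it can be absorbed only where it is. The square is
  therefore truncated at height \<open>M\<^sup>2\<close>, and the cutoffs near \<open>K\<close> get
  an energy of order \<open>1 / M ^ 4\<close>, which beats the factor \<open>M\<^sup>2\<close> that
  the truncation costs. The resulting bound is independent of \<open>M\<close>, and Fatou's lemma
  gives finiteness. The same circle threatens for the powers of the weight; they are approached from
  below by bounded smooth functions. Both constants come from one computation: in the completed
  square half of the Hardy integral, from the cross term, meets a quarter of it from the last term,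
  and half of the mass is left over.\<close>

lemma grad_eqI:
  assumes "(f has_derivative D) (at x)"
  shows "grad f x $ i = D (axis i 1)"
  using frechet_derivative_at[OF assms] by (simp add: grad_def)

lemma has_derivative_grad:
  fixes f :: "real^'n \<Rightarrow> real"
  assumes "f differentiable (at x)"
  shows "(f has_derivative (\<lambda>h. grad f x \<bullet> h)) (at x)"
proof -
  obtain D where D: "(f has_derivative D) (at x)"
    using assms by (auto simp: differentiable_def)
  then interpret bounded_linear D by (rule has_derivative_bounded_linear)
  have "D h = grad f x \<bullet> h" for h :: "real^'n"
  proof -
    have "h = (\<Sum>i\<in>UNIV. (h $ i) *\<^sub>R axis i 1)"
      using basis_expansion[of h] by (simp add: scalar_mult_eq_scaleR)
    then have "D h = D (\<Sum>i\<in>UNIV. (h $ i) *\<^sub>R axis i 1)" by simp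
    also have "\<dots> = (\<Sum>i\<in>UNIV. (h $ i) * D (axis i 1))"
      by (simp add: sum scaleR)
    also have "\<dots> = grad f x \<bullet> h"
      by (simp add: inner_vec_def grad_eqI[OF D] mult.commute)
    finally show ?thesis .
  qed
  then have "D = (\<lambda>h. grad f x \<bullet> h)" by auto
  then show ?thesis using D by simp
qed

lemma grad_unique:
  assumes "(f has_derivative (\<lambda>h. p \<bullet> h)) (at x)"
  shows "grad f x = p"
  by (simp add: vec_eq_iff grad_eqI[OF assms] inner_axis)

text \<open>Functions that agree near \<open>x\<close> have the same derivatives there, so the
  choice inside \<open>frechet_derivative\<close> falls on the same map, even at points where there
  is no derivative. Gradients can thus be compared locally without side conditions.\<close>

lemma grad_cong:
  assumes "open U" "x \<in> U" "\<And>y. y \<in> U \<Longrightarrow> f y = g y"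
  shows "grad f x = grad g x"
proof -
  have "(f has_derivative D) (at x) \<longleftrightarrow> (g has_derivative D) (at x)" for D
    using has_derivative_transform_within_open[of f D x UNIV U g]
      has_derivative_transform_within_open[of g D x UNIV U f] assms by auto
  then show ?thesis by (simp add: grad_def frechet_derivative_def)
qed

lemma differentiable_cong_open:
  assumes "open U" "x \<in> U" "\<And>y. y \<in> U \<Longrightarrow> f y = g y" "f differentiable (at x)"
  shows "g differentiable (at x)"
  using assms has_derivative_transform_within_open[of f _ x UNIV U g]
  by (auto simp: differentiable_def)

lemma grad_add:
  assumes "f differentiable (at x)" "g differentiable (at x)"
  shows "grad (\<lambda>x. f x + g x) x = grad f x + grad g x"
  by (rule grad_unique) (auto intro!: derivative_eq_intros has_derivative_grad assms simp: inner_add_left)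

lemma grad_mult:
  assumes "f differentiable (at x)" "g differentiable (at x)"
  shows "grad (\<lambda>x. f x * g x) x = f x *\<^sub>R grad g x + g x *\<^sub>R grad f x"
  by (rule grad_unique) (auto intro!: derivative_eq_intros has_derivative_grad assms simp: inner_add_left)

lemma grad_compose:
  fixes h :: "real \<Rightarrow> real"
  assumes "f differentiable (at x)" "(h has_field_derivative h') (at (f x))"
  shows "grad (\<lambda>x. h (f x)) x = h' *\<^sub>R grad f x"
proof -
  have "((\<lambda>x. h (f x)) has_derivative (\<lambda>y. h' * (grad f x \<bullet> y))) (at x)"
    using has_derivative_compose[OF has_derivative_grad[OF assms(1)]] assms(2)
    by (simp add: has_field_derivative_def)
  then show ?thesis by (intro grad_unique) simp
qed

lemma grad_const [simp]: "grad (\<lambda>x. c) x = 0"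
  by (rule grad_unique) simp

lemma Ck_on_cong:
  assumes "open U" "\<And>x. x \<in> U \<Longrightarrow> f x = g x" "Ck_on k U f"
  shows "Ck_on k U g"
  using assms(2,3)
proof (induction k arbitrary: f g)
  case 0
  then show ?case by (auto cong: continuous_on_cong)
next
  case (Suc k)
  have "grad f x = grad g x" if "x \<in> U" for x
    using grad_cong[OF assms(1) that] Suc.prems(1) by blast
  then have "Ck_on k U (\<lambda>x. grad g x $ i)" for i
    using Suc.IH[of "\<lambda>x. grad f x $ i" "\<lambda>x. grad g x $ i"] Suc.prems by auto
  moreover have "g differentiable (at x)" if "x \<in> U" for x
    using differentiable_cong_open[OF assms(1) that, of f g] Suc.prems that by auto
  ultimately show ?case by simp
qed

lemma Ck_on_subset: "Ck_on k V f \<Longrightarrow> U \<subseteq> V \<Longrightarrow> Ck_on k U f"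
  by (induction k arbitrary: f) (auto intro: continuous_on_subset)

lemma Ck_on_SucD: "Ck_on (Suc k) U f \<Longrightarrow> Ck_on k U f"
proof (induction k arbitrary: f)
  case 0
  then show ?case
    by (simp add: differentiable_imp_continuous_on differentiable_at_imp_differentiable_on)
qed auto

lemma Ck_on_Un:
  "open U \<Longrightarrow> open V \<Longrightarrow> Ck_on k U f \<Longrightarrow> Ck_on k V f \<Longrightarrow> Ck_on k (U \<union> V) f"
  by (induction k arbitrary: f) (auto intro: continuous_on_open_Un)

lemma Ck_on_const: "Ck_on k U (\<lambda>x. c)"
  by (induction k arbitrary: c) auto

lemma Ck_on_add:
  assumes "open U" "Ck_on k U f" "Ck_on k U g"
  shows "Ck_on k U (\<lambda>x. f x + g x)"
  using assms(2,3)
proof (induction k arbitrary: f g)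
  case (Suc k)
  have "Ck_on k U (\<lambda>x. grad (\<lambda>x. f x + g x) x $ i)" for i
    by (rule Ck_on_cong[OF assms(1), where f = "\<lambda>x. grad f x $ i + grad g x $ i"])
      (use Suc in \<open>auto simp: grad_add\<close>)
  then show ?case using Suc.prems by auto
qed (auto intro: continuous_on_add)

lemma Ck_on_mult:
  assumes "open U" "Ck_on k U f" "Ck_on k U g"
  shows "Ck_on k U (\<lambda>x. f x * g x)"
  using assms(2,3)
proof (induction k arbitrary: f g)
  case (Suc k)
  have *: "Ck_on k U f" "Ck_on k U g" using Suc.prems Ck_on_SucD by blast+
  have "Ck_on k U (\<lambda>x. grad (\<lambda>x. f x * g x) x $ i)" for i
    by (rule Ck_on_cong[OF assms(1), where f = "\<lambda>x. f x * grad g x $ i + g x * grad f x $ i"])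
      (use Suc * in \<open>auto simp: grad_mult intro!: Ck_on_add assms(1)\<close>)
  then show ?case using Suc.prems by auto
qed (auto intro: continuous_on_mult)

lemma Ck_on_coord: "Ck_on k U (\<lambda>x. x $ i)"
proof (cases k)
  case (Suc l)
  have "grad (\<lambda>x::real^'a. x $ i) x = axis i 1" for x
    using bounded_linear_imp_has_derivative[OF bounded_linear_vec_nth[of i], of "at x"]
    by (intro grad_unique) (simp add: inner_axis')
  then show ?thesis using Suc
    by (auto intro!: Ck_on_const bounded_linear_imp_differentiable bounded_linear_vec_nth)
qed (simp add: continuous_on_component continuous_on_id)

text \<open>The derivative is a witness \<open>h'\<close> rather than a fixed operator applied to
  \<open>h\<close>, so that explicit families such as the powers and \<open>flat_exp\<close> can be
  treated by induction on \<open>k\<close> with the exponent arbitrary.\<close>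

fun Ck1_on :: "nat \<Rightarrow> real set \<Rightarrow> (real \<Rightarrow> real) \<Rightarrow> bool" where
  "Ck1_on 0 S h \<longleftrightarrow> continuous_on S h"
| "Ck1_on (Suc k) S h \<longleftrightarrow> (\<exists>h'. (\<forall>t\<in>S. (h has_field_derivative h' t) (at t)) \<and> Ck1_on k S h')"

lemma Ck1_on_add: "Ck1_on k S h \<Longrightarrow> Ck1_on k S g \<Longrightarrow> Ck1_on k S (\<lambda>t. h t + g t)"
proof (induction k arbitrary: h g)
  case (Suc k)
  then obtain h' g' where "\<forall>t\<in>S. (h has_field_derivative h' t) (at t)" "Ck1_on k S h'"
    "\<forall>t\<in>S. (g has_field_derivative g' t) (at t)" "Ck1_on k S g'" by auto
  then show ?case unfolding Ck1_on.simps
    by (intro exI[of _ "\<lambda>t. h' t + g' t"] conjI ballI DERIV_add Suc.IH) auto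
qed (auto intro: continuous_on_add)

lemma Ck1_on_cmult: "Ck1_on k S h \<Longrightarrow> Ck1_on k S (\<lambda>t. c * h t)"
proof (induction k arbitrary: h)
  case (Suc k)
  then obtain h' where "\<forall>t\<in>S. (h has_field_derivative h' t) (at t)" "Ck1_on k S h'" by auto
  then show ?case unfolding Ck1_on.simps
    by (intro exI[of _ "\<lambda>t. c * h' t"] conjI ballI DERIV_cmult Suc.IH) auto
qed (simp add: continuous_on_mult_left)

lemma Ck_on_compose:
  assumes "open U" "Ck_on k U f" "f ` U \<subseteq> S" "Ck1_on k S h"
  shows "Ck_on k U (\<lambda>x. h (f x))"
  using assms(2,4)
proof (induction k arbitrary: h)
  case 0
  then show ?case using assms(3) continuous_on_compose2[of S h U f] by simp
next
  case (Suc k)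
  then obtain h' where h': "\<forall>t\<in>S. (h has_field_derivative h' t) (at t)" "Ck1_on k S h'" by auto
  have *: "Ck_on k U f" using Suc.prems Ck_on_SucD by blast
  have fd: "f differentiable (at x)" "(h has_field_derivative h' (f x)) (at (f x))" if "x \<in> U" for x
    using Suc.prems that h' assms(3) by auto
  have "Ck_on k U (\<lambda>x. grad (\<lambda>x. h (f x)) x $ i)" for i
  proof (rule Ck_on_cong[OF assms(1), where f = "\<lambda>x. h' (f x) * grad f x $ i"])
    show "Ck_on k U (\<lambda>x. h' (f x) * grad f x $ i)"
      using Suc.IH[OF * h'(2)] Suc.prems(1) by (intro Ck_on_mult assms(1)) auto
  qed (simp add: grad_compose[OF fd])
  moreover have "(\<lambda>x. h (f x)) differentiable (at x)" if "x \<in> U" for x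
    unfolding differentiable_def
    using has_derivative_compose[OF has_derivative_grad[OF fd(1)[OF that]]
        has_field_derivative_imp_has_derivative[OF fd(2)[OF that]]] by blast
  ultimately show ?case by simp
qed

lemma Ck1_on_powr: "Ck1_on k {0<..} (\<lambda>t. t powr a)"
proof (induction k arbitrary: a)
  case (Suc k)
  show ?case unfolding Ck1_on.simps
    by (rule exI[of _ "\<lambda>t. a * t powr (a - 1)"])
      (use Ck1_on_cmult[OF Suc.IH, of a "a - 1"] in \<open>auto intro: has_real_derivative_powr\<close>)
next
  case 0
  have "continuous_on {0<..} (\<lambda>t::real. t powr a)"
    by (intro continuous_on_powr continuous_on_id continuous_on_const) auto
  then show ?case by simp
qed

section \<open>Closure properties of smooth functions\<close>

lemma smooth_onI: "(\<And>k. Ck_on k U f) \<Longrightarrow> smooth_on U f"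
  by (simp add: smooth_on_def)

lemma smooth_onD: "smooth_on U f \<Longrightarrow> Ck_on k U f"
  by (simp add: smooth_on_def)

lemma smooth_on_cong: "open U \<Longrightarrow> (\<And>x. x \<in> U \<Longrightarrow> f x = g x) \<Longrightarrow> smooth_on U f \<Longrightarrow> smooth_on U g"
  by (rule smooth_onI, rule Ck_on_cong[of U f g]) (auto dest: smooth_onD)

lemma smooth_on_subset: "smooth_on V f \<Longrightarrow> U \<subseteq> V \<Longrightarrow> smooth_on U f"
  by (auto simp: smooth_on_def intro: Ck_on_subset)

lemma smooth_on_Un: "open U \<Longrightarrow> open V \<Longrightarrow> smooth_on U f \<Longrightarrow> smooth_on V f \<Longrightarrow> smooth_on (U \<union> V) f"
  by (auto simp: smooth_on_def intro: Ck_on_Un)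

lemma smooth_on_const: "smooth_on U (\<lambda>x. c)"
  by (intro smooth_onI Ck_on_const)

lemma smooth_on_coord: "smooth_on U (\<lambda>x. x $ i)"
  by (intro smooth_onI Ck_on_coord)

lemma smooth_on_add: "open U \<Longrightarrow> smooth_on U f \<Longrightarrow> smooth_on U g \<Longrightarrow> smooth_on U (\<lambda>x. f x + g x)"
  by (simp add: smooth_on_def Ck_on_add)

lemma smooth_on_mult: "open U \<Longrightarrow> smooth_on U f \<Longrightarrow> smooth_on U g \<Longrightarrow> smooth_on U (\<lambda>x. f x * g x)"
  by (simp add: smooth_on_def Ck_on_mult)

lemma smooth_on_uminus: "open U \<Longrightarrow> smooth_on U f \<Longrightarrow> smooth_on U (\<lambda>x. - f x)"
  using smooth_on_mult[OF _ smooth_on_const[of _ "-1"], of U f] by simp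

lemma smooth_on_diff: "open U \<Longrightarrow> smooth_on U f \<Longrightarrow> smooth_on U g \<Longrightarrow> smooth_on U (\<lambda>x. f x - g x)"
  using smooth_on_add[OF _ _ smooth_on_uminus, of U f g] by simp

lemma smooth_on_sum:
  assumes "open U" "\<And>i. i \<in> I \<Longrightarrow> smooth_on U (f i)"
  shows "smooth_on U (\<lambda>x. \<Sum>i\<in>I. f i x)"
  using assms(2)
  by (induction I rule: infinite_finite_induct) (auto intro: smooth_on_const smooth_on_add assms(1))

lemma smooth_on_grad: "smooth_on U f \<Longrightarrow> smooth_on U (\<lambda>x. grad f x $ i)"
  unfolding smooth_on_def using Ck_on.simps(2) by blast

lemma smooth_on_compose:
  assumes "open U" "smooth_on U f" "f ` U \<subseteq> S" "\<And>k. Ck1_on k S h"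
  shows "smooth_on U (\<lambda>x. h (f x))"
  using assms Ck_on_compose[OF assms(1) _ assms(3,4)] by (simp add: smooth_on_def)

lemma smooth_on_powr:
  assumes "open U" "smooth_on U f" "\<And>x. x \<in> U \<Longrightarrow> f x > 0"
  shows "smooth_on U (\<lambda>x. f x powr a)"
  by (rule smooth_on_compose[where S = "{0<..}"]) (use assms Ck1_on_powr in auto)

lemma smooth_on_inverse:
  assumes "open U" "smooth_on U f" "\<And>x. x \<in> U \<Longrightarrow> f x > 0"
  shows "smooth_on U (\<lambda>x. inverse (f x))"
  by (rule smooth_on_cong[OF assms(1) _ smooth_on_powr[where a = "-1", OF assms]])
    (use assms(3) in \<open>auto simp: powr_minus less_imp_le\<close>)

lemma smooth_on_divide:
  assumes "open U" "smooth_on U f" "smooth_on U g" "\<And>x. x \<in> U \<Longrightarrow> g x > 0"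
  shows "smooth_on U (\<lambda>x. f x / g x)"
  using smooth_on_mult[OF assms(1,2) smooth_on_inverse[OF assms(1,3,4)]] by (simp add: divide_inverse)

lemma smooth_on_differentiable: "smooth_on U f \<Longrightarrow> x \<in> U \<Longrightarrow> f differentiable (at x)"
  using smooth_onD[of U f 1] by simp

lemma smooth_on_continuous: "smooth_on U f \<Longrightarrow> continuous_on U f"
  using smooth_onD[of U f 0] by simp

lemma smooth_on_continuous_grad:
  assumes "smooth_on U f" shows "continuous_on U (grad f)"
proof -
  have "continuous_on U (\<lambda>x. \<chi> i. grad f x $ i)"
    by (intro continuous_on_vec_lambda smooth_on_continuous smooth_on_grad assms)
  then show ?thesis by simp
qed

subsection \<open>Bump functions\<close>

text \<open>For \<open>j = 0\<close> this is the classical function that is flat at the origin. The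
  factor \<open>1 / t ^ j\<close> makes the family closed under differentiation up to linear
  combinations, which turns smoothness into an induction.\<close>

definition flat_exp :: "nat \<Rightarrow> real \<Rightarrow> real" where
  "flat_exp j t = (if t > 0 then exp (- 1 / t) / t ^ j else 0)"

lemma flat_exp_tendsto_0: "(flat_exp j \<longlongrightarrow> 0) (at 0)"
proof -
  have "((\<lambda>t::real. exp (- 1 / t) / t ^ j) \<longlongrightarrow> 0) (at_right 0)" by real_asymp
  then have "(flat_exp j \<longlongrightarrow> 0) (at_right 0)"
    by (rule Lim_transform_eventually) (auto simp: eventually_at_filter flat_exp_def)
  moreover have "(flat_exp j \<longlongrightarrow> 0) (at_left 0)"
    by (rule Lim_transform_eventually[OF tendsto_const]) (auto simp: eventually_at_filter flat_exp_def)
  ultimately show ?thesis by (simp add: filterlim_split_at)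
qed

lemma flat_exp_deriv:
  "(flat_exp j has_field_derivative (- real j * flat_exp (Suc j) t + flat_exp (j + 2) t)) (at t)"
proof (cases t "0::real" rule: linorder_cases)
  case less
  have "(flat_exp j has_field_derivative 0) (at t)"
    by (rule has_field_derivative_transform_within_open[where f = "\<lambda>_. 0" and S = "{..<0}"])
      (use less in \<open>auto simp: flat_exp_def\<close>)
  then show ?thesis using less by (simp add: flat_exp_def)
next
  case equal
  \<comment> \<open>The difference quotient of \<open>flat_exp j\<close> at the origin is
    \<open>flat_exp (Suc j)\<close>, and this tends to 0.\<close>
  have "((\<lambda>y. (flat_exp j y - flat_exp j 0) / (y - 0)) \<longlongrightarrow> 0) (at 0)"
    by (rule Lim_transform_eventually[OF flat_exp_tendsto_0[of "Suc j"]])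
      (auto simp: eventually_at_filter flat_exp_def)
  then show ?thesis using equal by (simp add: has_field_derivative_iff flat_exp_def)
next
  case greater
  have 1: "((\<lambda>t. exp (- 1 / t)) has_field_derivative exp (- 1 / t) * (1 / t\<^sup>2)) (at t)"
    using greater by (auto intro!: derivative_eq_intros simp: power2_eq_square)
  have 2: "((\<lambda>t. t ^ j) has_field_derivative real j * t ^ (j - Suc 0)) (at t)"
    by (rule DERIV_pow)
  have "((\<lambda>t. exp (- 1 / t) / t ^ j) has_field_derivative
      (- real j * flat_exp (Suc j) t + flat_exp (j + 2) t)) (at t)"
  proof (rule DERIV_cong[OF DERIV_divide[OF 1 2]])
    show "(exp (- 1 / t) * (1 / t\<^sup>2) * t ^ j - exp (- 1 / t) * (real j * t ^ (j - Suc 0))) / (t ^ j * t ^ j)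
        = - real j * flat_exp (Suc j) t + flat_exp (j + 2) t"
      using greater by (cases j) (auto simp: flat_exp_def field_simps power2_eq_square)
  qed (use greater in auto)
  then show ?thesis
    by (rule has_field_derivative_transform_within_open[where S = "{0<..}"])
      (use greater in \<open>auto simp: flat_exp_def\<close>)
qed

lemma Ck1_on_flat_exp: "Ck1_on k UNIV (flat_exp j)"
proof (induction k arbitrary: j)
  case 0
  then show ?case
    using DERIV_isCont[OF flat_exp_deriv] by (auto intro!: continuous_at_imp_continuous_on)
next
  case (Suc k)
  show ?case unfolding Ck1_on.simps
    by (rule exI[of _ "\<lambda>t. - real j * flat_exp (Suc j) t + flat_exp (j + 2) t"])
      (intro conjI ballI flat_exp_deriv Ck1_on_add Ck1_on_cmult Suc.IH)
qed

lemma flat_exp_nonneg: "flat_exp j t \<ge> 0"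
  by (simp add: flat_exp_def)

lemma flat_exp_pos_iff: "flat_exp j t > 0 \<longleftrightarrow> t > 0"
  by (simp add: flat_exp_def)

text \<open>The squared norm is a polynomial in the coordinates, so the centre causes no loss of
  smoothness.\<close>

definition bump :: "real^'n \<Rightarrow> real \<Rightarrow> real^'n \<Rightarrow> real" where
  "bump a r x = flat_exp 0 (r\<^sup>2 - (norm (x - a))\<^sup>2)"

lemma bump_nonneg: "bump a r x \<ge> 0"
  by (simp add: bump_def flat_exp_nonneg)

lemma bump_pos_iff: "r > 0 \<Longrightarrow> bump a r x > 0 \<longleftrightarrow> x \<in> ball a r"
  by (auto simp: bump_def flat_exp_pos_iff dist_norm norm_minus_commute
      intro: power2_less_imp_less power_strict_mono)

lemma bump_eq_0_iff: "r > 0 \<Longrightarrow> bump a r x = 0 \<longleftrightarrow> x \<notin> ball a r"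
  using bump_pos_iff[of r a x] bump_nonneg[of a r x] by linarith

lemma smooth_on_bump:
  assumes "open U" shows "smooth_on U (bump a r)"
proof -
  have "bump a r = (\<lambda>x. flat_exp 0 (r\<^sup>2 - (\<Sum>i\<in>UNIV. (x $ i - a $ i) * (x $ i - a $ i))))"
    by (auto simp: bump_def fun_eq_iff power2_norm_eq_inner inner_vec_def)
  moreover have "smooth_on U (\<lambda>x. flat_exp 0 (r\<^sup>2 - (\<Sum>i\<in>UNIV. (x $ i - a $ i) * (x $ i - a $ i))))"
    by (rule smooth_on_compose[where S = UNIV, OF assms])
      (auto intro!: smooth_on_diff smooth_on_const smooth_on_sum smooth_on_mult smooth_on_coord assms Ck1_on_flat_exp)
  ultimately show ?thesis by simp
qed

subsection \<open>Test functions\<close>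

lemma test_functionsI:
  assumes "smooth_on UNIV \<phi>" "compact C" "C \<subseteq> \<Omega>" "\<And>x. x \<notin> C \<Longrightarrow> \<phi> x = 0"
  shows "\<phi> \<in> test_functions \<Omega>"
proof -
  have "closure {x. \<phi> x \<noteq> 0} \<subseteq> C"
    by (rule closure_minimal) (use assms compact_imp_closed in auto)
  then show ?thesis unfolding test_functions_def using assms
    using bounded_subset[OF compact_imp_bounded[OF assms(2)] order_trans[OF closure_subset]]
    by (auto simp: compact_closure)
qed

lemma test_functionsD:
  assumes "\<phi> \<in> test_functions \<Omega>"
  obtains C where "compact C" "C \<subseteq> \<Omega>" "\<And>x. x \<notin> C \<Longrightarrow> \<phi> x = 0" "\<And>x. x \<notin> C \<Longrightarrow> grad \<phi> x = 0"
proof -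
  let ?C = "closure {x. \<phi> x \<noteq> 0}"
  have *: "\<phi> x = 0" if "x \<notin> ?C" for x
    using closure_subset[of "{x. \<phi> x \<noteq> 0}"] that by auto
  moreover have "grad \<phi> x = 0" if "x \<notin> ?C" for x
  proof -
    have "grad \<phi> x = grad (\<lambda>_. 0) x"
      by (rule grad_cong[of "- ?C"]) (use that * in \<open>blast intro: open_Compl closed_closure\<close>)+
    then show ?thesis by simp
  qed
  moreover have "compact ?C" and "?C \<subseteq> \<Omega>" using assms unfolding test_functions_def by simp_all
  ultimately show ?thesis using that[of ?C] * by meson
qed

lemma test_functions_smooth: "\<phi> \<in> test_functions \<Omega> \<Longrightarrow> smooth_on UNIV \<phi>"
  by (simp add: test_functions_def)

lemma test_functions_mono: "\<Omega> \<subseteq> \<Omega>' \<Longrightarrow> \<phi> \<in> test_functions \<Omega> \<Longrightarrow> \<phi> \<in> test_functions \<Omega>'"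
  unfolding test_functions_def by blast

lemma test_functions_grad: "\<phi> \<in> test_functions \<Omega> \<Longrightarrow> (\<lambda>x. grad \<phi> x $ i) \<in> test_functions \<Omega>"
proof (rule test_functionsD)
  assume \<phi>: "\<phi> \<in> test_functions \<Omega>"
  fix C assume "compact C" "C \<subseteq> \<Omega>" "\<And>x. x \<notin> C \<Longrightarrow> grad \<phi> x = 0"
  then show "(\<lambda>x. grad \<phi> x $ i) \<in> test_functions \<Omega>"
    using smooth_on_grad[OF test_functions_smooth[OF \<phi>]] by (intro test_functionsI[of _ C]) simp_all
qed

lemma test_functions_add:
  assumes "\<phi> \<in> test_functions \<Omega>" "\<psi> \<in> test_functions \<Omega>"
  shows "(\<lambda>x. \<phi> x + \<psi> x) \<in> test_functions \<Omega>"
proof -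
  obtain C where C: "compact C" "C \<subseteq> \<Omega>" "\<And>x. x \<notin> C \<Longrightarrow> \<phi> x = 0"
    using assms(1) by (rule test_functionsD) blast
  obtain D where D: "compact D" "D \<subseteq> \<Omega>" "\<And>x. x \<notin> D \<Longrightarrow> \<psi> x = 0"
    using assms(2) by (rule test_functionsD) blast
  show ?thesis
    by (rule test_functionsI[of _ "C \<union> D"])
      (use C D assms in \<open>auto intro: smooth_on_add test_functions_smooth\<close>)
qed

text \<open>Outside \<open>U\<close> the factor \<open>f\<close> is arbitrary. The product is smooth
  on \<open>U\<close> and identically zero on the complement of the compact set \<open>C\<close>
  that carries \<open>\<phi>\<close>, and these two open sets cover the space.\<close>

lemma test_functions_mult:
  assumes "open U" "smooth_on U f" "\<phi> \<in> test_functions \<Omega>" "\<Omega> \<subseteq> U"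
  shows "(\<lambda>x. f x * \<phi> x) \<in> test_functions \<Omega>"
proof -
  obtain C where C: "compact C" "C \<subseteq> \<Omega>" "\<And>x. x \<notin> C \<Longrightarrow> \<phi> x = 0"
    using assms(3) by (rule test_functionsD) blast
  have "smooth_on (- C) (\<lambda>x. f x * \<phi> x)"
    by (rule smooth_on_cong[OF _ _ smooth_on_const[of _ 0]]) (use C in \<open>auto simp: compact_imp_closed\<close>)
  moreover have "smooth_on U (\<lambda>x. f x * \<phi> x)"
    by (intro smooth_on_mult assms smooth_on_subset[OF test_functions_smooth[OF assms(3)]]) auto
  ultimately have "smooth_on (U \<union> - C) (\<lambda>x. f x * \<phi> x)"
    using smooth_on_Un assms(1) C(1) compact_imp_closed by blast
  moreover have "U \<union> - C = UNIV" using C(2) assms(4) by auto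
  ultimately show ?thesis using C by (intro test_functionsI[of _ C]) auto
qed

lemma test_functions_sum:
  assumes "\<And>i. i \<in> I \<Longrightarrow> f i \<in> test_functions \<Omega>"
  shows "(\<lambda>x. \<Sum>i\<in>I. f i x) \<in> test_functions \<Omega>"
  using assms
  by (induction I rule: infinite_finite_induct)
    (auto intro: test_functions_add test_functionsI[of _ "{}"] smooth_on_const)

lemma bump_test:
  assumes "r > 0" "cball a r \<subseteq> \<Omega>"
  shows "bump a r \<in> test_functions \<Omega>"
proof (rule test_functionsI[of _ "cball a r"])
  show "bump a r x = 0" if "x \<notin> cball a r" for x
    using that assms(1) bump_eq_0_iff[of r a x] by auto
qed (use assms in \<open>auto intro: smooth_on_bump\<close>)

lemma test_functions_continuous: "\<phi> \<in> test_functions \<Omega> \<Longrightarrow> continuous_on S \<phi>"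
  using smooth_on_continuous[OF test_functions_smooth] continuous_on_subset by blast

lemma test_functions_bounded:
  assumes "\<phi> \<in> test_functions \<Omega>"
  obtains B where "B > 0" "\<And>x. \<bar>\<phi> x\<bar> \<le> B"
proof -
  obtain C where C: "compact C" "\<And>x. x \<notin> C \<Longrightarrow> \<phi> x = 0"
    using assms by (rule test_functionsD) blast
  have "bounded (\<phi> ` C)"
    by (intro compact_imp_bounded compact_continuous_image test_functions_continuous[OF assms] C)
  then obtain B where "B > 0" "\<And>x. x \<in> C \<Longrightarrow> \<bar>\<phi> x\<bar> \<le> B"
    by (auto simp: bounded_pos)
  then show ?thesis using that[of B] C(2) by (metis abs_zero less_imp_le)
qed

subsection \<open>Convolution with a test function\<close>

lemma continuous_lebesgue_measurable:
  fixes f :: "'a::euclidean_space \<Rightarrow> 'b::{second_countable_topology, metric_space}"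
  assumes "continuous_on UNIV f"
  shows "f \<in> borel_measurable lebesgue"
  using borel_measurable_continuous_onI[OF assms] by (simp add: measurable_completion)

text \<open>With \<open>c = 1\<close> and \<open>c = -1\<close> this covers translations and point
  reflections, the two changes of variables behind convolution.\<close>

lemma distr_lebesgue_affine:
  fixes a :: "'a::euclidean_space" and c :: real
  assumes "\<bar>c\<bar> = 1"
  shows "distr lebesgue lebesgue (\<lambda>x. a + c *\<^sub>R x) = lebesgue"
    and "(\<lambda>x. a + c *\<^sub>R x) \<in> lebesgue \<rightarrow>\<^sub>M lebesgue"
proof -
  have T: "(\<lambda>x. a + c *\<^sub>R x) = (\<lambda>x. a + (\<Sum>j\<in>Basis. (c * (x \<bullet> j)) *\<^sub>R j))"
    by (simp add: fun_eq_iff euclidean_representation scaleR_sum_right[symmetric] scaleR_scaleR[symmetric]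
        del: scaleR_scaleR)
  have c: "c \<noteq> 0" using assms by auto
  show "(\<lambda>x. a + c *\<^sub>R x) \<in> lebesgue \<rightarrow>\<^sub>M lebesgue"
    unfolding T using lebesgue_affine_measurable[of "\<lambda>_. c" a] c by simp
  have "lebesgue = density (distr lebesgue lebesgue (\<lambda>x. a + c *\<^sub>R x)) (\<lambda>_. (\<Prod>j\<in>(Basis::'a set). \<bar>c\<bar>))"
    unfolding T using lebesgue_affine_euclidean[of "\<lambda>_. c" a] c by simp
  then show "distr lebesgue lebesgue (\<lambda>x. a + c *\<^sub>R x) = lebesgue"
    using assms by (simp add: density_1)
qed

lemma lebesgue_integral_affine:
  fixes f :: "'a::euclidean_space \<Rightarrow> 'b::{banach, second_countable_topology}"
  assumes "\<bar>c\<bar> = 1" "f \<in> borel_measurable lebesgue"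
  shows "(LINT x|lebesgue. f (a + c *\<^sub>R x)) = (LINT x|lebesgue. f x)"
    and "integrable lebesgue (\<lambda>x. f (a + c *\<^sub>R x)) \<longleftrightarrow> integrable lebesgue f"
    and "(\<lambda>x. f (a + c *\<^sub>R x)) \<in> borel_measurable lebesgue"
proof -
  note D = distr_lebesgue_affine[OF assms(1), of a]
  show "(LINT x|lebesgue. f (a + c *\<^sub>R x)) = (LINT x|lebesgue. f x)"
    using integral_distr[OF D(2) assms(2)] by (simp add: D(1))
  show "integrable lebesgue (\<lambda>x. f (a + c *\<^sub>R x)) \<longleftrightarrow> integrable lebesgue f"
    using integrable_distr_eq[OF D(2) assms(2)] by (simp add: D(1))
  show "(\<lambda>x. f (a + c *\<^sub>R x)) \<in> borel_measurable lebesgue"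
    using measurable_compose[OF D(2) assms(2)] by simp
qed

lemma lebesgue_integral_reflect_shift:
  fixes f :: "'a::euclidean_space \<Rightarrow> 'b::{banach, second_countable_topology}"
  assumes "f \<in> borel_measurable lebesgue"
  shows "(LINT x|lebesgue. f (a - x)) = (LINT x|lebesgue. f x)"
    and "integrable lebesgue (\<lambda>x. f (a - x)) \<longleftrightarrow> integrable lebesgue f"
    and "(\<lambda>x. f (a - x)) \<in> borel_measurable lebesgue"
  using lebesgue_integral_affine[OF _ assms, of "-1" a] by simp_all

lemma lebesgue_integral_shift:
  fixes f :: "'a::euclidean_space \<Rightarrow> 'b::{banach, second_countable_topology}"
  assumes "f \<in> borel_measurable lebesgue"
  shows "(LINT x|lebesgue. f (x + a)) = (LINT x|lebesgue. f x)"
    and "integrable lebesgue (\<lambda>x. f (x + a)) \<longleftrightarrow> integrable lebesgue f"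
    and "(\<lambda>x. f (x + a)) \<in> borel_measurable lebesgue"
  using lebesgue_integral_affine[OF _ assms, of 1 a] by (simp_all add: add.commute)

lemma integrable_bounded_mult:
  fixes f g :: "'a \<Rightarrow> real"
  assumes "integrable M g" "f \<in> borel_measurable M" "\<And>x. \<bar>f x\<bar> \<le> B"
  shows "integrable M (\<lambda>x. f x * g x)"
proof (rule Bochner_Integration.integrable_bound[of _ "\<lambda>x. B * g x"])
  show "(\<lambda>x. f x * g x) \<in> borel_measurable M"
    using assms(1,2) by (intro borel_measurable_times) auto
  show "AE x in M. norm (f x * g x) \<le> norm (B * g x)"
    using assms(3) by (intro AE_I2) (auto simp: abs_mult intro!: mult_right_mono order_trans[OF assms(3) abs_ge_self])
qed (use assms(1) in simp)

definition conv :: "(real^'n \<Rightarrow> real) \<Rightarrow> (real^'n \<Rightarrow> real) \<Rightarrow> real^'n \<Rightarrow> real" where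
  "conv J w x = (LINT y|lebesgue. J (x - y) * w y)"

lemma test_measurable: "\<phi> \<in> test_functions \<Omega> \<Longrightarrow> \<phi> \<in> borel_measurable lebesgue"
  by (intro continuous_lebesgue_measurable) (erule test_functions_continuous)

lemma test_integrable_mult:
  assumes "\<phi> \<in> test_functions \<Omega>" "integrable lebesgue w"
  shows "integrable lebesgue (\<lambda>y. \<phi> y * w y)"
proof -
  obtain B where "\<And>x. \<bar>\<phi> x\<bar> \<le> B" using test_functions_bounded[OF assms(1)] by metis
  then show ?thesis
    by (intro integrable_bounded_mult[OF assms(2) test_measurable[OF assms(1)]])
qed

lemma conv_integrable:
  assumes "J \<in> test_functions \<Omega>" "integrable lebesgue w"
  shows "integrable lebesgue (\<lambda>y. J (x - y) * w y)"
proof -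
  obtain B where "\<And>x. \<bar>J x\<bar> \<le> B" using test_functions_bounded[OF assms(1)] by metis
  then show ?thesis
    using lebesgue_integral_reflect_shift(3)[OF test_measurable[OF assms(1)]]
    by (intro integrable_bounded_mult[OF assms(2)])
qed

lemma test_uniformly_continuous:
  assumes "\<phi> \<in> test_functions \<Omega>" "e > 0"
  obtains d where "d > 0" "\<And>x y. dist x y < d \<Longrightarrow> \<bar>\<phi> x - \<phi> y\<bar> < e"
proof -
  obtain C where C: "compact C" "\<And>x. x \<notin> C \<Longrightarrow> \<phi> x = 0"
    using assms(1) by (rule test_functionsD) blast
  obtain R where "\<forall>x\<in>C. norm x \<le> R"
    using compact_imp_bounded[OF C(1)] unfolding bounded_iff by blast
  then have R: "C \<subseteq> cball 0 R" by auto
  have "uniformly_continuous_on (cball 0 (R + 1)) \<phi>"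
    by (rule compact_uniformly_continuous[OF test_functions_continuous[OF assms(1)] compact_cball])
  then obtain d where d: "d > 0"
    "\<And>x y. x \<in> cball 0 (R + 1) \<Longrightarrow> y \<in> cball 0 (R + 1) \<Longrightarrow> dist x y < d \<Longrightarrow> dist (\<phi> x) (\<phi> y) < e"
    unfolding uniformly_continuous_on_def using assms(2) by (metis (no_types, lifting) dist_commute)
  have "\<bar>\<phi> x - \<phi> y\<bar> < e" if xy: "dist x y < min d 1" for x y
  proof (cases "x \<in> cball 0 (R + 1) \<and> y \<in> cball 0 (R + 1)")
    case True
    then show ?thesis using d(2)[of x y] xy by (simp add: dist_real_def)
  next
    case False
    have "x \<notin> cball 0 R" "y \<notin> cball 0 R"
      using False xy norm_triangle_sub[of x y] norm_triangle_sub[of y x]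
      by (auto simp: dist_norm norm_minus_commute)
    then show ?thesis using R C(2) assms(2) by (metis abs_zero diff_self in_mono)
  qed
  then show ?thesis using that[of "min d 1"] d(1) by simp
qed

text \<open>The components of the gradient are uniformly continuous, and the mean value inequality
  on a ball turns this into a remainder that is uniform in \<open>x\<close>. The uniformity is what
  permits differentiation under a convolution integral.\<close>

lemma test_linearization:
  fixes \<phi> :: "real^'n \<Rightarrow> real"
  assumes "\<phi> \<in> test_functions \<Omega>" "e > 0"
  obtains d where "d > 0" "\<And>x h. norm h < d \<Longrightarrow> \<bar>\<phi> (x + h) - \<phi> x - grad \<phi> x \<bullet> h\<bar> \<le> e * norm h"
proof -
  have "\<exists>d>0. \<forall>x y. dist x y < d \<longrightarrow> \<bar>grad \<phi> x $ i - grad \<phi> y $ i\<bar> < e / real CARD('n)" for i :: 'n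
    using test_uniformly_continuous[OF test_functions_grad[OF assms(1), of i], of "e / real CARD('n)"] assms(2)
    by (metis divide_pos_pos of_nat_0_less_iff zero_less_card_finite)
  then obtain D where D: "\<And>i. D i > 0"
    "\<And>i x y. dist x y < D i \<Longrightarrow> \<bar>grad \<phi> x $ i - grad \<phi> y $ i\<bar> < e / real CARD('n)" by metis
  define d where "d = Min (range D)"
  have d: "d > 0" "d \<le> D i" for i using D(1) by (auto simp: d_def)
  have B: "norm (grad \<phi> x - grad \<phi> y) \<le> e" if "dist x y < d" for x y
  proof -
    have "norm (grad \<phi> x - grad \<phi> y) \<le> (\<Sum>i\<in>UNIV. \<bar>(grad \<phi> x - grad \<phi> y) $ i\<bar>)"
      by (rule norm_le_l1_cart)
    also have "\<dots> \<le> (\<Sum>i\<in>(UNIV::'n set). e / real CARD('n))"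
      using D(2)[OF less_le_trans[OF that d(2)]] by (intro sum_mono) (simp add: less_imp_le)
    finally show ?thesis by simp
  qed
  have "\<bar>\<phi> (x + h) - \<phi> x - grad \<phi> x \<bullet> h\<bar> \<le> e * norm h" if "norm h < d" for x h
  proof -
    have "norm (\<phi> (x + h) - \<phi> x - grad \<phi> x \<bullet> (x + h - x)) \<le> norm (x + h - x) * e"
    proof (rule differentiable_bound_linearization[where S = "ball x d" and f' = "\<lambda>y h. grad \<phi> y \<bullet> h"])
      show "x + t *\<^sub>R (x + h - x) \<in> ball x d" if "t \<in> {0..1}" for t
      proof -
        have "norm (t *\<^sub>R h) \<le> norm h" using that by (simp add: mult_left_le_one_le)
        then show ?thesis using \<open>norm h < d\<close> by (simp add: dist_norm)
      qed
      have "\<phi> differentiable (at y)" for y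
        using smooth_on_differentiable[OF test_functions_smooth[OF assms(1)]] by simp
      then show "(\<phi> has_derivative (\<bullet>) (grad \<phi> y)) (at y within ball x d)" for y
        using has_derivative_at_withinI has_derivative_grad by blast
      show "onorm ((\<bullet>) (grad \<phi> y) - (\<bullet>) (grad \<phi> x)) \<le> e" if "y \<in> ball x d" for y
      proof (rule onorm_le)
        fix h
        have "norm (((\<bullet>) (grad \<phi> y) - (\<bullet>) (grad \<phi> x)) h) = \<bar>(grad \<phi> y - grad \<phi> x) \<bullet> h\<bar>"
          by (simp add: inner_diff_left)
        also have "\<dots> \<le> norm (grad \<phi> y - grad \<phi> x) * norm h" by (rule Cauchy_Schwarz_ineq2)
        also have "\<dots> \<le> e * norm h"
          using B[of y x] that by (intro mult_right_mono) (auto simp: dist_commute)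
        finally show "norm (((\<bullet>) (grad \<phi> y) - (\<bullet>) (grad \<phi> x)) h) \<le> e * norm h" .
      qed
    qed (use d in auto)
    then show ?thesis by (simp add: mult.commute)
  qed
  then show ?thesis using that[of d] d(1) by blast
qed

text \<open>The uniform linearization of \<open>J\<close> is integrated against \<open>w\<close>.
  The tolerance is divided by \<open>W + 1\<close>, where \<open>W\<close> is the integral of
  \<open>\<bar>w\<bar>\<close>; the \<open>+ 1\<close> keeps the quotient meaningful if
  \<open>W = 0\<close>.\<close>

lemma conv_has_derivative:
  assumes J: "J \<in> test_functions \<Omega>" and w: "integrable lebesgue w"
  shows "(conv J w has_derivative (\<lambda>h. (\<chi> i. conv (\<lambda>z. grad J z $ i) w x) \<bullet> h)) (at x)"
  unfolding has_derivative_at_alt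
proof (intro conjI allI impI)
  let ?p = "\<chi> i. conv (\<lambda>z. grad J z $ i) w x"
  show "bounded_linear (\<lambda>h. ?p \<bullet> h)" by (rule bounded_linear_inner_right)
  fix e :: real assume "e > 0"
  define W where "W = (LINT y|lebesgue. \<bar>w y\<bar>)"
  have "W \<ge> 0" unfolding W_def by simp
  then have "e / (W + 1) > 0" using \<open>e > 0\<close> by simp
  then obtain d where d: "d > 0" "\<And>x h. norm h < d \<Longrightarrow> \<bar>J (x + h) - J x - grad J x \<bullet> h\<bar> \<le> e / (W + 1) * norm h"
    using test_linearization[OF J] by metis
  have "norm (conv J w y - conv J w x - ?p \<bullet> (y - x)) \<le> e * norm (y - x)" if y: "norm (y - x) < d" for y
  proof -
    let ?h = "y - x"
    let ?F = "\<lambda>z. (J (y - z) - J (x - z) - grad J (x - z) \<bullet> ?h) * w z"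
    have int: "integrable lebesgue (\<lambda>z. J (y - z) * w z)" "integrable lebesgue (\<lambda>z. J (x - z) * w z)"
      "integrable lebesgue (\<lambda>z. grad J (x - z) $ i * w z)" for i
      using conv_integrable[OF J w] conv_integrable[OF test_functions_grad[OF J] w] by auto
    have F: "?F = (\<lambda>z. J (y - z) * w z - J (x - z) * w z - (\<Sum>i\<in>UNIV. ?h $ i * (grad J (x - z) $ i * w z)))"
      by (auto simp: fun_eq_iff inner_vec_def algebra_simps sum_distrib_left sum_distrib_right)
    have "?p \<bullet> ?h = (\<Sum>i\<in>UNIV. ?h $ i * (LINT z|lebesgue. grad J (x - z) $ i * w z))"
      by (simp add: inner_vec_def conv_def mult.commute)
    then have eq: "conv J w y - conv J w x - ?p \<bullet> ?h = (LINT z|lebesgue. ?F z)"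
      unfolding F conv_def using int by (simp add: Bochner_Integration.integral_diff Bochner_Integration.integral_sum)
    have "norm (LINT z|lebesgue. ?F z) \<le> (LINT z|lebesgue. (e / (W + 1) * norm ?h) * \<bar>w z\<bar>)"
    proof (rule Bochner_Integration.integral_norm_bound_integral)
      show "integrable lebesgue ?F" unfolding F using int by auto
      show "norm (?F z) \<le> (e / (W + 1) * norm ?h) * \<bar>w z\<bar>" for z
      proof -
        have "(x - z) + ?h = y - z" by simp
        from d(2)[OF y, of "x - z", unfolded this] show ?thesis
          unfolding real_norm_def abs_mult by (rule mult_right_mono) simp
      qed
    qed (use w in auto)
    also have "\<dots> = e * norm ?h * (W / (W + 1))"
      unfolding W_def by simp
    also have "\<dots> \<le> e * norm ?h"
      using \<open>e > 0\<close> \<open>W \<ge> 0\<close> by (intro mult_left_le) auto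
    finally show ?thesis unfolding eq .
  qed
  then show "\<exists>d>0. \<forall>y. norm (y - x) < d \<longrightarrow> norm (conv J w y - conv J w x - ?p \<bullet> (y - x)) \<le> e * norm (y - x)"
    using d(1) by blast
qed

lemma grad_conv:
  assumes "J \<in> test_functions \<Omega>" "integrable lebesgue w"
  shows "grad (conv J w) x $ i = conv (\<lambda>z. grad J z $ i) w x"
  using grad_unique[OF conv_has_derivative[OF assms]] by simp

lemma smooth_on_conv:
  assumes "J \<in> test_functions \<Omega>" "integrable lebesgue w"
  shows "smooth_on U (conv J w)"
proof -
  have "Ck_on k UNIV (conv J w)" if "J \<in> test_functions \<Omega>" for k J
    using that
  proof (induction k arbitrary: J)
    case 0
    then show ?case
      using has_derivative_continuous[OF conv_has_derivative[OF 0 assms(2)]]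
      by (simp add: continuous_at_imp_continuous_on)
  next
    case (Suc k)
    have "(\<lambda>x. grad (conv J w) x $ i) = conv (\<lambda>z. grad J z $ i) w" for i
      using grad_conv[OF Suc.prems assms(2)] by auto
    then show ?case
      using Suc.IH[OF test_functions_grad[OF Suc.prems]] conv_has_derivative[OF Suc.prems assms(2)]
      by (auto simp: differentiable_def)
  qed
  then have "Ck_on k U (conv J w)" for k
    using Ck_on_subset[OF _ subset_UNIV] assms(1) by blast
  then show ?thesis by (rule smooth_onI)
qed

subsection \<open>Mollifiers\<close>

definition mollifier :: "real \<Rightarrow> real^'n \<Rightarrow> real" where
  "mollifier e x = bump 0 e x / (LINT y|lebesgue. bump (0::real^'n) e y)"

lemma test_integrable: 
  assumes "\<phi> \<in> test_functions \<Omega>" shows "integrable lebesgue \<phi>"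
proof -
  obtain C where C: "compact C" "\<And>x. x \<notin> C \<Longrightarrow> \<phi> x = 0"
    using assms by (rule test_functionsD) blast
  have "integrable lebesgue (\<lambda>x. \<phi> x * indicator C x)"
    by (intro test_integrable_mult[OF assms] integrable_real_indicator)
      (use lmeasurable_compact[OF C(1)] in \<open>auto simp: fmeasurable_def\<close>)
  moreover have "(\<lambda>x. \<phi> x * indicator C x) = \<phi>"
    using C(2) by (auto simp: fun_eq_iff indicator_def)
  ultimately show ?thesis by simp
qed

lemma bump_integral_pos:
  assumes "e > 0"
  shows "(LINT y|lebesgue. bump (0::real^'n) e y) > 0"
proof -
  have t: "bump (0::real^'n) e \<in> test_functions UNIV"
    by (rule bump_test[OF assms]) simp
  have "(LINT y|lebesgue. bump (0::real^'n) e y) \<noteq> 0"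
  proof
    assume "(LINT y|lebesgue. bump (0::real^'n) e y) = 0"
    then have "AE y in lebesgue. bump (0::real^'n) e y = 0"
      using integral_nonneg_eq_0_iff_AE[OF test_integrable[OF t]] bump_nonneg by auto
    then have "AE y in lebesgue. (y::real^'n) \<notin> ball 0 e"
      by (simp only: bump_eq_0_iff[OF assms])
    then have "ball (0::real^'n) e \<in> null_sets lebesgue"
      using AE_iff_null_sets[of "ball (0::real^'n) e" lebesgue] by simp
    then have "negligible (ball (0::real^'n) e)"
      by (simp add: negligible_iff_null_sets)
    then show False
      using assms open_not_negligible[of "ball (0::real^'n) e"] by auto
  qed
  moreover have "(LINT y|lebesgue. bump (0::real^'n) e y) \<ge> 0"
    by (simp add: bump_nonneg)
  ultimately show ?thesis by simp
qed

lemma mollifier_test: "e > 0 \<Longrightarrow> mollifier e \<in> test_functions UNIV"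
  using test_functions_mult[OF open_UNIV smooth_on_const bump_test[of e 0 UNIV],
      of "inverse (LINT y|lebesgue. bump 0 e y)"]
  by (simp add: mollifier_def[abs_def] divide_inverse mult.commute)

lemma mollifier_nonneg: "mollifier e x \<ge> 0"
  by (simp add: mollifier_def bump_nonneg)

lemma mollifier_eq_0: "e > 0 \<Longrightarrow> norm x \<ge> e \<Longrightarrow> mollifier e x = 0"
  by (simp add: mollifier_def bump_eq_0_iff)

lemma mollifier_integral:
  assumes "e > 0" shows "(LINT y|lebesgue. mollifier e (y::real^'n)) = 1"
proof -
  have "(LINT y|lebesgue. mollifier e (y::real^'n)) = (LINT y|lebesgue. bump (0::real^'n) e y) / (LINT y|lebesgue. bump (0::real^'n) e y)"
    unfolding mollifier_def by (rule integral_divide_zero)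
  then show ?thesis using bump_integral_pos[OF assms, where 'n = 'n] by simp
qed

lemma conv_alt:
  assumes "J \<in> test_functions \<Omega>" "integrable lebesgue w"
  shows "conv J w x = (LINT y|lebesgue. J y * w (x - y))" "integrable lebesgue (\<lambda>y. J y * w (x - y))"
proof -
  have m: "(\<lambda>y. J (x - y) * w y) \<in> borel_measurable lebesgue"
    using conv_integrable[OF assms] by auto
  show "conv J w x = (LINT y|lebesgue. J y * w (x - y))"
    using lebesgue_integral_reflect_shift(1)[OF m, of x] by (simp add: conv_def)
  show "integrable lebesgue (\<lambda>y. J y * w (x - y))"
    using lebesgue_integral_reflect_shift(2)[OF m, of x] conv_integrable[OF assms, of x] by simp
qed

text \<open>Mollification is local. With the constants 0 and 1 this turns rough cutoffs into smooth
  ones.\<close>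

lemma conv_mollifier_const:
  fixes w :: "real^'n \<Rightarrow> real"
  assumes "e > 0" "integrable lebesgue w" "\<And>y. dist x y < e \<Longrightarrow> w y = c"
  shows "conv (mollifier e) w x = c"
proof -
  have "(\<lambda>y. mollifier e (x - y) * w y) = (\<lambda>y. mollifier e (x - y) * c)"
  proof
    show "mollifier e (x - y) * w y = mollifier e (x - y) * c" for y
      using assms(3)[of y] mollifier_eq_0[OF assms(1), of "x - y"] by (cases "dist x y < e") (auto simp: dist_norm)
  qed
  then have "conv (mollifier e) w x = (LINT y|lebesgue. mollifier e (x - y) * c)"
    by (simp only: conv_def)
  also have "\<dots> = c"
    using lebesgue_integral_reflect_shift(1)[OF test_measurable[OF mollifier_test[OF assms(1)]], of x]
    by (simp add: mollifier_integral[OF assms(1)])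
  finally show ?thesis .
qed

lemma conv_mollifier_bound:
  fixes w :: "real^'n \<Rightarrow> real"
  assumes "e > 0" "integrable lebesgue w" "\<And>y. \<bar>w y\<bar> \<le> B"
  shows "\<bar>conv (mollifier e) w x\<bar> \<le> B"
proof -
  note t = mollifier_test[OF assms(1)]
  have "norm (conv (mollifier e) w x) \<le> (LINT y|lebesgue. mollifier e (y::real^'n) * B)"
    unfolding conv_alt(1)[OF t assms(2)]
  proof (rule Bochner_Integration.integral_norm_bound_integral[OF conv_alt(2)[OF t assms(2)]])
    show "integrable lebesgue (\<lambda>y::real^'n. mollifier e y * B)"
      by (intro integrable_mult_left test_integrable[OF t])
    show "norm (mollifier e y * w (x - y)) \<le> mollifier e y * B" for y
      unfolding norm_mult using assms(3)[of "x - y"] by (simp add: mollifier_nonneg mult_left_mono)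
  qed
  then show ?thesis by (simp add: mollifier_integral[OF assms(1)])
qed

lemma conv_mollifier_nonneg:
  assumes "\<And>y. w y \<ge> 0"
  shows "conv (mollifier e) w x \<ge> 0"
  unfolding conv_def by (intro Bochner_Integration.integral_nonneg mult_nonneg_nonneg mollifier_nonneg assms)

text \<open>The difference quotients in the direction \<open>p\<close> tend to
  \<open>p \<bullet> p\<close> and are at most \<open>L * norm p\<close>; it remains to divide by
  \<open>norm p\<close>.\<close>

lemma norm_grad_le_Lipschitz:
  fixes f :: "real^'n \<Rightarrow> real"
  assumes f: "(f has_derivative (\<lambda>h. p \<bullet> h)) (at x)" and L: "\<And>y. \<bar>f y - f x\<bar> \<le> L * norm (y - x)"
  shows "norm p \<le> L"
proof (cases "p = 0")
  case True
  \<comment> \<open>If \<open>p = 0\<close>, only the sign of \<open>L\<close> is left to show; it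
    is read off from the hypothesis at a point at distance one.\<close>
  have "0 \<le> L * norm (x + axis undefined 1 - x)" using L[of "x + axis undefined 1"] by linarith
  then show ?thesis using True by simp
next
  case False
  have "((\<lambda>t::real. x + t *\<^sub>R p) has_derivative (\<lambda>t. t *\<^sub>R p)) (at 0)"
    by (auto intro!: derivative_eq_intros)
  moreover have "(f has_derivative (\<lambda>h. p \<bullet> h)) (at (x + 0 *\<^sub>R p))" using f by simp
  ultimately have "((\<lambda>t. f (x + t *\<^sub>R p)) has_derivative (\<lambda>t. p \<bullet> (t *\<^sub>R p))) (at 0)"
    by (rule has_derivative_compose)
  then have "((\<lambda>t. f (x + t *\<^sub>R p)) has_field_derivative (p \<bullet> p)) (at 0)"
    unfolding has_field_derivative_def by (simp add: mult.commute[of _ "p \<bullet> p"])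
  then have lim: "((\<lambda>t. (f (x + t *\<^sub>R p) - f x) / t) \<longlongrightarrow> p \<bullet> p) (at 0)"
    by (simp add: has_field_derivative_iff)
  have "(f (x + t *\<^sub>R p) - f x) / t \<le> L * norm p" for t
  proof -
    have "\<bar>(f (x + t *\<^sub>R p) - f x) / t\<bar> \<le> L * norm p"
    proof (cases "t = 0")
      case True
      have "0 \<le> L * norm (x + p - x)" using L[of "x + p"] by linarith
      then show ?thesis using True by simp
    next
      case False
      then show ?thesis using L[of "x + t *\<^sub>R p"] by (simp add: abs_divide divide_le_eq mult_ac)
    qed
    then show ?thesis by linarith
  qed
  then have "p \<bullet> p \<le> L * norm p"
    by (intro tendsto_upperbound[OF lim]) auto
  then have "norm p * norm p \<le> L * norm p"
    by (simp add: dot_square_norm power2_eq_square)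
  then show ?thesis using False by simp
qed

lemma conv_mollifier_grad_bound:
  fixes w :: "real^'n \<Rightarrow> real"
  assumes e: "e > 0" and w: "integrable lebesgue w" and L: "\<And>x y. \<bar>w x - w y\<bar> \<le> L * norm (x - y)"
  shows "norm (grad (conv (mollifier e) w) x) \<le> L"
proof -
  note t = mollifier_test[OF e]
  have "\<bar>conv (mollifier e) w y - conv (mollifier e) w x\<bar> \<le> L * norm (y - x)" for y
  proof -
    have "conv (mollifier e) w y - conv (mollifier e) w x
        = (LINT z|lebesgue. mollifier e z * (w (y - z) - w (x - z)))"
      using conv_alt[OF t w] by (simp add: algebra_simps)
    moreover have "norm \<dots> \<le> (LINT z|lebesgue. mollifier e (z::real^'n) * (L * norm (y - x)))"
    proof (rule Bochner_Integration.integral_norm_bound_integral)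
      show "integrable lebesgue (\<lambda>z. mollifier e z * (w (y - z) - w (x - z)))"
        using conv_alt(2)[OF t w] by (simp add: right_diff_distrib)
      show "norm (mollifier e z * (w (y - z) - w (x - z))) \<le> mollifier e z * (L * norm (y - x))" for z
        using L[of "y - z" "x - z"] by (auto simp: abs_mult mollifier_nonneg intro!: mult_left_mono)
    qed (use test_integrable[OF t] in auto)
    ultimately show ?thesis by (simp add: mollifier_integral[OF e])
  qed
  moreover have "(conv (mollifier e) w has_derivative (\<lambda>h. grad (conv (mollifier e) w) x \<bullet> h)) (at x)"
    by (intro has_derivative_grad smooth_on_differentiable[OF smooth_on_conv[OF t w, of UNIV]]) simp
  ultimately show ?thesis by (rule norm_grad_le_Lipschitz[rotated])
qed

section \<open>Neighbourhoods of compact sets and smooth cutoffs\<close>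

lemma infdist_neighbourhood_bounded:
  fixes C :: "'a::{real_normed_vector, heine_borel} set"
  assumes "compact C" "C \<noteq> {}"
  shows "bounded {x. infdist x C \<le> r}"
proof -
  obtain R where R: "\<And>c. c \<in> C \<Longrightarrow> norm c \<le> R"
    using compact_imp_bounded[OF assms(1)] by (auto simp: bounded_iff)
  have "norm x \<le> R + r" if "infdist x C \<le> r" for x
  proof -
    obtain c where "c \<in> C" "infdist x C = dist x c"
      using infdist_attains_inf[OF compact_imp_closed[OF assms(1)] assms(2)] by metis
    then show ?thesis using R[of c] that norm_triangle_sub[of x c] by (simp add: dist_norm)
  qed
  then show ?thesis by (auto simp: bounded_iff)
qed

lemma compact_infdist_subset:
  fixes C :: "'a::heine_borel set"
  assumes "compact C" "C \<noteq> {}" "open U" "C \<subseteq> U"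
  obtains e where "e > 0" "{x. infdist x C \<le> e} \<subseteq> U"
proof -
  have "C \<inter> - U = {}" "closed (- U)" using assms by auto
  then obtain d where d: "d > 0" "\<And>x y. x \<in> C \<Longrightarrow> y \<in> - U \<Longrightarrow> d \<le> dist x y"
    using separate_compact_closed[of C "- U"] assms(1) by metis
  have "{x. infdist x C \<le> d / 2} \<subseteq> U"
  proof
    fix x assume "x \<in> {x. infdist x C \<le> d / 2}"
    then have "infdist x C < d" using d by auto
    moreover obtain c where "c \<in> C" "infdist x C = dist x c"
      using infdist_attains_inf[OF compact_imp_closed[OF assms(1)] assms(2)] by metis
    ultimately show "x \<in> U" using d(2)[of c x] by (auto simp: dist_commute)
  qed
  then show ?thesis using that[of "d / 2"] d(1) by simp
qed

lemma integrable_bounded_support: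
  fixes f :: "real^'n \<Rightarrow> real"
  assumes "f \<in> borel_measurable lebesgue" "bounded S" "\<And>x. x \<notin> S \<Longrightarrow> f x = 0" "\<And>x. \<bar>f x\<bar> \<le> B"
  shows "integrable lebesgue f"
proof -
  have "integrable lebesgue (\<lambda>x. f x * indicator (closure S) x)"
    by (rule integrable_bounded_mult[OF _ assms(1,4)], rule integrable_real_indicator)
      (use assms(2) lmeasurable_compact[of "closure S"] in \<open>auto simp: compact_closure fmeasurable_def\<close>)
  moreover have "(\<lambda>x. f x * indicator (closure S) x) = f"
    using assms(3) closure_subset[of S] by (auto simp: fun_eq_iff indicator_def)
  ultimately show ?thesis by simp
qed

text \<open>The indicator of the neighbourhood of radius \<open>2 * e\<close> is mollified at radius
  \<open>e\<close>, which gives 1 within \<open>e\<close> and 0 beyond \<open>3 * e = d\<close>. The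
  value 1 is taken on a neighbourhood of \<open>C\<close> and not only on \<open>C\<close>, so that
  the gradient vanishes on \<open>C\<close> as well.\<close>

lemma smooth_cutoff:
  assumes "compact C" "C \<noteq> {}" "open U" "C \<subseteq> U"
  obtains \<eta> e where "\<eta> \<in> test_functions U" "e > 0" "\<And>x. 0 \<le> \<eta> x" "\<And>x. \<bar>\<eta> x\<bar> \<le> 1"
    "\<And>x. infdist x C < e \<Longrightarrow> \<eta> x = 1"
proof -
  obtain d where d: "d > 0" "{x. infdist x C \<le> d} \<subseteq> U"
    using compact_infdist_subset[OF assms] .
  define e where "e = d / 3"
  have e: "e > 0" using d by (simp add: e_def)
  define S where "S = {x. infdist x C < 2 * e}"
  have S: "open S"
    unfolding S_def by (intro open_Collect_less continuous_intros)
  have bS: "bounded S"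
    by (rule bounded_subset[OF infdist_neighbourhood_bounded[OF assms(1,2), of "2 * e"]])
      (auto simp: S_def)
  have w: "integrable lebesgue (indicator S :: _ \<Rightarrow> real)"
  proof (rule integrable_bounded_support[OF _ bS, of _ 1])
    have "S \<in> sets lebesgue" using S by auto
    then show "(indicator S :: _ \<Rightarrow> real) \<in> borel_measurable lebesgue" by (rule borel_measurable_indicator)
  qed (auto simp: indicator_def)
  let ?\<eta> = "conv (mollifier e) (indicator S)"
  have near: "infdist y C < infdist x C + e" "infdist x C < infdist y C + e" if "dist x y < e" for x y
    using infdist_triangle[of x C y] infdist_triangle[of y C x] that by (auto simp: dist_commute)
  have "?\<eta> x = 0" if "x \<notin> {x. infdist x C \<le> d}" for x
    by (rule conv_mollifier_const[OF e w]) (use that near(2)[of x] in \<open>force simp: S_def e_def indicator_def\<close>)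
  moreover have "compact {x. infdist x C \<le> d}"
    using infdist_neighbourhood_bounded[OF assms(1,2)]
    by (auto simp: compact_eq_bounded_closed intro!: closed_Collect_le continuous_intros)
  ultimately have "?\<eta> \<in> test_functions U"
    using d(2) by (intro test_functionsI[of _ "{x. infdist x C \<le> d}"] smooth_on_conv[OF mollifier_test[OF e] w]) auto
  moreover have "?\<eta> x = 1" if "infdist x C < e" for x
    by (rule conv_mollifier_const[OF e w]) (use that near(1)[of x] in \<open>force simp: S_def indicator_def\<close>)
  moreover have "\<bar>?\<eta> x\<bar> \<le> 1" for x
    by (rule conv_mollifier_bound[OF e w]) (simp add: indicator_def)
  moreover have "?\<eta> x \<ge> 0" for x
    by (rule conv_mollifier_nonneg) simp
  ultimately show ?thesis using that e by blast
qed

subsection \<open>Convergence of mollifications in mean\<close>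

lemma integral_mono_abs_tendsto_0:
  fixes f :: "'b \<Rightarrow> real"
  assumes "\<And>e. e > 0 \<Longrightarrow> \<forall>\<^sub>F y in F. \<bar>f y\<bar> \<le> e"
  shows "(f \<longlongrightarrow> 0) F"
proof (rule tendstoI)
  fix e :: real assume "e > 0"
  then have "\<forall>\<^sub>F y in F. \<bar>f y\<bar> \<le> e / 2" using assms[of "e / 2"] by simp
  then show "\<forall>\<^sub>F y in F. dist (f y) 0 < e"
    by eventually_elim (use \<open>e > 0\<close> in simp)
qed

text \<open>The modulus of continuity of \<open>w\<close> in mean. Its values for \<open>y\<close>
  within the mollification radius bound the mollification error.\<close>

definition shift_diff :: "(real^'n \<Rightarrow> real) \<Rightarrow> real^'n \<Rightarrow> real" where
  "shift_diff w y = (LINT x|lebesgue. \<bar>w (x + y) - w x\<bar>)"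

lemma shift_integrable:
  fixes w :: "real^'n \<Rightarrow> real"
  assumes "integrable lebesgue w"
  shows "integrable lebesgue (\<lambda>x. w (x + y))" "(LINT x|lebesgue. w (x + y)) = (LINT x|lebesgue. w x)"
  using lebesgue_integral_shift[of w y] assms borel_measurable_integrable[OF assms] by simp_all

lemma shift_diff_approx:
  fixes w g :: "real^'n \<Rightarrow> real"
  assumes w: "integrable lebesgue w" and g: "integrable lebesgue g"
  shows "shift_diff w y \<le> shift_diff g y + 2 * (LINT x|lebesgue. \<bar>w x - g x\<bar>)"
proof -
  let ?d = "\<lambda>x. \<bar>w x - g x\<bar>"
  have d: "integrable lebesgue ?d" using w g by simp
  have "shift_diff w y \<le> (LINT x|lebesgue. \<bar>g (x + y) - g x\<bar> + ?d (x + y) + ?d x)"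
    unfolding shift_diff_def
  proof (rule integral_mono)
    show "integrable lebesgue (\<lambda>x. \<bar>g (x + y) - g x\<bar> + ?d (x + y) + ?d x)"
      using shift_integrable(1)[OF g] g shift_integrable(1)[OF w] w
      by (intro Bochner_Integration.integrable_add integrable_abs Bochner_Integration.integrable_diff)
  qed (use shift_integrable(1)[OF w] w in \<open>auto intro!: integrable_abs\<close>)
  also have "\<dots> = shift_diff g y + (LINT x|lebesgue. ?d (x + y)) + (LINT x|lebesgue. ?d x)"
    unfolding shift_diff_def
    using shift_integrable(1)[OF g] g shift_integrable(1)[OF w] w shift_integrable(1)[OF d, of y] d
    by (simp add: Bochner_Integration.integral_add)
  finally show ?thesis using shift_integrable(2)[OF d, of y] by simp
qed

lemma shift_diff_nonneg: "shift_diff w y \<ge> 0"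
  by (simp add: shift_diff_def)

text \<open>Replacing \<open>w\<close> by \<open>g\<close> costs twice their distance in mean,
  whatever the shift, so continuity of translations survives approximation in mean.\<close>

lemma shift_diff_tendsto_approx:
  fixes w :: "real^'n \<Rightarrow> real"
  assumes w: "integrable lebesgue w"
    and g: "\<And>e. e > 0 \<Longrightarrow> \<exists>g. integrable lebesgue g \<and> (shift_diff g \<longlongrightarrow> 0) (at 0) \<and> (LINT x|lebesgue. \<bar>w x - g x\<bar>) \<le> e"
  shows "(shift_diff w \<longlongrightarrow> 0) (at 0)"
proof (rule integral_mono_abs_tendsto_0)
  fix e :: real assume "e > 0"
  then obtain g where g: "integrable lebesgue g" "(shift_diff g \<longlongrightarrow> 0) (at 0)"
    "(LINT x|lebesgue. \<bar>w x - g x\<bar>) \<le> e / 4"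
    using g[of "e / 4"] by auto
  have "\<forall>\<^sub>F y in at 0. shift_diff g y < e / 2"
    using order_tendstoD(2)[OF g(2), of "e / 2"] \<open>e > 0\<close> by simp
  then show "\<forall>\<^sub>F y in at 0. \<bar>shift_diff w y\<bar> \<le> e"
  proof eventually_elim
    case (elim y)
    then show ?case
      using shift_diff_approx[OF w g(1), of y] g(3) shift_diff_nonneg[of w y] by linarith
  qed
qed

text \<open>Openness gives pointwise convergence only at the points of \<open>U\<close>. For
  indicator values \<open>a\<close> at \<open>x + y\<close> and \<open>b\<close> at \<open>x\<close>
  one has \<open>\<bar>a - b\<bar> = (a - b) + 2 * ((1 - a) * b)\<close>; the first summand
  integrates to 0 by translation invariance, and the second lives on \<open>U\<close>, where
  dominated convergence applies.\<close>

lemma shift_diff_open: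
  fixes U :: "(real^'n) set"
  assumes "open U" "U \<in> lmeasurable"
  shows "(shift_diff (indicator U) \<longlongrightarrow> 0) (at 0)"
proof (rule tendsto_at_iff_sequentially[THEN iffD2], intro allI impI)
  fix Y :: "nat \<Rightarrow> real^'n" assume "\<forall>i. Y i \<in> UNIV - {0}" and Y: "Y \<longlonglongrightarrow> 0"
  let ?f = "indicator U :: real^'n \<Rightarrow> real"
  have f: "integrable lebesgue ?f" using assms(2) by (auto simp: fmeasurable_def)
  have i: "integrable lebesgue (\<lambda>x. (1 - ?f (x + y)) * ?f x)" for y
    by (rule integrable_bounded_mult[OF f, of _ 1])
      (use borel_measurable_integrable[OF shift_integrable(1)[OF f, of y]] in \<open>auto simp: indicator_def\<close>)
  have eq: "shift_diff ?f y = 2 * (LINT x|lebesgue. (1 - ?f (x + y)) * ?f x)" for y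
  proof -
    have "\<bar>?f (x + y) - ?f x\<bar> = (?f (x + y) - ?f x) + 2 * ((1 - ?f (x + y)) * ?f x)" for x
      by (auto simp: indicator_def)
    then have "shift_diff ?f y = (LINT x|lebesgue. (?f (x + y) - ?f x) + 2 * ((1 - ?f (x + y)) * ?f x))"
      by (simp only: shift_diff_def)
    also have "\<dots> = (LINT x|lebesgue. ?f (x + y)) - (LINT x|lebesgue. ?f x) + 2 * (LINT x|lebesgue. (1 - ?f (x + y)) * ?f x)"
      using f shift_integrable(1)[OF f, of y] i[of y]
      by (subst Bochner_Integration.integral_add) (auto intro: Bochner_Integration.integral_diff)
    finally show ?thesis using shift_integrable(2)[OF f, of y] by simp
  qed
  have "(\<lambda>n. LINT x|lebesgue. (1 - ?f (x + Y n)) * ?f x) \<longlonglongrightarrow> (LINT x|(lebesgue :: (real^'n) measure). 0)"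
  proof (rule integral_dominated_convergence[where w = ?f])
    show "AE x in lebesgue. (\<lambda>n. (1 - ?f (x + Y n)) * ?f x) \<longlonglongrightarrow> 0"
    proof (rule AE_I2)
      fix x
      show "(\<lambda>n. (1 - ?f (x + Y n)) * ?f x) \<longlonglongrightarrow> 0"
      proof (cases "x \<in> U")
        case True
        have "(\<lambda>n. x + Y n) \<longlonglongrightarrow> x + 0" by (intro tendsto_intros Y)
        then have "\<forall>\<^sub>F n in sequentially. x + Y n \<in> U"
          using topological_tendstoD[OF _ assms(1)] True by fastforce
        then show ?thesis by (intro tendsto_eventually) (auto elim: eventually_mono)
      qed simp
    qed
  qed (use f borel_measurable_integrable[OF i] in \<open>auto simp: indicator_def\<close>)
  then have "(\<lambda>n. shift_diff ?f (Y n)) \<longlonglongrightarrow> 0"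
    unfolding eq using tendsto_mult_right_zero by fastforce
  then show "(shift_diff ?f \<circ> Y) \<longlonglongrightarrow> 0" by (simp add: o_def)
qed

lemma shift_diff_cmult: "shift_diff (\<lambda>x. c * w x) y = \<bar>c\<bar> * shift_diff w y"
  by (simp add: shift_diff_def abs_mult flip: right_diff_distrib)

text \<open>Sums and limits in mean reduce the claim to indicators of measurable sets of finite
  measure, and outer regularity reduces these to indicators of open sets.\<close>

proposition shift_diff_tendsto_0:
  fixes w :: "real^'n \<Rightarrow> real"
  assumes "integrable lebesgue w"
  shows "(shift_diff w \<longlongrightarrow> 0) (at 0)"
  using assms
proof (induction rule: integrable_induct)
  case (base A c)
  show ?case
  proof (rule shift_diff_tendsto_approx)
    show "integrable lebesgue (\<lambda>x. indicator A x *\<^sub>R c)"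
      using base by simp
    fix e :: real assume "e > 0"
    define d where "d = e / (\<bar>c\<bar> + 1)"
    have d: "d > 0" "\<bar>c\<bar> * d \<le> e" using \<open>e > 0\<close> by (auto simp: d_def field_simps)
    obtain U where U: "open U" "A \<subseteq> U" "(U - A) \<in> lmeasurable" "emeasure lebesgue (U - A) < ennreal d"
      using sets_lebesgue_outer_open[OF base(1) d(1)] .
    have A: "A \<in> lmeasurable" using base by (auto simp: fmeasurable_def)
    have "U = (U - A) \<union> A" using U by auto
    then have Um: "U \<in> lmeasurable" using fmeasurable.Un[OF U(3) A] by metis
    have *: "integrable lebesgue (indicator U :: _ \<Rightarrow> real)" using Um by (auto simp: fmeasurable_def)
    have "\<bar>indicator A x *\<^sub>R c - c * indicator U x\<bar> = \<bar>c\<bar> * indicator (U - A) x" for x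
      using U(2) by (auto simp: indicator_def)
    then have "(LINT x|lebesgue. \<bar>indicator A x *\<^sub>R c - c * indicator U x\<bar>) = \<bar>c\<bar> * measure lebesgue (U - A)"
      by simp
    also have "\<dots> \<le> \<bar>c\<bar> * d"
      using U(3,4) d(1) by (intro mult_left_mono) (auto simp: emeasure_eq_measure2 ennreal_less_iff less_imp_le)
    finally have "(LINT x|lebesgue. \<bar>indicator A x *\<^sub>R c - c * indicator U x\<bar>) \<le> e" using d by simp
    moreover have "((\<lambda>y. shift_diff (\<lambda>x. c * indicator U x) y) \<longlongrightarrow> 0) (at 0)"
      unfolding shift_diff_cmult using tendsto_mult_left[OF shift_diff_open[OF U(1) Um], of "\<bar>c\<bar>"] by simp
    ultimately show "\<exists>g. integrable lebesgue g \<and> (shift_diff g \<longlongrightarrow> 0) (at 0) \<and>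
        (LINT x|lebesgue. \<bar>indicator A x *\<^sub>R c - g x\<bar>) \<le> e"
      using * by (intro exI[of _ "\<lambda>x. c * indicator U x"]) auto
  qed
next
  case (add f g)
  have le: "shift_diff (\<lambda>x. f x + g x) y \<le> shift_diff f y + shift_diff g y" for y
  proof -
    note i = shift_integrable(1)[OF add.hyps(1), of y] shift_integrable(1)[OF add.hyps(2), of y] add.hyps
    have "shift_diff (\<lambda>x. f x + g x) y \<le> (LINT x|lebesgue. \<bar>f (x + y) - f x\<bar> + \<bar>g (x + y) - g x\<bar>)"
      unfolding shift_diff_def using i by (intro integral_mono) auto
    also have "\<dots> = shift_diff f y + shift_diff g y"
      unfolding shift_diff_def using i by (intro Bochner_Integration.integral_add) auto
    finally show ?thesis .
  qed
  have "((\<lambda>y. shift_diff f y + shift_diff g y) \<longlongrightarrow> 0) (at 0)"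
    using tendsto_add[OF add.IH] by simp
  then show ?case
    by (rule Lim_null_comparison[OF always_eventually, rotated]) (use le in \<open>simp add: shift_diff_nonneg\<close>)
next
  case (lim f s)
  have "(\<lambda>i. LINT x|lebesgue. \<bar>f x - s i x\<bar>) \<longlonglongrightarrow> (LINT x|(lebesgue :: (real^'n) measure). 0)"
  proof (rule integral_dominated_convergence[where w = "\<lambda>x. 3 * \<bar>f x\<bar>"])
    show "AE x in lebesgue. (\<lambda>i. \<bar>f x - s i x\<bar>) \<longlonglongrightarrow> 0"
    proof (rule AE_I2)
      fix x :: "real^'n"
      have "(\<lambda>i. \<bar>f x - s i x\<bar>) \<longlonglongrightarrow> \<bar>f x - f x\<bar>"
        using lim.hyps(2) by (intro tendsto_intros) auto
      then show "(\<lambda>i. \<bar>f x - s i x\<bar>) \<longlonglongrightarrow> 0" by simp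
    qed
    show "AE x in lebesgue. norm \<bar>f x - s i x\<bar> \<le> 3 * \<bar>f x\<bar>" for i
      using lim.hyps(3)[of _ i] by (intro AE_I2) (smt (verit) real_norm_def space_completion space_lborel UNIV_I)
    show "(\<lambda>x. \<bar>f x - s i x\<bar>) \<in> borel_measurable lebesgue" for i
      using lim.hyps(1,4) by (intro borel_measurable_abs borel_measurable_diff) auto
  qed (use lim.hyps(4) in auto)
  then have L: "(\<lambda>i. LINT x|lebesgue. \<bar>f x - s i x\<bar>) \<longlonglongrightarrow> 0" by simp
  show ?case
  proof (rule shift_diff_tendsto_approx[OF lim.hyps(4)])
    fix e :: real assume "e > 0"
    then have "\<forall>\<^sub>F i in sequentially. (LINT x|lebesgue. \<bar>f x - s i x\<bar>) < e"
      using order_tendstoD(2)[OF L] by simp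
    then obtain i where "(LINT x|lebesgue. \<bar>f x - s i x\<bar>) < e"
      using eventually_happens'[OF sequentially_bot] by blast
    then show "\<exists>g. integrable lebesgue g \<and> (shift_diff g \<longlongrightarrow> 0) (at 0) \<and> (LINT x|lebesgue. \<bar>f x - g x\<bar>) \<le> e"
      using lim.hyps(1) lim.IH less_imp_le by blast
  qed
qed

lemma conv_measurable:
  assumes "J \<in> test_functions \<Omega>" "integrable lebesgue w"
  shows "conv J w \<in> borel_measurable borel"
  using smooth_on_continuous[OF smooth_on_conv[OF assms, of UNIV]] by (rule borel_measurable_continuous_onI)

text \<open>As \<open>mollifier e\<close> has integral one, \<open>conv (mollifier e) w - w\<close>
  is an average of differences of translates of \<open>w\<close>. Its norm in mean is at most the
  average of their norms, by exchanging the integrals, and each of these is at most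
  \<open>B\<close>.\<close>

lemma conv_mollifier_L1_bound:
  fixes w :: "real^'n \<Rightarrow> real"
  assumes e: "e > 0" and w: "integrable lebesgue w" and B: "\<And>y. norm y < e \<Longrightarrow> shift_diff w y \<le> B"
  shows "integrable lebesgue (conv (mollifier e) w)"
    and "(LINT x|lebesgue. \<bar>conv (mollifier e) w x - w x\<bar>) \<le> B"
proof -
  let ?J = "mollifier e :: real^'n \<Rightarrow> real"
  note t = mollifier_test[OF e, where 'a = 'n]
  \<comment> \<open>The exchange of integrals needs joint measurability of
    \<open>(y, x) \<mapsto> v (x - y)\<close>, so \<open>w\<close> is replaced by a Borel function
    equal to it almost everywhere.\<close>
  obtain v where v: "v \<in> borel_measurable lborel" "AE x in lborel. w x = v x"
    using completion_ex_borel_measurable_real[OF borel_measurable_integrable[OF w]] by blast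
  have vb: "v \<in> borel_measurable borel" using v(1) by simp
  have ae: "AE x in lebesgue. w x = v x" using AE_completion[OF v(2)] .
  have vl: "v \<in> borel_measurable lebesgue" using v(1) by (rule measurable_completion)
  have vi: "integrable lebesgue v"
    using integrable_cong_AE[of w lebesgue v] w vl ae borel_measurable_integrable[OF w] by blast
  have Jb: "?J \<in> borel_measurable borel"
    by (rule borel_measurable_continuous_onI[OF test_functions_continuous[OF t]])
  have B0: "B \<ge> 0" using B[of 0] e shift_diff_nonneg[of w 0] by simp
  have sd: "shift_diff v y = shift_diff w y" for y
  proof -
    have "AE x in lebesgue. w (x + y) = v (x + y)"
    proof -
      have "(LINT x|lebesgue. \<bar>w x - v x\<bar>) = 0"
        using ae by (intro integral_eq_zero_AE) auto
      then have "(LINT x|lebesgue. \<bar>w (x + y) - v (x + y)\<bar>) = 0"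
        using shift_integrable(2)[of "\<lambda>x. \<bar>w x - v x\<bar>" y] w vi by simp
      then have "AE x in lebesgue. \<bar>w (x + y) - v (x + y)\<bar> = 0"
        using integral_nonneg_eq_0_iff_AE[of lebesgue "\<lambda>x. \<bar>w (x + y) - v (x + y)\<bar>"]
          shift_integrable(1)[OF w] shift_integrable(1)[OF vi] by auto
      then show ?thesis by simp
    qed
    then show ?thesis unfolding shift_diff_def using ae
      shift_integrable(1)[OF w] shift_integrable(1)[OF vi] w vi
      by (intro integral_cong_AE) auto
  qed
  have cv: "conv ?J w x = conv ?J v x" for x
    unfolding conv_def
    by (rule integral_cong_AE)
      (use ae borel_measurable_integrable[OF conv_integrable[OF t w]]
        borel_measurable_integrable[OF conv_integrable[OF t vi]] in auto)
  have inner: "(\<integral>\<^sup>+x. ennreal (?J y * \<bar>v (x - y) - v x\<bar>) \<partial>lborel) \<le> ennreal (?J y * B)" for y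
  proof (cases "norm y < e")
    case True
    have i: "integrable lebesgue (\<lambda>x. \<bar>v (x + - y) - v x\<bar>)"
      using shift_integrable(1)[OF vi, of "- y"] vi by (intro integrable_abs Bochner_Integration.integrable_diff)
    have "(\<integral>\<^sup>+x. ennreal (?J y * \<bar>v (x - y) - v x\<bar>) \<partial>lborel) = (\<integral>\<^sup>+x. ennreal (?J y * \<bar>v (x + - y) - v x\<bar>) \<partial>lebesgue)"
      by (simp add: nn_integral_completion)
    also have "\<dots> = ennreal (LINT x|lebesgue. ?J y * \<bar>v (x + - y) - v x\<bar>)"
      using i by (intro nn_integral_eq_integral) (auto simp: mollifier_nonneg)
    also have "\<dots> = ennreal (?J y * shift_diff v (- y))"
      by (simp add: shift_diff_def)
    also have "\<dots> \<le> ennreal (?J y * B)"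
      using B[of "- y"] True unfolding sd by (intro ennreal_leI mult_left_mono mollifier_nonneg) simp
    finally show ?thesis .
  qed (simp add: mollifier_eq_0[OF e])
  have outer: "ennreal \<bar>conv ?J v x - v x\<bar> \<le> (\<integral>\<^sup>+y. ennreal (?J y * \<bar>v (x - y) - v x\<bar>) \<partial>lborel)" for x
  proof -
    have i: "integrable lebesgue (\<lambda>y. ?J y * v (x - y) - ?J y * v x)"
      by (intro Bochner_Integration.integrable_diff conv_alt(2)[OF t vi] integrable_mult_left test_integrable[OF t])
    have "conv ?J v x - v x = (LINT y|lebesgue. ?J y * v (x - y) - ?J y * v x)"
      using conv_alt[OF t vi, of x] test_integrable[OF t] by (simp add: mollifier_integral[OF e])
    then have "ennreal \<bar>conv ?J v x - v x\<bar> \<le> (\<integral>\<^sup>+y. ennreal (norm (?J y * v (x - y) - ?J y * v x)) \<partial>lebesgue)"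
      using integral_norm_bound_ennreal[OF i] by simp
    also have "\<dots> = (\<integral>\<^sup>+y. ennreal (?J y * \<bar>v (x - y) - v x\<bar>) \<partial>lborel)"
      by (simp add: nn_integral_completion abs_mult mollifier_nonneg flip: right_diff_distrib)
    finally show ?thesis .
  qed
  have "(\<integral>\<^sup>+x. ennreal \<bar>conv ?J v x - v x\<bar> \<partial>lborel)
      \<le> (\<integral>\<^sup>+x. \<integral>\<^sup>+y. ennreal (?J y * \<bar>v (x - y) - v x\<bar>) \<partial>lborel \<partial>lborel)"
    by (intro nn_integral_mono outer)
  also have "\<dots> = (\<integral>\<^sup>+y. \<integral>\<^sup>+x. ennreal (?J y * \<bar>v (x - y) - v x\<bar>) \<partial>lborel \<partial>lborel)"
  proof (rule pair_sigma_finite.Fubini'[OF pair_sigma_finite.intro[OF sigma_finite_lborel sigma_finite_lborel]])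
    show "(\<lambda>(y, x). ennreal (?J y * \<bar>v (x - y) - v x\<bar>)) \<in> borel_measurable (lborel \<Otimes>\<^sub>M lborel)"
      using vb Jb by measurable
  qed
  also have "\<dots> \<le> (\<integral>\<^sup>+y. ennreal (?J y * B) \<partial>lborel)"
    by (intro nn_integral_mono inner)
  also have "\<dots> = (\<integral>\<^sup>+y. ennreal (?J y * B) \<partial>lebesgue)"
    by (simp add: nn_integral_completion)
  also have "\<dots> = ennreal (LINT y|lebesgue. ?J y * B)"
    using test_integrable[OF t] B0 by (intro nn_integral_eq_integral) (auto simp: mollifier_nonneg)
  also have "\<dots> = ennreal B" by (simp add: mollifier_integral[OF e])
  finally have le: "(\<integral>\<^sup>+x. ennreal \<bar>conv ?J v x - v x\<bar> \<partial>lebesgue) \<le> ennreal B"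
    by (simp add: nn_integral_completion)
  have cm: "conv ?J v \<in> borel_measurable lebesgue"
    using conv_measurable[OF t vi] by (simp add: measurable_completion)
  have i: "integrable lebesgue (\<lambda>x. conv ?J v x - v x)"
    using le cm vl by (intro integrableI_bounded) (auto simp: le_less_trans[OF _ ennreal_less_top])
  then have "integrable lebesgue (\<lambda>x. (conv ?J v x - v x) + v x)"
    using vi by (rule Bochner_Integration.integrable_add)
  then show "integrable lebesgue (conv ?J w)" by (simp add: cv[abs_def])
  have eq: "ennreal (LINT x|lebesgue. \<bar>conv ?J v x - v x\<bar>) = (\<integral>\<^sup>+x. ennreal \<bar>conv ?J v x - v x\<bar> \<partial>lebesgue)"
    using i by (intro nn_integral_eq_integral[symmetric]) auto
  have "(LINT x|lebesgue. \<bar>conv ?J v x - v x\<bar>) \<le> B"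
    using le unfolding eq[symmetric] ennreal_le_iff[OF B0] .
  moreover have "(LINT x|lebesgue. \<bar>conv ?J w x - w x\<bar>) = (LINT x|lebesgue. \<bar>conv ?J v x - v x\<bar>)"
    unfolding cv using ae cm vl borel_measurable_integrable[OF w] by (intro integral_cong_AE) auto
  ultimately show "(LINT x|lebesgue. \<bar>conv ?J w x - w x\<bar>) \<le> B" by simp
qed

definition mollify :: "nat \<Rightarrow> (real^'n \<Rightarrow> real) \<Rightarrow> real^'n \<Rightarrow> real" where
  "mollify k = conv (mollifier (inverse (real (Suc k))))"

lemma mollify_L1:
  fixes w :: "real^'n \<Rightarrow> real"
  assumes w: "integrable lebesgue w"
  shows "integrable lebesgue (mollify k w)"
    and "(\<lambda>k. LINT x|lebesgue. \<bar>mollify k w x - w x\<bar>) \<longlonglongrightarrow> 0"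
proof -
  have "shift_diff w y \<le> 2 * (LINT x|lebesgue. \<bar>w x\<bar>)" for y
    using shift_diff_approx[OF w, of "\<lambda>_. 0" y] by (simp add: shift_diff_def)
  then show "integrable lebesgue (mollify k w)"
    unfolding mollify_def by (intro conv_mollifier_L1_bound(1)[OF _ w]) auto
  show "(\<lambda>k. LINT x|lebesgue. \<bar>mollify k w x - w x\<bar>) \<longlonglongrightarrow> 0"
  proof (rule integral_mono_abs_tendsto_0)
    fix e :: real assume "e > 0"
    then have "\<forall>\<^sub>F y in at 0. shift_diff w y < e"
      using order_tendstoD(2)[OF shift_diff_tendsto_0[OF w]] by simp
    then obtain d where d: "d > 0" "\<And>y. y \<noteq> 0 \<Longrightarrow> norm y < d \<Longrightarrow> shift_diff w y < e"
      unfolding eventually_at by (auto simp: dist_norm)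
    have le: "shift_diff w y \<le> e" if "norm y < d" for y
      using d(2)[OF _ that] \<open>e > 0\<close> by (cases "y = 0") (auto simp: shift_diff_def less_imp_le)
    have "\<forall>\<^sub>F k in sequentially. inverse (real (Suc k)) < d"
      using order_tendstoD(2)[OF LIMSEQ_inverse_real_of_nat d(1)] .
    then show "\<forall>\<^sub>F k in sequentially. \<bar>LINT x|lebesgue. \<bar>mollify k w x - w x\<bar>\<bar> \<le> e"
    proof eventually_elim
      case (elim k)
      have "(LINT x|lebesgue. \<bar>mollify k w x - w x\<bar>) \<le> e"
        unfolding mollify_def by (rule conv_mollifier_L1_bound(2)[OF _ w]) (use elim le in auto)
      then show ?case by simp
    qed
  qed
qed

lemma mollify_test: "mollifier (inverse (real (Suc k))) \<in> test_functions UNIV"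
  by (rule mollifier_test) simp

subsection \<open>Locally integrable functions\<close>

lemma set_LINT_support:
  assumes "\<And>x. x \<notin> S \<Longrightarrow> F x = 0"
  shows "(LINT x:S|M. F x) = (LINT x|M. F x)"
proof -
  have "(\<lambda>x. indicator S x *\<^sub>R F x) = F" using assms by (auto simp: indicator_def fun_eq_iff)
  then show ?thesis by (simp add: set_lebesgue_integral_def)
qed

lemma locally_integrableD: "locally_integrable O' u \<Longrightarrow> compact C \<Longrightarrow> C \<subseteq> O' \<Longrightarrow> set_integrable lebesgue C u"
  by (simp add: locally_integrable_def)

lemma locally_integrable_mono: "locally_integrable O' u \<Longrightarrow> U \<subseteq> O' \<Longrightarrow> locally_integrable U u"
  unfolding locally_integrable_def by blast

lemma set_integrable_continuous_compact:
  fixes f :: "'a::euclidean_space \<Rightarrow> 'b::{banach, second_countable_topology}"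
  assumes "compact C" "continuous_on C f"
  shows "set_integrable lebesgue C f"
  using borel_integrable_compact[OF assms] borel_measurable_integrable[OF borel_integrable_compact[OF assms]]
  unfolding set_integrable_def by (subst integrable_completion) auto

lemma locally_integrable_continuous:
  "continuous_on O' f \<Longrightarrow> locally_integrable O' f"
  unfolding locally_integrable_def
  using set_integrable_continuous_compact continuous_on_subset by blast

lemma locally_integrable_scaleR:
  fixes f :: "real^'n \<Rightarrow> real" and u :: "real^'n \<Rightarrow> 'b::{banach, second_countable_topology}"
  assumes f: "continuous_on O' f" and u: "locally_integrable O' u"
  shows "locally_integrable O' (\<lambda>x. f x *\<^sub>R u x)"
  unfolding locally_integrable_def
proof (intro allI impI, elim conjE)
  fix C assume C: "compact C" "C \<subseteq> O'"
  have fC: "continuous_on C f" using f C(2) continuous_on_subset by blast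
  obtain B where B: "\<And>x. x \<in> C \<Longrightarrow> \<bar>f x\<bar> \<le> B"
    using compact_imp_bounded[OF compact_continuous_image[OF fC C(1)]] by (auto simp: bounded_iff)
  have uC: "set_integrable lebesgue C u" using locally_integrableD[OF u C] .
  show "set_integrable lebesgue C (\<lambda>x. f x *\<^sub>R u x)"
  proof (rule set_integrable_bound[of _ _ "\<lambda>x. B *\<^sub>R u x"])
    show "set_integrable lebesgue C (\<lambda>x. B *\<^sub>R u x)" using uC by simp
    have 1: "(\<lambda>x. indicator C x *\<^sub>R f x) \<in> borel_measurable lebesgue"
      using set_integrable_continuous_compact[OF C(1) fC] unfolding set_integrable_def
      by (rule borel_measurable_integrable)
    have 2: "(\<lambda>x. indicator C x *\<^sub>R u x) \<in> borel_measurable lebesgue"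
      using uC unfolding set_integrable_def by (rule borel_measurable_integrable)
    have eq: "(\<lambda>x. (indicator C x *\<^sub>R f x) *\<^sub>R (indicator C x *\<^sub>R u x)) = (\<lambda>x. indicator C x *\<^sub>R f x *\<^sub>R u x)"
      by (auto simp: fun_eq_iff indicator_def)
    show "set_borel_measurable lebesgue C (\<lambda>x. f x *\<^sub>R u x)"
      using borel_measurable_scaleR[OF 1 2] unfolding set_borel_measurable_def eq .
    have "norm (f x *\<^sub>R u x) \<le> norm (B *\<^sub>R u x)" if "x \<in> C" for x
      using B[OF that] by (simp add: mult_right_mono)
    then show "AE x in lebesgue. x \<in> C \<longrightarrow> norm (f x *\<^sub>R u x) \<le> norm (B *\<^sub>R u x)"
      by simp
  qed
qed

lemma locally_integrable_add:
  "locally_integrable O' u \<Longrightarrow> locally_integrable O' v \<Longrightarrow> locally_integrable O' (\<lambda>x. u x + v x)"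
  unfolding locally_integrable_def by (blast intro: set_integral_add(1))

lemma locally_integrable_component:
  fixes g :: "real^'n \<Rightarrow> real^'m"
  assumes "locally_integrable O' g" shows "locally_integrable O' (\<lambda>x. g x $ i)"
  unfolding locally_integrable_def
proof (intro allI impI, elim conjE)
  fix C assume C: "compact C" "C \<subseteq> O'"
  have "integrable lebesgue (\<lambda>x. (indicator C x *\<^sub>R g x) $ i)"
    using integrable_bounded_linear[OF bounded_linear_vec_nth locally_integrableD[OF assms C, unfolded set_integrable_def]] .
  then show "set_integrable lebesgue C (\<lambda>x. g x $ i)"
    by (simp add: set_integrable_def)
qed

lemma locally_integrable_test:
  assumes "locally_integrable \<Omega> u" "\<phi> \<in> test_functions \<Omega>"
  shows "integrable lebesgue (\<lambda>x. u x * \<phi> x)"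
proof -
  obtain C where C: "compact C" "C \<subseteq> \<Omega>" "\<And>x. x \<notin> C \<Longrightarrow> \<phi> x = 0"
    using assms(2) by (rule test_functionsD) blast
  have "integrable lebesgue (\<lambda>x. \<phi> x * (indicator C x *\<^sub>R u x))"
    using locally_integrableD[OF assms(1) C(1,2)] unfolding set_integrable_def
    by (rule test_integrable_mult[OF assms(2)])
  moreover have "(\<lambda>x. \<phi> x * (indicator C x *\<^sub>R u x)) = (\<lambda>x. u x * \<phi> x)"
    using C(3) by (auto simp: fun_eq_iff indicator_def)
  ultimately show ?thesis by simp
qed

lemma set_integrable_locally_integrable:
  fixes \<Omega> :: "(real^'n) set"
  assumes "set_integrable lebesgue \<Omega> u"
  shows "locally_integrable \<Omega> u"
  unfolding locally_integrable_def
proof (intro allI impI, elim conjE)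
  fix C :: "(real^'n) set" assume "compact C" "C \<subseteq> \<Omega>"
  moreover have "C \<in> sets lebesgue" using lmeasurable_compact[OF \<open>compact C\<close>] by (rule fmeasurableD)
  ultimately show "set_integrable lebesgue C u"
    using set_integrable_subset[OF assms] by blast
qed

subsection \<open>Weak gradients\<close>

lemma has_weak_gradient_iff:
  "has_weak_gradient \<Omega> u g \<longleftrightarrow> locally_integrable \<Omega> u \<and> locally_integrable \<Omega> g \<and>
     (\<forall>\<phi>\<in>test_functions \<Omega>. \<forall>i. (LINT x|lebesgue. u x * grad \<phi> x $ i) = - (LINT x|lebesgue. g x $ i * \<phi> x))"
proof -
  have "(LINT x:\<Omega>|lebesgue. u x * grad \<phi> x $ i) = (LINT x|lebesgue. u x * grad \<phi> x $ i)"
    "(LINT x:\<Omega>|lebesgue. g x $ i * \<phi> x) = (LINT x|lebesgue. g x $ i * \<phi> x)"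
    if \<phi>: "\<phi> \<in> test_functions \<Omega>" for \<phi> i
  proof -
    obtain C where C: "C \<subseteq> \<Omega>" "\<And>x. x \<notin> C \<Longrightarrow> \<phi> x = 0" "\<And>x. x \<notin> C \<Longrightarrow> grad \<phi> x = 0"
      using \<phi> by (rule test_functionsD) blast
    have "\<phi> x = 0" "grad \<phi> x = 0" if "x \<notin> \<Omega>" for x using C that by blast+
    then show "(LINT x:\<Omega>|lebesgue. u x * grad \<phi> x $ i) = (LINT x|lebesgue. u x * grad \<phi> x $ i)"
      "(LINT x:\<Omega>|lebesgue. g x $ i * \<phi> x) = (LINT x|lebesgue. g x $ i * \<phi> x)"
      by (simp_all add: set_LINT_support)
  qed
  then show ?thesis unfolding has_weak_gradient_def by simp
qed

lemma has_weak_gradientD: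
  assumes "has_weak_gradient \<Omega> u g"
  shows "locally_integrable \<Omega> u" "locally_integrable \<Omega> g"
    "\<phi> \<in> test_functions \<Omega> \<Longrightarrow> (LINT x|lebesgue. u x * grad \<phi> x $ i) = - (LINT x|lebesgue. g x $ i * \<phi> x)"
  using assms by (simp_all add: has_weak_gradient_iff)

lemma has_weak_gradient_mono:
  "has_weak_gradient \<Omega> u g \<Longrightarrow> U \<subseteq> \<Omega> \<Longrightarrow> has_weak_gradient U u g"
  unfolding has_weak_gradient_iff
  by (intro conjI ballI) (auto dest: locally_integrable_mono test_functions_mono)

lemma set_integrable_cong_AE_on:
  fixes u v :: "real^'n \<Rightarrow> 'b::euclidean_space"
  assumes "set_integrable lebesgue C u" "AE x in lebesgue. x \<in> C \<longrightarrow> u x = v x"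
  shows "set_integrable lebesgue C v"
proof -
  have i: "integrable lebesgue (\<lambda>x. indicator C x *\<^sub>R u x)" using assms(1) by (simp add: set_integrable_def)
  have ae: "AE x in lebesgue. indicator C x *\<^sub>R u x = indicator C x *\<^sub>R v x"
    using assms(2) by eventually_elim (auto simp: indicator_def)
  have "(\<lambda>x. indicator C x *\<^sub>R v x) \<in> borel_measurable lebesgue"
    by (rule borel_measurable_AE[OF borel_measurable_integrable[OF i] ae])
  then show ?thesis
    unfolding set_integrable_def by (rule integrable_cong_AE_imp[OF i _ ae])
qed

lemma has_weak_gradient_cong_AE:
  assumes "has_weak_gradient \<Omega> u g"
    and u: "AE x in lebesgue. x \<in> \<Omega> \<longrightarrow> u x = v x" and g: "AE x in lebesgue. x \<in> \<Omega> \<longrightarrow> g x = h x"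
  shows "has_weak_gradient \<Omega> v h"
  unfolding has_weak_gradient_iff
proof (intro conjI ballI allI)
  show lv: "locally_integrable \<Omega> v"
    unfolding locally_integrable_def
  proof (intro allI impI, elim conjE)
    fix C assume C: "compact C" "C \<subseteq> \<Omega>"
    show "set_integrable lebesgue C v"
      by (rule set_integrable_cong_AE_on[OF locally_integrableD[OF has_weak_gradientD(1)[OF assms(1)] C]])
        (use u C(2) in \<open>eventually_elim; blast\<close>)
  qed
  show lh: "locally_integrable \<Omega> h"
    unfolding locally_integrable_def
  proof (intro allI impI, elim conjE)
    fix C assume C: "compact C" "C \<subseteq> \<Omega>"
    show "set_integrable lebesgue C h"
      by (rule set_integrable_cong_AE_on[OF locally_integrableD[OF has_weak_gradientD(2)[OF assms(1)] C]])
        (use g C(2) in \<open>eventually_elim; blast\<close>)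
  qed
  fix \<phi> i assume \<phi>: "\<phi> \<in> test_functions \<Omega>"
  obtain C where C: "C \<subseteq> \<Omega>" "\<And>x. x \<notin> C \<Longrightarrow> \<phi> x = 0" "\<And>x. x \<notin> C \<Longrightarrow> grad \<phi> x = 0"
    using \<phi> by (rule test_functionsD) blast
  have z: "\<phi> x = 0" "grad \<phi> x = 0" if "x \<notin> \<Omega>" for x using C that by blast+
  note lu = has_weak_gradientD(1)[OF assms(1)] and lg = has_weak_gradientD(2)[OF assms(1)]
  have "(LINT x|lebesgue. v x * grad \<phi> x $ i) = (LINT x|lebesgue. u x * grad \<phi> x $ i)"
  proof (rule integral_cong_AE)
    show "AE x in lebesgue. v x * grad \<phi> x $ i = u x * grad \<phi> x $ i"
      using u
    proof eventually_elim
      case (elim x)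
      then show ?case using z(2)[of x] by (cases "x \<in> \<Omega>") simp_all
    qed
  qed (use locally_integrable_test[OF lv test_functions_grad[OF \<phi>]]
      locally_integrable_test[OF lu test_functions_grad[OF \<phi>]] in \<open>blast intro: borel_measurable_integrable\<close>)+
  moreover have "(LINT x|lebesgue. h x $ i * \<phi> x) = (LINT x|lebesgue. g x $ i * \<phi> x)"
  proof (rule integral_cong_AE)
    show "AE x in lebesgue. h x $ i * \<phi> x = g x $ i * \<phi> x"
      using g
    proof eventually_elim
      case (elim x)
      then show ?case using z(1)[of x] by (cases "x \<in> \<Omega>") simp_all
    qed
  qed (use locally_integrable_test[OF locally_integrable_component[OF lh] \<phi>]
      locally_integrable_test[OF locally_integrable_component[OF lg] \<phi>] in \<open>blast intro: borel_measurable_integrable\<close>)+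
  ultimately show "(LINT x|lebesgue. v x * grad \<phi> x $ i) = - (LINT x|lebesgue. h x $ i * \<phi> x)"
    using has_weak_gradientD(3)[OF assms(1) \<phi>] by simp
qed

text \<open>The product of \<open>f\<close> with a test function is again a test function. Testing
  the weak gradient of \<open>u\<close> with it and expanding the classical product rule gives the
  claim.\<close>

lemma has_weak_gradient_mult:
  assumes O: "open \<Omega>" and u: "has_weak_gradient \<Omega> u g" and f: "smooth_on \<Omega> f"
  shows "has_weak_gradient \<Omega> (\<lambda>x. f x * u x) (\<lambda>x. f x *\<^sub>R g x + u x *\<^sub>R grad f x)"
  unfolding has_weak_gradient_iff
proof (intro conjI ballI allI)
  note U = has_weak_gradientD[OF u]
  note fc = smooth_on_continuous[OF f]
  show "locally_integrable \<Omega> (\<lambda>x. f x * u x)"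
    using locally_integrable_scaleR[OF fc U(1)] by simp
  have comp: "locally_integrable \<Omega> (\<lambda>x. grad f x $ i * u x)" for i
    using locally_integrable_scaleR[OF smooth_on_continuous[OF smooth_on_grad[OF f]] U(1)] by simp
  have "locally_integrable \<Omega> (\<lambda>x. u x *\<^sub>R grad f x)"
    unfolding locally_integrable_def
  proof (intro allI impI, elim conjE)
    fix C assume C: "compact C" "C \<subseteq> \<Omega>"
    have "integrable lebesgue (\<lambda>x. \<Sum>i\<in>UNIV. (indicator C x *\<^sub>R (grad f x $ i * u x)) *\<^sub>R (axis i 1 :: real^'a))"
      using locally_integrableD[OF comp C] unfolding set_integrable_def
      by (intro Bochner_Integration.integrable_sum integrable_scaleR_left) auto
    moreover have "(\<lambda>x. \<Sum>i\<in>UNIV. (indicator C x *\<^sub>R (grad f x $ i * u x)) *\<^sub>R axis i 1)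
        = (\<lambda>x. indicator C x *\<^sub>R u x *\<^sub>R grad f x)"
      by (simp add: fun_eq_iff vec_eq_iff axis_def if_distrib mult.commute cong: if_cong)
    ultimately show "set_integrable lebesgue C (\<lambda>x. u x *\<^sub>R grad f x)"
      unfolding set_integrable_def by (simp only:)
  qed
  then show "locally_integrable \<Omega> (\<lambda>x. f x *\<^sub>R g x + u x *\<^sub>R grad f x)"
    by (intro locally_integrable_add locally_integrable_scaleR[OF fc U(2)])
  fix \<phi> i assume \<phi>: "\<phi> \<in> test_functions \<Omega>"
  have f\<phi>: "(\<lambda>x. f x * \<phi> x) \<in> test_functions \<Omega>"
    by (rule test_functions_mult[OF O f \<phi>]) simp
  obtain C where C: "C \<subseteq> \<Omega>" "\<And>x. x \<notin> C \<Longrightarrow> \<phi> x = 0" "\<And>x. x \<notin> C \<Longrightarrow> grad \<phi> x = 0"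
    "compact C"
    using \<phi> by (rule test_functionsD) blast
  have gr: "grad (\<lambda>x. f x * \<phi> x) x = f x *\<^sub>R grad \<phi> x + \<phi> x *\<^sub>R grad f x" for x
  proof (cases "x \<in> \<Omega>")
    case True
    then show ?thesis
      by (intro grad_mult smooth_on_differentiable[OF f] smooth_on_differentiable[OF test_functions_smooth[OF \<phi>]]) auto
  next
    case False
    have "grad (\<lambda>x. f x * \<phi> x) x = grad (\<lambda>_. 0) x"
      by (rule grad_cong[of "- C"]) (use C(1,2) False compact_imp_closed[OF C(4)] in auto)
    moreover have "x \<notin> C" using C(1) False by blast
    ultimately show ?thesis using C(2,3) by simp
  qed
  have i1: "integrable lebesgue (\<lambda>x. u x * (f x * grad \<phi> x $ i))"
    using locally_integrable_test[OF U(1) test_functions_mult[OF O f test_functions_grad[OF \<phi>]]] by simp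
  have i2: "integrable lebesgue (\<lambda>x. u x * grad f x $ i * \<phi> x)"
    using locally_integrable_test[OF comp \<phi>, of i] by (simp add: mult.commute)
  have i3: "integrable lebesgue (\<lambda>x. g x $ i * (f x * \<phi> x))"
    using locally_integrable_test[OF locally_integrable_component[OF U(2)] f\<phi>] .
  have "(LINT x|lebesgue. u x * (f x * grad \<phi> x $ i)) + (LINT x|lebesgue. u x * grad f x $ i * \<phi> x)
      = (LINT x|lebesgue. u x * grad (\<lambda>x. f x * \<phi> x) x $ i)"
    unfolding gr Bochner_Integration.integral_add[OF i1 i2, symmetric]
    by (rule Bochner_Integration.integral_cong) (auto simp: algebra_simps)
  also have "\<dots> = - (LINT x|lebesgue. g x $ i * (f x * \<phi> x))"
    by (rule U(3)[OF f\<phi>])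
  finally have eq: "(LINT x|lebesgue. u x * (f x * grad \<phi> x $ i)) + (LINT x|lebesgue. u x * grad f x $ i * \<phi> x)
      = - (LINT x|lebesgue. g x $ i * (f x * \<phi> x))" .
  have "(LINT x|lebesgue. (f x *\<^sub>R g x + u x *\<^sub>R grad f x) $ i * \<phi> x)
      = (LINT x|lebesgue. g x $ i * (f x * \<phi> x) + u x * grad f x $ i * \<phi> x)"
    by (rule Bochner_Integration.integral_cong) (auto simp: algebra_simps)
  also have "\<dots> = (LINT x|lebesgue. g x $ i * (f x * \<phi> x)) + (LINT x|lebesgue. u x * grad f x $ i * \<phi> x)"
    by (rule Bochner_Integration.integral_add[OF i3 i2])
  finally show "(LINT x|lebesgue. f x * u x * grad \<phi> x $ i) = - (LINT x|lebesgue. (f x *\<^sub>R g x + u x *\<^sub>R grad f x) $ i * \<phi> x)"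
    using eq by (simp add: mult_ac)
qed

section \<open>Reflections, and uniqueness of weak gradients\<close>

lemma Ck_on_reflect:
  fixes f :: "real^'n \<Rightarrow> real"
  assumes "Ck_on k UNIV f" shows "Ck_on k UNIV (\<lambda>y. f (a - y))"
  using assms
proof (induction k arbitrary: f)
  case 0
  then show ?case by (auto intro!: continuous_on_compose2[of UNIV f] continuous_intros)
next
  case (Suc k)
  have d: "((\<lambda>y. f (a - y)) has_derivative (\<lambda>h. (- grad f (a - y)) \<bullet> h)) (at y)" for y
  proof -
    have "((\<lambda>y. a - y) has_derivative (\<lambda>h. - h)) (at y)"
      by (auto intro!: derivative_eq_intros)
    moreover have "(f has_derivative (\<lambda>h. grad f (a - y) \<bullet> h)) (at (a - y))"
      using Suc.prems by (intro has_derivative_grad) simp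
    ultimately have "((\<lambda>y. f (a - y)) has_derivative (\<lambda>h. grad f (a - y) \<bullet> (- h))) (at y)"
      by (rule has_derivative_compose)
    then show ?thesis by simp
  qed
  have "Ck_on k UNIV (\<lambda>y. (-1) * (\<lambda>z. grad f z $ i) (a - y))" for i
    by (rule Ck_on_mult[OF open_UNIV Ck_on_const Suc.IH]) (use Suc.prems in simp)
  then show ?case using d grad_unique[OF d] by (auto simp: differentiable_def)
qed

lemma smooth_on_reflect:
  fixes f :: "real^'n \<Rightarrow> real"
  shows "smooth_on UNIV f \<Longrightarrow> smooth_on UNIV (\<lambda>y. f (a - y))"
  using Ck_on_reflect unfolding smooth_on_def by blast

lemma grad_reflect:
  fixes f :: "real^'n \<Rightarrow> real"
  assumes "f differentiable (at (a - y))"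
  shows "grad (\<lambda>y. f (a - y)) y = - grad f (a - y)"
proof (rule grad_unique)
  have "((\<lambda>y. a - y) has_derivative (\<lambda>h. - h)) (at y)"
    by (auto intro!: derivative_eq_intros)
  then have "((\<lambda>y. f (a - y)) has_derivative (\<lambda>h. grad f (a - y) \<bullet> (- h))) (at y)"
    by (rule has_derivative_compose) (rule has_derivative_grad[OF assms])
  then show "((\<lambda>y. f (a - y)) has_derivative (\<lambda>h. (- grad f (a - y)) \<bullet> h)) (at y)"
    by simp
qed

text \<open>Every value of a mollification of \<open>h * \<eta>\<close> is a test integral of
  \<open>h\<close>, because the reflected mollifier times the cutoff \<open>\<eta>\<close> is a test
  function. So all mollifications vanish, while they converge to \<open>h * \<eta>\<close> in
  mean.\<close>

proposition AE_zero_if_test_integrals_zero: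
  assumes \<Omega>: "open \<Omega>" and h: "locally_integrable \<Omega> h"
    and z: "\<And>\<phi>. \<phi> \<in> test_functions \<Omega> \<Longrightarrow> (LINT x|lebesgue. h x * \<phi> x) = 0"
  shows "AE x in lebesgue. x \<in> \<Omega> \<longrightarrow> h x = 0"
proof -
  have cpt: "AE x in lebesgue. x \<in> C \<longrightarrow> h x = 0" if C: "compact C" "C \<subseteq> \<Omega>" for C
  proof (cases "C = {}")
    case False
    obtain \<eta> e where \<eta>: "\<eta> \<in> test_functions \<Omega>" "e > 0" "\<And>x. infdist x C < e \<Longrightarrow> \<eta> x = 1"
      using smooth_cutoff[OF C(1) False \<Omega> C(2)] by metis
    have i: "integrable lebesgue (\<lambda>x. h x * \<eta> x)" by (rule locally_integrable_test[OF h \<eta>(1)])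
    have "mollify k (\<lambda>x. h x * \<eta> x) x = 0" for k x
    proof -
      let ?J = "mollifier (inverse (real (Suc k)))"
      have "(\<lambda>y. ?J (x - y) * \<eta> y) \<in> test_functions \<Omega>"
        by (rule test_functions_mult[OF open_UNIV smooth_on_reflect[OF test_functions_smooth[OF mollify_test]] \<eta>(1)]) simp
      from z[OF this] show ?thesis
        by (simp add: mollify_def conv_def mult_ac)
    qed
    then have "(\<lambda>k::nat. LINT x|lebesgue. \<bar>h x * \<eta> x\<bar>) \<longlonglongrightarrow> 0"
      using mollify_L1(2)[OF i] by simp
    then have "(LINT x|lebesgue. \<bar>h x * \<eta> x\<bar>) = 0"
      using LIMSEQ_unique[OF tendsto_const] by blast
    then have "AE x in lebesgue. \<bar>h x * \<eta> x\<bar> = 0"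
      using integral_nonneg_eq_0_iff_AE[OF integrable_abs[OF i]] by simp
    then show ?thesis
    proof eventually_elim
      case (elim x)
      show ?case
      proof
        assume "x \<in> C"
        then have "\<eta> x = 1" using \<eta>(2,3) by simp
        then show "h x = 0" using elim by simp
      qed
    qed
  qed simp
  obtain D :: "nat \<Rightarrow> _" where D: "\<And>n. compact (D n)" "\<And>n. D n \<subseteq> \<Omega>" "\<Union> (range D) = \<Omega>"
    using open_Union_compact_subsets[OF \<Omega>] by metis
  have "AE x in lebesgue. \<forall>n. x \<in> D n \<longrightarrow> h x = 0"
    unfolding AE_all_countable using cpt D(1,2) by blast
  then show ?thesis by eventually_elim (use D(3) in blast)
qed

theorem has_weak_gradient_unique:
  assumes \<Omega>: "open \<Omega>" and g: "has_weak_gradient \<Omega> u g" and h: "has_weak_gradient \<Omega> u h"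
  shows "AE x in lebesgue. x \<in> \<Omega> \<longrightarrow> g x = h x"
proof -
  note G = has_weak_gradientD[OF g] and H = has_weak_gradientD[OF h]
  have "AE x in lebesgue. x \<in> \<Omega> \<longrightarrow> g x $ i - h x $ i = 0" for i
  proof (rule AE_zero_if_test_integrals_zero[OF \<Omega>])
    have "locally_integrable \<Omega> (\<lambda>x. (-1) *\<^sub>R (h x $ i))"
      by (intro locally_integrable_scaleR continuous_intros locally_integrable_component H)
    then show "locally_integrable \<Omega> (\<lambda>x. g x $ i - h x $ i)"
      using locally_integrable_add[OF locally_integrable_component[OF G(2), of i]] by fastforce
    fix \<phi> assume \<phi>: "\<phi> \<in> test_functions \<Omega>"
    show "(LINT x|lebesgue. (g x $ i - h x $ i) * \<phi> x) = 0"
      using G(3)[OF \<phi>, of i] H(3)[OF \<phi>, of i]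
        locally_integrable_test[OF locally_integrable_component[OF G(2)] \<phi>, of i]
        locally_integrable_test[OF locally_integrable_component[OF H(2)] \<phi>, of i]
      by (simp add: left_diff_distrib)
  qed
  then have "AE x in lebesgue. \<forall>i\<in>UNIV. x \<in> \<Omega> \<longrightarrow> g x $ i - h x $ i = 0"
    by (intro AE_finite_allI) simp_all
  then show ?thesis by eventually_elim (simp add: vec_eq_iff)
qed

subsection \<open>Weak gradients of continuously differentiable functions\<close>

lemma grad_component_line:
  fixes f :: "real^'n \<Rightarrow> real"
  assumes "f differentiable (at (x + t *\<^sub>R axis i 1))"
  shows "((\<lambda>t. f (x + t *\<^sub>R axis i 1)) has_field_derivative grad f (x + t *\<^sub>R axis i 1) $ i) (at t)"
proof -
  have "((\<lambda>t::real. x + t *\<^sub>R axis i 1) has_derivative (\<lambda>s. s *\<^sub>R axis i 1)) (at t)"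
    by (auto intro!: derivative_eq_intros)
  then have "((\<lambda>t. f (x + t *\<^sub>R axis i 1)) has_derivative
      (\<lambda>s. grad f (x + t *\<^sub>R axis i 1) \<bullet> (s *\<^sub>R axis i 1))) (at t)"
    by (rule has_derivative_compose) (rule has_derivative_grad[OF assms])
  then show ?thesis
    unfolding has_field_derivative_def by (simp add: inner_axis mult.commute[of _ "grad f _ $ i"])
qed

text \<open>By translation invariance the difference quotients \<open>D k\<close> have integral
  zero. They are bounded and vanish outside the compact set \<open>S\<close> of points within
  distance one of \<open>C\<close>, the steps \<open>t k\<close> being at most one, so dominated
  convergence passes this on to the derivative.\<close>

lemma integral_grad_zero:
  fixes \<psi> :: "real^'n \<Rightarrow> real"
  assumes \<psi>: "Ck_on 1 UNIV \<psi>" and C: "compact C" "\<And>x. x \<notin> C \<Longrightarrow> \<psi> x = 0"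
  shows "(LINT x|lebesgue. grad \<psi> x $ i) = 0"
proof (cases "C = {}")
  case True
  then have "\<psi> = (\<lambda>_. 0)" using C(2) by (simp add: fun_eq_iff)
  then show ?thesis by simp
next
  case False
  let ?G = "\<lambda>x. grad \<psi> x $ i"
  let ?e = "axis i 1 :: real^'n"
  have d: "\<psi> differentiable (at x)" and Gc: "continuous_on UNIV ?G" for x using \<psi> by auto
  have \<psi>c: "continuous_on UNIV \<psi>" using Ck_on_SucD[of 0 UNIV \<psi>] \<psi> by simp
  have G0: "grad \<psi> x = 0" if "x \<notin> C" for x
  proof -
    have "grad \<psi> x = grad (\<lambda>_. 0) x"
      by (rule grad_cong[of "- C"]) (use C(2) that compact_imp_closed[OF C(1)] in auto)
    then show ?thesis by simp
  qed
  have "bounded (?G ` C)"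
    by (rule compact_imp_bounded[OF compact_continuous_image[OF continuous_on_subset[OF Gc subset_UNIV] C(1)]])
  then obtain B where "B > 0" "\<forall>y\<in>?G ` C. norm y \<le> B"
    unfolding bounded_pos by blast
  then have B: "B > 0" "\<And>x. x \<in> C \<Longrightarrow> \<bar>?G x\<bar> \<le> B" by auto
  have GB: "\<bar>?G x\<bar> \<le> B" for x using B G0[of x] by (cases "x \<in> C") auto
  define t where "t k = inverse (real (Suc k))" for k
  have t: "t k > 0" "t k \<le> 1" for k by (auto simp: t_def field_simps)
  define D where "D k x = (\<psi> (x + t k *\<^sub>R ?e) - \<psi> x) / t k" for k x
  define S where "S = {x. infdist x C \<le> 1}"
  have S: "compact S"
    unfolding S_def using infdist_neighbourhood_bounded[OF C(1) False]
    by (auto simp: compact_eq_bounded_closed intro!: closed_Collect_le continuous_intros)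
  have DB: "norm (D k x) \<le> B * indicator S x" for k x
  proof (cases "x \<in> S")
    case True
    obtain z where "\<psi> (x + t k *\<^sub>R ?e) - \<psi> (x + 0 *\<^sub>R ?e) = (t k - 0) * ?G (x + z *\<^sub>R ?e)"
      using MVT2[OF t(1)[of k], of "\<lambda>s. \<psi> (x + s *\<^sub>R ?e)" "\<lambda>s. ?G (x + s *\<^sub>R ?e)"]
        grad_component_line[OF d] by blast
    then show ?thesis using t(1)[of k] GB True by (simp add: D_def)
  next
    case False
    have "infdist x C \<le> dist x (x + t k *\<^sub>R ?e)" if "x + t k *\<^sub>R ?e \<in> C"
      by (rule infdist_le[OF that])
    then have "x + t k *\<^sub>R ?e \<notin> C" "x \<notin> C"
      using False t[of k] by (auto simp: S_def dist_norm)
    then show ?thesis using C(2) False by (simp add: D_def)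
  qed
  have \<psi>i: "integrable lebesgue \<psi>"
  proof -
    have "continuous_on C \<psi>" by (rule continuous_on_subset[OF \<psi>c subset_UNIV])
    from set_integrable_continuous_compact[OF C(1) this]
    have "integrable lebesgue (\<lambda>x. indicator C x *\<^sub>R \<psi> x)" by (simp add: set_integrable_def)
    moreover have "(\<lambda>x. indicator C x *\<^sub>R \<psi> x) = \<psi>" using C(2) by (auto simp: fun_eq_iff indicator_def)
    ultimately show ?thesis by simp
  qed
  have "(LINT x|lebesgue. D k x) = 0" for k
    unfolding D_def using shift_integrable[OF \<psi>i, of "t k *\<^sub>R ?e"] \<psi>i by simp
  moreover have "(\<lambda>k. LINT x|lebesgue. D k x) \<longlonglongrightarrow> (LINT x|lebesgue. ?G x)"
  proof (rule integral_dominated_convergence[where w = "\<lambda>x. B * indicator S x"])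
    show "integrable lebesgue (\<lambda>x. B * indicator S x)"
    proof -
      have "S \<in> sets lebesgue" "emeasure lebesgue S < \<infinity>"
        using lmeasurable_compact[OF S] by (auto simp: fmeasurable_def)
      then show ?thesis by (intro integrable_mult_right integrable_real_indicator)
    qed
    show "AE x in lebesgue. (\<lambda>k. D k x) \<longlonglongrightarrow> ?G x"
    proof (rule AE_I2)
      fix x
      have "((\<lambda>s. (\<psi> (x + s *\<^sub>R ?e) - \<psi> x) / s) \<longlongrightarrow> ?G x) (at 0)"
        using grad_component_line[OF d, where x = x and t = 0 and i = i] by (simp add: has_field_derivative_iff)
      moreover have "filterlim t (at 0) sequentially"
        using LIMSEQ_inverse_real_of_nat t(1) unfolding t_def filterlim_at by (auto intro: always_eventually)
      ultimately show "(\<lambda>k. D k x) \<longlonglongrightarrow> ?G x"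
        unfolding D_def by (rule filterlim_compose)
    qed
    show "?G \<in> borel_measurable lebesgue" by (rule continuous_lebesgue_measurable[OF Gc])
    have "continuous_on UNIV (D k)" for k
      unfolding D_def by (intro continuous_intros continuous_on_compose2[OF \<psi>c] \<psi>c) (use t(1)[of k] in auto)
    then show "D k \<in> borel_measurable lebesgue" for k by (rule continuous_lebesgue_measurable)
  qed (use DB in auto)
  ultimately show ?thesis by (simp add: LIMSEQ_const_iff)
qed

lemma Ck_on_mult_test:
  assumes "open U" "Ck_on k U f" "\<phi> \<in> test_functions \<Omega>" "\<Omega> \<subseteq> U"
  shows "Ck_on k UNIV (\<lambda>x. f x * \<phi> x)"
proof -
  obtain C where C: "compact C" "C \<subseteq> \<Omega>" "\<And>x. x \<notin> C \<Longrightarrow> \<phi> x = 0"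
    using assms(3) by (rule test_functionsD) blast
  have "Ck_on k (- C) (\<lambda>x. f x * \<phi> x)"
    by (rule Ck_on_cong[OF _ _ Ck_on_const[of _ _ 0]]) (use C in \<open>auto simp: compact_imp_closed\<close>)
  moreover have "Ck_on k U (\<lambda>x. f x * \<phi> x)"
    by (intro Ck_on_mult assms Ck_on_subset[OF smooth_onD[OF test_functions_smooth[OF assms(3)]]]) simp
  ultimately have "Ck_on k (U \<union> - C) (\<lambda>x. f x * \<phi> x)"
    using Ck_on_Un assms(1) C(1) compact_imp_closed by blast
  moreover have "U \<union> - C = UNIV" using C(2) assms(4) by auto
  ultimately show ?thesis by simp
qed

lemma has_weak_gradient_C1:
  assumes O: "open \<Omega>" and f: "Ck_on 1 \<Omega> f"
  shows "has_weak_gradient \<Omega> f (grad f)"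
  unfolding has_weak_gradient_iff
proof (intro conjI ballI allI)
  have fc: "continuous_on \<Omega> f" using Ck_on_SucD[of 0 \<Omega> f] f by simp
  have Gc: "continuous_on \<Omega> (\<lambda>x. grad f x $ i)" for i using f by simp
  have Gc': "continuous_on \<Omega> (grad f)"
  proof -
    have "continuous_on \<Omega> (\<lambda>x. \<chi> i. grad f x $ i)" by (intro continuous_on_vec_lambda Gc)
    then show ?thesis by simp
  qed
  show lf: "locally_integrable \<Omega> f" and lG: "locally_integrable \<Omega> (grad f)"
    by (rule locally_integrable_continuous[OF fc], rule locally_integrable_continuous[OF Gc'])
  fix \<phi> i assume \<phi>: "\<phi> \<in> test_functions \<Omega>"
  obtain C where C: "C \<subseteq> \<Omega>" "\<And>x. x \<notin> C \<Longrightarrow> \<phi> x = 0" "\<And>x. x \<notin> C \<Longrightarrow> grad \<phi> x = 0" "compact C"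
    using \<phi> by (rule test_functionsD) blast
  have 0: "(LINT x|lebesgue. grad (\<lambda>x. f x * \<phi> x) x $ i) = 0"
    by (rule integral_grad_zero[OF Ck_on_mult_test[OF O f \<phi>] C(4)]) (simp_all add: C(2))
  have gr: "grad (\<lambda>x. f x * \<phi> x) x = f x *\<^sub>R grad \<phi> x + \<phi> x *\<^sub>R grad f x" for x
  proof (cases "x \<in> \<Omega>")
    case True
    then have "f differentiable (at x)" using f by simp
    then show ?thesis
      by (rule grad_mult) (intro smooth_on_differentiable[OF test_functions_smooth[OF \<phi>]] UNIV_I)
  next
    case False
    have "grad (\<lambda>x. f x * \<phi> x) x = grad (\<lambda>_. 0) x"
      by (rule grad_cong[of "- C"]) (use C(1,2) False compact_imp_closed[OF C(4)] in auto)
    moreover have "x \<notin> C" using C(1) False by blast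
    ultimately show ?thesis using C(2,3) by simp
  qed
  have "(LINT x|lebesgue. f x * grad \<phi> x $ i) + (LINT x|lebesgue. grad f x $ i * \<phi> x)
      = (LINT x|lebesgue. f x * grad \<phi> x $ i + grad f x $ i * \<phi> x)"
    by (intro Bochner_Integration.integral_add[symmetric] locally_integrable_test[OF lf test_functions_grad[OF \<phi>]]
        locally_integrable_test[OF locally_integrable_component[OF lG] \<phi>])
  also have "\<dots> = (LINT x|lebesgue. grad (\<lambda>x. f x * \<phi> x) x $ i)"
    unfolding gr by (rule Bochner_Integration.integral_cong) (auto simp: mult.commute)
  finally show "(LINT x|lebesgue. f x * grad \<phi> x $ i) = - (LINT x|lebesgue. grad f x $ i * \<phi> x)"
    using 0 by simp
qed

lemma has_weak_gradient_smooth: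
  "open \<Omega> \<Longrightarrow> smooth_on \<Omega> f \<Longrightarrow> has_weak_gradient \<Omega> f (grad f)"
  by (erule has_weak_gradient_C1) (erule smooth_onD)

text \<open>A test function on the whole space is multiplied by a cutoff equal to 1 near
  \<open>C\<close>. The product is a test function on \<open>\<Omega>\<close>, and on
  \<open>C\<close>, where \<open>v\<close> and \<open>h\<close> live, neither its values nor its
  gradient have changed.\<close>

lemma has_weak_gradient_extend:
  fixes v :: "real^'n \<Rightarrow> real"
  assumes O: "open \<Omega>" and v: "has_weak_gradient \<Omega> v h" and C: "compact C" "C \<subseteq> \<Omega>"
    and v0: "\<And>x. x \<notin> C \<Longrightarrow> v x = 0" and h0: "\<And>x. x \<notin> C \<Longrightarrow> h x = 0"
  shows "has_weak_gradient UNIV v h" "integrable lebesgue v" "integrable lebesgue h"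
proof -
  note V = has_weak_gradientD[OF v]
  have "(\<lambda>x. indicator C x *\<^sub>R v x) = v" "(\<lambda>x. indicator C x *\<^sub>R h x) = h"
    using v0 h0 by (auto simp: fun_eq_iff indicator_def)
  then show iv: "integrable lebesgue v" and ih: "integrable lebesgue h"
    using locally_integrableD[OF V(1) C] locally_integrableD[OF V(2) C] by (simp_all add: set_integrable_def)
  show "has_weak_gradient UNIV v h"
  proof (cases "C = {}")
    case True
    then have "v = (\<lambda>_. 0)" "h = (\<lambda>_. 0)" using v0 h0 by auto
    then show ?thesis using has_weak_gradient_smooth[OF open_UNIV smooth_on_const[of _ 0]]
      by (simp add: grad_const[abs_def])
  next
    case False
    obtain \<eta> e where \<eta>: "\<eta> \<in> test_functions \<Omega>" "e > 0" "\<And>x. infdist x C < e \<Longrightarrow> \<eta> x = 1"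
      using smooth_cutoff[OF C(1) False O C(2)] by metis
    have \<eta>C: "\<eta> x = 1" "grad \<eta> x = 0" if "x \<in> C" for x
    proof -
      show "\<eta> x = 1" using \<eta>(2,3) that by simp
      have "open {y. infdist y C < e}" by (intro open_Collect_less continuous_intros)
      then have "grad \<eta> x = grad (\<lambda>_. 1) x"
        by (rule grad_cong) (use that \<eta>(2,3) in auto)
      then show "grad \<eta> x = 0" by simp
    qed
    show ?thesis unfolding has_weak_gradient_iff
    proof (intro conjI ballI allI)
      show "locally_integrable UNIV v" "locally_integrable UNIV h"
        using iv ih by (auto intro!: set_integrable_locally_integrable simp: set_integrable_def)
      fix \<phi> :: "real^'n \<Rightarrow> real" and i assume \<phi>: "\<phi> \<in> test_functions UNIV"
      have \<phi>s: "smooth_on UNIV \<phi>" by (rule test_functions_smooth[OF \<phi>])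
      have t: "(\<lambda>x. \<phi> x * \<eta> x) \<in> test_functions \<Omega>"
        by (rule test_functions_mult[OF open_UNIV \<phi>s \<eta>(1)]) simp
      have gr: "grad (\<lambda>x. \<phi> x * \<eta> x) x = \<phi> x *\<^sub>R grad \<eta> x + \<eta> x *\<^sub>R grad \<phi> x" for x
        by (intro grad_mult smooth_on_differentiable[OF \<phi>s]
            smooth_on_differentiable[OF test_functions_smooth[OF \<eta>(1)]]) auto
      have 1: "(\<lambda>x. v x * grad (\<lambda>x. \<phi> x * \<eta> x) x $ i) = (\<lambda>x. v x * grad \<phi> x $ i)"
      proof
        show "v x * grad (\<lambda>x. \<phi> x * \<eta> x) x $ i = v x * grad \<phi> x $ i" for x
          unfolding gr using \<eta>C[of x] v0[of x] by (cases "x \<in> C") auto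
      qed
      have 2: "(\<lambda>x. h x $ i * (\<phi> x * \<eta> x)) = (\<lambda>x. h x $ i * \<phi> x)"
      proof
        show "h x $ i * (\<phi> x * \<eta> x) = h x $ i * \<phi> x" for x
          using \<eta>C[of x] h0[of x] by (cases "x \<in> C") auto
      qed
      show "(LINT x|lebesgue. v x * grad \<phi> x $ i) = - (LINT x|lebesgue. h x $ i * \<phi> x)"
        using V(3)[OF t, of i] unfolding 1 2 .
    qed
  qed
qed

lemma grad_mollify:
  fixes w :: "real^'n \<Rightarrow> real"
  assumes w: "has_weak_gradient UNIV w G" and i: "integrable lebesgue w"
  shows "grad (mollify k w) x $ i = mollify k (\<lambda>x. G x $ i) x"
proof -
  let ?J = "mollifier (inverse (real (Suc k))) :: real^'n \<Rightarrow> real"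
  note t = mollify_test[of k, where 'a = 'n]
  obtain C where C: "compact C" "\<And>x. x \<notin> C \<Longrightarrow> ?J x = 0"
    using t by (rule test_functionsD) blast
  have "compact ((\<lambda>y. x - y) ` C)"
    by (intro compact_continuous_image C continuous_intros)
  then have \<phi>: "(\<lambda>y. ?J (x - y)) \<in> test_functions UNIV"
  proof (rule test_functionsI[OF smooth_on_reflect[OF test_functions_smooth[OF t]]])
    fix y assume "y \<notin> (\<lambda>y. x - y) ` C"
    then have "x - y \<notin> C" by (metis imageI diff_diff_eq2 add_diff_cancel_left')
    then show "?J (x - y) = 0" by (rule C(2))
  qed simp
  have gr: "grad (\<lambda>y. ?J (x - y)) y = - grad ?J (x - y)" for y
    by (intro grad_reflect smooth_on_differentiable[OF test_functions_smooth[OF t]]) simp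
  have "grad (mollify k w) x $ i = (LINT y|lebesgue. grad ?J (x - y) $ i * w y)"
    unfolding mollify_def grad_conv[OF t i] by (simp add: conv_def)
  also have "\<dots> = - (LINT y|lebesgue. w y * grad (\<lambda>y. ?J (x - y)) y $ i)"
    unfolding gr by (simp add: mult.commute)
  also have "\<dots> = (LINT y|lebesgue. G y $ i * ?J (x - y))"
    unfolding has_weak_gradientD(3)[OF w \<phi>] by simp
  finally show ?thesis by (simp add: mollify_def conv_def mult.commute)
qed

subsection \<open>The chain rule\<close>

lemma tendsto_integral_bounded_mult:
  fixes f b :: "nat \<Rightarrow> 'a::euclidean_space \<Rightarrow> real"
  assumes f: "\<And>k. integrable lebesgue (f k)" "(\<lambda>k. LINT x|lebesgue. \<bar>f k x\<bar>) \<longlonglongrightarrow> 0"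
    and b: "\<And>k. b k \<in> borel_measurable lebesgue" "\<And>k x. \<bar>b k x\<bar> \<le> B"
  shows "(\<lambda>k. LINT x|lebesgue. b k x * f k x) \<longlonglongrightarrow> 0"
proof (rule Lim_null_comparison)
  show "(\<lambda>k. B * (LINT x|lebesgue. \<bar>f k x\<bar>)) \<longlonglongrightarrow> 0"
    using tendsto_mult_left[OF f(2), of B] by simp
  have "norm (LINT x|lebesgue. b k x * f k x) \<le> (LINT x|lebesgue. B * \<bar>f k x\<bar>)" for k
  proof (rule Bochner_Integration.integral_norm_bound_integral)
    show "integrable lebesgue (\<lambda>x. b k x * f k x)"
      by (rule integrable_bounded_mult[OF f(1) b])
    show "integrable lebesgue (\<lambda>x. B * \<bar>f k x\<bar>)" using f(1) by simp
    show "norm (b k x * f k x) \<le> B * \<bar>f k x\<bar>" for x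
      using b(2) by (simp add: abs_mult mult_right_mono)
  qed
  then show "\<forall>\<^sub>F k in sequentially. norm (LINT x|lebesgue. b k x * f k x) \<le> B * (LINT x|lebesgue. \<bar>f k x\<bar>)"
    by simp
qed

text \<open>After localization to \<open>w = \<eta> * u\<close> the classical chain rule holds for
  the mollifications of \<open>w\<close>. Since \<open>S\<close> is Lipschitz, the left sides
  converge along with the mollifications in mean. On the right the gradients converge in mean while
  \<open>S'\<close> is merely bounded and continuous, so the limit is taken separately in the two
  factors.\<close>

theorem has_weak_gradient_chain:
  fixes u :: "real^'n \<Rightarrow> real"
  assumes O: "open \<Omega>" and u: "has_weak_gradient \<Omega> u g"
    and S: "\<And>t. (S has_field_derivative S' t) (at t)" and S'c: "continuous_on UNIV S'"
    and S'B: "\<And>t. \<bar>S' t\<bar> \<le> B"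
  shows "has_weak_gradient \<Omega> (\<lambda>x. S (u x)) (\<lambda>x. S' (u x) *\<^sub>R g x)"
  unfolding has_weak_gradient_iff
proof (intro conjI ballI allI)
  note U = has_weak_gradientD[OF u]
  have Sc: "continuous_on UNIV S" using DERIV_isCont[OF S] by (simp add: continuous_at_imp_continuous_on)
  have SL: "\<bar>S a - S b\<bar> \<le> B * \<bar>a - b\<bar>" for a b
    using differentiable_bound[of UNIV S "\<lambda>t. (*) (S' t)" B a b] S S'B
    by (auto simp: has_field_derivative_def onorm_le abs_mult mult_right_mono intro!: onorm_le)
  have SL': "\<bar>S a - S b\<bar> \<le> \<bar>B * (a - b)\<bar>" for a b
    using SL[of a b] abs_ge_self[of B] mult_right_mono[of B "\<bar>B\<bar>" "\<bar>a - b\<bar>"] by (simp add: abs_mult)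
  have Sm: "(\<lambda>x. S (f x)) \<in> borel_measurable lebesgue" "(\<lambda>x. S' (f x)) \<in> borel_measurable lebesgue"
    if "f \<in> borel_measurable lebesgue" for f :: "real^'n \<Rightarrow> real"
    using borel_measurable_continuous_on[OF Sc that] borel_measurable_continuous_on[OF S'c that] by auto
  show "locally_integrable \<Omega> (\<lambda>x. S (u x))"
    unfolding locally_integrable_def
  proof (intro allI impI, elim conjE)
    fix C assume C: "compact C" "C \<subseteq> \<Omega>"
    note uC = locally_integrableD[OF U(1) C]
    have Cm: "C \<in> sets lebesgue" "emeasure lebesgue C < \<infinity>"
      using lmeasurable_compact[OF C(1)] by (auto simp: fmeasurable_def)
    have i: "integrable lebesgue (\<lambda>x. S (indicator C x *\<^sub>R u x) - S 0)"
    proof (rule Bochner_Integration.integrable_bound[of _ "\<lambda>x. B * (indicator C x *\<^sub>R u x)"])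
      show "integrable lebesgue (\<lambda>x. B * (indicator C x *\<^sub>R u x))"
        using uC by (simp add: set_integrable_def)
      show "(\<lambda>x. S (indicator C x *\<^sub>R u x) - S 0) \<in> borel_measurable lebesgue"
        using Sm(1)[OF borel_measurable_integrable[OF uC[unfolded set_integrable_def]]] by simp
      show "AE x in lebesgue. norm (S (indicator C x *\<^sub>R u x) - S 0) \<le> norm (B * (indicator C x *\<^sub>R u x))"
        using SL'[of "indicator C x *\<^sub>R u x" 0 for x] by (intro AE_I2) simp
    qed
    have "integrable lebesgue (\<lambda>x. (S (indicator C x *\<^sub>R u x) - S 0) + S 0 * indicator C x)"
      using i Cm by (intro Bochner_Integration.integrable_add integrable_mult_right integrable_real_indicator)
    moreover have "(\<lambda>x. (S (indicator C x *\<^sub>R u x) - S 0) + S 0 * indicator C x) = (\<lambda>x. indicator C x *\<^sub>R S (u x))"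
      by (auto simp: fun_eq_iff indicator_def)
    ultimately show "set_integrable lebesgue C (\<lambda>x. S (u x))"
      by (simp add: set_integrable_def)
  qed
  show "locally_integrable \<Omega> (\<lambda>x. S' (u x) *\<^sub>R g x)"
    unfolding locally_integrable_def
  proof (intro allI impI, elim conjE)
    fix C assume C: "compact C" "C \<subseteq> \<Omega>"
    note uC = locally_integrableD[OF U(1) C] and gC = locally_integrableD[OF U(2) C]
    have "(\<lambda>x. S' (indicator C x *\<^sub>R u x) *\<^sub>R (indicator C x *\<^sub>R g x)) = (\<lambda>x. indicator C x *\<^sub>R S' (u x) *\<^sub>R g x)"
      by (auto simp: fun_eq_iff indicator_def)
    moreover have "integrable lebesgue (\<lambda>x. S' (indicator C x *\<^sub>R u x) *\<^sub>R (indicator C x *\<^sub>R g x))"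
    proof (rule Bochner_Integration.integrable_bound[of _ "\<lambda>x. B *\<^sub>R (indicator C x *\<^sub>R g x)"])
      show "integrable lebesgue (\<lambda>x. B *\<^sub>R (indicator C x *\<^sub>R g x))"
        using gC unfolding set_integrable_def by (rule integrable_scaleR_right)
      show "(\<lambda>x. S' (indicator C x *\<^sub>R u x) *\<^sub>R (indicator C x *\<^sub>R g x)) \<in> borel_measurable lebesgue"
        using Sm(2)[OF borel_measurable_integrable[OF uC[unfolded set_integrable_def]]]
          borel_measurable_integrable[OF gC[unfolded set_integrable_def]] by (rule borel_measurable_scaleR)
      have "\<bar>S' t\<bar> \<le> \<bar>B\<bar>" for t using S'B[of t] by linarith
      then show "AE x in lebesgue. norm (S' (indicator C x *\<^sub>R u x) *\<^sub>R (indicator C x *\<^sub>R g x)) \<le> norm (B *\<^sub>R (indicator C x *\<^sub>R g x))"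
        unfolding norm_scaleR[of "S' _"] norm_scaleR[of B] by (intro AE_I2 mult_right_mono) simp_all
    qed
    ultimately show "set_integrable lebesgue C (\<lambda>x. S' (u x) *\<^sub>R g x)"
      by (simp add: set_integrable_def)
  qed
  fix \<phi> :: "real^'n \<Rightarrow> real" and i assume \<phi>: "\<phi> \<in> test_functions \<Omega>"
  obtain C where C: "C \<subseteq> \<Omega>" "\<And>x. x \<notin> C \<Longrightarrow> \<phi> x = 0" "\<And>x. x \<notin> C \<Longrightarrow> grad \<phi> x = 0" "compact C"
    using \<phi> by (rule test_functionsD) blast
  show "(LINT x|lebesgue. S (u x) * grad \<phi> x $ i) = - (LINT x|lebesgue. (S' (u x) *\<^sub>R g x) $ i * \<phi> x)"
  proof (cases "C = {}")
    case True
    then show ?thesis using C by simp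
  next
    case False
    obtain \<eta> e where \<eta>: "\<eta> \<in> test_functions \<Omega>" "e > 0" "\<And>x. infdist x C < e \<Longrightarrow> \<eta> x = 1"
      using smooth_cutoff[OF C(4) False O C(1)] by metis
    obtain D where D: "D \<subseteq> \<Omega>" "\<And>x. x \<notin> D \<Longrightarrow> \<eta> x = 0" "\<And>x. x \<notin> D \<Longrightarrow> grad \<eta> x = 0" "compact D"
      using \<eta>(1) by (rule test_functionsD) blast
    define w where "w x = \<eta> x * u x" for x
    define G where "G x = \<eta> x *\<^sub>R g x + u x *\<^sub>R grad \<eta> x" for x
    have "has_weak_gradient \<Omega> w G"
      unfolding w_def G_def
      by (rule has_weak_gradient_mult[OF O u smooth_on_subset[OF test_functions_smooth[OF \<eta>(1)]]]) simp
    note W = has_weak_gradient_extend[OF O this D(4,1)]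
    have W1: "has_weak_gradient UNIV w G" "integrable lebesgue w" "integrable lebesgue G"
      using W D(2,3) by (auto simp: w_def G_def)
    have Gi: "integrable lebesgue (\<lambda>x. G x $ i)"
      using integrable_bounded_linear[OF bounded_linear_vec_nth W1(3)] .
    have wm: "w \<in> borel_measurable lebesgue" and mm: "mollify k w \<in> borel_measurable lebesgue" for k
      using W1(2) mollify_L1(1)[OF W1(2)] by (auto dest: borel_measurable_integrable)
    obtain P where P: "\<And>x. \<bar>\<phi> x\<bar> \<le> P" using test_functions_bounded[OF \<phi>] by metis
    obtain Q where Q: "\<And>x. \<bar>grad \<phi> x $ i\<bar> \<le> Q"
      using test_functions_bounded[OF test_functions_grad[OF \<phi>, of i]] by metis
    note \<phi>m = test_measurable[OF \<phi>] and d\<phi>m = test_measurable[OF test_functions_grad[OF \<phi>, of i]]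
    have S1: "Ck1_on 1 UNIV S"
      using S S'c unfolding One_nat_def Ck1_on.simps by (intro exI[of _ S'] conjI ballI)
    have "smooth_on UNIV (mollify k w)" for k
      unfolding mollify_def by (rule smooth_on_conv[OF mollify_test W1(2)])
    then have "Ck_on 1 UNIV (\<lambda>x. S (mollify k w x))" for k
      using Ck_on_compose[OF open_UNIV smooth_onD subset_UNIV S1] by blast
    then have "has_weak_gradient UNIV (\<lambda>x. S (mollify k w x)) (grad (\<lambda>x. S (mollify k w x)))" for k
      by (rule has_weak_gradient_C1[OF open_UNIV])
    from has_weak_gradientD(3)[OF this test_functions_mono[OF subset_UNIV \<phi>]]
    have "(LINT x|lebesgue. S (mollify k w x) * grad \<phi> x $ i)
        = - (LINT x|lebesgue. grad (\<lambda>x. S (mollify k w x)) x $ i * \<phi> x)" for k .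
    moreover have "grad (\<lambda>x. S (mollify k w x)) x $ i = S' (mollify k w x) * mollify k (\<lambda>x. G x $ i) x" for k x
    proof -
      have "mollify k w differentiable (at x)"
        unfolding mollify_def
        by (rule smooth_on_differentiable[OF smooth_on_conv[OF mollify_test W1(2), of UNIV]]) simp
      from grad_compose[OF this S] show ?thesis by (simp add: grad_mollify[OF W1(1,2)])
    qed
    ultimately have eq: "(LINT x|lebesgue. S (mollify k w x) * grad \<phi> x $ i)
        = - (LINT x|lebesgue. S' (mollify k w x) * mollify k (\<lambda>x. G x $ i) x * \<phi> x)" for k
      by simp
    \<comment> \<open>Convergence in mean says nothing about \<open>S'\<close> of the
      mollifications; a subsequence that converges almost everywhere does, by continuity of
      \<open>S'\<close>.\<close>
    obtain r where r: "strict_mono r" "AE x in lebesgue. (\<lambda>k. mollify (r k) w x - w x) \<longlonglongrightarrow> 0"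
    proof -
      have "integrable lebesgue (\<lambda>x. mollify k w x - w x)" for k
        using mollify_L1(1)[OF W1(2)] W1(2) by (rule Bochner_Integration.integrable_diff)
      moreover have "(\<lambda>k. LINT x|lebesgue. norm (mollify k w x - w x)) \<longlonglongrightarrow> 0"
        using mollify_L1(2)[OF W1(2)] by simp
      ultimately show ?thesis
        using tendsto_L1_AE_subseq[of lebesgue "\<lambda>k x. mollify k w x - w x"] that by blast
    qed
    have i1: "integrable lebesgue (\<lambda>x. S (w x) * grad \<phi> x $ i)"
    proof -
      have "integrable lebesgue (\<lambda>x. grad \<phi> x $ i * (S (w x) - S 0))"
      proof (rule integrable_bounded_mult[OF _ d\<phi>m Q])
        show "integrable lebesgue (\<lambda>x. S (w x) - S 0)"
          by (rule Bochner_Integration.integrable_bound[of _ "\<lambda>x. B * w x"])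
            (use W1(2) Sm(1)[OF wm] SL'[of "w x" 0 for x] in auto)
      qed
      then have "integrable lebesgue (\<lambda>x. grad \<phi> x $ i * (S (w x) - S 0) + S 0 * grad \<phi> x $ i)"
        using test_integrable[OF test_functions_grad[OF \<phi>]]
        by (intro Bochner_Integration.integrable_add integrable_mult_right)
      then show ?thesis by (simp add: algebra_simps)
    qed
    have dS: "integrable lebesgue (\<lambda>x. S (mollify k w x) - S (w x))" for k
      by (rule Bochner_Integration.integrable_bound[of _ "\<lambda>x. B * (mollify k w x - w x)"])
        (use W1(2) mollify_L1(1)[OF W1(2)] Sm(1)[OF wm] Sm(1)[OF mm] SL' in auto)
    have L1: "(\<lambda>k. LINT x|lebesgue. grad \<phi> x $ i * (S (mollify k w x) - S (w x))) \<longlonglongrightarrow> 0"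
    proof (rule tendsto_integral_bounded_mult[OF dS _ d\<phi>m Q])
      show "(\<lambda>k. LINT x|lebesgue. \<bar>S (mollify k w x) - S (w x)\<bar>) \<longlonglongrightarrow> 0"
      proof (rule Lim_null_comparison)
        show "(\<lambda>k. B * (LINT x|lebesgue. \<bar>mollify k w x - w x\<bar>)) \<longlonglongrightarrow> 0"
          using tendsto_mult_left[OF mollify_L1(2)[OF W1(2)], of B] by simp
        have "(LINT x|lebesgue. \<bar>S (mollify k w x) - S (w x)\<bar>) \<le> (LINT x|lebesgue. B * \<bar>mollify k w x - w x\<bar>)" for k
          using dS W1(2) mollify_L1(1)[OF W1(2)] SL by (intro integral_mono) auto
        then show "\<forall>\<^sub>F k in sequentially. norm (LINT x|lebesgue. \<bar>S (mollify k w x) - S (w x)\<bar>)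
            \<le> B * (LINT x|lebesgue. \<bar>mollify k w x - w x\<bar>)"
          by simp
      qed
    qed
    have "(\<lambda>k. (LINT x|lebesgue. S (mollify k w x) * grad \<phi> x $ i)) \<longlonglongrightarrow> (LINT x|lebesgue. S (w x) * grad \<phi> x $ i)"
    proof -
      have "(LINT x|lebesgue. S (mollify k w x) * grad \<phi> x $ i) = (LINT x|lebesgue. grad \<phi> x $ i * (S (mollify k w x) - S (w x)))
          + (LINT x|lebesgue. S (w x) * grad \<phi> x $ i)" for k
        using integrable_bounded_mult[OF dS[of k] d\<phi>m Q] i1
        by (subst Bochner_Integration.integral_add[symmetric]) (auto simp: algebra_simps)
      then show ?thesis using tendsto_add[OF L1 tendsto_const] by simp
    qed
    then have lhs: "(\<lambda>k. (LINT x|lebesgue. S (mollify (r k) w x) * grad \<phi> x $ i)) \<longlonglongrightarrow> (LINT x|lebesgue. S (w x) * grad \<phi> x $ i)"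
      using LIMSEQ_subseq_LIMSEQ[OF _ r(1)] by (fastforce simp: o_def)
    let ?H = "\<lambda>k. mollify k (\<lambda>x. G x $ i)"
    have BP: "\<bar>S' a * \<phi> x\<bar> \<le> B * P" for a x
      unfolding abs_mult using S'B[of a] P[of x] by (intro mult_mono) linarith+
    have HG: "integrable lebesgue (\<lambda>x. ?H k x - G x $ i)" for k
      using mollify_L1(1)[OF Gi] Gi by simp
    have b1: "(\<lambda>x. S' (mollify k w x) * \<phi> x) \<in> borel_measurable lebesgue" for k
      using Sm(2)[OF mm] \<phi>m by (intro borel_measurable_times)
    have R1: "(\<lambda>k. LINT x|lebesgue. (S' (mollify (r k) w x) * \<phi> x) * (?H (r k) x - G x $ i)) \<longlonglongrightarrow> 0"
    proof (rule tendsto_integral_bounded_mult[OF HG _ b1 BP])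
      show "(\<lambda>k. LINT x|lebesgue. \<bar>?H (r k) x - G x $ i\<bar>) \<longlonglongrightarrow> 0"
        using LIMSEQ_subseq_LIMSEQ[OF mollify_L1(2)[OF Gi] r(1)] by (simp add: o_def)
    qed
    have i2: "integrable lebesgue (\<lambda>x. S' (mollify k w x) * \<phi> x * G x $ i)" for k
      by (rule integrable_bounded_mult[OF Gi b1 BP])
    have R2: "(\<lambda>k. LINT x|lebesgue. S' (mollify (r k) w x) * \<phi> x * G x $ i) \<longlonglongrightarrow> (LINT x|lebesgue. S' (w x) * \<phi> x * G x $ i)"
    proof (rule integral_dominated_convergence[where w = "\<lambda>x. B * P * \<bar>G x $ i\<bar>"])
      show "integrable lebesgue (\<lambda>x. B * P * \<bar>G x $ i\<bar>)" using Gi by simp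
      show "AE x in lebesgue. (\<lambda>k. S' (mollify (r k) w x) * \<phi> x * G x $ i) \<longlonglongrightarrow> S' (w x) * \<phi> x * G x $ i"
        using r(2)
      proof eventually_elim
        case (elim x)
        then have "(\<lambda>k. mollify (r k) w x) \<longlonglongrightarrow> w x" by (simp add: LIM_zero_iff)
        then have "(\<lambda>k. S' (mollify (r k) w x)) \<longlonglongrightarrow> S' (w x)"
          using S'c by (intro continuous_on_tendsto_compose[OF S'c]) auto
        then show ?case by (intro tendsto_mult tendsto_const)
      qed
      show "AE x in lebesgue. norm (S' (mollify (r k) w x) * \<phi> x * G x $ i) \<le> B * P * \<bar>G x $ i\<bar>" for k
        using BP by (intro AE_I2) (simp add: abs_mult[of "_ * _" "G _ $ i"] mult_right_mono)
    qed (use borel_measurable_integrable[OF i2] Sm(2)[OF wm] \<phi>m borel_measurable_integrable[OF Gi] in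
        \<open>auto intro!: borel_measurable_times\<close>)
    have "(LINT x|lebesgue. S' (mollify k w x) * ?H k x * \<phi> x) =
        (LINT x|lebesgue. (S' (mollify k w x) * \<phi> x) * (?H k x - G x $ i)) + (LINT x|lebesgue. S' (mollify k w x) * \<phi> x * G x $ i)" for k
      using integrable_bounded_mult[OF HG[of k] b1 BP] i2
      by (subst Bochner_Integration.integral_add[symmetric]) (auto simp: algebra_simps)
    then have "(\<lambda>k. (LINT x|lebesgue. S (mollify (r k) w x) * grad \<phi> x $ i)) \<longlonglongrightarrow> - (0 + (LINT x|lebesgue. S' (w x) * \<phi> x * G x $ i))"
      unfolding eq using tendsto_minus[OF tendsto_add[OF R1 R2]] by simp
    then have fin: "(LINT x|lebesgue. S (w x) * grad \<phi> x $ i) = - (LINT x|lebesgue. S' (w x) * \<phi> x * G x $ i)"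
      using LIMSEQ_unique[OF lhs] by simp
    have \<eta>C: "\<eta> x = 1" "grad \<eta> x = 0" if "x \<in> C" for x
    proof -
      show "\<eta> x = 1" using \<eta>(2,3) that by simp
      have "open {y. infdist y C < e}" by (intro open_Collect_less continuous_intros)
      then have "grad \<eta> x = grad (\<lambda>_. 1) x"
        by (rule grad_cong) (use that \<eta>(2,3) in auto)
      then show "grad \<eta> x = 0" by simp
    qed
    have 1: "(\<lambda>x. S (w x) * grad \<phi> x $ i) = (\<lambda>x. S (u x) * grad \<phi> x $ i)"
    proof
      show "S (w x) * grad \<phi> x $ i = S (u x) * grad \<phi> x $ i" for x
        using C(3)[of x] \<eta>C[of x] by (cases "x \<in> C") (auto simp: w_def)
    qed
    have 2: "(\<lambda>x. S' (w x) * \<phi> x * G x $ i) = (\<lambda>x. (S' (u x) *\<^sub>R g x) $ i * \<phi> x)"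
    proof
      show "S' (w x) * \<phi> x * G x $ i = (S' (u x) *\<^sub>R g x) $ i * \<phi> x" for x
        using C(2)[of x] \<eta>C[of x] by (cases "x \<in> C") (auto simp: w_def G_def)
    qed
    show ?thesis using fin unfolding 1 2 .
  qed
qed

lemma test_functions_outside:
  assumes "\<phi> \<in> test_functions \<Omega>" "x \<notin> \<Omega>"
  shows "\<phi> x = 0" "grad \<phi> x = 0"
proof -
  obtain C where C: "C \<subseteq> \<Omega>" "\<And>x. x \<notin> C \<Longrightarrow> \<phi> x = 0" "\<And>x. x \<notin> C \<Longrightarrow> grad \<phi> x = 0"
    using assms(1) by (rule test_functionsD) blast
  have "x \<notin> C" using C(1) assms(2) by blast
  then show "\<phi> x = 0" "grad \<phi> x = 0" using C(2,3) by blast+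
qed

subsection \<open>Weak gradients of Lipschitz functions\<close>

text \<open>Midpoint hulls of the tails stand in for the closed convex hulls in Mazur's lemma.\<close>

inductive tail_hull :: "(nat \<Rightarrow> 'a \<Rightarrow> real) \<Rightarrow> nat \<Rightarrow> ('a \<Rightarrow> real) \<Rightarrow> bool" for f m where
  base: "k \<ge> m \<Longrightarrow> tail_hull f m (f k)"
| mid: "tail_hull f m a \<Longrightarrow> tail_hull f m b \<Longrightarrow> tail_hull f m (\<lambda>x. (a x + b x) / 2)"

lemma tail_hull_mono: "tail_hull f m h \<Longrightarrow> n \<le> m \<Longrightarrow> tail_hull f n h"
  by (induction rule: tail_hull.induct) (auto intro: tail_hull.intros)

lemma tail_hull_measurable:
  "tail_hull f m h \<Longrightarrow> (\<And>k. f k \<in> borel_measurable M) \<Longrightarrow> h \<in> borel_measurable M"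
  by (induction rule: tail_hull.induct) auto

lemma tail_hull_bound:
  assumes "tail_hull f m h" "\<And>k x. \<bar>f k x\<bar> \<le> F x"
  shows "\<bar>h x\<bar> \<le> F x"
  using assms
proof (induction rule: tail_hull.induct)
  case (mid a b)
  have "\<bar>a x\<bar> \<le> F x" "\<bar>b x\<bar> \<le> F x" using mid by auto
  then show ?case by (simp add: abs_le_iff field_simps)
qed auto

lemma tail_hull_integral:
  assumes "tail_hull f m h" "\<And>h. tail_hull f m h \<Longrightarrow> integrable M (\<lambda>x. h x * \<phi> x)"
    and "\<And>k. k \<ge> m \<Longrightarrow> \<bar>(LINT x|M. f k x * \<phi> x) - l\<bar> \<le> e"
  shows "\<bar>(LINT x|M. h x * \<phi> x) - l\<bar> \<le> e"
  using assms(1)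
proof (induction rule: tail_hull.induct)
  case (mid a b)
  have "(LINT x|M. (a x + b x) / 2 * \<phi> x) = (LINT x|M. (a x * \<phi> x + b x * \<phi> x) / 2)"
    by (simp add: distrib_right)
  also have "\<dots> = ((LINT x|M. a x * \<phi> x) + (LINT x|M. b x * \<phi> x)) / 2"
    using assms(2)[OF mid(1)] assms(2)[OF mid(2)] by simp
  finally show ?case using mid.IH by (simp add: abs_if field_simps split: if_splits)
qed (rule assms(3))

text \<open>In each tail hull a near minimizer of the integral of the square is chosen. The
  parallelogram law makes these functions a Cauchy sequence in quadratic mean, hence in mean since
  \<open>S\<close> has finite measure. If the test integrals of the \<open>f k\<close> against
  \<open>\<phi>\<close> converge, their limit is inherited by elements of ever later tail hulls, and
  so by the limit function, which is the same for all \<open>\<phi>\<close>.\<close>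

proposition bounded_sequence_weak_limit:
  fixes f :: "nat \<Rightarrow> 'a::euclidean_space \<Rightarrow> real"
  assumes S: "S \<in> lmeasurable" and B: "B \<ge> 0"
    and fm: "\<And>k. f k \<in> borel_measurable lebesgue" and fB: "\<And>k x. \<bar>f k x\<bar> \<le> B * indicator S x"
  shows "\<exists>g\<in>borel_measurable lebesgue. (\<forall>x. \<bar>g x\<bar> \<le> B * indicator S x) \<and>
    (\<forall>\<phi> P l. \<phi> \<in> borel_measurable lebesgue \<longrightarrow> (\<forall>x. \<bar>\<phi> x\<bar> \<le> P) \<longrightarrow>
       (\<lambda>k. LINT x|lebesgue. f k x * \<phi> x) \<longlonglongrightarrow> l \<longrightarrow> (LINT x|lebesgue. g x * \<phi> x) = l)"
proof -
  let ?C = "tail_hull f"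
  define I where "I x = B * indicator S x" for x
  have Ssets: "S \<in> sets lebesgue" "emeasure lebesgue S < \<infinity>" using S by (auto simp: fmeasurable_def)
  have Si: "integrable lebesgue (indicator S :: _ \<Rightarrow> real)"
    using Ssets by (rule integrable_real_indicator)
  have Ii: "integrable lebesgue I" unfolding I_def using Si by (rule integrable_mult_right)
  have hm: "h \<in> borel_measurable lebesgue" if "?C m h" for m h
    using tail_hull_measurable[OF that] fm by blast
  have hB: "\<bar>h x\<bar> \<le> I x" if "?C m h" for m h x
    using tail_hull_bound[OF that, of I x] fB by (simp add: I_def)
  have hB': "\<bar>h x\<bar> \<le> B" if "?C m h" for m h x
    using hB[OF that, of x] B by (cases "x \<in> S") (auto simp: I_def)
  have hi: "integrable lebesgue h" if "?C m h" for m h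
    by (rule Bochner_Integration.integrable_bound[OF Ii hm[OF that]])
      (use hB[OF that] in \<open>auto intro: order_trans[OF _ abs_ge_self]\<close>)
  define N where "N h = (LINT x|lebesgue. (h x)\<^sup>2)" for h :: "'a \<Rightarrow> real"
  have hh: "integrable lebesgue (\<lambda>x. a x * b x)" if "?C m a" "?C n b" for m n a b
    by (rule integrable_bounded_mult[OF hi[OF that(2)] hm[OF that(1)] hB'[OF that(1)]])
  have Nnn: "N h \<ge> 0" for h by (simp add: N_def)
  \<comment> \<open>The hulls shrink with \<open>m\<close>, so the infima increase, and
    \<open>B\<^sup>2 * measure lebesgue S\<close> bounds them. Their convergence is what forces the
    near minimizers together.\<close>
  define d where "d m = Inf (N ` Collect (?C m))" for m
  have ne: "N ` Collect (?C m) \<noteq> {}" for m using tail_hull.base[of m m f] by auto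
  have bb: "bdd_below (N ` Collect (?C m))" for m using Nnn by (intro bdd_belowI[of _ 0]) auto
  have dle: "d m \<le> N h" if "?C m h" for m h
    unfolding d_def by (rule cInf_lower[OF _ bb]) (use that in auto)
  have dmono: "d m \<le> d n" if "m \<le> n" for m n
    unfolding d_def by (rule cInf_superset_mono[OF ne bb]) (use that tail_hull_mono in blast)
  have dub: "d m \<le> B\<^sup>2 * measure lebesgue S" for m
  proof -
    have "d m \<le> N (f m)" by (rule dle) (rule tail_hull.base, simp)
    also have "N (f m) \<le> (LINT x|lebesgue. B\<^sup>2 * indicator S x)"
      unfolding N_def
    proof (rule integral_mono)
      show "integrable lebesgue (\<lambda>x. (f m x)\<^sup>2)"
        using hh[OF tail_hull.base[of m m f] tail_hull.base[of m m f]] by (simp add: power2_eq_square)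
      show "integrable lebesgue (\<lambda>x. B\<^sup>2 * indicator S x)" using Si by (rule integrable_mult_right)
      show "(f m x)\<^sup>2 \<le> B\<^sup>2 * indicator S x" for x
        using power_mono[OF fB[of m x], of 2] by (cases "x \<in> S") (simp_all add: power_mult_distrib)
    qed
    finally show ?thesis using Ssets by simp
  qed
  have "norm (d n) \<le> \<bar>d 0\<bar> + B\<^sup>2 * measure lebesgue S" for n
  proof -
    have "B\<^sup>2 * measure lebesgue S \<ge> 0" by simp
    then show ?thesis using dmono[of 0 n] dub[of n] unfolding real_norm_def by linarith
  qed
  then have "convergent d"
    by (intro Bseq_mono_convergent BseqI'[of d]) (use dmono in auto)
  then have dC: "Cauchy d" by (rule convergent_Cauchy)
  define v where "v j = inverse (real (Suc j))" for j
  have v: "v j > 0" "i \<le> j \<Longrightarrow> v j \<le> v i" for i j by (auto simp: v_def)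
  have "\<exists>h. ?C j h \<and> N h < d j + v j" for j
  proof -
    have "Inf (N ` Collect (?C j)) < d j + v j" using v(1)[of j] by (simp add: d_def)
    then obtain y where "y \<in> N ` Collect (?C j)" "y < d j + v j"
      using cInf_lessD[OF ne] by blast
    then show ?thesis by auto
  qed
  then obtain h where h: "\<And>j. ?C j (h j)" "\<And>j. N (h j) < d j + v j" by metis
  \<comment> \<open>The parallelogram law: the midpoint of \<open>h i\<close> and \<open>h j\<close>
    lies in the hull of the tail \<open>n\<close>, so its value under \<open>N\<close> is at least
    \<open>d n\<close>, while \<open>h i\<close> and \<open>h j\<close> exceed their infima by at
    most \<open>v n\<close>.\<close>
  have par: "N (\<lambda>x. h i x - h j x) \<le> 2 * (d i - d n) + 2 * (d j - d n) + 4 * v n"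
    if "n \<le> i" "n \<le> j" for i j n
  proof -
    let ?m = "\<lambda>x. (h i x + h j x) / 2"
    have m: "?C n ?m" using h(1) that by (intro tail_hull.mid) (blast intro: tail_hull_mono)+
    have sq: "integrable lebesgue (\<lambda>x. (h i x)\<^sup>2)" "integrable lebesgue (\<lambda>x. (h j x)\<^sup>2)" "integrable lebesgue (\<lambda>x. (?m x)\<^sup>2)"
      using hh[OF h(1)[of i] h(1)[of i]] hh[OF h(1)[of j] h(1)[of j]] hh[OF m m]
      by (simp_all add: power2_eq_square)
    have "N (\<lambda>x. h i x - h j x) = (LINT x|lebesgue. 2 * (h i x)\<^sup>2 + 2 * (h j x)\<^sup>2 - 4 * (?m x)\<^sup>2)"
      unfolding N_def by (rule Bochner_Integration.integral_cong) (auto simp: power2_eq_square field_simps)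
    also have "\<dots> = 2 * N (h i) + 2 * N (h j) - 4 * N ?m"
      unfolding N_def using sq by (simp add: Bochner_Integration.integral_diff Bochner_Integration.integral_add del: power_divide)
    finally have 1: "N (\<lambda>x. h i x - h j x) = 2 * N (h i) + 2 * N (h j) - 4 * N ?m" .
    have 2: "d n \<le> N ?m" by (rule dle[OF m])
    have arith: "a \<le> 2 * (di - dn) + 2 * (dj - dn) + 4 * vn"
      if "a = 2 * b + 2 * c - 4 * f" "dn \<le> f" "vi \<le> vn" "vj \<le> vn" "b < di + vi" "c < dj + vj"
      for a b c f di dj dn vi vj vn :: real
      using that by argo
    have "v i \<le> v n" "v j \<le> v n" using that v(2) by auto
    then show ?thesis by (rule arith[OF 1 2 _ _ h(2) h(2)])
  qed
  have "\<exists>n. \<forall>i\<ge>n. \<forall>j\<ge>n. N (\<lambda>x. h i x - h j x) < e" if e: "e > 0" for e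
  proof -
    obtain n1 where n1: "\<And>i j. i \<ge> n1 \<Longrightarrow> j \<ge> n1 \<Longrightarrow> dist (d i) (d j) < e / 8"
      using metric_CauchyD[OF dC, of "e / 8"] e by auto
    obtain n2 where n2: "v n2 < e / 8"
      using reals_Archimedean[of "e / 8"] e unfolding v_def by auto
    let ?n = "max n1 n2"
    have n2': "v ?n \<le> v n2" by (rule v(2)) simp
    have "N (\<lambda>x. h i x - h j x) < e" if "i \<ge> ?n" "j \<ge> ?n" for i j
    proof -
      have "\<bar>d i - d ?n\<bar> < e / 8" "\<bar>d j - d ?n\<bar> < e / 8"
        using n1[of i ?n] n1[of j ?n] that by (auto simp: dist_real_def)
      then have "d i - d ?n < e / 8" "d j - d ?n < e / 8" by linarith+
      moreover have "a < e" if "a \<le> 2 * b + 2 * c + 4 * f" "b < e / 8" "c < e / 8" "f \<le> p" "p < e / 8" for a b c f p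
        using that by argo
      ultimately show ?thesis using par[OF that] n2 n2' by blast
    qed
    then show ?thesis by blast
  qed
  note CN = this
  have diffi: "integrable lebesgue (\<lambda>x. h i x - h j x)" for i j
    using hi[OF h(1)] by (intro Bochner_Integration.integrable_diff)
  have CL: "\<exists>n. \<forall>i\<ge>n. \<forall>j\<ge>n. (LINT x|lebesgue. norm (h i x - h j x)) < e" if e: "e > 0" for e
  proof -
    define m where "m = measure lebesgue S + 1"
    have m: "m > 0" by (simp add: m_def add_nonneg_pos)
    \<comment> \<open>From quadratic mean to mean through
      \<open>\<bar>s\<bar> \<le> s\<^sup>2 / c + c\<close> on \<open>S\<close>. With this
      \<open>c\<close> the second summand contributes at most \<open>e / 2\<close>.\<close>
    define c where "c = e / (2 * m)"
    have c: "c > 0" using e m by (simp add: c_def)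
    have cS: "c * measure lebesgue S \<le> e / 2"
    proof -
      have "c * measure lebesgue S \<le> c * m" using c by (simp add: m_def)
      also have "\<dots> = e / 2" using m by (simp add: c_def)
      finally show ?thesis .
    qed
    obtain n where n: "\<And>i j. i \<ge> n \<Longrightarrow> j \<ge> n \<Longrightarrow> N (\<lambda>x. h i x - h j x) < c * e / 2"
      using CN[of "c * e / 2"] c e by auto
    have "(LINT x|lebesgue. norm (h i x - h j x)) < e" if "i \<ge> n" "j \<ge> n" for i j
    proof -
      have sq: "integrable lebesgue (\<lambda>x. (h i x - h j x)\<^sup>2)"
      proof -
        have "integrable lebesgue (\<lambda>x. h i x * h i x - 2 * (h i x * h j x) + h j x * h j x)"
          using hh[OF h(1)[of i] h(1)[of i]] hh[OF h(1)[of i] h(1)[of j]] hh[OF h(1)[of j] h(1)[of j]] by simp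
        then show ?thesis by (simp add: power2_eq_square algebra_simps)
      qed
      have "(LINT x|lebesgue. norm (h i x - h j x)) \<le> (LINT x|lebesgue. (h i x - h j x)\<^sup>2 / c + c * indicator S x)"
      proof (rule integral_mono)
        show "integrable lebesgue (\<lambda>x. norm (h i x - h j x))" using diffi by (rule integrable_norm)
        show "integrable lebesgue (\<lambda>x. (h i x - h j x)\<^sup>2 / c + c * indicator S x)"
          using sq Si by (intro Bochner_Integration.integrable_add integrable_divide_zero integrable_mult_right) auto
        show "norm (h i x - h j x) \<le> (h i x - h j x)\<^sup>2 / c + c * indicator S x" for x
        proof (cases "x \<in> S")
          case True
          define s where "s = \<bar>h i x - h j x\<bar>"
          have "(s - c)\<^sup>2 \<ge> 0" "c * s \<ge> 0" using c by (auto simp: s_def)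
          moreover have "(s - c)\<^sup>2 = s\<^sup>2 - 2 * (c * s) + c * c"
            by (simp add: power2_eq_square algebra_simps)
          ultimately have "c * s \<le> s\<^sup>2 + c * c" by linarith
          then have "c * \<bar>h i x - h j x\<bar> \<le> (h i x - h j x)\<^sup>2 + c * c" by (simp add: s_def)
          then show ?thesis using c True by (simp add: field_simps power2_eq_square)
        next
          case False
          then have "h i x = 0" "h j x = 0" using hB[OF h(1), of _ x] by (auto simp: I_def)
          then show ?thesis using False by simp
        qed
      qed
      also have "\<dots> = N (\<lambda>x. h i x - h j x) / c + c * measure lebesgue S"
        unfolding N_def using sq Si Ssets by (subst Bochner_Integration.integral_add) auto
      also have "\<dots> < (c * e / 2) / c + e / 2"
        using n[OF that] c cS by (intro add_less_le_mono divide_strict_right_mono) auto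
      also have "\<dots> = e" using c by simp
      finally show ?thesis .
    qed
    then show ?thesis by blast
  qed
  obtain r where r: "strict_mono r" "AE x in lebesgue. Cauchy (\<lambda>i. h (r i) x)"
    using cauchy_L1_AE_cauchy_subseq[of lebesgue h, OF hi[OF h(1)] CL] by metis
  \<comment> \<open>Clipping makes the bound hold at every point, also where the sequence diverges
    and \<open>lim\<close> is an arbitrary number.\<close>
  define g where "g x = max (- I x) (min (I x) (lim (\<lambda>i. h (r i) x)))" for x
  have Im: "I \<in> borel_measurable lebesgue" using Ii by auto
  have gm: "g \<in> borel_measurable lebesgue"
    unfolding g_def using Im hm[OF h(1)]
    by (intro borel_measurable_max borel_measurable_min borel_measurable_uminus borel_measurable_lim_metric) auto
  have I0: "I x \<ge> 0" for x using B by (simp add: I_def)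
  have gB: "\<bar>g x\<bar> \<le> I x" for x using I0[of x] by (auto simp: g_def)
  have lim: "AE x in lebesgue. (\<lambda>i. h (r i) x) \<longlonglongrightarrow> g x"
    using r(2)
  proof eventually_elim
    case (elim x)
    then have *: "(\<lambda>i. h (r i) x) \<longlonglongrightarrow> lim (\<lambda>i. h (r i) x)"
      by (simp add: Cauchy_convergent convergent_LIMSEQ_iff[symmetric])
    have "\<bar>lim (\<lambda>i. h (r i) x)\<bar> \<le> I x"
      by (rule tendsto_upperbound[OF tendsto_rabs[OF *]]) (use hB[OF h(1)] in auto)
    then have "g x = lim (\<lambda>i. h (r i) x)" by (auto simp: g_def abs_if split: if_splits)
    with * show ?case by simp
  qed
  have "(LINT x|lebesgue. g x * \<phi> x) = l"
    if \<phi>: "\<phi> \<in> borel_measurable lebesgue" "\<And>x. \<bar>\<phi> x\<bar> \<le> P"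
      and l: "(\<lambda>k. LINT x|lebesgue. f k x * \<phi> x) \<longlonglongrightarrow> l" for \<phi> P l
  proof -
    have h\<phi>: "integrable lebesgue (\<lambda>x. a x * \<phi> x)" if "?C m a" for m a
      using integrable_bounded_mult[OF hi[OF that] \<phi>] by (simp add: mult.commute)
    have 1: "(\<lambda>i. LINT x|lebesgue. h (r i) x * \<phi> x) \<longlonglongrightarrow> (LINT x|lebesgue. g x * \<phi> x)"
    proof (rule integral_dominated_convergence[where w = "\<lambda>x. I x * P"])
      show "integrable lebesgue (\<lambda>x. I x * P)" using Ii by (rule integrable_mult_left)
      show "AE x in lebesgue. (\<lambda>i. h (r i) x * \<phi> x) \<longlonglongrightarrow> g x * \<phi> x"
        using lim by eventually_elim (intro tendsto_mult tendsto_const)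
      show "AE x in lebesgue. norm (h (r i) x * \<phi> x) \<le> I x * P" for i
        unfolding norm_mult using hB[OF h(1)] \<phi>(2) I0 by (intro AE_I2 mult_mono) auto
    qed (use gm hm[OF h(1)] \<phi>(1) in \<open>auto intro!: borel_measurable_times\<close>)
    have 2: "(\<lambda>i. LINT x|lebesgue. h (r i) x * \<phi> x) \<longlonglongrightarrow> l"
    proof (rule LIMSEQ_I)
      fix e :: real assume "e > 0"
      then obtain m where m: "\<And>k. k \<ge> m \<Longrightarrow> \<bar>(LINT x|lebesgue. f k x * \<phi> x) - l\<bar> < e / 2"
        using LIMSEQ_D[OF l, of "e / 2"] by auto
      have "norm ((LINT x|lebesgue. h (r i) x * \<phi> x) - l) < e" if "i \<ge> m" for i
      proof -
        have "?C m (h (r i))"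
          using h(1)[of "r i"] seq_suble[OF r(1), of i] that tail_hull_mono by (meson order_trans)
        then have "\<bar>(LINT x|lebesgue. h (r i) x * \<phi> x) - l\<bar> \<le> e / 2"
          by (rule tail_hull_integral) (use h\<phi> m less_imp_le in blast)+
        then show ?thesis using \<open>e > 0\<close> by simp
      qed
      then show "\<exists>no. \<forall>n\<ge>no. norm ((LINT x|lebesgue. h (r n) x * \<phi> x) - l) < e" by blast
    qed
    show ?thesis by (rule LIMSEQ_unique[OF 1 2])
  qed
  note lim' = this
  have gB': "\<bar>g x\<bar> \<le> B * indicator S x" for x using gB by (simp add: I_def)
  show ?thesis
    by (intro bexI[OF _ gm] conjI allI impI gB') (rule lim', auto)
qed

section \<open>Extension of Lipschitz functions\<close>

lemma McShane_extension:
  fixes u :: "'a::metric_space \<Rightarrow> real"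
  assumes S: "S \<noteq> {}" and L: "L \<ge> 0" and u: "\<And>x y. x \<in> S \<Longrightarrow> y \<in> S \<Longrightarrow> \<bar>u x - u y\<bar> \<le> L * dist x y"
  obtains w where "\<And>x y. \<bar>w x - w y\<bar> \<le> L * dist x y" "\<And>x. x \<in> S \<Longrightarrow> w x = u x"
proof -
  define w where "w x = (INF z\<in>S. u z + L * dist x z)" for x
  obtain s where s: "s \<in> S" using S by blast
  have bb: "bdd_below ((\<lambda>z. u z + L * dist x z) ` S)" for x
  proof (rule bdd_belowI)
    fix y assume "y \<in> (\<lambda>z. u z + L * dist x z) ` S"
    then obtain z where z: "z \<in> S" "y = u z + L * dist x z" by blast
    have "L * dist s z \<le> L * (dist x s + dist x z)"
      using L dist_triangle[of s z x] by (intro mult_left_mono) (auto simp: dist_commute)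
    then show "u s - L * dist x s \<le> y" using u[OF s z(1)] z(2) by (simp add: distrib_left abs_if split: if_splits)
  qed
  have le: "w x \<le> w y + L * dist x y" for x y
  proof -
    have "w x - L * dist x y \<le> u z + L * dist y z" if "z \<in> S" for z
    proof -
      have "w x \<le> u z + L * dist x z" unfolding w_def by (rule cINF_lower[OF bb that])
      also have "\<dots> \<le> u z + L * (dist x y + dist y z)"
        using L by (intro add_left_mono mult_left_mono dist_triangle)
      finally show ?thesis by (simp add: distrib_left)
    qed
    then have "w x - L * dist x y \<le> w y" unfolding w_def[of y] using S by (intro cINF_greatest)
    then show ?thesis by simp
  qed
  have "\<bar>w x - w y\<bar> \<le> L * dist x y" for x y
    using le[of x y] le[of y x] by (simp add: dist_commute abs_if)
  moreover have "w x = u x" if "x \<in> S" for x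
  proof (rule antisym)
    show "w x \<le> u x" unfolding w_def using cINF_lower[OF bb that, of x] by simp
    show "u x \<le> w x" unfolding w_def
    proof (rule cINF_greatest[OF S])
      show "u x \<le> u z + L * dist x z" if "z \<in> S" for z
        using u[OF \<open>x \<in> S\<close> that] by (simp add: abs_if split: if_splits)
    qed
  qed
  ultimately show ?thesis using that by blast
qed

text \<open>The Lipschitz extension \<open>v\<close> is clipped to the interval from
  \<open>- h x\<close> to \<open>h x\<close>, where \<open>h\<close> has slope \<open>L\<close>,
  equals the bound \<open>M\<close> of \<open>\<bar>u\<bar>\<close> on \<open>S\<close> and is
  negative far away. Clipping by functions with the same Lipschitz constant preserves it, and
  nothing changes on \<open>S\<close>.\<close>

lemma Lipschitz_compactly_supported_extension:
  fixes u :: "real^'n \<Rightarrow> real"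
  assumes S: "S \<noteq> {}" "bounded S" and u: "\<And>x y. x \<in> S \<Longrightarrow> y \<in> S \<Longrightarrow> \<bar>u x - u y\<bar> \<le> L0 * norm (x - y)"
  obtains w L where "\<And>x y. \<bar>w x - w y\<bar> \<le> L * norm (x - y)" "\<And>x. x \<in> S \<Longrightarrow> w x = u x"
    "integrable lebesgue w" "L \<ge> 0"
proof -
  \<comment> \<open>Strictly positive, so that the radius \<open>M / L\<close> beyond which
    \<open>w\<close> vanishes makes sense.\<close>
  define L where "L = \<bar>L0\<bar> + 1"
  have L: "L > 0" by (simp add: L_def)
  have uL: "\<bar>u x - u y\<bar> \<le> L * dist x y" if "x \<in> S" "y \<in> S" for x y
  proof -
    have "L0 * norm (x - y) \<le> L * norm (x - y)" by (rule mult_right_mono) (auto simp: L_def)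
    then show ?thesis using u[OF that] by (simp add: dist_norm)
  qed
  obtain v where v: "\<And>x y. \<bar>v x - v y\<bar> \<le> L * dist x y" "\<And>x. x \<in> S \<Longrightarrow> v x = u x"
    using McShane_extension[OF S(1) less_imp_le[OF L] uL] by metis
  obtain s R where s: "s \<in> S" and R: "\<And>x. x \<in> S \<Longrightarrow> dist s x \<le> R"
    using S unfolding bounded_any_center[of S "SOME s. s \<in> S"] by (metis ex_in_conv someI)
  define M where "M = \<bar>u s\<bar> + L * R"
  have uM: "\<bar>u x\<bar> \<le> M" if "x \<in> S" for x
    using uL[OF that s] R[OF that] mult_left_mono[OF R[OF that] less_imp_le[OF L]]
    by (simp add: M_def dist_commute abs_if split: if_splits)
  define h where "h x = M - L * infdist x S" for x
  define w where "w x = (if h x \<le> 0 then 0 else max (- h x) (min (h x) (v x)))" for x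
  have hL: "\<bar>h x - h y\<bar> \<le> L * dist x y" for x y
  proof -
    have "\<bar>infdist y S - infdist x S\<bar> \<le> dist x y" by (metis abs_minus_commute infdist_triangle_abs)
    then have "L * \<bar>infdist y S - infdist x S\<bar> \<le> L * dist x y" using L by simp
    moreover have "\<bar>h x - h y\<bar> = L * \<bar>infdist y S - infdist x S\<bar>"
      using L by (simp add: h_def abs_mult flip: right_diff_distrib)
    ultimately show ?thesis by simp
  qed
  have wL: "\<bar>w x - w y\<bar> \<le> L * norm (x - y)" for x y
    using hL[of x y] v(1)[of x y] by (auto simp: w_def dist_norm max_def min_def abs_if split: if_splits)
  have wS: "w x = u x" if "x \<in> S" for x
    using uM[OF that] v(2)[OF that] that by (auto simp: w_def h_def abs_if split: if_splits)
  have wM: "\<bar>w x\<bar> \<le> \<bar>M\<bar>" for x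
    using mult_nonneg_nonneg[OF less_imp_le[OF L] infdist_nonneg[of x S]] by (auto simp: w_def h_def)
  have cl: "compact (closure S)" using S(2) by (simp add: compact_closure)
  have "integrable lebesgue w"
  proof (rule integrable_bounded_support[OF _ _ _ wM])
    have "continuous_on UNIV w"
      by (rule lipschitz_on_continuous_on[of L], rule lipschitz_onI) (use wL L in \<open>auto simp: dist_norm\<close>)
    then show "w \<in> borel_measurable lebesgue" by (rule continuous_lebesgue_measurable)
    show "bounded {x. infdist x (closure S) \<le> M / L}"
      by (rule infdist_neighbourhood_bounded[OF cl]) (use S in auto)
    show "w x = 0" if "x \<notin> {x. infdist x (closure S) \<le> M / L}" for x
      using that L S(1) by (auto simp: w_def h_def infdist_eq_setdist field_simps)
  qed
  then show ?thesis using that[of w L] wL wS L by auto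
qed

text \<open>No differentiability at points is used. The mollifications of a global extension have
  gradients bounded by the Lipschitz constant, and a weak limit of each component, which keeps the
  bound, is tested against the same functions as the derivative. Bounding the components one by one
  costs the factor \<open>CARD('n)\<close>.\<close>

theorem Lipschitz_has_weak_gradient:
  fixes u :: "real^'n \<Rightarrow> real"
  assumes O: "open \<Omega>" "bounded \<Omega>" "\<Omega> \<noteq> {}"
    and u: "\<And>x y. x \<in> \<Omega> \<Longrightarrow> y \<in> \<Omega> \<Longrightarrow> \<bar>u x - u y\<bar> \<le> L0 * norm (x - y)"
  obtains g B where "g \<in> borel_measurable lebesgue" "\<And>x. norm (g x) \<le> B" "has_weak_gradient \<Omega> u g"
proof -
  obtain w L where w: "\<And>x y. \<bar>w x - w y\<bar> \<le> L * norm (x - y)" "\<And>x. x \<in> \<Omega> \<Longrightarrow> w x = u x"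
    "integrable lebesgue w" and L: "L \<ge> 0"
    using Lipschitz_compactly_supported_extension[OF O(3,2) u] by metis
  have Om: "\<Omega> \<in> lmeasurable" using O lmeasurable_open by blast
  have ws: "smooth_on UNIV (mollify k w)" for k
    unfolding mollify_def by (rule smooth_on_conv[OF mollify_test w(3)])
  have gB: "norm (grad (mollify k w) x) \<le> L" for k x
    unfolding mollify_def by (rule conv_mollifier_grad_bound[OF _ w(3,1)]) simp
  have "\<exists>g. g \<in> borel_measurable lebesgue \<and> (\<forall>x. \<bar>g x\<bar> \<le> L * indicator \<Omega> x) \<and>
      (\<forall>\<phi>\<in>test_functions \<Omega>. (LINT x|lebesgue. g x * \<phi> x) = - (LINT x|lebesgue. w x * grad \<phi> x $ i))" for i
  proof -
    let ?f = "\<lambda>k x. indicator \<Omega> x * grad (mollify k w) x $ i"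
    have m: "?f k \<in> borel_measurable lebesgue" for k
    proof (rule borel_measurable_times)
      show "(indicator \<Omega> :: _ \<Rightarrow> real) \<in> borel_measurable lebesgue"
        using Om by (intro borel_measurable_indicator) (auto simp: fmeasurable_def)
      show "(\<lambda>x. grad (mollify k w) x $ i) \<in> borel_measurable lebesgue"
        by (rule continuous_lebesgue_measurable[OF smooth_on_continuous[OF smooth_on_grad[OF ws]]])
    qed
    have b: "\<bar>?f k x\<bar> \<le> L * indicator \<Omega> x" for k x
      using order_trans[OF component_le_norm_cart[of "grad (mollify k w) x" i] gB]
      by (auto simp: indicator_def)
    obtain g where g: "g \<in> borel_measurable lebesgue" "\<forall>x. \<bar>g x\<bar> \<le> L * indicator \<Omega> x"
      "\<forall>\<phi> P l. \<phi> \<in> borel_measurable lebesgue \<longrightarrow> (\<forall>x. \<bar>\<phi> x\<bar> \<le> P) \<longrightarrow>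
         (\<lambda>k. LINT x|lebesgue. ?f k x * \<phi> x) \<longlonglongrightarrow> l \<longrightarrow> (LINT x|lebesgue. g x * \<phi> x) = l"
      using bounded_sequence_weak_limit[where f = ?f, OF Om L m b] by (elim bexE conjE) (rule that)
    have "(LINT x|lebesgue. g x * \<phi> x) = - (LINT x|lebesgue. w x * grad \<phi> x $ i)" if \<phi>: "\<phi> \<in> test_functions \<Omega>" for \<phi>
    proof -
      obtain P where P: "\<And>x. \<bar>\<phi> x\<bar> \<le> P" using test_functions_bounded[OF \<phi>] by metis
      obtain Q where Q: "\<And>x. \<bar>grad \<phi> x $ i\<bar> \<le> Q"
        using test_functions_bounded[OF test_functions_grad[OF \<phi>, of i]] by metis
      note d\<phi>m = test_measurable[OF test_functions_grad[OF \<phi>, of i]]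
      have \<phi>0: "\<phi> x = 0" if "x \<notin> \<Omega>" for x
        using test_functions_outside(1)[OF \<phi> that] .
      have f\<phi>: "(\<lambda>x. ?f k x * \<phi> x) = (\<lambda>x. grad (mollify k w) x $ i * \<phi> x)" for k
      proof
        show "?f k x * \<phi> x = grad (mollify k w) x $ i * \<phi> x" for x
          using \<phi>0[of x] by (cases "x \<in> \<Omega>") auto
      qed
      have eq: "(LINT x|lebesgue. ?f k x * \<phi> x) = - (LINT x|lebesgue. mollify k w x * grad \<phi> x $ i)" for k
        using has_weak_gradientD(3)[OF has_weak_gradient_smooth[OF open_UNIV ws] test_functions_mono[OF subset_UNIV \<phi>], of k i]
        unfolding f\<phi> by simp
      have wi: "integrable lebesgue (\<lambda>x. w x * grad \<phi> x $ i)"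
        using integrable_bounded_mult[OF w(3) d\<phi>m Q] by (simp add: mult.commute)
      have di: "integrable lebesgue (\<lambda>x. mollify k w x - w x)" for k
        using mollify_L1(1)[OF w(3)] w(3) by (rule Bochner_Integration.integrable_diff)
      have "(\<lambda>k. LINT x|lebesgue. grad \<phi> x $ i * (mollify k w x - w x)) \<longlonglongrightarrow> 0"
        by (rule tendsto_integral_bounded_mult[OF di mollify_L1(2)[OF w(3)] d\<phi>m Q])
      then have "(\<lambda>k. - ((LINT x|lebesgue. grad \<phi> x $ i * (mollify k w x - w x)) + (LINT x|lebesgue. w x * grad \<phi> x $ i)))
          \<longlonglongrightarrow> - (0 + (LINT x|lebesgue. w x * grad \<phi> x $ i))"
        by (intro tendsto_intros)
      moreover have "(LINT x|lebesgue. mollify k w x * grad \<phi> x $ i) =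
          (LINT x|lebesgue. grad \<phi> x $ i * (mollify k w x - w x)) + (LINT x|lebesgue. w x * grad \<phi> x $ i)" for k
        using integrable_bounded_mult[OF di[of k] d\<phi>m Q] wi
        by (subst Bochner_Integration.integral_add[symmetric]) (auto simp: algebra_simps)
      ultimately have "(\<lambda>k. LINT x|lebesgue. ?f k x * \<phi> x) \<longlonglongrightarrow> - (LINT x|lebesgue. w x * grad \<phi> x $ i)"
        unfolding eq by simp
      then show ?thesis using g(3)[rule_format, OF test_measurable[OF \<phi>] P] by blast
    qed
    then show ?thesis using g(1,2) by blast
  qed
  then have "\<exists>G. \<forall>i. G i \<in> borel_measurable lebesgue \<and> (\<forall>x. \<bar>G i x\<bar> \<le> L * indicator \<Omega> x) \<and>
      (\<forall>\<phi>\<in>test_functions \<Omega>. (LINT x|lebesgue. G i x * \<phi> x) = - (LINT x|lebesgue. w x * grad \<phi> x $ i))"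
    by (intro choice allI)
  then obtain G where "\<forall>i. G i \<in> borel_measurable lebesgue \<and> (\<forall>x. \<bar>G i x\<bar> \<le> L * indicator \<Omega> x) \<and>
      (\<forall>\<phi>\<in>test_functions \<Omega>. (LINT x|lebesgue. G i x * \<phi> x) = - (LINT x|lebesgue. w x * grad \<phi> x $ i))" ..
  then have G: "\<And>i. G i \<in> borel_measurable lebesgue" "\<And>i x. \<bar>G i x\<bar> \<le> L * indicator \<Omega> x"
    "\<And>i \<phi>. \<phi> \<in> test_functions \<Omega> \<Longrightarrow> (LINT x|lebesgue. G i x * \<phi> x) = - (LINT x|lebesgue. w x * grad \<phi> x $ i)"
    by blast+
  define g where "g x = (\<Sum>i\<in>UNIV. G i x *\<^sub>R axis i 1 :: real^'n)" for x
  have gi: "g x $ i = G i x" for x i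
    by (simp add: g_def axis_def if_distrib cong: if_cong)
  have gm: "g \<in> borel_measurable lebesgue"
    unfolding g_def by (intro borel_measurable_sum borel_measurable_scaleR G borel_measurable_const)
  have gn: "norm (g x) \<le> real CARD('n) * L" for x
  proof -
    have "\<bar>G i x\<bar> \<le> L" for i using G(2)[of i x] L by (cases "x \<in> \<Omega>") auto
    then have "(\<Sum>i\<in>UNIV. \<bar>g x $ i\<bar>) \<le> (\<Sum>i\<in>(UNIV::'n set). L)"
      unfolding gi by (intro sum_mono)
    then show ?thesis using norm_le_l1_cart[of "g x"] by simp
  qed
  have "integrable lebesgue g"
  proof -
    have "integrable lebesgue (G i)" for i
    proof (rule Bochner_Integration.integrable_bound[OF _ G(1)])
      show "integrable lebesgue (\<lambda>x. L * indicator \<Omega> x)"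
        using Om by (intro integrable_mult_right integrable_real_indicator) (auto simp: fmeasurable_def)
      show "AE x in lebesgue. norm (G i x) \<le> norm (L * indicator \<Omega> x)"
        using G(2) by (intro AE_I2) (auto intro: order_trans[OF _ abs_ge_self])
    qed
    then show ?thesis unfolding g_def by (intro Bochner_Integration.integrable_sum integrable_scaleR_left) auto
  qed
  then have "set_integrable lebesgue UNIV g" by (simp add: set_integrable_def)
  then have lg: "locally_integrable \<Omega> g"
    using locally_integrable_mono[OF set_integrable_locally_integrable subset_UNIV] by blast
  have "set_integrable lebesgue UNIV w" using w(3) by (simp add: set_integrable_def)
  then have lw: "locally_integrable \<Omega> w"
    using locally_integrable_mono[OF set_integrable_locally_integrable subset_UNIV] by blast
  have "has_weak_gradient \<Omega> w g"
    unfolding has_weak_gradient_iff gi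
  proof (intro conjI ballI allI lg lw)
    show "(LINT x|lebesgue. w x * grad \<phi> x $ i) = - (LINT x|lebesgue. G i x * \<phi> x)"
      if "\<phi> \<in> test_functions \<Omega>" for \<phi> i
      unfolding G(3)[OF that] by simp
  qed
  then have "has_weak_gradient \<Omega> u g"
    by (rule has_weak_gradient_cong_AE) (simp_all add: w(2))
  then show ?thesis using that gm gn by blast
qed

subsection \<open>Sets of box dimension less than n - 2 have zero capacity\<close>

text \<open>The constant is not sharp: a set of diameter d lies in a ball of radius d, so the
  isodiametric inequality is not needed.\<close>

lemma lebesgue_le_hausdorff_measure:
  fixes X :: "(real^'n) set"
  assumes "X \<in> sets lebesgue"
  shows "ennreal (1 / 2 ^ CARD('n)) * emeasure lebesgue X \<le> hausdorff_measure CARD('n) X"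
proof -
  let ?n = "CARD('n)"
  have "ennreal (1 / 2 ^ ?n) * emeasure lebesgue X
      \<le> (\<Sum>i. ennreal (unit_ball_vol (real ?n) * (diameter (U i) / 2) ^ ?n))"
    if U: "X \<subseteq> (\<Union>i. U i)" "\<And>i. bounded (U i)" for U :: "nat \<Rightarrow> (real^'n) set"
  proof -
    have "\<exists>B. B \<in> sets lebesgue \<and> U i \<subseteq> B \<and>
        emeasure lebesgue B \<le> ennreal (2 ^ ?n * (unit_ball_vol (real ?n) * (diameter (U i) / 2) ^ ?n))" for i
    proof (cases "U i = {}")
      case True
      then show ?thesis by (intro exI[of _ "{}"]) auto
    next
      case False
      then obtain c where c: "c \<in> U i" by blast
      have "U i \<subseteq> cball c (diameter (U i))"
        using diameter_bounded_bound[OF U(2) c] by auto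
      moreover have "emeasure lebesgue (cball c (diameter (U i))) =
          ennreal (2 ^ ?n * (unit_ball_vol (real ?n) * (diameter (U i) / 2) ^ ?n))"
        using emeasure_cball[OF diameter_ge_0[OF U(2)[of i]], of c] by (simp add: power_divide)
      ultimately show ?thesis
        by (intro exI[of _ "cball c (diameter (U i))"] conjI) (simp_all only: order_refl, simp)
    qed
    then have "\<exists>B. \<forall>i. B i \<in> sets lebesgue \<and> U i \<subseteq> B i \<and>
        emeasure lebesgue (B i) \<le> ennreal (2 ^ ?n * (unit_ball_vol (real ?n) * (diameter (U i) / 2) ^ ?n))"
      by (intro choice allI)
    then obtain B where B: "\<And>i. B i \<in> sets lebesgue" "\<And>i. U i \<subseteq> B i"
      "\<And>i. emeasure lebesgue (B i) \<le> ennreal (2 ^ ?n * (unit_ball_vol (real ?n) * (diameter (U i) / 2) ^ ?n))"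
      by blast
    have "emeasure lebesgue X \<le> emeasure lebesgue (\<Union>i. B i)"
      using U(1) B(1,2) by (intro emeasure_mono) (blast, auto)
    also have "\<dots> \<le> (\<Sum>i. emeasure lebesgue (B i))"
      using B(1) by (intro emeasure_subadditive_countably) auto
    also have "\<dots> \<le> (\<Sum>i. ennreal (2 ^ ?n * (unit_ball_vol (real ?n) * (diameter (U i) / 2) ^ ?n)))"
      by (intro suminf_le B(3)) auto
    also have "\<dots> = (\<Sum>i. ennreal (2 ^ ?n) * ennreal (unit_ball_vol (real ?n) * (diameter (U i) / 2) ^ ?n))"
      by (intro arg_cong[of _ _ suminf] ext ennreal_mult) (auto intro!: mult_nonneg_nonneg zero_le_power diameter_ge_0 U(2))
    also have "\<dots> = ennreal (2 ^ ?n) * (\<Sum>i. ennreal (unit_ball_vol (real ?n) * (diameter (U i) / 2) ^ ?n))"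
      by simp
    finally have "ennreal (1 / 2 ^ ?n) * emeasure lebesgue X
        \<le> ennreal (1 / 2 ^ ?n) * (ennreal (2 ^ ?n) * (\<Sum>i. ennreal (unit_ball_vol (real ?n) * (diameter (U i) / 2) ^ ?n)))"
      by (intro mult_left_mono) auto
    also have "\<dots> = (\<Sum>i. ennreal (unit_ball_vol (real ?n) * (diameter (U i) / 2) ^ ?n))"
      by (simp add: mult.assoc[symmetric] ennreal_mult[symmetric] del: ennreal_power)
    finally show ?thesis .
  qed
  then have "ennreal (1 / 2 ^ ?n) * emeasure lebesgue X \<le> hausdorff_content ?n 1 X"
    unfolding hausdorff_content_def by (intro INF_greatest) blast
  also have "\<dots> \<le> hausdorff_measure ?n X"
    unfolding hausdorff_measure_def by (intro SUP_upper) simp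
  finally show ?thesis .
qed

lemma open_infdist_less: "open \<Omega> \<Longrightarrow> open {x\<in>\<Omega>. infdist x K < r}"
proof -
  assume "open \<Omega>"
  moreover have "open {x. infdist x K < r}" by (intro open_Collect_less continuous_intros)
  ultimately have "open (\<Omega> \<inter> {x. infdist x K < r})" by (rule open_Int)
  then show ?thesis by (simp add: Int_def)
qed

text \<open>The exponent \<open>a\<close> is the midpoint of 2 and \<open>n - d\<close>. For small
  \<open>r\<close> the quotient of logarithms exceeds \<open>a\<close>, and as \<open>ln r\<close>
  is negative this says that the measure is at most \<open>r powr a\<close>; passing from Hausdorff
  to Lebesgue measure costs \<open>2 ^ n\<close>.\<close>

lemma box_dim_measure_bound:
  fixes \<Omega> K :: "(real^'n) set"
  assumes \<Omega>: "open \<Omega>" and d: "has_box_dim \<Omega> K d" "d < real CARD('n) - 2"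
  shows "\<exists>a r0. a > 2 \<and> r0 > 0 \<and>
    (\<forall>r. 0 < r \<longrightarrow> r < r0 \<longrightarrow> emeasure lebesgue {x\<in>\<Omega>. infdist x K < r} \<le> ennreal (2 ^ CARD('n) * r powr a))"
proof -
  let ?n = "CARD('n)"
  define M where "M r = enn2real (hausdorff_measure ?n {x\<in>\<Omega>. infdist x K < r})" for r
  define a where "a = (2 + (real ?n - d)) / 2"
  have a: "a > 2" "a < real ?n - d" using d(2) by (auto simp: a_def field_simps)
  have "\<forall>\<^sub>F r in at_right 0. a < ln (M r) / ln r"
    using order_tendstoD(1)[OF d(1)[unfolded has_box_dim_def] a(2)] by (simp add: M_def)
  then obtain b where b: "b > 0" "\<And>r. 0 < r \<Longrightarrow> r < b \<Longrightarrow> a < ln (M r) / ln r"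
    unfolding eventually_at_right_field by auto
  have "emeasure lebesgue {x\<in>\<Omega>. infdist x K < r} \<le> ennreal (2 ^ ?n * r powr a)"
    if r: "0 < r" "r < min b 1" for r
  proof -
    let ?X = "{x\<in>\<Omega>. infdist x K < r}"
    have "a < ln (M r) / ln r" using b(2) r by simp
    moreover have lr: "ln r < 0" using r by simp
    ultimately have lM: "ln (M r) < a * ln r" by (simp add: less_divide_eq)
    \<comment> \<open>If \<open>M r\<close> were 0, in particular as the value of
      \<open>enn2real\<close> at infinity, then \<open>ln (M r) = 0\<close> and the quotient could
      not exceed \<open>a\<close>. So the Hausdorff measure is finite and positive.\<close>
    have "M r \<noteq> 0" using \<open>a < ln (M r) / ln r\<close> a(1) by auto
    then have M0: "M r > 0" by (simp add: M_def less_le)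
    have "M r \<le> r powr a"
    proof -
      have "exp (ln (M r)) \<le> exp (a * ln r)" using lM by simp
      then show ?thesis using M0 r by (simp add: powr_def)
    qed
    have fin: "hausdorff_measure ?n ?X = ennreal (M r)"
    proof -
      have "hausdorff_measure ?n ?X \<noteq> top" using M0 by (auto simp: M_def)
      then show ?thesis by (simp add: M_def ennreal_enn2real_if)
    qed
    have "?X \<in> sets lebesgue" using open_infdist_less[OF \<Omega>] by auto
    then have le: "ennreal (1 / 2 ^ ?n) * emeasure lebesgue ?X \<le> ennreal (r powr a)"
      using order_trans[OF lebesgue_le_hausdorff_measure[of ?X, unfolded fin] ennreal_leI[OF \<open>M r \<le> r powr a\<close>]]
      by blast
    have one: "ennreal (2 ^ ?n) * ennreal (1 / 2 ^ ?n) = 1"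
      by (subst ennreal_mult[symmetric]) simp_all
    have "emeasure lebesgue ?X = ennreal (2 ^ ?n) * ennreal (1 / 2 ^ ?n) * emeasure lebesgue ?X"
      by (simp only: one mult_1)
    also have "\<dots> = ennreal (2 ^ ?n) * (ennreal (1 / 2 ^ ?n) * emeasure lebesgue ?X)"
      by (rule mult.assoc)
    also have "\<dots> \<le> ennreal (2 ^ ?n) * ennreal (r powr a)"
      by (intro mult_left_mono le) simp
    also have "\<dots> = ennreal (2 ^ ?n * r powr a)"
      by (rule ennreal_mult[symmetric]) simp_all
    finally show ?thesis .
  qed
  note bd = this
  have "min b 1 > 0" using b(1) by simp
  with a(1) bd show ?thesis by (intro exI conjI allI impI)
qed

text \<open>The two tolerances are independent: \<open>\<rho>\<close> forces pointwise convergence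
  to 1 off \<open>K\<close>, and \<open>\<delta>\<close> controls the energy. The radius
  \<open>r\<close> and the bound \<open>B\<close> may depend on both; they make the truncated
  products admissible, and no estimate relies on their size.\<close>

definition zero_capacity :: "(real^'n) set \<Rightarrow> (real^'n) set \<Rightarrow> bool" where
  "zero_capacity \<Omega> K \<longleftrightarrow> (\<forall>\<delta>>0. \<forall>\<rho>>0. \<exists>\<phi> r B. r > 0 \<and> smooth_on UNIV \<phi> \<and>
     (\<forall>x. 0 \<le> \<phi> x \<and> \<phi> x \<le> 1 \<and> norm (grad \<phi> x) \<le> B) \<and>
     (\<forall>x. infdist x K < r \<longrightarrow> \<phi> x = 0) \<and> (\<forall>x. infdist x K \<ge> \<rho> \<longrightarrow> \<phi> x = 1) \<and>
     (LINT x|lebesgue. indicator \<Omega> x * (norm (grad \<phi> x))\<^sup>2) \<le> \<delta>)"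

text \<open>A cutoff at scale \<open>r\<close> has a gradient of size \<open>1 / r\<close> that
  lives within \<open>5 * r\<close> of \<open>K\<close>, where the measure is of order
  \<open>r powr a\<close>. Its energy is of order \<open>r powr (a - 2)\<close>, which tends to 0
  because \<open>a > 2\<close>.\<close>

lemma box_dim_zero_capacity:
  fixes \<Omega> K :: "(real^'n) set"
  assumes \<Omega>: "open \<Omega>" "\<Omega> \<noteq> {}" and K: "compact K" "K \<subseteq> \<Omega>"
    and d: "has_box_dim \<Omega> K d" "d < real CARD('n) - 2"
  shows "K \<noteq> {}" "K \<in> null_sets lebesgue" "zero_capacity \<Omega> K"
proof -
  let ?n = "CARD('n)"
  obtain a r0 where a: "a > 2" "r0 > 0"
    and bd: "\<And>r. 0 < r \<Longrightarrow> r < r0 \<Longrightarrow> emeasure lebesgue {x\<in>\<Omega>. infdist x K < r} \<le> ennreal (2 ^ ?n * r powr a)"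
    using box_dim_measure_bound[OF \<Omega>(1) d] by blast
  have lim: "((\<lambda>r. ennreal (2 ^ ?n * r powr a)) \<longlongrightarrow> 0) (at_right 0)"
  proof -
    have "((\<lambda>r. 2 ^ ?n * r powr a) \<longlongrightarrow> 2 ^ ?n * 0) (at_right 0)"
      by (intro tendsto_intros) (use a(1) in real_asymp)
    then show ?thesis using tendsto_ennrealI by fastforce
  qed
  have null: "emeasure lebesgue X = 0" if X: "\<And>r. r > 0 \<Longrightarrow> X \<subseteq> {x\<in>\<Omega>. infdist x K < r}" for X
  proof -
    have "\<forall>\<^sub>F r in at_right 0. emeasure lebesgue X \<le> ennreal (2 ^ ?n * r powr a)"
      unfolding eventually_at_right_field
    proof (intro exI[of _ r0] conjI allI impI)
      fix r :: real assume "0 < r" "r < r0"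
      have "{x\<in>\<Omega>. infdist x K < r} \<in> sets lebesgue" using open_infdist_less[OF \<Omega>(1)] by auto
      then have "emeasure lebesgue X \<le> emeasure lebesgue {x\<in>\<Omega>. infdist x K < r}"
        by (rule emeasure_mono[OF X[OF \<open>0 < r\<close>]])
      also note bd[OF \<open>0 < r\<close> \<open>r < r0\<close>]
      finally show "emeasure lebesgue X \<le> ennreal (2 ^ ?n * r powr a)" .
    qed (use a in simp)
    then have "emeasure lebesgue X \<le> 0"
      by (intro tendsto_lowerbound[OF lim]) auto
    then show ?thesis by simp
  qed
  \<comment> \<open>\<open>infdist\<close> to the empty set is 0, so an empty \<open>K\<close> would
    have \<open>\<Omega>\<close> as each of its neighbourhoods, and the measure of
    \<open>\<Omega>\<close> does not tend to 0.\<close>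
  show ne: "K \<noteq> {}"
  proof
    assume "K = {}"
    then have "emeasure lebesgue \<Omega> = 0" by (intro null) (simp add: infdist_def)
    then have "negligible \<Omega>" using \<Omega>(1) by (simp add: negligible_iff_null_sets null_sets_def)
    then show False using open_not_negligible[OF \<Omega>] by blast
  qed
  have "emeasure lebesgue K = 0" by (rule null) (use K in auto)
  moreover have "K \<in> sets lebesgue" using lmeasurable_compact[OF K(1)] by (rule fmeasurableD)
  ultimately show "K \<in> null_sets lebesgue" by blast
  show "zero_capacity \<Omega> K" unfolding zero_capacity_def
  proof (intro allI impI)
    fix \<delta> \<rho> :: real assume \<delta>: "\<delta> > 0" and \<rho>: "\<rho> > 0"
    have "((\<lambda>r. 2 ^ ?n * (5 * r) powr a / r\<^sup>2) \<longlongrightarrow> 0) (at_right 0)"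
    proof -
      have "((\<lambda>r::real. (5 * r) powr a / r\<^sup>2) \<longlongrightarrow> 0) (at_right 0)" using a(1) by real_asymp
      from tendsto_mult_right_zero[OF this, of "2 ^ ?n"] show ?thesis by simp
    qed
    then have "\<forall>\<^sub>F r in at_right 0. 2 ^ ?n * (5 * r) powr a / r\<^sup>2 < \<delta>"
      using order_tendstoD(2)[OF _ \<delta>] by fast
    then obtain b where b: "b > 0" "\<And>r. 0 < r \<Longrightarrow> r < b \<Longrightarrow> 2 ^ ?n * (5 * r) powr a / r\<^sup>2 < \<delta>"
      unfolding eventually_at_right_field by auto
    define r where "r = min (b / 2) (min (r0 / 10) (\<rho> / 5))"
    have r: "0 < r" "r < b" "5 * r < r0" "4 * r \<le> \<rho>" using b(1) a(2) \<rho> by (auto simp: r_def)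
    \<comment> \<open>The profile is 1 within \<open>2 * r\<close> and 0 from \<open>3 * r\<close>
      on. Mollification at radius \<open>r\<close> moves both thresholds outwards by
      \<open>r\<close> at most: the result is 1 within \<open>r\<close> and 0 from
      \<open>4 * r\<close> on, and its gradient vanishes beyond \<open>4 * r\<close>.\<close>
    define g where "g x = max 0 (min 1 (3 - infdist x K / r))" for x
    have gL: "\<bar>g x - g y\<bar> \<le> 1 / r * norm (x - y)" for x y
    proof -
      have "\<bar>infdist x K - infdist y K\<bar> \<le> norm (x - y)" by (metis dist_norm infdist_triangle_abs)
      then have "\<bar>infdist x K / r - infdist y K / r\<bar> \<le> norm (x - y) / r"
        using r(1) by (simp add: diff_divide_distrib[symmetric] abs_divide divide_right_mono)
      then show ?thesis by (auto simp: g_def max_def min_def abs_if split: if_splits)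
    qed
    have gi: "integrable lebesgue g"
    proof (rule integrable_bounded_support[where B = 1])
      have "continuous_on UNIV g" unfolding g_def by (intro continuous_intros) (use r in auto)
      then show "g \<in> borel_measurable lebesgue" by (rule continuous_lebesgue_measurable)
      show "bounded {x. infdist x K \<le> 3 * r}" by (rule infdist_neighbourhood_bounded[OF K(1) ne])
      show "g x = 0" if "x \<notin> {x. infdist x K \<le> 3 * r}" for x
        using that r(1) by (auto simp: g_def field_simps)
    qed (auto simp: g_def)
    define \<psi> where "\<psi> = conv (mollifier r) g"
    have \<psi>s: "smooth_on UNIV \<psi>"
      unfolding \<psi>_def by (rule smooth_on_conv[OF mollifier_test[OF r(1)] gi])
    have \<psi>0: "\<psi> x \<ge> 0" for x unfolding \<psi>_def by (rule conv_mollifier_nonneg) (simp add: g_def)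
    have \<psi>1: "\<bar>\<psi> x\<bar> \<le> 1" for x unfolding \<psi>_def by (rule conv_mollifier_bound[OF r(1) gi]) (simp add: g_def)
    have \<psi>g: "norm (grad \<psi> x) \<le> 1 / r" for x
      unfolding \<psi>_def by (rule conv_mollifier_grad_bound[OF r(1) gi gL])
    have near: "infdist y K < infdist x K + r" "infdist x K < infdist y K + r" if "dist x y < r" for x y
      using infdist_triangle[of x K y] infdist_triangle[of y K x] that by (auto simp: dist_commute)
    have in1: "\<psi> x = 1" if "infdist x K < r" for x
      unfolding \<psi>_def
    proof (rule conv_mollifier_const[OF r(1) gi])
      fix y assume "dist x y < r"
      then have "infdist y K < 2 * r" using near(1)[of x y] that by simp
      then have "infdist y K / r < 2" using r(1) by (simp add: field_simps)
      then show "g y = 1" by (simp add: g_def)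
    qed
    have out0: "\<psi> x = 0" if "infdist x K \<ge> 4 * r" for x
      unfolding \<psi>_def
    proof (rule conv_mollifier_const[OF r(1) gi])
      fix y assume "dist x y < r"
      then have "infdist y K > 3 * r" using near(2)[of x y] that by simp
      then have "infdist y K / r > 3" using r(1) by (simp add: field_simps)
      then show "g y = 0" by (simp add: g_def)
    qed
    have gr0: "grad \<psi> x = 0" if "infdist x K > 4 * r" for x
    proof -
      have "open {y. infdist y K > 4 * r}" by (intro open_Collect_less continuous_intros)
      then have "grad \<psi> x = grad (\<lambda>_. 0) x"
        by (rule grad_cong) (use that out0 in auto)
      then show ?thesis by simp
    qed
    define \<phi> where "\<phi> x = 1 - \<psi> x" for x
    have \<phi>g: "grad \<phi> x = - grad \<psi> x" for x
      unfolding \<phi>_def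
      by (rule grad_unique)
        (auto intro!: derivative_eq_intros has_derivative_grad smooth_on_differentiable[OF \<psi>s])
    let ?X = "{x\<in>\<Omega>. infdist x K < 5 * r}"
    have Xm: "?X \<in> sets lebesgue" using open_infdist_less[OF \<Omega>(1)] by auto
    have X5: "emeasure lebesgue ?X \<le> ennreal (2 ^ ?n * (5 * r) powr a)" by (rule bd) (use r in auto)
    then have Xf: "emeasure lebesgue ?X < \<infinity>" using le_less_trans ennreal_less_top by fastforce
    have "(LINT x|lebesgue. indicator \<Omega> x * (norm (grad \<phi> x))\<^sup>2) \<le> (LINT x|lebesgue. (1 / r)\<^sup>2 * indicator ?X x)"
    proof (rule integral_mono')
      show "integrable lebesgue (\<lambda>x. (1 / r)\<^sup>2 * indicator ?X x)"
        using Xm Xf by (intro integrable_mult_right integrable_real_indicator)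
      show "indicator \<Omega> x * (norm (grad \<phi> x))\<^sup>2 \<le> (1 / r)\<^sup>2 * indicator ?X x" for x
      proof (cases "x \<in> ?X")
        case True
        then show ?thesis using power_mono[OF \<psi>g[of x], of 2] by (simp add: \<phi>g)
      next
        case False
        then have "x \<notin> \<Omega> \<or> infdist x K > 4 * r" using r(1) by auto
        then show ?thesis using False gr0[of x] by (auto simp: \<phi>g)
      qed
    qed simp
    also have "\<dots> = (1 / r)\<^sup>2 * measure lebesgue ?X" using Xm Xf by simp
    also have "\<dots> \<le> (1 / r)\<^sup>2 * (2 ^ ?n * (5 * r) powr a)"
      using X5 Xf unfolding measure_def
      by (intro mult_left_mono) (auto intro: enn2real_leI simp del: ennreal_power)
    also have "\<dots> \<le> \<delta>" using b(2)[OF r(1,2)] by (simp add: power_divide)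
    finally have int: "(LINT x|lebesgue. indicator \<Omega> x * (norm (grad \<phi> x))\<^sup>2) \<le> \<delta>" .
    have "smooth_on UNIV \<phi>"
      unfolding \<phi>_def by (intro smooth_on_diff smooth_on_const \<psi>s open_UNIV)
    moreover have "0 \<le> \<phi> x \<and> \<phi> x \<le> 1 \<and> norm (grad \<phi> x) \<le> 1 / r" for x
      using \<psi>0[of x] \<psi>1[of x] \<psi>g[of x] unfolding \<phi>g by (auto simp: \<phi>_def abs_le_iff)
    ultimately show "\<exists>\<phi> r B. r > 0 \<and> smooth_on UNIV \<phi> \<and>
       (\<forall>x. 0 \<le> \<phi> x \<and> \<phi> x \<le> 1 \<and> norm (grad \<phi> x) \<le> B) \<and>
       (\<forall>x. infdist x K < r \<longrightarrow> \<phi> x = 0) \<and> (\<forall>x. infdist x K \<ge> \<rho> \<longrightarrow> \<phi> x = 1) \<and>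
       (LINT x|lebesgue. indicator \<Omega> x * (norm (grad \<phi> x))\<^sup>2) \<le> \<delta>"
      using int in1 out0 r by (intro exI[of _ \<phi>] exI[of _ r] exI[of _ "1 / r"]) (auto simp: \<phi>_def)
  qed
qed

section \<open>Sequences of cutoffs, and removability of the singular set\<close>

lemma zero_capacity_cutoffs:
  fixes \<Omega> K :: "(real^'n) set"
  assumes cap: "zero_capacity \<Omega> K" and K: "closed K" "K \<noteq> {}" and \<delta>: "\<And>k. \<delta> k > 0"
  obtains \<phi> :: "nat \<Rightarrow> real^'n \<Rightarrow> real" and r B :: "nat \<Rightarrow> real" where
    "\<And>k. r k > 0" "\<And>k. smooth_on UNIV (\<phi> k)" "\<And>k x. 0 \<le> \<phi> k x" "\<And>k x. \<phi> k x \<le> 1"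
    "\<And>k x. norm (grad (\<phi> k) x) \<le> B k" "\<And>k x. infdist x K < r k \<Longrightarrow> \<phi> k x = 0"
    "\<And>k. (LINT x|lebesgue. indicator \<Omega> x * (norm (grad (\<phi> k) x))\<^sup>2) \<le> \<delta> k"
    "\<And>x. x \<notin> K \<Longrightarrow> (\<lambda>k. \<phi> k x) \<longlonglongrightarrow> 1"
proof -
  have "\<exists>p :: (real^'n \<Rightarrow> real) \<times> real \<times> real. fst (snd p) > 0 \<and> smooth_on UNIV (fst p) \<and>
     (\<forall>x. 0 \<le> fst p x \<and> fst p x \<le> 1 \<and> norm (grad (fst p) x) \<le> snd (snd p)) \<and>
     (\<forall>x. infdist x K < fst (snd p) \<longrightarrow> fst p x = 0) \<and> (\<forall>x. infdist x K \<ge> inverse (real (Suc k)) \<longrightarrow> fst p x = 1) \<and>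
     (LINT x|lebesgue. indicator \<Omega> x * (norm (grad (fst p) x))\<^sup>2) \<le> \<delta> k" for k
    using cap[unfolded zero_capacity_def, rule_format, OF \<delta>[of k], of "inverse (real (Suc k))"] by force
  then have "\<exists>p :: nat \<Rightarrow> (real^'n \<Rightarrow> real) \<times> real \<times> real. \<forall>k. fst (snd (p k)) > 0 \<and> smooth_on UNIV (fst (p k)) \<and>
     (\<forall>x. 0 \<le> fst (p k) x \<and> fst (p k) x \<le> 1 \<and> norm (grad (fst (p k)) x) \<le> snd (snd (p k))) \<and>
     (\<forall>x. infdist x K < fst (snd (p k)) \<longrightarrow> fst (p k) x = 0) \<and> (\<forall>x. infdist x K \<ge> inverse (real (Suc k)) \<longrightarrow> fst (p k) x = 1) \<and>
     (LINT x|lebesgue. indicator \<Omega> x * (norm (grad (fst (p k)) x))\<^sup>2) \<le> \<delta> k"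
    by (intro choice allI)
  then obtain p :: "nat \<Rightarrow> (real^'n \<Rightarrow> real) \<times> real \<times> real" where p: "\<And>k. fst (snd (p k)) > 0" "\<And>k. smooth_on UNIV (fst (p k))"
     "\<And>k x. 0 \<le> fst (p k) x \<and> fst (p k) x \<le> 1 \<and> norm (grad (fst (p k)) x) \<le> snd (snd (p k))"
     "\<And>k x. infdist x K < fst (snd (p k)) \<Longrightarrow> fst (p k) x = 0"
     "\<And>k x. infdist x K \<ge> inverse (real (Suc k)) \<Longrightarrow> fst (p k) x = 1"
     "\<And>k. (LINT x|lebesgue. indicator \<Omega> x * (norm (grad (fst (p k)) x))\<^sup>2) \<le> \<delta> k"
    by blast
  have lim: "(\<lambda>k. fst (p k) x) \<longlonglongrightarrow> 1" if "x \<notin> K" for x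
  proof -
    have "infdist x K > 0" using infdist_pos_not_in_closed[OF K that] .
    then have "\<forall>\<^sub>F k in sequentially. inverse (real (Suc k)) < infdist x K"
      by (rule order_tendstoD(2)[OF LIMSEQ_inverse_real_of_nat])
    then have "\<forall>\<^sub>F k in sequentially. fst (p k) x = 1"
      by eventually_elim (rule p(5), simp)
    then show ?thesis by (rule tendsto_eventually)
  qed
  show ?thesis
    by (rule that[OF p(1,2) p(3)[THEN conjunct1] p(3)[THEN conjunct2, THEN conjunct1]
          p(3)[THEN conjunct2, THEN conjunct2] p(4,6) lim])
qed

text \<open>The cutoff times a test function is admissible off \<open>K\<close>. The error pairs
  \<open>v\<close> with the gradient of the cutoff; since the cutoffs have energy at most
  \<open>(t k)\<^sup>2\<close>, Young's inequality with weight \<open>t k\<close> bounds it by a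
  multiple of \<open>t k\<close>. This is where the square integrability of \<open>v\<close>
  enters.\<close>

theorem has_weak_gradient_removable:
  fixes \<Omega> K :: "(real^'n) set"
  assumes \<Omega>: "open \<Omega>" and K: "compact K" "K \<noteq> {}" "K \<in> null_sets lebesgue" and cap: "zero_capacity \<Omega> K"
    and v: "has_weak_gradient (\<Omega> - K) v g" and lv: "locally_integrable \<Omega> v" and lg: "locally_integrable \<Omega> g"
    and v2: "set_integrable lebesgue \<Omega> (\<lambda>x. (v x)\<^sup>2)" and fin: "emeasure lebesgue \<Omega> < \<infinity>"
  shows "has_weak_gradient \<Omega> v g"
  unfolding has_weak_gradient_iff
proof (intro conjI ballI allI lv lg)
  fix \<theta> :: "real^'n \<Rightarrow> real" and i assume \<theta>: "\<theta> \<in> test_functions \<Omega>"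
  define t where "t k = inverse (real (Suc k))" for k
  have t: "t k > 0" for k by (simp add: t_def)
  obtain \<phi> :: "nat \<Rightarrow> real^'n \<Rightarrow> real" and r B where
    \<phi>: "\<And>k. r k > 0" "\<And>k. smooth_on UNIV (\<phi> k)" "\<And>k x. 0 \<le> \<phi> k x" "\<And>k x. \<phi> k x \<le> 1"
    "\<And>k x. norm (grad (\<phi> k) x) \<le> B k" "\<And>k x. infdist x K < r k \<Longrightarrow> \<phi> k x = 0"
    "\<And>k. (LINT x|lebesgue. indicator \<Omega> x * (norm (grad (\<phi> k) x))\<^sup>2) \<le> (t k)\<^sup>2"
    "\<And>x. x \<notin> K \<Longrightarrow> (\<lambda>k. \<phi> k x) \<longlonglongrightarrow> 1"
    by (rule zero_capacity_cutoffs[OF cap compact_imp_closed[OF K(1)] K(2) zero_less_power[OF t, of _ 2]], rule that)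
  obtain P where P: "\<And>x. \<bar>\<theta> x\<bar> \<le> P" using test_functions_bounded[OF \<theta>] by metis
  have P0: "P \<ge> 0" using P[of 0] by simp
  have Om: "\<Omega> \<in> sets lebesgue" using \<Omega> by auto
  have \<phi>m: "\<phi> k \<in> borel_measurable lebesgue" for k
    by (rule continuous_lebesgue_measurable[OF smooth_on_continuous[OF \<phi>(2)]])
  have \<phi>gm: "grad (\<phi> k) \<in> borel_measurable lebesgue" for k
    by (rule continuous_lebesgue_measurable[OF smooth_on_continuous_grad[OF \<phi>(2)]])
  have ae: "AE x in lebesgue. x \<notin> K" using K(3) by (rule AE_not_in)
  have test: "(\<lambda>x. \<phi> k x * \<theta> x) \<in> test_functions (\<Omega> - K)" for k
  proof -
    obtain C where C: "compact C" "C \<subseteq> \<Omega>" "\<And>x. x \<notin> C \<Longrightarrow> \<theta> x = 0"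
      using \<theta> by (rule test_functionsD) blast
    have cl: "closed {x. infdist x K \<ge> r k}" by (intro closed_Collect_le continuous_intros)
    show ?thesis
    proof (rule test_functionsI[of _ "C \<inter> {x. infdist x K \<ge> r k}"])
      show "smooth_on UNIV (\<lambda>x. \<phi> k x * \<theta> x)"
        by (rule smooth_on_mult[OF open_UNIV \<phi>(2) test_functions_smooth[OF \<theta>]])
      show "compact (C \<inter> {x. infdist x K \<ge> r k})" by (rule compact_Int_closed[OF C(1) cl])
      show "C \<inter> {x. infdist x K \<ge> r k} \<subseteq> \<Omega> - K" using C(2) \<phi>(1)[of k] by auto
      show "\<phi> k x * \<theta> x = 0" if "x \<notin> C \<inter> {x. infdist x K \<ge> r k}" for x
        using that C(3)[of x] \<phi>(6)[of x k] by auto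
    qed
  qed
  have gr: "grad (\<lambda>x. \<phi> k x * \<theta> x) x = \<phi> k x *\<^sub>R grad \<theta> x + \<theta> x *\<^sub>R grad (\<phi> k) x" for k x
    by (intro grad_mult smooth_on_differentiable[OF \<phi>(2)] smooth_on_differentiable[OF test_functions_smooth[OF \<theta>]]) auto
  have iv: "integrable lebesgue (\<lambda>x. v x * grad \<theta> x $ i)"
    by (rule locally_integrable_test[OF lv test_functions_grad[OF \<theta>]])
  have ig: "integrable lebesgue (\<lambda>x. g x $ i * \<theta> x)"
    by (rule locally_integrable_test[OF locally_integrable_component[OF lg] \<theta>])
  have ab: "\<bar>\<phi> k x\<bar> \<le> 1" for k x using \<phi>(3,4)[of k x] by simp
  have L1: "(\<lambda>k. LINT x|lebesgue. \<phi> k x * f x) \<longlonglongrightarrow> (LINT x|lebesgue. f x)" if f: "integrable lebesgue f" for f :: "real^'n \<Rightarrow> real"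
  proof (rule integral_dominated_convergence[where w = "\<lambda>x. \<bar>f x\<bar>"])
    show "AE x in lebesgue. (\<lambda>k. \<phi> k x * f x) \<longlonglongrightarrow> f x"
      using ae
    proof eventually_elim
      case (elim x)
      from tendsto_mult[OF \<phi>(8)[OF elim] tendsto_const[of "f x"]] show ?case by simp
    qed
    show "AE x in lebesgue. norm (\<phi> k x * f x) \<le> \<bar>f x\<bar>" for k
      using ab[of k] by (intro AE_I2) (simp add: abs_mult mult_left_le_one_le)
    show "(\<lambda>x. \<phi> k x * f x) \<in> borel_measurable lebesgue" for k
      using \<phi>m borel_measurable_integrable[OF f] by (rule borel_measurable_times)
  qed (use f in auto)
  define V where "V = (LINT x|lebesgue. indicator \<Omega> x * (v x)\<^sup>2)"
  have v2': "integrable lebesgue (\<lambda>x. indicator \<Omega> x * (v x)\<^sup>2)" using v2 by (simp add: set_integrable_def)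
  have g2: "integrable lebesgue (\<lambda>x. indicator \<Omega> x * (norm (grad (\<phi> k) x))\<^sup>2)" for k
  proof (rule Bochner_Integration.integrable_bound[where f = "\<lambda>x. (B k)\<^sup>2 * indicator \<Omega> x"])
    show "integrable lebesgue (\<lambda>x. (B k)\<^sup>2 * indicator \<Omega> x)"
      using Om fin by (intro integrable_mult_right integrable_real_indicator)
    show "(\<lambda>x. indicator \<Omega> x * (norm (grad (\<phi> k) x))\<^sup>2) \<in> borel_measurable lebesgue"
      by (intro borel_measurable_times borel_measurable_indicator borel_measurable_power Om
          continuous_lebesgue_measurable continuous_on_norm smooth_on_continuous_grad \<phi>(2))
    show "AE x in lebesgue. norm (indicator \<Omega> x * (norm (grad (\<phi> k) x))\<^sup>2) \<le> norm ((B k)\<^sup>2 * indicator \<Omega> x)"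
      using power_mono[OF \<phi>(5)[where k = k] norm_ge_zero, where n = 2] by (intro AE_I2) (simp add: indicator_def)
  qed
  have i3: "integrable lebesgue (\<lambda>x. v x * \<theta> x * grad (\<phi> k) x $ i)" for k
  proof -
    have "(\<lambda>x. grad (\<phi> k) x $ i) \<in> borel_measurable lebesgue"
      by (rule continuous_lebesgue_measurable[OF smooth_on_continuous[OF smooth_on_grad[OF \<phi>(2)]]])
    from integrable_bounded_mult[OF locally_integrable_test[OF lv \<theta>] this order_trans[OF component_le_norm_cart \<phi>(5)]]
    show ?thesis by (simp add: mult.commute)
  qed
  have "(\<lambda>k. LINT x|lebesgue. v x * \<theta> x * grad (\<phi> k) x $ i) \<longlonglongrightarrow> 0"
  proof (rule Lim_null_comparison)
    have "norm (LINT x|lebesgue. v x * \<theta> x * grad (\<phi> k) x $ i) \<le> t k * (P * (V + 1))" for k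
    proof -
      have "norm (LINT x|lebesgue. v x * \<theta> x * grad (\<phi> k) x $ i)
          \<le> (LINT x|lebesgue. P * (t k * (indicator \<Omega> x * (v x)\<^sup>2) + (indicator \<Omega> x * (norm (grad (\<phi> k) x))\<^sup>2) / t k))"
      proof (rule Bochner_Integration.integral_norm_bound_integral[OF i3])
        show "integrable lebesgue (\<lambda>x. P * (t k * (indicator \<Omega> x * (v x)\<^sup>2) + (indicator \<Omega> x * (norm (grad (\<phi> k) x))\<^sup>2) / t k))"
          using v2' g2[of k] by simp
        show "norm (v x * \<theta> x * grad (\<phi> k) x $ i) \<le> P * (t k * (indicator \<Omega> x * (v x)\<^sup>2) + (indicator \<Omega> x * (norm (grad (\<phi> k) x))\<^sup>2) / t k)" for x
        proof (cases "x \<in> \<Omega>")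
          case True
          define a b where "a = \<bar>v x\<bar>" and "b = norm (grad (\<phi> k) x)"
          have ab0: "a \<ge> 0" "b \<ge> 0" by (auto simp: a_def b_def)
          have "(t k * a - b)\<^sup>2 \<ge> 0" "t k * (a * b) \<ge> 0" using t[of k] ab0 by auto
          moreover have "(t k * a - b)\<^sup>2 = t k * t k * a\<^sup>2 - 2 * (t k * (a * b)) + b\<^sup>2"
            by (simp add: power2_eq_square algebra_simps)
          ultimately have "t k * (a * b) \<le> t k * t k * a\<^sup>2 + b\<^sup>2" by linarith
          then have "a * b \<le> t k * a\<^sup>2 + b\<^sup>2 / t k" using t[of k] by (simp add: field_simps power2_eq_square)
          then have "P * (a * b) \<le> P * (t k * (v x)\<^sup>2 + b\<^sup>2 / t k)" using P0 by (intro mult_left_mono) (auto simp: a_def)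
          moreover have "norm (v x * \<theta> x * grad (\<phi> k) x $ i) \<le> P * (a * b)"
          proof -
            have "\<bar>\<theta> x\<bar> * (\<bar>v x\<bar> * \<bar>grad (\<phi> k) x $ i\<bar>) \<le> P * (a * b)"
              using P[of x] P0 ab0 component_le_norm_cart[of "grad (\<phi> k) x" i]
              by (intro mult_mono) (auto simp: a_def b_def)
            then show ?thesis by (simp add: abs_mult mult_ac)
          qed
          ultimately show ?thesis using True by (simp add: b_def)
        next
          case False
          then show ?thesis using test_functions_outside(1)[OF \<theta> False] by simp
        qed
      qed
      also have "\<dots> = P * (t k * V + (LINT x|lebesgue. indicator \<Omega> x * (norm (grad (\<phi> k) x))\<^sup>2) / t k)"
        unfolding V_def using v2' g2[of k] by simp
      also have "\<dots> \<le> P * (t k * V + (t k)\<^sup>2 / t k)"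
        using P0 \<phi>(7)[of k] t[of k] by (intro mult_left_mono add_left_mono divide_right_mono) auto
      also have "\<dots> = t k * (P * (V + 1))" using t[of k] by (simp add: power2_eq_square algebra_simps)
      finally show ?thesis .
    qed
    then show "\<forall>\<^sub>F k in sequentially. norm (LINT x|lebesgue. v x * \<theta> x * grad (\<phi> k) x $ i) \<le> t k * (P * (V + 1))"
      by simp
    show "(\<lambda>k. t k * (P * (V + 1))) \<longlonglongrightarrow> 0"
      unfolding t_def using tendsto_mult_left_zero[OF LIMSEQ_inverse_real_of_nat] .
  qed
  from tendsto_add[OF L1[OF iv] this]
  have A: "(\<lambda>k. (LINT x|lebesgue. \<phi> k x * (v x * grad \<theta> x $ i)) + (LINT x|lebesgue. v x * \<theta> x * grad (\<phi> k) x $ i))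
      \<longlonglongrightarrow> (LINT x|lebesgue. v x * grad \<theta> x $ i)" by simp
  have "(LINT x|lebesgue. \<phi> k x * (v x * grad \<theta> x $ i)) + (LINT x|lebesgue. v x * \<theta> x * grad (\<phi> k) x $ i)
      = - (LINT x|lebesgue. \<phi> k x * (g x $ i * \<theta> x))" for k
  proof -
    have "integrable lebesgue (\<lambda>x. \<phi> k x * (v x * grad \<theta> x $ i))"
      by (rule integrable_bounded_mult[OF iv \<phi>m ab])
    then have "(LINT x|lebesgue. \<phi> k x * (v x * grad \<theta> x $ i)) + (LINT x|lebesgue. v x * \<theta> x * grad (\<phi> k) x $ i)
        = (LINT x|lebesgue. \<phi> k x * (v x * grad \<theta> x $ i) + v x * \<theta> x * grad (\<phi> k) x $ i)"
      using i3 by (rule Bochner_Integration.integral_add[symmetric])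
    also have "\<dots> = (LINT x|lebesgue. v x * grad (\<lambda>x. \<phi> k x * \<theta> x) x $ i)"
      unfolding gr by (rule Bochner_Integration.integral_cong) (auto simp: algebra_simps)
    also have "\<dots> = - (LINT x|lebesgue. g x $ i * (\<phi> k x * \<theta> x))"
      by (rule has_weak_gradientD(3)[OF v test])
    finally show ?thesis by (simp add: mult_ac)
  qed
  then have "(\<lambda>k. - (LINT x|lebesgue. \<phi> k x * (g x $ i * \<theta> x))) \<longlonglongrightarrow> (LINT x|lebesgue. v x * grad \<theta> x $ i)"
    using A by simp
  moreover have "(\<lambda>k. - (LINT x|lebesgue. \<phi> k x * (g x $ i * \<theta> x))) \<longlonglongrightarrow> - (LINT x|lebesgue. g x $ i * \<theta> x)"
    by (rule tendsto_minus[OF L1[OF ig]])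
  ultimately show "(LINT x|lebesgue. v x * grad \<theta> x $ i) = - (LINT x|lebesgue. g x $ i * \<theta> x)"
    by (rule LIMSEQ_unique)
qed

subsection \<open>The weak form of the Neumann problem\<close>

text \<open>Here \<open>A\<close> and \<open>e\<close> stand for smooth extensions to open sets
  containing \<open>closure \<Omega>\<close> and \<open>closure \<Omega> - K\<close>, so that
  gradients at boundary points are ordinary ones. The dimension of \<open>K\<close> is represented
  by its being a null set of zero capacity, and the measure by the homogeneous equation off
  \<open>K\<close>.\<close>

locale interior_weight =
  fixes \<Omega> K V W :: "(real^'n) set" and A :: "real^'n \<Rightarrow> real^'n^'n" and e :: "real^'n \<Rightarrow> real" and c m :: real
  assumes dom: "smooth_bounded_domain \<Omega>"
    and c: "c > 0" and ell: "\<And>x \<xi>. x \<in> closure \<Omega> \<Longrightarrow> (A x *v \<xi>) \<bullet> \<xi> \<ge> c * (norm \<xi>)\<^sup>2"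
    and sym: "\<And>x. x \<in> closure \<Omega> \<Longrightarrow> transpose (A x) = A x"
    and V: "open V" "closure \<Omega> \<subseteq> V" and A: "\<And>i j. smooth_on V (\<lambda>x. A x $ i $ j)"
    and W: "open W" "closure \<Omega> - K \<subseteq> W" "W \<subseteq> V" and e: "smooth_on W e"
    and K: "compact K" "K \<subseteq> \<Omega>" "K \<noteq> {}" "K \<in> null_sets lebesgue" and cap: "zero_capacity \<Omega> K"
    and m: "m > 0" and em: "\<And>x. x \<in> \<Omega> - K \<Longrightarrow> m \<le> e x"
    and ei: "set_integrable lebesgue \<Omega> e"
    and weak_eq: "\<And>\<phi>. \<phi> \<in> test_functions (\<Omega> - K) \<Longrightarrow> (LINT x|lebesgue. e x * (elliptic_op A \<phi> x + \<phi> x)) = 0"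
    and neumann: "\<And>x \<nu>. x \<in> frontier \<Omega> \<Longrightarrow> outward_unit_normal \<Omega> x \<nu> \<Longrightarrow> (A x *v grad e x) \<bullet> \<nu> = 0"
begin

lemma open_dom: "open \<Omega>" and bounded_dom: "bounded \<Omega>" and nonempty_dom: "\<Omega> \<noteq> {}"
  using dom by (auto simp: smooth_bounded_domain_def)

lemma open_punctured: "open (\<Omega> - K)"
  using open_dom K(1) by (simp add: open_Diff compact_imp_closed)

lemma compact_closure_dom: "compact (closure \<Omega>)"
  using bounded_dom by (simp add: compact_closure)

lemma dom_measure: "\<Omega> \<in> sets lebesgue" "emeasure lebesgue \<Omega> < \<infinity>"
  using lmeasurable_open[OF bounded_dom open_dom] by (auto simp: fmeasurable_def)

lemma punctured_subset: "\<Omega> - K \<subseteq> W"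
  using W(2) closure_subset[of \<Omega>] by blast

definition flux :: "real^'n \<Rightarrow> real^'n" where
  "flux x = A x *v grad e x"

lemma flux_component: "flux x $ i = (\<Sum>j\<in>UNIV. A x $ i $ j * grad e x $ j)"
  by (simp add: flux_def matrix_vector_mult_def)

lemma smooth_flux: "smooth_on W (\<lambda>x. flux x $ i)"
  unfolding flux_component
  by (intro smooth_on_sum smooth_on_mult smooth_on_grad W(1) e smooth_on_subset[OF A W(3)])

lemma flux_continuous: "continuous_on W flux"
proof -
  have "continuous_on W (\<lambda>x. \<chi> i. flux x $ i)"
    by (intro continuous_on_vec_lambda smooth_on_continuous smooth_flux)
  then show ?thesis by simp
qed

lemma symmetric_component: "x \<in> closure \<Omega> \<Longrightarrow> A x $ i $ j = A x $ j $ i"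
  using sym[of x] by (simp add: transpose_def vec_eq_iff)

text \<open>Two integrations by parts carry the derivatives from the test function to
  \<open>e\<close>, with the symmetry of the coefficients used between them. Everything is smooth
  off \<open>K\<close>, but equality almost everywhere is enough under integrals.\<close>

lemma AE_flux_equation:
  "AE x in lebesgue. x \<in> \<Omega> - K \<longrightarrow> e x - (\<Sum>i\<in>UNIV. grad (\<lambda>y. flux y $ i) x $ i) = 0"
proof (rule AE_zero_if_test_integrals_zero[OF open_punctured])
  let ?D = "\<lambda>x. \<Sum>i\<in>UNIV. grad (\<lambda>y. flux y $ i) x $ i"
  have ec: "continuous_on (\<Omega> - K) e"
    by (rule continuous_on_subset[OF smooth_on_continuous[OF e] punctured_subset])
  have Dc: "continuous_on (\<Omega> - K) ?D"
    by (intro continuous_on_sum continuous_on_subset[OF smooth_on_continuous[OF smooth_on_grad[OF smooth_flux]] punctured_subset])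
  show "locally_integrable (\<Omega> - K) (\<lambda>x. e x - ?D x)"
    by (rule locally_integrable_continuous[OF continuous_on_diff[OF ec Dc]])
  fix \<phi> assume \<phi>: "\<phi> \<in> test_functions (\<Omega> - K)"
  have we: "has_weak_gradient (\<Omega> - K) e (grad e)"
    by (rule has_weak_gradient_smooth[OF open_punctured smooth_on_subset[OF e punctured_subset]])
  have wf: "has_weak_gradient (\<Omega> - K) (\<lambda>x. flux x $ i) (grad (\<lambda>x. flux x $ i))" for i
    by (rule has_weak_gradient_smooth[OF open_punctured smooth_on_subset[OF smooth_flux punctured_subset]])
  define \<psi> where "\<psi> i x = (\<Sum>j\<in>UNIV. A x $ i $ j * grad \<phi> x $ j)" for i x
  have OV: "\<Omega> - K \<subseteq> V" using punctured_subset W(3) by blast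
  have \<psi>t: "\<psi> i \<in> test_functions (\<Omega> - K)" for i
    unfolding \<psi>_def by (intro test_functions_sum test_functions_mult[OF V(1) A _ OV] test_functions_grad \<phi>)
  have ell: "elliptic_op A \<phi> x = - (\<Sum>i\<in>UNIV. grad (\<psi> i) x $ i)" for x
    by (simp add: elliptic_op_def divergence_def matrix_vector_mult_def \<psi>_def[abs_def])
  have i1: "integrable lebesgue (\<lambda>x. e x * grad (\<psi> i) x $ i)" for i
    by (rule locally_integrable_test[OF has_weak_gradientD(1)[OF we] test_functions_grad[OF \<psi>t]])
  have i2: "integrable lebesgue (\<lambda>x. e x * \<phi> x)"
    by (rule locally_integrable_test[OF has_weak_gradientD(1)[OF we] \<phi>])
  have i3: "integrable lebesgue (\<lambda>x. grad e x $ i * \<psi> i x)" for i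
    by (rule locally_integrable_test[OF locally_integrable_component[OF has_weak_gradientD(2)[OF we]] \<psi>t])
  have i4: "integrable lebesgue (\<lambda>x. flux x $ i * grad \<phi> x $ i)" for i
    by (rule locally_integrable_test[OF has_weak_gradientD(1)[OF wf] test_functions_grad[OF \<phi>]])
  have i5: "integrable lebesgue (\<lambda>x. grad (\<lambda>y. flux y $ i) x $ i * \<phi> x)" for i
    by (rule locally_integrable_test[OF locally_integrable_component[OF has_weak_gradientD(2)[OF wf]] \<phi>])
  have "0 = (LINT x|lebesgue. e x * \<phi> x - (\<Sum>i\<in>UNIV. e x * grad (\<psi> i) x $ i))"
    using weak_eq[OF \<phi>] unfolding ell by (simp add: algebra_simps sum_distrib_left)
  also have "\<dots> = (LINT x|lebesgue. e x * \<phi> x) - (\<Sum>i\<in>UNIV. LINT x|lebesgue. e x * grad (\<psi> i) x $ i)"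
    using i1 i2 by (simp add: Bochner_Integration.integral_diff Bochner_Integration.integral_sum)
  also have "\<dots> = (LINT x|lebesgue. e x * \<phi> x) + (\<Sum>i\<in>UNIV. LINT x|lebesgue. grad e x $ i * \<psi> i x)"
    unfolding has_weak_gradientD(3)[OF we \<psi>t] by (simp add: sum_negf)
  also have "(\<Sum>i\<in>UNIV. LINT x|lebesgue. grad e x $ i * \<psi> i x) = (LINT x|lebesgue. (\<Sum>i\<in>UNIV. grad e x $ i * \<psi> i x))"
    by (rule Bochner_Integration.integral_sum[symmetric]) (rule i3)
  also have "(\<lambda>x. \<Sum>i\<in>UNIV. grad e x $ i * \<psi> i x) = (\<lambda>x. \<Sum>i\<in>UNIV. flux x $ i * grad \<phi> x $ i)"
  proof
    fix x
    show "(\<Sum>i\<in>UNIV. grad e x $ i * \<psi> i x) = (\<Sum>i\<in>UNIV. flux x $ i * grad \<phi> x $ i)"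
    proof (cases "x \<in> \<Omega> - K")
      case True
      then have x: "x \<in> closure \<Omega>" using closure_subset[of \<Omega>] by blast
      have "(\<Sum>i\<in>UNIV. grad e x $ i * \<psi> i x) = (\<Sum>i\<in>UNIV. \<Sum>j\<in>UNIV. grad e x $ i * (A x $ i $ j * grad \<phi> x $ j))"
        by (simp add: \<psi>_def sum_distrib_left)
      also have "\<dots> = (\<Sum>j\<in>UNIV. \<Sum>i\<in>UNIV. grad e x $ i * (A x $ i $ j * grad \<phi> x $ j))"
        by (rule sum.swap)
      also have "\<dots> = (\<Sum>j\<in>UNIV. \<Sum>i\<in>UNIV. A x $ j $ i * grad e x $ i * grad \<phi> x $ j)"
        by (intro sum.cong refl) (simp add: symmetric_component[OF x] mult_ac)
      finally show ?thesis by (simp add: flux_component sum_distrib_right)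
    next
      case False
      then show ?thesis
        using test_functions_outside(1)[OF \<psi>t False] test_functions_outside(2)[OF \<phi> False] by simp
    qed
  qed
  also have "(LINT x|lebesgue. (\<Sum>i\<in>UNIV. flux x $ i * grad \<phi> x $ i)) = (\<Sum>i\<in>UNIV. LINT x|lebesgue. flux x $ i * grad \<phi> x $ i)"
    by (rule Bochner_Integration.integral_sum) (rule i4)
  also have "\<dots> = - (\<Sum>i\<in>UNIV. LINT x|lebesgue. grad (\<lambda>y. flux y $ i) x $ i * \<phi> x)"
    unfolding has_weak_gradientD(3)[OF wf \<phi>] by (simp add: sum_negf)
  also have "(LINT x|lebesgue. e x * \<phi> x) + - (\<Sum>i\<in>UNIV. LINT x|lebesgue. grad (\<lambda>y. flux y $ i) x $ i * \<phi> x)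
      = (LINT x|lebesgue. e x * \<phi> x - (\<Sum>i\<in>UNIV. grad (\<lambda>y. flux y $ i) x $ i * \<phi> x))"
    using i2 i5 by (simp add: Bochner_Integration.integral_diff Bochner_Integration.integral_sum)
  also have "\<dots> = (LINT x|lebesgue. (e x - ?D x) * \<phi> x)"
    by (simp add: left_diff_distrib sum_distrib_right)
  finally show "(LINT x|lebesgue. (e x - ?D x) * \<phi> x) = 0" by simp
qed

text \<open>The roles are exchanged: the flux times a cutoff that is 1 near \<open>C\<close> is a
  test function for the weak gradient of \<open>w\<close>. The pointwise equation for the flux then
  makes the integrand vanish almost everywhere.\<close>

lemma weak_form_interior:
  assumes w: "has_weak_gradient UNIV w g" and C: "compact C" "C \<subseteq> \<Omega> - K"
    and w0: "\<And>x. x \<notin> C \<Longrightarrow> w x = 0" and g0: "\<And>x. x \<notin> C \<Longrightarrow> g x = 0"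
  shows "(LINT x|lebesgue. g x \<bullet> flux x + e x * w x) = 0 \<and> integrable lebesgue (\<lambda>x. g x \<bullet> flux x + e x * w x)"
proof (cases "C = {}")
  case True
  then have "w = (\<lambda>_. 0)" "g = (\<lambda>_. 0)" using w0 g0 by auto
  then show ?thesis by simp
next
  case False
  obtain \<eta> r where \<eta>: "\<eta> \<in> test_functions (\<Omega> - K)" "r > 0" "\<And>x. infdist x C < r \<Longrightarrow> \<eta> x = 1"
    using smooth_cutoff[OF C(1) False open_punctured C(2)] by metis
  have \<eta>C: "\<eta> x = 1" "grad \<eta> x = 0" if "x \<in> C" for x
  proof -
    show "\<eta> x = 1" using \<eta>(2,3) that by simp
    have "open {y. infdist y C < r}" by (intro open_Collect_less continuous_intros)
    then have "grad \<eta> x = grad (\<lambda>_. 1) x"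
      by (rule grad_cong) (use that \<eta>(2,3) in auto)
    then show "grad \<eta> x = 0" by simp
  qed
  have t: "(\<lambda>x. flux x $ i * \<eta> x) \<in> test_functions UNIV" for i
    by (rule test_functions_mono[OF subset_UNIV test_functions_mult[OF W(1) smooth_flux \<eta>(1) punctured_subset]])
  have te: "(\<lambda>x. e x * \<eta> x) \<in> test_functions UNIV"
    by (rule test_functions_mono[OF subset_UNIV test_functions_mult[OF W(1) e \<eta>(1) punctured_subset]])
  note Wd = has_weak_gradientD[OF w]
  let ?D = "\<lambda>i x. grad (\<lambda>y. flux y $ i) x $ i"
  have g1: "(\<lambda>x. g x $ i * (flux x $ i * \<eta> x)) = (\<lambda>x. g x $ i * flux x $ i)" for i
  proof
    show "g x $ i * (flux x $ i * \<eta> x) = g x $ i * flux x $ i" for x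
      using \<eta>C(1)[of x] g0[of x] by (cases "x \<in> C") auto
  qed
  have e1: "(\<lambda>x. w x * (e x * \<eta> x)) = (\<lambda>x. e x * w x)"
  proof
    show "w x * (e x * \<eta> x) = e x * w x" for x
      using \<eta>C(1)[of x] w0[of x] by (cases "x \<in> C") auto
  qed
  have d1: "(\<lambda>x. w x * grad (\<lambda>y. flux y $ i * \<eta> y) x $ i) = (\<lambda>x. w x * ?D i x)" for i
  proof
    fix x
    show "w x * grad (\<lambda>y. flux y $ i * \<eta> y) x $ i = w x * ?D i x"
    proof (cases "x \<in> C")
      case True
      then have "x \<in> W" using C(2) punctured_subset by blast
      then have "grad (\<lambda>y. flux y $ i * \<eta> y) x = flux x $ i *\<^sub>R grad \<eta> x + \<eta> x *\<^sub>R grad (\<lambda>y. flux y $ i) x"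
        by (intro grad_mult smooth_on_differentiable[OF smooth_flux]
            smooth_on_differentiable[OF test_functions_smooth[OF \<eta>(1)]]) auto
      then show ?thesis using \<eta>C[OF True] by simp
    qed (simp add: w0)
  qed
  have i1: "integrable lebesgue (\<lambda>x. g x $ i * flux x $ i)" for i
    using locally_integrable_test[OF locally_integrable_component[OF Wd(2)] t[of i], of i] unfolding g1 .
  have i2: "integrable lebesgue (\<lambda>x. e x * w x)"
    using locally_integrable_test[OF Wd(1) te] unfolding e1 .
  have i3: "integrable lebesgue (\<lambda>x. w x * ?D i x)" for i
    using locally_integrable_test[OF Wd(1) test_functions_grad[OF t[of i]], of i] unfolding d1 .
  have by_parts: "(LINT x|lebesgue. g x $ i * flux x $ i) = - (LINT x|lebesgue. w x * ?D i x)" for i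
    using Wd(3)[OF t[of i], of i] unfolding g1 d1 by simp
  have "(LINT x|lebesgue. g x \<bullet> flux x + e x * w x) = (\<Sum>i\<in>UNIV. LINT x|lebesgue. g x $ i * flux x $ i) + (LINT x|lebesgue. e x * w x)"
    using i1 i2 by (simp add: inner_vec_def Bochner_Integration.integral_add Bochner_Integration.integral_sum)
  also have "\<dots> = (LINT x|lebesgue. e x * w x - (\<Sum>i\<in>UNIV. w x * ?D i x))"
    unfolding by_parts using i2 i3
    by (simp add: Bochner_Integration.integral_diff Bochner_Integration.integral_sum sum_negf)
  also have "\<dots> = (LINT x|(lebesgue :: (real^'n) measure). 0)"
  proof (rule integral_cong_AE)
    show "AE x in lebesgue. e x * w x - (\<Sum>i\<in>UNIV. w x * ?D i x) = 0"
      using AE_flux_equation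
    proof eventually_elim
      case (elim x)
      show ?case
      proof (cases "x \<in> C")
        case True
        then have "e x - (\<Sum>i\<in>UNIV. ?D i x) = 0" using elim C(2) by blast
        then have "w x * (e x - (\<Sum>i\<in>UNIV. ?D i x)) = 0" by simp
        then show ?thesis by (simp add: right_diff_distrib sum_distrib_left mult.commute)
      qed (simp add: w0)
    qed
    show "(\<lambda>x. e x * w x - (\<Sum>i\<in>UNIV. w x * ?D i x)) \<in> borel_measurable lebesgue"
      using i2 i3 by (intro borel_measurable_integrable Bochner_Integration.integrable_diff Bochner_Integration.integrable_sum)
  qed simp
  finally have "(LINT x|lebesgue. g x \<bullet> flux x + e x * w x) = 0" by simp
  moreover have "integrable lebesgue (\<lambda>x. g x \<bullet> flux x + e x * w x)"
    unfolding inner_vec_def inner_real_def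
    by (intro Bochner_Integration.integrable_add Bochner_Integration.integrable_sum i1 i2)
  ultimately show ?thesis by blast
qed

text \<open>The Neumann condition makes the normal component of the flux vanish on the boundary,
  hence of the order of the distance to it.\<close>

lemma normal_flux_bound:
  assumes x0: "x0 \<in> frontier \<Omega>" and ldf: "local_defining_function \<Omega> x0 U \<rho>"
  obtains R C where "R > 0" "cball x0 R \<subseteq> U \<inter> W - K" "C \<ge> 0"
    "\<And>y. y \<in> \<Omega> \<Longrightarrow> y \<in> cball x0 R \<Longrightarrow> \<bar>grad \<rho> y \<bullet> flux y\<bar> \<le> C * \<bar>\<rho> y\<bar>"
proof -
  have U: "open U" "x0 \<in> U" "smooth_on U \<rho>" "\<Omega> \<inter> U = {y\<in>U. \<rho> y < 0}" "frontier \<Omega> \<inter> U = {y\<in>U. \<rho> y = 0}"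
    "\<And>y. y \<in> frontier \<Omega> \<inter> U \<Longrightarrow> grad \<rho> y \<noteq> 0"
    using ldf unfolding local_defining_function_def by blast+
  define f where "f y = (\<Sum>i\<in>UNIV. grad \<rho> y $ i * flux y $ i)" for y
  have f_inner: "f y = grad \<rho> y \<bullet> flux y" for y by (simp add: f_def inner_vec_def)
  have fr: "frontier \<Omega> \<inter> \<Omega> = {}" using open_dom by (auto simp: frontier_def interior_open)
  have x0K: "x0 \<notin> K" using x0 fr K(2) by blast
  have x0W: "x0 \<in> W" using x0 x0K W(2) by (auto simp: frontier_def)
  have oUW: "open (U \<inter> W - K)" using U(1) W(1) K(1) by (simp add: open_Diff open_Int compact_imp_closed)
  \<comment> \<open>\<open>\<rho>\<close> is a local defining function at each boundary point in
    \<open>U\<close>, so its normalized gradient is the normal at all of them and not only at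
    \<open>x0\<close>.\<close>
  have f0: "f y = 0" if y: "y \<in> frontier \<Omega>" "y \<in> U" for y
  proof -
    have "local_defining_function \<Omega> y U \<rho>"
      using ldf y(2) unfolding local_defining_function_def by blast
    then have "outward_unit_normal \<Omega> y (grad \<rho> y /\<^sub>R norm (grad \<rho> y))"
      unfolding outward_unit_normal_def by blast
    from neumann[OF y(1) this] have "flux y \<bullet> (grad \<rho> y /\<^sub>R norm (grad \<rho> y)) = 0"
      by (simp add: flux_def)
    then show ?thesis using U(6)[of y] y by (simp add: f_inner inner_commute)
  qed
  define p where "p = grad \<rho> x0"
  have p: "p \<noteq> 0" unfolding p_def using U(6)[of x0] x0 U(2) by blast
  \<comment> \<open>Near \<open>x0\<close> the derivative of \<open>\<rho>\<close> in the fixed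
    direction \<open>p\<close> is more than half of its value \<open>(norm p)\<^sup>2\<close> at
    \<open>x0\<close>. So \<open>p\<close> is a common direction along which all nearby points move
    towards the boundary at a definite rate.\<close>
  have "continuous_on U (\<lambda>y. grad \<rho> y \<bullet> p)"
    by (rule continuous_on_inner[OF smooth_on_continuous_grad[OF U(3)] continuous_on_const])
  from continuous_open_preimage[OF this U(1) open_greaterThan]
  have "open (U \<inter> (\<lambda>y. grad \<rho> y \<bullet> p) -` {(norm p)\<^sup>2 / 2<..})" .
  moreover have "x0 \<in> U \<inter> (\<lambda>y. grad \<rho> y \<bullet> p) -` {(norm p)\<^sup>2 / 2<..}"
    using U(2) p by (simp add: p_def[symmetric] dot_square_norm)
  ultimately have "open ((U \<inter> W - K) \<inter> (U \<inter> (\<lambda>y. grad \<rho> y \<bullet> p) -` {(norm p)\<^sup>2 / 2<..}))"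
    "x0 \<in> (U \<inter> W - K) \<inter> (U \<inter> (\<lambda>y. grad \<rho> y \<bullet> p) -` {(norm p)\<^sup>2 / 2<..})"
    using oUW x0W x0K U(2) by blast+
  then obtain R1 where R1: "R1 > 0" "cball x0 R1 \<subseteq> (U \<inter> W - K) \<inter> (U \<inter> (\<lambda>y. grad \<rho> y \<bullet> p) -` {(norm p)\<^sup>2 / 2<..})"
    using open_contains_cball by blast
  have fs: "smooth_on (U \<inter> W) f"
    unfolding f_def
    by (intro smooth_on_sum smooth_on_mult open_Int U(1) W(1) smooth_on_grad smooth_on_subset[OF U(3)] smooth_on_subset[OF smooth_flux]) auto
  obtain L where L: "\<And>y z. y \<in> cball x0 R1 \<Longrightarrow> z \<in> cball x0 R1 \<Longrightarrow> \<bar>f y - f z\<bar> \<le> L * norm (y - z)" "L \<ge> 0"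
  proof -
    have "continuous_on (cball x0 R1) (grad f)"
      by (rule continuous_on_subset[OF smooth_on_continuous_grad[OF fs]]) (use R1(2) in blast)
    then have "bounded (grad f ` cball x0 R1)"
      by (intro compact_imp_bounded compact_continuous_image compact_cball)
    then obtain L where L: "L > 0" "\<forall>v\<in>grad f ` cball x0 R1. norm v \<le> L"
      unfolding bounded_pos by blast
    have "norm (f y - f z) \<le> L * norm (y - z)" if "y \<in> cball x0 R1" "z \<in> cball x0 R1" for y z
    proof (rule differentiable_bound[OF convex_cball _ _ that])
      fix x assume x: "x \<in> cball x0 R1"
      then have "x \<in> U \<inter> W" using R1(2) by blast
      then show "(f has_derivative (\<lambda>h. grad f x \<bullet> h)) (at x within cball x0 R1)"
        by (rule has_derivative_at_withinI[OF has_derivative_grad[OF smooth_on_differentiable[OF fs]]])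
      have "norm (grad f x) \<le> L" using L(2) x by blast
      then show "onorm (\<lambda>h. grad f x \<bullet> h) \<le> L"
      proof (intro onorm_le)
        fix h
        have "norm (grad f x \<bullet> h) \<le> norm (grad f x) * norm h" by (simp add: Cauchy_Schwarz_ineq2)
        also have "\<dots> \<le> L * norm h" using \<open>norm (grad f x) \<le> L\<close> by (rule mult_right_mono) simp
        finally show "norm (grad f x \<bullet> h) \<le> L * norm h" .
      qed
    qed
    then have "\<bar>f y - f z\<bar> \<le> L * norm (y - z)" if "y \<in> cball x0 R1" "z \<in> cball x0 R1" for y z
      using that by simp
    then show ?thesis by (rule that[OF _ less_imp_le[OF L(1)]])
  qed
  \<comment> \<open>A point within \<open>R1 / 2\<close> of \<open>x0\<close> can follow
    \<open>p\<close> for the time \<open>T\<close> without leaving \<open>cball x0 R1\<close>. The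
    radius \<open>R2\<close> is then chosen such that the boundary is reached before that
    time.\<close>
  define T where "T = R1 / (2 * norm p)"
  have T: "T > 0" "T * norm p = R1 / 2" using p R1(1) by (auto simp: T_def)
  have \<rho>c: "continuous_on U \<rho>" by (rule smooth_on_continuous[OF U(3)])
  have "open (U \<inter> \<rho> -` {- (T * (norm p)\<^sup>2 / 2)<..})"
    by (rule continuous_open_preimage[OF \<rho>c U(1) open_greaterThan])
  moreover have "x0 \<in> U \<inter> \<rho> -` {- (T * (norm p)\<^sup>2 / 2)<..}"
  proof -
    have "\<rho> x0 = 0" using U(2,5) x0 by blast
    then show ?thesis using U(2) T(1) p by simp
  qed
  ultimately obtain R2 where R2: "R2 > 0" "cball x0 R2 \<subseteq> U \<inter> \<rho> -` {- (T * (norm p)\<^sup>2 / 2)<..}"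
    using open_contains_cball by blast
  define R where "R = min R2 (R1 / 2)"
  have R: "R > 0" "R \<le> R2" "R \<le> R1 / 2" using R1(1) R2(1) by (auto simp: R_def)
  have main: "\<bar>f y\<bar> \<le> (L * 2 / norm p) * \<bar>\<rho> y\<bar>" if y: "y \<in> \<Omega>" "y \<in> cball x0 R" for y
  proof -
    have yU: "y \<in> U" using y(2) R(2) R2(2) by auto
    have yneg: "\<rho> y < 0" using U(4) y(1) yU by blast
    have "y \<in> cball x0 R2" using y(2) R(2) by simp
    then have ylow: "\<rho> y > - (T * (norm p)\<^sup>2 / 2)" using R2(2) by blast
    \<comment> \<open>At the rate \<open>(norm p)\<^sup>2 / 2\<close> this time suffices to raise
      \<open>\<rho>\<close> from \<open>\<rho> y\<close> to 0. The path therefore meets the boundary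
      within distance \<open>2 * \<bar>\<rho> y\<bar> / norm p\<close>; there \<open>f\<close>
      vanishes, and its Lipschitz bound gives the estimate.\<close>
    define t where "t = 2 * \<bar>\<rho> y\<bar> / (norm p)\<^sup>2"
    have t: "t > 0" "t < T" using yneg ylow p by (auto simp: t_def field_simps)
    have inb: "y + s *\<^sub>R p \<in> cball x0 R1" if s: "0 \<le> s" "s \<le> t" for s
    proof -
      have "norm (s *\<^sub>R p) \<le> T * norm p" using s t by (simp add: mult_right_mono)
      then have "norm (s *\<^sub>R p) \<le> R1 / 2" using T(2) by simp
      moreover have "dist x0 y \<le> R1 / 2" using y(2) R(3) by simp
      moreover have "dist x0 (y + s *\<^sub>R p) \<le> dist x0 y + norm (s *\<^sub>R p)"
        using dist_triangle[of x0 "y + s *\<^sub>R p" y] by (simp add: dist_norm)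
      ultimately show ?thesis by simp
    qed
    have der: "((\<lambda>s. \<rho> (y + s *\<^sub>R p)) has_field_derivative grad \<rho> (y + s *\<^sub>R p) \<bullet> p) (at s)" if s: "0 \<le> s" "s \<le> t" for s
    proof -
      have "y + s *\<^sub>R p \<in> U" using inb[OF s] R1(2) by blast
      then have 1: "(\<rho> has_derivative (\<lambda>h. grad \<rho> (y + s *\<^sub>R p) \<bullet> h)) (at (y + s *\<^sub>R p))"
        by (rule has_derivative_grad[OF smooth_on_differentiable[OF U(3)]])
      have "((\<lambda>s. y + s *\<^sub>R p) has_derivative (\<lambda>h. h *\<^sub>R p)) (at s)"
        by (auto intro!: derivative_eq_intros)
      then have "((\<lambda>s. \<rho> (y + s *\<^sub>R p)) has_derivative (\<lambda>h. grad \<rho> (y + s *\<^sub>R p) \<bullet> (h *\<^sub>R p))) (at s)"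
        using 1 by (rule has_derivative_compose)
      then show ?thesis unfolding has_field_derivative_def by (simp add: mult.commute[of _ "_ \<bullet> p"])
    qed
    obtain z where z: "0 < z" "z < t" "\<rho> (y + t *\<^sub>R p) - \<rho> (y + 0 *\<^sub>R p) = (t - 0) * (grad \<rho> (y + z *\<^sub>R p) \<bullet> p)"
      using MVT2[OF t(1), of "\<lambda>s. \<rho> (y + s *\<^sub>R p)" "\<lambda>s. grad \<rho> (y + s *\<^sub>R p) \<bullet> p", OF der] by blast
    have "y + z *\<^sub>R p \<in> cball x0 R1" using inb z by simp
    then have "(norm p)\<^sup>2 / 2 \<le> grad \<rho> (y + z *\<^sub>R p) \<bullet> p" using R1(2) by fastforce
    then have "t * ((norm p)\<^sup>2 / 2) \<le> t * (grad \<rho> (y + z *\<^sub>R p) \<bullet> p)" using t(1) by simp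
    moreover have "t * ((norm p)\<^sup>2 / 2) = \<bar>\<rho> y\<bar>" using p by (simp add: t_def)
    ultimately have end_nonneg: "\<rho> (y + t *\<^sub>R p) \<ge> 0" using z(3) yneg by simp
    have "\<exists>s\<ge>0. s \<le> t \<and> \<rho> (y + s *\<^sub>R p) = 0"
    proof (rule IVT')
      show "continuous_on {0..t} (\<lambda>s. \<rho> (y + s *\<^sub>R p))"
        using DERIV_isCont[OF der] by (intro continuous_at_imp_continuous_on) auto
    qed (use yneg end_nonneg t in auto)
    then obtain s where s: "0 \<le> s" "s \<le> t" "\<rho> (y + s *\<^sub>R p) = 0" by blast
    have "y + s *\<^sub>R p \<in> U" using inb[OF s(1,2)] R1(2) by blast
    then have "f (y + s *\<^sub>R p) = 0" using f0 U(5) s(3) by blast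
    then have "\<bar>f y\<bar> \<le> L * norm (s *\<^sub>R p)"
      using L(1)[of y "y + s *\<^sub>R p"] inb[of 0] inb[OF s(1,2)] t(1) by simp
    also have "\<dots> \<le> L * (t * norm p)" using L(2) s by (intro mult_left_mono) (auto intro: mult_right_mono)
    also have "\<dots> = (L * 2 / norm p) * \<bar>\<rho> y\<bar>" using p by (simp add: t_def power2_eq_square)
    finally show ?thesis .
  qed
  have sub: "cball x0 R \<subseteq> U \<inter> W - K" using R1(2) R(3) R1(1) by force
  have C0: "L * 2 / norm p \<ge> 0" using L(2) by simp
  show ?thesis
    by (rule that[OF R(1) sub C0]) (use main in \<open>simp add: f_inner\<close>)
qed

end

section \<open>Integrability of products on a set, and estimates for the boundary cutoff\<close>

lemma grad_sum:
  assumes "finite I" "\<And>i. i \<in> I \<Longrightarrow> f i differentiable (at x)"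
  shows "grad (\<lambda>x. \<Sum>i\<in>I. f i x) x = (\<Sum>i\<in>I. grad (f i) x)"
  using assms
proof (induction I rule: finite_induct)
  case (insert i I)
  have "(\<lambda>x. \<Sum>i\<in>I. f i x) differentiable (at x)"
    using insert by (intro differentiable_sum) auto
  then show ?case using insert by (simp add: grad_add)
qed simp

lemma set_integrable_scaleR_bounded:
  fixes f :: "'a::euclidean_space \<Rightarrow> real" and u :: "'a \<Rightarrow> 'b::euclidean_space"
  assumes u: "set_integrable lebesgue S u" and f: "set_borel_measurable lebesgue S f" "\<And>x. x \<in> S \<Longrightarrow> \<bar>f x\<bar> \<le> B"
  shows "set_integrable lebesgue S (\<lambda>x. f x *\<^sub>R u x)"
proof (rule set_integrable_bound[of _ _ "\<lambda>x. B *\<^sub>R u x"])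
  show "set_integrable lebesgue S (\<lambda>x. B *\<^sub>R u x)" using u by simp
  have "(\<lambda>x. (indicator S x *\<^sub>R f x) *\<^sub>R (indicator S x *\<^sub>R u x)) \<in> borel_measurable lebesgue"
    using f(1) borel_measurable_integrable[OF u[unfolded set_integrable_def]]
    unfolding set_borel_measurable_def by (rule borel_measurable_scaleR)
  moreover have "(\<lambda>x. (indicator S x *\<^sub>R f x) *\<^sub>R (indicator S x *\<^sub>R u x)) = (\<lambda>x. indicator S x *\<^sub>R f x *\<^sub>R u x)"
    by (auto simp: fun_eq_iff indicator_def)
  ultimately show "set_borel_measurable lebesgue S (\<lambda>x. f x *\<^sub>R u x)"
    by (simp only: set_borel_measurable_def)
  have "norm (f x *\<^sub>R u x) \<le> norm (B *\<^sub>R u x)" if "x \<in> S" for x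
    using order_trans[OF f(2)[OF that] abs_ge_self] by (simp add: mult_right_mono)
  then show "AE x in lebesgue. x \<in> S \<longrightarrow> norm (f x *\<^sub>R u x) \<le> norm (B *\<^sub>R u x)" by simp
qed

lemma set_integrable_scaleR_bounded':
  fixes u :: "'a::euclidean_space \<Rightarrow> real" and f :: "'a \<Rightarrow> 'b::euclidean_space"
  assumes u: "set_integrable lebesgue S u" and f: "set_borel_measurable lebesgue S f" "\<And>x. x \<in> S \<Longrightarrow> norm (f x) \<le> B"
  shows "set_integrable lebesgue S (\<lambda>x. u x *\<^sub>R f x)"
proof (rule set_integrable_bound[of _ _ "\<lambda>x. B * u x"])
  show "set_integrable lebesgue S (\<lambda>x. B * u x)" using u by simp
  have "(\<lambda>x. (indicator S x *\<^sub>R u x) *\<^sub>R (indicator S x *\<^sub>R f x)) \<in> borel_measurable lebesgue"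
    using borel_measurable_integrable[OF u[unfolded set_integrable_def]] f(1)
    unfolding set_borel_measurable_def by (rule borel_measurable_scaleR)
  moreover have "(\<lambda>x. (indicator S x *\<^sub>R u x) *\<^sub>R (indicator S x *\<^sub>R f x)) = (\<lambda>x. indicator S x *\<^sub>R u x *\<^sub>R f x)"
    by (auto simp: fun_eq_iff indicator_def)
  ultimately show "set_borel_measurable lebesgue S (\<lambda>x. u x *\<^sub>R f x)"
    by (simp only: set_borel_measurable_def)
  have "norm (u x *\<^sub>R f x) \<le> norm (B * u x)" if "x \<in> S" for x
    using mult_left_mono[OF order_trans[OF f(2)[OF that] abs_ge_self], of "\<bar>u x\<bar>"] by (simp add: abs_mult mult.commute)
  then show "AE x in lebesgue. x \<in> S \<longrightarrow> norm (u x *\<^sub>R f x) \<le> norm (B * u x)" by simp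
qed

lemma set_integrable_inner_bounded:
  fixes f g :: "'a::euclidean_space \<Rightarrow> 'b::euclidean_space"
  assumes g: "set_integrable lebesgue S g" and f: "set_borel_measurable lebesgue S f" "\<And>x. x \<in> S \<Longrightarrow> g x \<noteq> 0 \<Longrightarrow> norm (f x) \<le> B"
  shows "set_integrable lebesgue S (\<lambda>x. g x \<bullet> f x)"
proof (rule set_integrable_bound[of _ _ "\<lambda>x. B *\<^sub>R g x"])
  show "set_integrable lebesgue S (\<lambda>x. B *\<^sub>R g x)" using g by simp
  have "(\<lambda>x. (indicator S x *\<^sub>R g x) \<bullet> (indicator S x *\<^sub>R f x)) \<in> borel_measurable lebesgue"
    using borel_measurable_integrable[OF g[unfolded set_integrable_def]] f(1)
    unfolding set_borel_measurable_def by (rule borel_measurable_inner)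
  moreover have "(\<lambda>x. (indicator S x *\<^sub>R g x) \<bullet> (indicator S x *\<^sub>R f x)) = (\<lambda>x. indicator S x *\<^sub>R (g x \<bullet> f x))"
    by (auto simp: fun_eq_iff indicator_def)
  ultimately show "set_borel_measurable lebesgue S (\<lambda>x. g x \<bullet> f x)"
    by (simp only: set_borel_measurable_def)
  have "norm (g x \<bullet> f x) \<le> norm (B *\<^sub>R g x)" if "x \<in> S" for x
  proof (cases "g x = 0")
    case False
    have "norm (g x \<bullet> f x) \<le> norm (g x) * norm (f x)" by (simp add: Cauchy_Schwarz_ineq2)
    also have "\<dots> \<le> norm (g x) * \<bar>B\<bar>"
      using order_trans[OF f(2)[OF that False] abs_ge_self] by (rule mult_left_mono) simp
    finally show ?thesis by (simp add: mult.commute)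
  qed simp
  then show "AE x in lebesgue. x \<in> S \<longrightarrow> norm (g x \<bullet> f x) \<le> norm (B *\<^sub>R g x)" by simp
qed

lemma set_borel_measurable_continuous_lebesgue:
  fixes f :: "'a::euclidean_space \<Rightarrow> 'b::euclidean_space"
  assumes "S \<in> sets borel" "continuous_on S f"
  shows "set_borel_measurable lebesgue S f"
proof -
  have "(\<lambda>x. indicator S x *\<^sub>R f x) \<in> borel_measurable borel"
    by (rule borel_measurable_continuous_on_indicator[OF assms])
  then show ?thesis unfolding set_borel_measurable_def by (simp add: measurable_completion)
qed

lemma flat_exp_0_le_1: "flat_exp 0 t \<le> 1"
  by (simp add: flat_exp_def)

text \<open>With \<open>z = 1 / (\<tau> - 1)\<close> the left side becomes
  \<open>(z + z\<^sup>2) * exp (- z)\<close>, and the quadratic Taylor bound of the exponential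
  gives the 2. Later \<open>\<tau>\<close> is the depth below the boundary in units of the width of
  the cutoff layer.\<close>

lemma flat_exp_2_bound:
  assumes "\<tau> \<ge> 0" shows "\<tau> * flat_exp 2 (\<tau> - 1) \<le> 2"
proof (cases "\<tau> > 1")
  case True
  define z where "z = 1 / (\<tau> - 1)"
  have z: "z > 0" "\<tau> - 1 = 1 / z" "\<tau> = 1 + 1 / z" using True by (auto simp: z_def)
  have "\<tau> * flat_exp 2 (\<tau> - 1) = (1 + 1 / z) * (exp (- z) / (1 / z)\<^sup>2)"
    unfolding z(2) using z(1) by (simp add: flat_exp_def z(3))
  also have "\<dots> = (z + z\<^sup>2) * exp (- z)"
    using z(1) by (simp add: field_simps power2_eq_square)
  also have "\<dots> \<le> (2 * exp z) * exp (- z)"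
    using exp_lower_Taylor_quadratic[of z] z(1) by (intro mult_right_mono) auto
  also have "\<dots> = 2" by (simp add: exp_minus)
  finally show ?thesis .
qed (simp add: flat_exp_def)

lemma flat_exp_0_tendsto: "(flat_exp 0 \<longlongrightarrow> 1) at_top"
proof (rule Lim_transform_eventually)
  show "((\<lambda>t::real. exp (- 1 / t)) \<longlongrightarrow> 1) at_top" by real_asymp
  show "\<forall>\<^sub>F t in at_top. exp (- 1 / t) = flat_exp 0 t"
    using eventually_gt_at_top[of 0] by eventually_elim (simp add: flat_exp_def)
qed

lemma flat_exp_2_tendsto: "((\<lambda>\<tau>. \<tau> * flat_exp 2 (\<tau> - 1)) \<longlongrightarrow> 0) at_top"
proof (rule Lim_transform_eventually)
  show "((\<lambda>t::real. t * (exp (- 1 / (t - 1)) / (t - 1)\<^sup>2)) \<longlongrightarrow> 0) at_top" by real_asymp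
  show "\<forall>\<^sub>F t in at_top. t * (exp (- 1 / (t - 1)) / (t - 1)\<^sup>2) = t * flat_exp 2 (t - 1)"
    using eventually_gt_at_top[of 1] by eventually_elim (simp add: flat_exp_def)
qed

context interior_weight
begin

text \<open>\<open>K\<close> is a null set and Lebesgue measure is complete, so arbitrary values of
  \<open>f\<close> on \<open>K\<close> do no harm.\<close>

lemma measurable_punctured:
  fixes f :: "real^'n \<Rightarrow> 'b::euclidean_space"
  assumes "continuous_on (\<Omega> - K) f"
  shows "set_borel_measurable lebesgue \<Omega> f"
proof -
  have "(\<Omega> - K) \<in> sets borel" using open_punctured by simp
  from set_borel_measurable_continuous_lebesgue[OF this assms]
  have m: "(\<lambda>x. indicator (\<Omega> - K) x *\<^sub>R f x) \<in> borel_measurable lebesgue"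
    by (simp add: set_borel_measurable_def)
  have "AE x in lebesgue. x \<notin> K" using K(4) by (rule AE_not_in)
  then have "AE x in lebesgue. indicator (\<Omega> - K) x *\<^sub>R f x = indicator \<Omega> x *\<^sub>R f x"
    by eventually_elim (auto simp: indicator_def)
  from borel_measurable_AE[OF m this] show ?thesis by (simp add: set_borel_measurable_def)
qed

lemma flux_measurable: "set_borel_measurable lebesgue \<Omega> flux"
  by (rule measurable_punctured[OF continuous_on_subset[OF flux_continuous punctured_subset]])

lemma weight_measurable: "set_borel_measurable lebesgue \<Omega> e"
  by (rule measurable_punctured[OF continuous_on_subset[OF smooth_on_continuous[OF e] punctured_subset]])

lemma bounded_away:
  fixes f :: "real^'n \<Rightarrow> 'b::euclidean_space"
  assumes f: "continuous_on W f" and s: "s > 0"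
  obtains P where "P > 0" "\<And>x. x \<in> \<Omega> \<Longrightarrow> infdist x K \<ge> s \<Longrightarrow> norm (f x) \<le> P"
proof -
  let ?S = "closure \<Omega> \<inter> {x. infdist x K \<ge> s}"
  have "compact ?S"
    by (intro compact_Int_closed compact_closure_dom closed_Collect_le continuous_intros)
  moreover have "?S \<subseteq> W" using W(2) s by auto
  ultimately have "bounded (f ` ?S)"
    by (intro compact_imp_bounded compact_continuous_image continuous_on_subset[OF f])
  then obtain P where P: "P > 0" "\<forall>y\<in>f ` ?S. norm y \<le> P" unfolding bounded_pos by blast
  have "norm (f x) \<le> P" if "x \<in> \<Omega>" "infdist x K \<ge> s" for x
    using P(2) that closure_subset[of \<Omega>] by blast
  then show ?thesis by (rule that[OF P(1)])
qed

lemma weak_form_integrable: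
  assumes w: "set_integrable lebesgue \<Omega> w" and g: "set_integrable lebesgue \<Omega> g"
    and P: "\<And>x. x \<in> \<Omega> \<Longrightarrow> w x \<noteq> 0 \<or> g x \<noteq> 0 \<Longrightarrow> norm (flux x) \<le> P \<and> \<bar>e x\<bar> \<le> P"
  shows "integrable lebesgue (\<lambda>x. indicator \<Omega> x * (g x \<bullet> flux x + e x * w x))"
proof -
  have "set_integrable lebesgue \<Omega> (\<lambda>x. g x \<bullet> flux x)"
    by (rule set_integrable_inner_bounded[OF g flux_measurable]) (use P in blast)
  moreover have "set_integrable lebesgue \<Omega> (\<lambda>x. w x \<bullet> e x)"
    by (rule set_integrable_inner_bounded[OF w weight_measurable, of P]) (use P in auto)
  ultimately have "set_integrable lebesgue \<Omega> (\<lambda>x. g x \<bullet> flux x + w x \<bullet> e x)"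
    by (rule set_integral_add(1))
  then show ?thesis by (simp add: set_integrable_def mult.commute)
qed

text \<open>The weak form for pairs that vanish outside \<open>X\<close>, in a shape that a
  partition of unity can assemble. No boundary values are imposed on \<open>w\<close>, which is the
  Neumann character of the problem.\<close>

definition weak_form_on :: "(real^'n) set \<Rightarrow> bool" where
  "weak_form_on X \<longleftrightarrow> (\<forall>w g. has_weak_gradient (\<Omega> - K) w g \<and> set_integrable lebesgue \<Omega> w \<and> set_integrable lebesgue \<Omega> g \<and>
      (\<forall>x\<in>\<Omega>. x \<notin> X \<longrightarrow> w x = 0 \<and> g x = 0) \<longrightarrow>
      (LINT x|lebesgue. indicator \<Omega> x * (g x \<bullet> flux x + e x * w x)) = 0)"

lemma weak_form_interior_ball:
  assumes "cball x0 r \<subseteq> \<Omega> - K"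
  shows "weak_form_on (ball x0 r)"
  unfolding weak_form_on_def
proof (intro allI impI, elim conjE)
  fix w g assume w: "has_weak_gradient (\<Omega> - K) w g"
    and 0: "\<forall>x\<in>\<Omega>. x \<notin> ball x0 r \<longrightarrow> w x = 0 \<and> g x = 0"
  let ?C = "cball x0 r"
  define w' where "w' x = (if x \<in> ?C then w x else 0)" for x
  define g' where "g' x = (if x \<in> ?C then g x else 0)" for x
  have eq: "w' x = w x" "g' x = g x" if "x \<in> \<Omega>" for x
    using 0 that by (auto simp: w'_def g'_def)
  have w': "has_weak_gradient (\<Omega> - K) w' g'"
    by (rule has_weak_gradient_cong_AE[OF w]) (auto simp: eq)
  have w'0: "w' x = 0" "g' x = 0" if "x \<notin> ?C" for x using that by (auto simp: w'_def g'_def)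
  have "(LINT x|lebesgue. g' x \<bullet> flux x + e x * w' x) = 0"
    using weak_form_interior[OF has_weak_gradient_extend(1)[OF open_punctured w' compact_cball assms w'0] compact_cball assms w'0]
    by blast
  moreover have "(\<lambda>x. g' x \<bullet> flux x + e x * w' x) = (\<lambda>x. indicator \<Omega> x * (g x \<bullet> flux x + e x * w x))"
  proof
    fix x
    show "g' x \<bullet> flux x + e x * w' x = indicator \<Omega> x * (g x \<bullet> flux x + e x * w x)"
    proof (cases "x \<in> \<Omega>")
      case False
      then have "x \<notin> ?C" using assms by blast
      then show ?thesis using False w'0 by simp
    qed (simp add: eq)
  qed
  ultimately show "(LINT x|lebesgue. indicator \<Omega> x * (g x \<bullet> flux x + e x * w x)) = 0" by simp
qed

text \<open>The pair is multiplied by a cutoff vanishing in a layer of width about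
  \<open>1 / \<kappa>\<close> along the boundary, which reduces the claim to the interior. The
  gradient of the cutoff is of size \<open>\<kappa>\<close>, but it is parallel to
  \<open>grad \<rho>\<close>, so only the normal part of the flux meets it, and that is at most
  \<open>C * \<bar>\<rho>\<bar>\<close>. In terms of
  \<open>\<tau> = \<kappa> * \<bar>\<rho>\<bar>\<close> the product is at most
  \<open>C * (\<tau> * flat_exp 2 (\<tau> - 1))\<close>: bounded for all \<open>\<kappa>\<close>,
  and tending to 0 at each point as \<open>\<kappa>\<close> grows.\<close>

lemma weak_form_boundary_ball:
  assumes x0: "x0 \<in> frontier \<Omega>"
  shows "\<exists>r>0. weak_form_on (ball x0 r)"
proof -
  obtain U \<rho> where ldf: "local_defining_function \<Omega> x0 U \<rho>"
    using dom x0 unfolding smooth_bounded_domain_def by blast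
  have U: "open U" "smooth_on U \<rho>" "\<Omega> \<inter> U = {y\<in>U. \<rho> y < 0}"
    using ldf unfolding local_defining_function_def by blast+
  obtain R C where R: "R > 0" "cball x0 R \<subseteq> U \<inter> W - K" and C: "C \<ge> 0"
    "\<And>y. y \<in> \<Omega> \<Longrightarrow> y \<in> cball x0 R \<Longrightarrow> \<bar>grad \<rho> y \<bullet> flux y\<bar> \<le> C * \<bar>\<rho> y\<bar>"
    by (rule normal_flux_bound[OF x0 ldf]) blast
  have cW: "cball x0 R \<subseteq> W" and cU: "cball x0 R \<subseteq> U" using R(2) by blast+
  obtain P1 where P1: "\<And>y. y \<in> cball x0 R \<Longrightarrow> norm (flux y) \<le> P1"
    using compact_imp_bounded[OF compact_continuous_image[OF continuous_on_subset[OF flux_continuous cW] compact_cball]]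
    unfolding bounded_iff by blast
  obtain P2 where P2: "\<And>y. y \<in> cball x0 R \<Longrightarrow> norm (e y) \<le> P2"
    using compact_imp_bounded[OF compact_continuous_image[OF continuous_on_subset[OF smooth_on_continuous[OF e] cW] compact_cball]]
    unfolding bounded_iff by blast
  have "weak_form_on (ball x0 (R / 2))"
    unfolding weak_form_on_def
  proof (intro allI impI, elim conjE)
    fix w g assume w: "has_weak_gradient (\<Omega> - K) w g" and wi: "set_integrable lebesgue \<Omega> w" and gi: "set_integrable lebesgue \<Omega> g"
      and 0: "\<forall>x\<in>\<Omega>. x \<notin> ball x0 (R / 2) \<longrightarrow> w x = 0 \<and> g x = 0"
    define D where "D = \<Omega> \<inter> ball x0 R"
    have DR: "D \<subseteq> cball x0 R" by (auto simp: D_def)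
    have "open D" using open_dom by (auto simp: D_def intro!: open_Int)
    moreover have "D \<subseteq> \<Omega> - K" using DR R(2) by (auto simp: D_def)
    ultimately have D: "open D" "D \<subseteq> \<Omega> - K" "D \<subseteq> U"
      using DR R(2) by blast+
    define \<kappa> where "\<kappa> k = real (Suc k)" for k
    have \<kappa>: "\<kappa> k > 0" for k by (simp add: \<kappa>_def)
    \<comment> \<open>A compact subset of the domain outside which the cutoff pair vanishes, so that
      the interior case applies to it.\<close>
    define Z where "Z k = cball x0 (R / 2) \<inter> \<rho> -` {.. - 1 / \<kappa> k}" for k
    have cU2: "cball x0 (R / 2) \<subseteq> U" using cU R(1) by (force intro: order_trans)
    have ZD: "Z k \<subseteq> D" for k
    proof
      fix y assume "y \<in> Z k"
      then have y: "y \<in> cball x0 (R / 2)" "\<rho> y \<le> - 1 / \<kappa> k" by (auto simp: Z_def)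
      have "\<rho> y < 0" using y(2) \<kappa>[of k] by (smt (verit) divide_neg_pos)
      then have "y \<in> \<Omega>" using y(1) cU2 U(3) by blast
      then show "y \<in> D" using y(1) R(1) by (auto simp: D_def)
    qed
    have Zc: "compact (Z k)" for k
    proof -
      have "closed (Z k)" unfolding Z_def
        by (rule continuous_closed_preimage[OF continuous_on_subset[OF smooth_on_continuous[OF U(2)] cU2] closed_cball closed_atMost])
      moreover have "bounded (Z k)" using bounded_subset[OF bounded_cball[of x0 "R / 2"]] by (auto simp: Z_def)
      ultimately show ?thesis by (simp add: compact_eq_bounded_closed)
    qed
    \<comment> \<open>As \<open>\<rho>\<close> is negative inside, the argument is
      \<open>\<tau> - 1\<close> with \<open>\<tau> = \<kappa> * \<bar>\<rho>\<bar>\<close>. The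
      shift by one makes the cutoff vanish for \<open>\<tau> \<le> 1\<close>, and thus already at a
      positive depth.\<close>
    define \<eta> where "\<eta> k y = flat_exp 0 (- \<kappa> k * \<rho> y - 1)" for k y
    have \<eta>s: "smooth_on U (\<eta> k)" for k
      unfolding \<eta>_def
      by (rule smooth_on_compose[OF U(1) _ subset_UNIV Ck1_on_flat_exp])
        (intro smooth_on_diff smooth_on_mult smooth_on_const U(1,2))
    have \<eta>g: "grad (\<eta> k) y = (- \<kappa> k * flat_exp 2 (- \<kappa> k * \<rho> y - 1)) *\<^sub>R grad \<rho> y" if "y \<in> U" for k y
    proof -
      have d\<rho>: "\<rho> differentiable (at y)" by (rule smooth_on_differentiable[OF U(2) that])
      have 1: "((\<lambda>y. - \<kappa> k * \<rho> y - 1) has_derivative (\<lambda>h. (- \<kappa> k *\<^sub>R grad \<rho> y) \<bullet> h)) (at y)"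
        by (auto intro!: derivative_eq_intros has_derivative_grad d\<rho>)
      then have "(\<lambda>y. - \<kappa> k * \<rho> y - 1) differentiable (at y)" by (auto simp: differentiable_def)
      from grad_compose[OF this flat_exp_deriv[of 0]]
      show ?thesis unfolding \<eta>_def grad_unique[OF 1] by (simp add: mult.commute numeral_2_eq_2)
    qed
    have \<eta>0: "\<eta> k y = 0" "grad (\<eta> k) y = 0" if "y \<in> U" "\<rho> y > - 1 / \<kappa> k" for k y
    proof -
      have "- \<kappa> k * \<rho> y - 1 \<le> 0" using that(2) \<kappa>[of k] by (simp add: field_simps)
      then show "\<eta> k y = 0" "grad (\<eta> k) y = 0" unfolding \<eta>g[OF that(1)] by (simp_all add: \<eta>_def flat_exp_def)
    qed
    define w' where "w' k y = (if y \<in> Z k then \<eta> k y * w y else 0)" for k y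
    define g' where "g' k y = (if y \<in> Z k then \<eta> k y *\<^sub>R g y + w y *\<^sub>R grad (\<eta> k) y else 0)" for k y
    have eq: "w' k y = \<eta> k y * w y" "g' k y = \<eta> k y *\<^sub>R g y + w y *\<^sub>R grad (\<eta> k) y" if "y \<in> D" for k y
    proof -
      have "w' k y = \<eta> k y * w y \<and> g' k y = \<eta> k y *\<^sub>R g y + w y *\<^sub>R grad (\<eta> k) y"
      proof (cases "y \<in> Z k")
        case False
        have y: "y \<in> \<Omega>" "y \<in> U" using that D(2,3) by blast+
        show ?thesis
        proof (cases "y \<in> ball x0 (R / 2)")
          case True
          then have "\<rho> y > - 1 / \<kappa> k" using False by (auto simp: Z_def)
          from \<eta>0[OF y(2) this] show ?thesis using False by (simp add: w'_def g'_def)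
        next
          case ny: False
          then have "w y = 0" "g y = 0" using 0 y(1) by blast+
          then show ?thesis using False by (simp add: w'_def g'_def)
        qed
      qed (simp add: w'_def g'_def)
      then show "w' k y = \<eta> k y * w y" "g' k y = \<eta> k y *\<^sub>R g y + w y *\<^sub>R grad (\<eta> k) y" by blast+
    qed
    have "has_weak_gradient D (\<lambda>x. \<eta> k x * w x) (\<lambda>x. \<eta> k x *\<^sub>R g x + w x *\<^sub>R grad (\<eta> k) x)" for k
      by (rule has_weak_gradient_mult[OF D(1) has_weak_gradient_mono[OF w D(2)] smooth_on_subset[OF \<eta>s D(3)]])
    from this have wD: "has_weak_gradient D (w' k) (g' k)" for k
      by (rule has_weak_gradient_cong_AE[where u = "\<lambda>x. \<eta> k x * w x" and g = "\<lambda>x. \<eta> k x *\<^sub>R g x + w x *\<^sub>R grad (\<eta> k) x"]) (simp_all add: eq)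
    have w'0: "w' k x = 0" "g' k x = 0" if "x \<notin> Z k" for k x using that by (auto simp: w'_def g'_def)
    note wf = weak_form_interior[OF has_weak_gradient_extend(1)[OF D(1) wD Zc ZD w'0] Zc order_trans[OF ZD D(2)] w'0]
    let ?F = "\<lambda>x. indicator \<Omega> x * (g x \<bullet> flux x + e x * w x)"
    define P where "P = \<bar>P1\<bar> + \<bar>P2\<bar> + 2 * C"
    have P: "norm (flux y) \<le> P" "\<bar>e y\<bar> \<le> P" if "y \<in> cball x0 R" for y
      using P1[OF that] P2[OF that] C(1) by (auto simp: P_def)
    have P0: "P \<ge> 0" using C(1) by (simp add: P_def)
    have dom_pt: "norm (g' k x \<bullet> flux x + e x * w' k x) \<le> indicator \<Omega> x * (P * norm (g x) + 2 * P * \<bar>w x\<bar>)" for k x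
    proof (cases "x \<in> D")
      case True
      have x: "x \<in> \<Omega>" "x \<in> U" "x \<in> cball x0 R" using True D(2,3) by (auto simp: D_def)
      have \<rho>x: "\<rho> x < 0" using x U(3) by blast
      define \<tau> where "\<tau> = \<kappa> k * \<bar>\<rho> x\<bar>"
      have \<tau>: "\<tau> \<ge> 0" using \<kappa>[of k] by (simp add: \<tau>_def)
      have \<tau>': "- \<kappa> k * \<rho> x - 1 = \<tau> - 1" using \<rho>x by (simp add: \<tau>_def)
      have \<eta>1: "0 \<le> \<eta> k x" "\<eta> k x \<le> 1" by (simp_all add: \<eta>_def flat_exp_nonneg flat_exp_0_le_1)
      have "\<bar>grad (\<eta> k) x \<bullet> flux x\<bar> = \<kappa> k * flat_exp 2 (\<tau> - 1) * \<bar>grad \<rho> x \<bullet> flux x\<bar>"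
        unfolding \<eta>g[OF x(2)] \<tau>' using \<kappa>[of k] by (simp add: abs_mult flat_exp_nonneg)
      also have "\<dots> \<le> \<kappa> k * flat_exp 2 (\<tau> - 1) * (C * \<bar>\<rho> x\<bar>)"
        using C(2)[OF x(1,3)] \<kappa>[of k] by (intro mult_left_mono mult_nonneg_nonneg flat_exp_nonneg) auto
      also have "\<dots> = C * (\<tau> * flat_exp 2 (\<tau> - 1))" by (simp add: \<tau>_def)
      also have "\<dots> \<le> C * 2" using C(1) flat_exp_2_bound[OF \<tau>] by (rule mult_left_mono[rotated])
      also have "\<dots> \<le> P" by (simp add: P_def)
      finally have b3: "\<bar>grad (\<eta> k) x \<bullet> flux x\<bar> \<le> P" .
      have b1: "\<bar>g x \<bullet> flux x\<bar> \<le> P * norm (g x)"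
      proof -
        have "\<bar>g x \<bullet> flux x\<bar> \<le> norm (g x) * norm (flux x)" by (rule Cauchy_Schwarz_ineq2)
        also have "\<dots> \<le> norm (g x) * P" by (rule mult_left_mono[OF P(1)[OF x(3)]]) simp
        finally show ?thesis by (simp add: mult.commute)
      qed
      have b2: "\<bar>e x * w x\<bar> \<le> P * \<bar>w x\<bar>" unfolding abs_mult by (rule mult_right_mono[OF P(2)[OF x(3)]]) simp
      have b4: "\<bar>w x * (grad (\<eta> k) x \<bullet> flux x)\<bar> \<le> P * \<bar>w x\<bar>"
        unfolding abs_mult using mult_left_mono[OF b3, of "\<bar>w x\<bar>"] by (simp add: mult.commute)
      have "g' k x \<bullet> flux x + e x * w' k x = \<eta> k x * (g x \<bullet> flux x) + \<eta> k x * (e x * w x) + w x * (grad (\<eta> k) x \<bullet> flux x)"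
        unfolding eq[OF True] by (simp add: inner_add_left)
      then have "\<bar>g' k x \<bullet> flux x + e x * w' k x\<bar> \<le> \<bar>\<eta> k x * (g x \<bullet> flux x)\<bar> + \<bar>\<eta> k x * (e x * w x)\<bar> + \<bar>w x * (grad (\<eta> k) x \<bullet> flux x)\<bar>"
        by linarith
      also have "\<dots> \<le> \<bar>g x \<bullet> flux x\<bar> + \<bar>e x * w x\<bar> + P * \<bar>w x\<bar>"
        using \<eta>1 b4 by (intro add_mono) (simp_all add: abs_mult mult_left_le_one_le)
      also have "\<dots> \<le> P * norm (g x) + P * \<bar>w x\<bar> + P * \<bar>w x\<bar>" using b1 b2 by simp
      finally show ?thesis using x(1) by simp
    next
      case False
      then have "x \<notin> Z k" using ZD by blast
      then show ?thesis using P0 by (simp add: w'0)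
    qed
    have conv_pt: "(\<lambda>k. g' k x \<bullet> flux x + e x * w' k x) \<longlonglongrightarrow> ?F x" for x
    proof (cases "x \<in> D")
      case True
      have x: "x \<in> \<Omega>" "x \<in> U" "x \<in> cball x0 R" using True D(2,3) by (auto simp: D_def)
      have \<rho>x: "\<rho> x < 0" using x U(3) by blast
      have lim: "filterlim (\<lambda>k. \<kappa> k * \<bar>\<rho> x\<bar>) at_top sequentially"
        unfolding \<kappa>_def using \<rho>x by real_asymp
      have \<tau>': "- \<kappa> k * \<rho> x - 1 = \<kappa> k * \<bar>\<rho> x\<bar> - 1" for k using \<rho>x by simp
      have lim1: "filterlim (\<lambda>k. \<kappa> k * \<bar>\<rho> x\<bar> - 1) at_top sequentially"
        unfolding \<kappa>_def using \<rho>x by real_asymp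
      have L1: "(\<lambda>k. \<eta> k x) \<longlonglongrightarrow> 1"
        unfolding \<eta>_def \<tau>' by (rule filterlim_compose[OF flat_exp_0_tendsto lim1])
      have "(\<lambda>k. (\<kappa> k * \<bar>\<rho> x\<bar>) * flat_exp 2 (\<kappa> k * \<bar>\<rho> x\<bar> - 1)) \<longlonglongrightarrow> 0"
        by (rule filterlim_compose[OF flat_exp_2_tendsto lim])
      from tendsto_mult_left[OF this, of "- (grad \<rho> x \<bullet> flux x) / \<bar>\<rho> x\<bar>"]
      have L2: "(\<lambda>k. grad (\<eta> k) x \<bullet> flux x) \<longlonglongrightarrow> 0"
        unfolding \<eta>g[OF x(2)] \<tau>' using \<rho>x by (simp add: mult_ac)
      have "(\<lambda>k. \<eta> k x * (g x \<bullet> flux x) + e x * (\<eta> k x * w x) + w x * (grad (\<eta> k) x \<bullet> flux x))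
          \<longlonglongrightarrow> 1 * (g x \<bullet> flux x) + e x * (1 * w x) + w x * 0"
        by (intro tendsto_intros L1 L2)
      then show ?thesis unfolding eq[OF True] using x(1) by (simp add: inner_add_left add_ac)
    next
      case False
      then have "x \<notin> Z k" for k using ZD by blast
      then have 1: "g' k x \<bullet> flux x + e x * w' k x = 0" for k by (simp add: w'0)
      have 2: "?F x = 0"
      proof (cases "x \<in> \<Omega>")
        case True
        then have "x \<notin> ball x0 (R / 2)" using False R(1) by (auto simp: D_def)
        then show ?thesis using 0 True by simp
      qed simp
      show ?thesis unfolding 1 2 by (rule tendsto_const)
    qed
    have Fi: "integrable lebesgue ?F"
    proof (rule weak_form_integrable[OF wi gi])
      fix x assume x: "x \<in> \<Omega>" "w x \<noteq> 0 \<or> g x \<noteq> 0"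
      then have "x \<in> ball x0 (R / 2)" using 0 by blast
      then have "x \<in> cball x0 R" using R(1) by simp
      then show "norm (flux x) \<le> P \<and> \<bar>e x\<bar> \<le> P" using P by blast
    qed
    have "(\<lambda>k. LINT x|lebesgue. g' k x \<bullet> flux x + e x * w' k x) \<longlonglongrightarrow> (LINT x|lebesgue. ?F x)"
    proof (rule integral_dominated_convergence)
      show "?F \<in> borel_measurable lebesgue" using Fi by (rule borel_measurable_integrable)
      show "(\<lambda>x. g' k x \<bullet> flux x + e x * w' k x) \<in> borel_measurable lebesgue" for k
        using wf by (intro borel_measurable_integrable) blast
      show "integrable lebesgue (\<lambda>x. indicator \<Omega> x * (P * norm (g x) + 2 * P * \<bar>w x\<bar>))"
      proof -
        have "set_integrable lebesgue \<Omega> (\<lambda>x. P * norm (g x) + 2 * P * \<bar>w x\<bar>)"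
          using set_integrable_norm[OF gi] set_integrable_norm[OF wi]
          by (intro set_integral_add(1)) simp_all
        then show ?thesis by (simp add: set_integrable_def)
      qed
      show "AE x in lebesgue. (\<lambda>k. g' k x \<bullet> flux x + e x * w' k x) \<longlonglongrightarrow> ?F x"
        using conv_pt by (intro AE_I2)
      show "AE x in lebesgue. norm (g' k x \<bullet> flux x + e x * w' k x) \<le> indicator \<Omega> x * (P * norm (g x) + 2 * P * \<bar>w x\<bar>)" for k
        using dom_pt by (intro AE_I2)
    qed
    moreover have "(LINT x|lebesgue. g' k x \<bullet> flux x + e x * w' k x) = 0" for k using wf by blast
    ultimately show "(LINT x|lebesgue. ?F x) = 0" by (simp add: LIMSEQ_const_iff)
  qed
  then show ?thesis using R(1) by (intro exI[of _ "R / 2"]) simp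
qed

text \<open>A partition of unity subordinate to a finite cover of \<open>closure \<Omega>\<close>
  splits the pair into local ones. The cutoff functions sum to 1 and their gradients to 0 on
  \<open>\<Omega>\<close>, so the local pairs add up to the given one and each contributes
  zero.\<close>

theorem weak_form:
  assumes w: "has_weak_gradient (\<Omega> - K) w g" and wi: "set_integrable lebesgue \<Omega> w" and gi: "set_integrable lebesgue \<Omega> g"
    and s: "s > 0" "\<And>x. x \<in> \<Omega> \<Longrightarrow> infdist x K < s \<Longrightarrow> w x = 0 \<and> g x = 0"
  shows "integrable lebesgue (\<lambda>x. indicator \<Omega> x * (g x \<bullet> flux x + e x * w x))"
    and "(LINT x|lebesgue. indicator \<Omega> x * (g x \<bullet> flux x + e x * w x)) = 0"
proof -
  obtain P1 where P1: "\<And>x. x \<in> \<Omega> \<Longrightarrow> infdist x K \<ge> s \<Longrightarrow> norm (flux x) \<le> P1"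
    by (rule bounded_away[OF flux_continuous s(1)]) blast
  obtain P2 where P2: "\<And>x. x \<in> \<Omega> \<Longrightarrow> infdist x K \<ge> s \<Longrightarrow> norm (e x) \<le> P2"
    by (rule bounded_away[OF smooth_on_continuous[OF e] s(1)]) blast
  have int: "integrable lebesgue (\<lambda>x. indicator \<Omega> x * (g1 x \<bullet> flux x + e x * w1 x))"
    if "set_integrable lebesgue \<Omega> w1" "set_integrable lebesgue \<Omega> g1"
      "\<And>x. x \<in> \<Omega> \<Longrightarrow> infdist x K < s \<Longrightarrow> w1 x = 0 \<and> g1 x = 0" for w1 g1
  proof (rule weak_form_integrable[OF that(1,2)])
    fix x assume "x \<in> \<Omega>" "w1 x \<noteq> 0 \<or> g1 x \<noteq> 0"
    then have "x \<in> \<Omega>" "infdist x K \<ge> s" using that(3)[of x] by (auto simp: not_less[symmetric])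
    then show "norm (flux x) \<le> max P1 P2 \<and> \<bar>e x\<bar> \<le> max P1 P2" using P1[of x] P2[of x] by auto
  qed
  show "integrable lebesgue (\<lambda>x. indicator \<Omega> x * (g x \<bullet> flux x + e x * w x))"
    by (rule int[OF wi gi s(2)])
  \<comment> \<open>There are three kinds of balls: inside \<open>\<Omega> - K\<close>, around a
    boundary point, and around a point of \<open>K\<close>. The last get the radius
    \<open>s\<close>; on them the given pair vanishes.\<close>
  have "\<exists>r>0. x \<in> K \<and> r = s \<or> weak_form_on (ball x r)" if x: "x \<in> closure \<Omega>" for x
  proof -
    have "frontier \<Omega> = closure \<Omega> - \<Omega>" by (simp add: frontier_def interior_open[OF open_dom])
    then consider "x \<in> K" | "x \<in> \<Omega> - K" | "x \<in> frontier \<Omega>"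
      using x by blast
    then show ?thesis
    proof cases
      case 1
      then show ?thesis using s(1) by blast
    next
      case 2
      then obtain r where "r > 0" "cball x r \<subseteq> \<Omega> - K"
        using open_punctured open_contains_cball by blast
      then show ?thesis using weak_form_interior_ball by blast
    next
      case 3
      then show ?thesis using weak_form_boundary_ball by blast
    qed
  qed
  then have "\<exists>r. \<forall>x\<in>closure \<Omega>. r x > 0 \<and> (x \<in> K \<and> r x = s \<or> weak_form_on (ball x (r x)))"
    by (intro bchoice) blast
  then obtain r where "\<forall>x\<in>closure \<Omega>. r x > 0 \<and> (x \<in> K \<and> r x = s \<or> weak_form_on (ball x (r x)))" ..
  then have r: "\<And>x. x \<in> closure \<Omega> \<Longrightarrow> r x > 0"
    "\<And>x. x \<in> closure \<Omega> \<Longrightarrow> x \<in> K \<and> r x = s \<or> weak_form_on (ball x (r x))" by blast+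
  have "closure \<Omega> \<subseteq> (\<Union>x\<in>closure \<Omega>. ball x (r x / 2))" using r(1) by force
  then obtain T where T: "T \<subseteq> closure \<Omega>" "finite T" "closure \<Omega> \<subseteq> (\<Union>x\<in>T. ball x (r x / 2))"
    using compactE_image[OF compact_closure_dom, of "closure \<Omega>" "\<lambda>x. ball x (r x / 2)"] by blast
  have rT: "r x > 0" if "x \<in> T" for x using T(1) r(1) that by blast
  \<comment> \<open>With half the radius the bump vanishes outside \<open>cball x (r x / 2)\<close>.
    The complement of the open ball of radius \<open>r x\<close> lies in the open complement of that
    set, so the gradient vanishes there too.\<close>
  define b where "b x = bump x (r x / 2)" for x
  define \<sigma> where "\<sigma> y = (\<Sum>x\<in>T. b x y)" for y
  have bs: "smooth_on X (b x)" if "open X" for x X unfolding b_def by (rule smooth_on_bump[OF that])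
  have \<sigma>s: "smooth_on UNIV \<sigma>" unfolding \<sigma>_def by (intro smooth_on_sum bs open_UNIV)
  define Y where "Y = {y. 0 < \<sigma> y}"
  have Y: "open Y" unfolding Y_def
    by (intro open_Collect_less continuous_on_const smooth_on_continuous[OF \<sigma>s])
  have \<Omega>Y: "closure \<Omega> \<subseteq> Y"
  proof
    fix y assume "y \<in> closure \<Omega>"
    then obtain x where x: "x \<in> T" "y \<in> ball x (r x / 2)" using T(3) by blast
    then have "b x y > 0" unfolding b_def using rT[OF x(1)] by (subst bump_pos_iff) auto
    then have "\<sigma> y > 0" unfolding \<sigma>_def
      using T(2) x(1) by (intro sum_pos2[of T x]) (auto simp: b_def bump_nonneg)
    then show "y \<in> Y" by (simp add: Y_def)
  qed
  define \<theta> where "\<theta> x y = b x y / \<sigma> y" for x y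
  have \<theta>s: "smooth_on Y (\<theta> x)" for x
    unfolding \<theta>_def by (rule smooth_on_divide[OF Y bs[OF Y] smooth_on_subset[OF \<sigma>s subset_UNIV]]) (simp add: Y_def)
  have sum1: "(\<Sum>x\<in>T. \<theta> x y) = 1" if "y \<in> Y" for y
    using that by (simp add: \<theta>_def \<sigma>_def[symmetric] sum_divide_distrib[symmetric] Y_def)
  have \<Omega>Y': "\<Omega> \<subseteq> Y" using \<Omega>Y closure_subset[of \<Omega>] by blast
  have sum0: "(\<Sum>x\<in>T. grad (\<theta> x) y) = 0" if "y \<in> \<Omega>" for y
  proof -
    have yY: "y \<in> Y" using that \<Omega>Y' by blast
    have "(\<Sum>x\<in>T. grad (\<theta> x) y) = grad (\<lambda>y. \<Sum>x\<in>T. \<theta> x y) y"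
      by (rule grad_sum[symmetric, OF T(2)]) (rule smooth_on_differentiable[OF \<theta>s yY])
    also have "\<dots> = grad (\<lambda>_. 1) y" by (rule grad_cong[OF Y yY sum1])
    finally show ?thesis by simp
  qed
  have \<theta>0: "\<theta> x y = 0" "grad (\<theta> x) y = 0" if "x \<in> T" "y \<notin> ball x (r x)" for x y
  proof -
    have z: "\<theta> x y = 0" if "y \<notin> cball x (r x / 2)" for y
      using that bump_eq_0_iff[of "r x / 2" x y] rT[OF \<open>x \<in> T\<close>] by (auto simp: \<theta>_def b_def)
    have yc: "y \<in> - cball x (r x / 2)" using that rT[OF that(1)] by auto
    then show "\<theta> x y = 0" using z by blast
    have "grad (\<theta> x) y = grad (\<lambda>_. 0) y"
      by (rule grad_cong[OF _ yc]) (use z in auto)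
    then show "grad (\<theta> x) y = 0" by simp
  qed
  define w1 where "w1 x y = \<theta> x y * w y" for x y
  define g1 where "g1 x y = \<theta> x y *\<^sub>R g y + w y *\<^sub>R grad (\<theta> x) y" for x y
  have w1: "has_weak_gradient (\<Omega> - K) (w1 x) (g1 x)" for x
    unfolding w1_def g1_def
    by (rule has_weak_gradient_mult[OF open_punctured w smooth_on_subset[OF \<theta>s]]) (use \<Omega>Y' in blast)
  have \<theta>c: "continuous_on Y (\<theta> x)" "continuous_on Y (grad (\<theta> x))" for x
    by (rule smooth_on_continuous[OF \<theta>s], rule smooth_on_continuous_grad[OF \<theta>s])
  have \<theta>m: "set_borel_measurable lebesgue \<Omega> (\<theta> x)" "set_borel_measurable lebesgue \<Omega> (grad (\<theta> x))" for x
    by (rule set_borel_measurable_continuous_lebesgue[OF _ continuous_on_subset[OF \<theta>c(1) \<Omega>Y']], simp add: open_dom,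
        rule set_borel_measurable_continuous_lebesgue[OF _ continuous_on_subset[OF \<theta>c(2) \<Omega>Y']], simp add: open_dom)
  have \<theta>b: "\<exists>B. \<forall>y\<in>\<Omega>. \<bar>\<theta> x y\<bar> \<le> B" "\<exists>B. \<forall>y\<in>\<Omega>. norm (grad (\<theta> x) y) \<le> B" for x
    using compact_imp_bounded[OF compact_continuous_image[OF continuous_on_subset[OF \<theta>c(1) \<Omega>Y] compact_closure_dom], of x]
      compact_imp_bounded[OF compact_continuous_image[OF continuous_on_subset[OF \<theta>c(2) \<Omega>Y] compact_closure_dom], of x]
      closure_subset[of \<Omega>]
    unfolding bounded_iff by (fastforce simp: image_iff)+
  have w1i: "set_integrable lebesgue \<Omega> (w1 x)" for x
  proof -
    obtain B where "\<forall>y\<in>\<Omega>. \<bar>\<theta> x y\<bar> \<le> B" using \<theta>b(1) by blast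
    then have "set_integrable lebesgue \<Omega> (\<lambda>y. \<theta> x y *\<^sub>R w y)"
      by (intro set_integrable_scaleR_bounded[OF wi \<theta>m(1)]) blast
    then show ?thesis by (simp add: w1_def[abs_def])
  qed
  have g1i: "set_integrable lebesgue \<Omega> (g1 x)" for x
  proof -
    obtain B where B: "\<forall>y\<in>\<Omega>. \<bar>\<theta> x y\<bar> \<le> B" using \<theta>b(1) by blast
    obtain B' where B': "\<forall>y\<in>\<Omega>. norm (grad (\<theta> x) y) \<le> B'" using \<theta>b(2) by blast
    have "set_integrable lebesgue \<Omega> (\<lambda>y. \<theta> x y *\<^sub>R g y)"
      using B by (intro set_integrable_scaleR_bounded[OF gi \<theta>m(1)]) blast
    moreover have "set_integrable lebesgue \<Omega> (\<lambda>y. w y *\<^sub>R grad (\<theta> x) y)"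
      using B' by (intro set_integrable_scaleR_bounded'[OF wi \<theta>m(2)]) blast
    ultimately show ?thesis unfolding g1_def by (rule set_integral_add(1))
  qed
  have w1s: "w1 x y = 0 \<and> g1 x y = 0" if "y \<in> \<Omega>" "infdist y K < s" for x y
    using s(2)[OF that] by (simp add: w1_def g1_def)
  have w1b: "w1 x y = 0 \<and> g1 x y = 0" if "x \<in> T" "y \<notin> ball x (r x)" for x y
    using \<theta>0[OF that] by (simp add: w1_def g1_def)
  have z: "(LINT y|lebesgue. indicator \<Omega> y * (g1 x y \<bullet> flux y + e y * w1 x y)) = 0" if x: "x \<in> T" for x
  proof (cases "x \<in> K \<and> r x = s")
    case True
    have "indicator \<Omega> y * (g1 x y \<bullet> flux y + e y * w1 x y) = 0" for y
    proof (cases "y \<in> \<Omega> \<and> y \<in> ball x (r x)")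
      case yb: True
      have "infdist y K \<le> dist y x" using True by (intro infdist_le) blast
      then have "infdist y K < s" using yb True by (simp add: dist_commute)
      then show ?thesis using w1s yb by simp
    next
      case False
      then show ?thesis using w1b[OF x, of y] by (cases "y \<in> \<Omega>") auto
    qed
    then show ?thesis by (simp only: integral_zero)
  next
    case False
    then have "weak_form_on (ball x (r x))" using r(2) T(1) x by blast
    then show ?thesis unfolding weak_form_on_def using w1 w1i g1i w1b[OF x] by blast
  qed
  have "(\<lambda>y. indicator \<Omega> y * (g y \<bullet> flux y + e y * w y)) = (\<lambda>y. \<Sum>x\<in>T. indicator \<Omega> y * (g1 x y \<bullet> flux y + e y * w1 x y))"
  proof
    fix y
    show "indicator \<Omega> y * (g y \<bullet> flux y + e y * w y) = (\<Sum>x\<in>T. indicator \<Omega> y * (g1 x y \<bullet> flux y + e y * w1 x y))"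
    proof (cases "y \<in> \<Omega>")
      case True
      have "(\<Sum>x\<in>T. g1 x y) = (\<Sum>x\<in>T. \<theta> x y) *\<^sub>R g y + w y *\<^sub>R (\<Sum>x\<in>T. grad (\<theta> x) y)"
        by (simp add: g1_def sum.distrib scaleR_sum_left scaleR_sum_right)
      also have "\<dots> = g y" using sum1[of y] sum0[OF True] True \<Omega>Y' by auto
      finally have G: "(\<Sum>x\<in>T. g1 x y) = g y" .
      have "(\<Sum>x\<in>T. w1 x y) = (\<Sum>x\<in>T. \<theta> x y) * w y" by (simp add: w1_def sum_distrib_right)
      then have Wy: "(\<Sum>x\<in>T. w1 x y) = w y" using sum1[of y] True \<Omega>Y' by auto
      have "(\<Sum>x\<in>T. g1 x y \<bullet> flux y + e y * w1 x y) = (\<Sum>x\<in>T. g1 x y) \<bullet> flux y + e y * (\<Sum>x\<in>T. w1 x y)"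
        by (simp add: sum.distrib inner_sum_left sum_distrib_left)
      then show ?thesis using True by (simp add: G Wy)
    qed simp
  qed
  then have "(LINT y|lebesgue. indicator \<Omega> y * (g y \<bullet> flux y + e y * w y))
      = (\<Sum>x\<in>T. LINT y|lebesgue. indicator \<Omega> y * (g1 x y \<bullet> flux y + e y * w1 x y))"
    using int[OF w1i g1i w1s] by (simp add: Bochner_Integration.integral_sum)
  then show "(LINT x|lebesgue. indicator \<Omega> x * (g x \<bullet> flux x + e x * w x)) = 0"
    using z by simp
qed

end

subsection \<open>The logarithmic identity\<close>

text \<open>A bounded smooth substitute \<open>S\<close> for \<open>t\<^sup>2\<close> with \<open>S'\<^sup>2 \<le> 4 S\<close>, as for \<open>t\<^sup>2\<close> itself, so that
  Young's inequality absorbs the cross term into the Hardy term uniformly in \<open>M\<close>.\<close>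

definition trunc_sq :: "real \<Rightarrow> real \<Rightarrow> real" where
  "trunc_sq M t = t\<^sup>2 / (1 + t\<^sup>2 / M\<^sup>2)"

definition trunc_sq' :: "real \<Rightarrow> real \<Rightarrow> real" where
  "trunc_sq' M t = 2 * t / (1 + t\<^sup>2 / M\<^sup>2)\<^sup>2"

lemma trunc_denominator: "1 + t\<^sup>2 / M\<^sup>2 \<ge> (1::real)"
  by simp

lemma trunc_denominator_pos: "1 + t\<^sup>2 / M\<^sup>2 > (0::real)"
  using trunc_denominator[of t M] by linarith

lemma trunc_sq_deriv:
  assumes "M > 0" shows "(trunc_sq M has_field_derivative trunc_sq' M t) (at t)"
proof -
  have p: "1 + t\<^sup>2 / M\<^sup>2 \<noteq> 0" using trunc_denominator[of t M] by linarith
  have 1: "((\<lambda>t. t\<^sup>2) has_field_derivative 2 * t) (at t)" by (auto intro!: derivative_eq_intros)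
  have 2: "((\<lambda>t. 1 + t\<^sup>2 / M\<^sup>2) has_field_derivative 2 * t / M\<^sup>2) (at t)"
    using DERIV_add[OF DERIV_const[of 1] DERIV_cdivide[OF 1, of "M\<^sup>2"]] by simp
  have "(2 * t * (1 + t\<^sup>2 / M\<^sup>2) - t\<^sup>2 * (2 * t / M\<^sup>2)) / ((1 + t\<^sup>2 / M\<^sup>2) * (1 + t\<^sup>2 / M\<^sup>2)) = trunc_sq' M t"
    by (simp add: trunc_sq'_def power2_eq_square algebra_simps)
  with DERIV_divide[OF 1 2 p] show ?thesis
    unfolding trunc_sq_def by simp
qed

lemma trunc_sq'_continuous: "continuous_on UNIV (trunc_sq' M)"
proof -
  have "(1 + t\<^sup>2 * inverse (M\<^sup>2))\<^sup>2 \<noteq> 0" for t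
    using trunc_denominator_pos[of t M] by (simp only: divide_inverse power_not_zero less_imp_neq[symmetric] not_False_eq_True)
  then show ?thesis unfolding trunc_sq'_def divide_inverse[of _ "M\<^sup>2"]
    by (intro continuous_intros) auto
qed

lemma trunc_sq_nonneg: "trunc_sq M t \<ge> 0"
  using trunc_denominator[of t M] by (simp add: trunc_sq_def)

lemma trunc_sq_le: "trunc_sq M t \<le> t\<^sup>2"
  unfolding trunc_sq_def pos_divide_le_eq[OF trunc_denominator_pos]
  using mult_left_mono[OF trunc_denominator[of t M] zero_le_power2[of t]] by simp

lemma trunc_sq_bounded:
  assumes "M > 0" shows "trunc_sq M t \<le> M\<^sup>2"
proof -
  have "t\<^sup>2 \<le> M\<^sup>2 * (1 + t\<^sup>2 / M\<^sup>2)" using assms by (simp add: distrib_left)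
  then show ?thesis unfolding trunc_sq_def pos_divide_le_eq[OF trunc_denominator_pos] .
qed

lemma trunc_sq'_le: "\<bar>trunc_sq' M t\<bar> \<le> 2 * \<bar>t\<bar>"
proof -
  have "1 \<le> (1 + t\<^sup>2 / M\<^sup>2)\<^sup>2" by (rule one_le_power[OF trunc_denominator])
  then have "2 * \<bar>t\<bar> * 1 \<le> 2 * \<bar>t\<bar> * (1 + t\<^sup>2 / M\<^sup>2)\<^sup>2" by (intro mult_left_mono) auto
  then show ?thesis using \<open>1 \<le> (1 + t\<^sup>2 / M\<^sup>2)\<^sup>2\<close> by (simp add: trunc_sq'_def abs_divide abs_mult divide_le_eq)
qed

lemma trunc_sq'_sq: "(trunc_sq' M t)\<^sup>2 \<le> 4 * trunc_sq M t"
proof -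
  define D where "D = 1 + t\<^sup>2 / M\<^sup>2"
  have D: "D \<ge> 1" using trunc_denominator by (simp add: D_def)
  have "(trunc_sq' M t)\<^sup>2 = 4 * (t\<^sup>2 / D) * (1 / D ^ 3)"
    unfolding trunc_sq'_def D_def[symmetric] by (simp add: power_divide power_mult_distrib eval_nat_numeral)
  also have "\<dots> \<le> 4 * (t\<^sup>2 / D) * 1"
    using D one_le_power[OF D, of 3] by (intro mult_left_mono) auto
  finally show ?thesis by (simp add: trunc_sq_def D_def)
qed

lemma trunc_sq'_bounded:
  assumes "M > 0" shows "\<bar>trunc_sq' M t\<bar> \<le> 2 * M"
proof -
  have "(trunc_sq' M t)\<^sup>2 \<le> (2 * M)\<^sup>2"
    using trunc_sq'_sq[of M t] trunc_sq_bounded[OF assms, of t] by (simp add: power_mult_distrib)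
  then show ?thesis using assms abs_le_square_iff[of "trunc_sq' M t" "2 * M"] by simp
qed

lemma trunc_sq_tendsto: "(\<lambda>k. trunc_sq (real (Suc k)) t) \<longlonglongrightarrow> t\<^sup>2"
  unfolding trunc_sq_def by real_asymp

lemma trunc_sq'_tendsto: "(\<lambda>k. trunc_sq' (real (Suc k)) t) \<longlonglongrightarrow> 2 * t"
  unfolding trunc_sq'_def by real_asymp

context interior_weight
begin

section \<open>Integration over the domain\<close>

abbreviation dom_leb :: "(real^'n) measure" where
  "dom_leb \<equiv> lebesgue_on \<Omega>"

lemma integrable_dom_leb:
  fixes f :: "real^'n \<Rightarrow> 'b::{banach, second_countable_topology}"
  shows "integrable dom_leb f \<longleftrightarrow> set_integrable lebesgue \<Omega> f"
  unfolding set_integrable_def by (rule integrable_restrict_space) (simp add: dom_measure)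

lemma LINT_dom_leb:
  fixes f :: "real^'n \<Rightarrow> 'b::{banach, second_countable_topology}"
  shows "(LINT x|dom_leb. f x) = (LINT x:\<Omega>|lebesgue. f x)"
  unfolding set_lebesgue_integral_def by (rule integral_restrict_space) (simp add: dom_measure)

lemma measurable_dom_leb:
  fixes f :: "real^'n \<Rightarrow> 'b::euclidean_space"
  shows "f \<in> borel_measurable dom_leb \<longleftrightarrow> set_borel_measurable lebesgue \<Omega> f"
  unfolding set_borel_measurable_def by (rule borel_measurable_restrict_space_iff) (simp add: dom_measure)

lemma AE_dom_leb: "(AE x in dom_leb. P x) \<longleftrightarrow> (AE x in lebesgue. x \<in> \<Omega> \<longrightarrow> P x)"
  by (rule AE_restrict_space_iff) (simp add: dom_measure)

lemma space_dom_leb [simp]: "space dom_leb = \<Omega>"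
  by (simp add: space_restrict_space)

lemma finite_measure_dom_leb: "finite_measure dom_leb"
  by (rule finite_measureI) (use dom_measure in \<open>simp add: emeasure_restrict_space\<close>)

lemma integrable_const_dom_leb: "integrable dom_leb (\<lambda>x. a::real)"
  by (rule finite_measure.integrable_const[OF finite_measure_dom_leb])

lemma AE_not_singular: "AE x in dom_leb. x \<in> \<Omega> - K"
proof -
  have "AE x in lebesgue. x \<notin> K" using K(4) by (rule AE_not_in)
  then show ?thesis unfolding AE_dom_leb by eventually_elim simp
qed

section \<open>The quadratic form of the coefficients\<close>

definition form :: "real^'n \<Rightarrow> real^'n \<Rightarrow> real^'n \<Rightarrow> real" where
  "form x \<xi> \<eta> = (A x *v \<xi>) \<bullet> \<eta>"

lemma norm_sq_form: "norm_sq A x \<xi> = form x \<xi> \<xi>"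
  by (simp add: norm_sq_def form_def)

lemma form_add: "form x (\<xi> + \<zeta>) \<eta> = form x \<xi> \<eta> + form x \<zeta> \<eta>" "form x \<eta> (\<xi> + \<zeta>) = form x \<eta> \<xi> + form x \<eta> \<zeta>"
  by (simp_all add: form_def matrix_vector_right_distrib inner_add_left inner_add_right)

lemma form_scale: "form x (a *\<^sub>R \<xi>) \<eta> = a * form x \<xi> \<eta>" "form x \<eta> (a *\<^sub>R \<xi>) = a * form x \<eta> \<xi>"
  by (simp_all add: form_def linear_scale[OF matrix_vector_mul_linear])

lemma form_commute: "x \<in> closure \<Omega> \<Longrightarrow> form x \<xi> \<eta> = form x \<eta> \<xi>"
proof -
  assume "x \<in> closure \<Omega>"
  then have "(A x *v \<xi>) \<bullet> \<eta> = (\<xi> v* A x) \<bullet> \<eta>"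
    using sym[of x] transpose_matrix_vector[of "A x" \<xi>] by simp
  also have "\<dots> = \<xi> \<bullet> (A x *v \<eta>)" by (rule dot_lmul_matrix)
  finally show ?thesis by (simp add: form_def inner_commute)
qed

lemma closureI: "x \<in> \<Omega> \<Longrightarrow> x \<in> closure \<Omega>"
  using closure_subset by blast

lemma form_ge: "x \<in> \<Omega> \<Longrightarrow> c * (norm \<xi>)\<^sup>2 \<le> form x \<xi> \<xi>"
  using ell closureI by (simp add: form_def)

lemma form_nonneg: "x \<in> \<Omega> \<Longrightarrow> form x \<xi> \<xi> \<ge> 0"
  using form_ge[of x \<xi>] c by (meson mult_nonneg_nonneg less_imp_le order_trans zero_le_power2)

text \<open>Nonnegativity of the form at \<open>2 * t * \<xi> + s * \<eta>\<close>, used for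
  \<open>s = 1\<close> and \<open>s = -1\<close>.\<close>

lemma form_Young:
  assumes x: "x \<in> \<Omega>" and t: "t > 0"
  shows "\<bar>form x \<xi> \<eta>\<bar> \<le> t * form x \<xi> \<xi> + form x \<eta> \<eta> / (4 * t)"
proof -
  have com: "form x \<eta> \<xi> = form x \<xi> \<eta>" by (rule form_commute[OF closureI[OF x]])
  have "4 * t * t * form x \<xi> \<xi> + 4 * t * s * form x \<xi> \<eta> + form x \<eta> \<eta> \<ge> 0" if "s\<^sup>2 = 1" for s :: real
  proof -
    have "0 \<le> form x ((2 * t) *\<^sub>R \<xi> + s *\<^sub>R \<eta>) ((2 * t) *\<^sub>R \<xi> + s *\<^sub>R \<eta>)" by (rule form_nonneg[OF x])
    also have "\<dots> = 4 * t * t * form x \<xi> \<xi> + 4 * t * s * form x \<xi> \<eta> + s\<^sup>2 * form x \<eta> \<eta>"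
      unfolding form_add form_scale com by (simp add: power2_eq_square algebra_simps)
    finally show ?thesis using that by simp
  qed
  from this[of 1] this[of "-1"]
  have "4 * t * \<bar>form x \<xi> \<eta>\<bar> \<le> 4 * t * t * form x \<xi> \<xi> + form x \<eta> \<eta>" using t by (simp add: abs_if)
  then show ?thesis using t by (simp add: field_simps)
qed

lemma form_upper_bound: "\<exists>C>0. \<forall>x\<in>\<Omega>. \<forall>\<xi>. form x \<xi> \<xi> \<le> C * (norm \<xi>)\<^sup>2"
proof -
  define S where "S x = (\<Sum>i\<in>UNIV. \<Sum>j\<in>UNIV. \<bar>A x $ i $ j\<bar>)" for x
  have "continuous_on (closure \<Omega>) S"
    unfolding S_def
    by (intro continuous_on_sum continuous_on_rabs continuous_on_subset[OF smooth_on_continuous[OF A] V(2)])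
  then have "bounded (S ` closure \<Omega>)"
    by (intro compact_imp_bounded compact_continuous_image compact_closure_dom)
  then obtain C where C: "C > 0" "\<forall>y\<in>S ` closure \<Omega>. norm y \<le> C" unfolding bounded_pos by blast
  have "form x \<xi> \<xi> \<le> C * (norm \<xi>)\<^sup>2" if x: "x \<in> \<Omega>" for x \<xi>
  proof -
    have "form x \<xi> \<xi> = (\<Sum>i\<in>UNIV. \<Sum>j\<in>UNIV. A x $ i $ j * \<xi> $ j * \<xi> $ i)"
      by (simp add: form_def inner_vec_def matrix_vector_mult_def sum_distrib_right)
    also have "\<dots> \<le> (\<Sum>i\<in>UNIV. \<Sum>j\<in>UNIV. \<bar>A x $ i $ j\<bar> * (norm \<xi>)\<^sup>2)"
    proof (intro sum_mono)
      fix i j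
      have "\<bar>\<xi> $ j\<bar> * \<bar>\<xi> $ i\<bar> \<le> norm \<xi> * norm \<xi>"
        by (intro mult_mono component_le_norm_cart) auto
      then have "\<bar>A x $ i $ j\<bar> * (\<bar>\<xi> $ j\<bar> * \<bar>\<xi> $ i\<bar>) \<le> \<bar>A x $ i $ j\<bar> * (norm \<xi>)\<^sup>2"
        unfolding power2_eq_square by (rule mult_left_mono) simp
      moreover have "A x $ i $ j * \<xi> $ j * \<xi> $ i \<le> \<bar>A x $ i $ j\<bar> * (\<bar>\<xi> $ j\<bar> * \<bar>\<xi> $ i\<bar>)"
        by (metis abs_ge_self abs_mult mult.assoc)
      ultimately show "A x $ i $ j * \<xi> $ j * \<xi> $ i \<le> \<bar>A x $ i $ j\<bar> * (norm \<xi>)\<^sup>2" by linarith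
    qed
    also have "\<dots> = S x * (norm \<xi>)\<^sup>2" by (simp add: S_def sum_distrib_right)
    also have "\<dots> \<le> C * (norm \<xi>)\<^sup>2"
    proof (rule mult_right_mono)
      have "norm (S x) \<le> C" using C(2) closureI[OF x] by blast
      then show "S x \<le> C" by simp
    qed simp
    finally show ?thesis .
  qed
  then show ?thesis using C(1) by blast
qed

lemma measurable_matrix_mult:
  assumes "g \<in> borel_measurable dom_leb"
  shows "(\<lambda>x. A x *v g x) \<in> borel_measurable dom_leb"
proof -
  have \<Omega>V: "\<Omega> \<subseteq> V" using V(2) closureI by blast
  have Am: "(\<lambda>x. A x $ i $ j) \<in> borel_measurable dom_leb" for i j
    unfolding measurable_dom_leb
    by (rule set_borel_measurable_continuous_lebesgue[OF _ continuous_on_subset[OF smooth_on_continuous[OF A] \<Omega>V]])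
      (simp add: open_dom)
  have gm: "(\<lambda>x. g x $ j) \<in> borel_measurable dom_leb" for j
  proof -
    have "(\<lambda>x. g x \<bullet> axis j 1) \<in> borel_measurable dom_leb"
      using assms by (intro borel_measurable_inner borel_measurable_const)
    then show ?thesis by (simp add: inner_axis)
  qed
  have "(\<lambda>x. \<Sum>i\<in>UNIV. (\<Sum>j\<in>UNIV. A x $ i $ j * g x $ j) *\<^sub>R (axis i 1 :: real^'n)) \<in> borel_measurable dom_leb"
    by (intro borel_measurable_sum borel_measurable_scaleR borel_measurable_times Am gm borel_measurable_const)
  moreover have "(\<lambda>x. \<Sum>i\<in>UNIV. (\<Sum>j\<in>UNIV. A x $ i $ j * g x $ j) *\<^sub>R (axis i 1 :: real^'n)) = (\<lambda>x. A x *v g x)"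
    by (simp add: fun_eq_iff vec_eq_iff matrix_vector_mult_def axis_def if_distrib cong: if_cong)
  ultimately show ?thesis by simp
qed

lemma measurable_form:
  "g \<in> borel_measurable dom_leb \<Longrightarrow> h \<in> borel_measurable dom_leb \<Longrightarrow> (\<lambda>x. form x (g x) (h x)) \<in> borel_measurable dom_leb"
  unfolding form_def by (intro borel_measurable_inner measurable_matrix_mult)

definition log_grad :: "real^'n \<Rightarrow> real^'n" where
  "log_grad x = grad e x /\<^sub>R e x"

definition hardy_weight :: "real^'n \<Rightarrow> real" where
  "hardy_weight x = form x (log_grad x) (log_grad x)"

lemma weight_pos: "x \<in> \<Omega> - K \<Longrightarrow> e x > 0"
  using em[of x] m by simp

lemma log_grad_measurable: "log_grad \<in> borel_measurable dom_leb"
  unfolding measurable_dom_leb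
proof (rule measurable_punctured)
  have "e x \<noteq> 0" if "x \<in> \<Omega> - K" for x using weight_pos[OF that] by simp
  then show "continuous_on (\<Omega> - K) log_grad"
    unfolding log_grad_def
    by (intro continuous_on_scaleR continuous_on_inverse ballI
        continuous_on_subset[OF smooth_on_continuous_grad[OF e] punctured_subset]
        continuous_on_subset[OF smooth_on_continuous[OF e] punctured_subset])
qed

lemma hardy_weight_measurable: "hardy_weight \<in> borel_measurable dom_leb"
  unfolding hardy_weight_def by (rule measurable_form[OF log_grad_measurable log_grad_measurable])

lemma hardy_weight_nonneg: "x \<in> \<Omega> \<Longrightarrow> hardy_weight x \<ge> 0"
  unfolding hardy_weight_def by (rule form_nonneg)

lemma flux_log_grad: "x \<in> \<Omega> - K \<Longrightarrow> flux x \<bullet> \<eta> = e x * form x (log_grad x) \<eta>"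
  using weight_pos[of x] by (simp add: log_grad_def form_scale form_def[symmetric] flux_def)

lemma integrable_form:
  assumes g: "g \<in> borel_measurable dom_leb" "integrable dom_leb (\<lambda>x. (norm (g x))\<^sup>2)"
  shows "integrable dom_leb (\<lambda>x. form x (g x) (g x))"
proof -
  obtain C where C: "\<And>x \<xi>. x \<in> \<Omega> \<Longrightarrow> form x \<xi> \<xi> \<le> C * (norm \<xi>)\<^sup>2" using form_upper_bound by blast
  show ?thesis
  proof (rule Bochner_Integration.integrable_bound[where f = "\<lambda>x. C * (norm (g x))\<^sup>2"])
    show "integrable dom_leb (\<lambda>x. C * (norm (g x))\<^sup>2)" using g(2) by (rule integrable_mult_right)
    show "(\<lambda>x. form x (g x) (g x)) \<in> borel_measurable dom_leb" by (rule measurable_form[OF g(1) g(1)])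
    show "AE x in dom_leb. norm (form x (g x) (g x)) \<le> norm (C * (norm (g x))\<^sup>2)"
    proof (rule AE_I2)
      fix x assume "x \<in> space dom_leb"
      then have x: "x \<in> \<Omega>" by simp
      show "norm (form x (g x) (g x)) \<le> norm (C * (norm (g x))\<^sup>2)"
        using form_nonneg[OF x, of "g x"] C[OF x, of "g x"] by simp
    qed
  qed
qed

text \<open>The weak form is tested with \<open>(\<phi> k)\<^sup>2 * S k / e\<close>. This yields an
  equation between the localized Hardy term \<open>d\<close>, the cross term \<open>a\<close>, the
  cutoff error \<open>b\<close> and the mass \<open>s\<close>. A quarter of \<open>d\<close> absorbs
  the critical part of \<open>a\<close> and another quarter that of \<open>b\<close>, so the
  integrals of \<open>d\<close> stay bounded. Fatou's lemma makes the limit integrable, and then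
  every term converges, with \<open>b\<close> tending to 0.\<close>

theorem log_identity:
  assumes w: "has_weak_gradient (\<Omega> - K) u g"
    and um: "u \<in> borel_measurable dom_leb" and u2: "integrable dom_leb (\<lambda>x. (u x)\<^sup>2)"
    and gm: "g \<in> borel_measurable dom_leb" and g2: "integrable dom_leb (\<lambda>x. (norm (g x))\<^sup>2)"
  shows "integrable dom_leb (\<lambda>x. hardy_weight x * (u x)\<^sup>2)"
    and "integrable dom_leb (\<lambda>x. u x * form x (log_grad x) (g x))"
    and "2 * (LINT x|dom_leb. u x * form x (log_grad x) (g x))
      = (LINT x|dom_leb. hardy_weight x * (u x)\<^sup>2) - (LINT x|dom_leb. (u x)\<^sup>2)"
proof -
  define M where "M k = real (Suc k)" for k
  have M: "M k > 0" for k by (simp add: M_def)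
  \<comment> \<open>The truncated square is at most \<open>M\<^sup>2\<close>, so Young's inequality
    leaves in \<open>b\<close> an error of \<open>M\<^sup>2 / t\<close> times the energy of the
    cutoff. With energy \<open>1 / M ^ 4\<close> this is of order
    \<open>1 / (t * M\<^sup>2)\<close>: bounded for \<open>t = 1 / 4\<close>, which serves the
    uniform bound, and of order \<open>1 / M\<close> for \<open>t = 1 / M\<close>, which serves the
    limit.\<close>
  have M4: "inverse (M k) ^ 4 > 0" for k using M[of k] by simp
  obtain \<phi> :: "nat \<Rightarrow> real^'n \<Rightarrow> real" and r B where
    \<phi>: "\<And>k. r k > 0" "\<And>k. smooth_on UNIV (\<phi> k)" "\<And>k x. 0 \<le> \<phi> k x" "\<And>k x. \<phi> k x \<le> 1"
    "\<And>k x. norm (grad (\<phi> k) x) \<le> B k" "\<And>k x. infdist x K < r k \<Longrightarrow> \<phi> k x = 0"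
    "\<And>k. (LINT x|lebesgue. indicator \<Omega> x * (norm (grad (\<phi> k) x))\<^sup>2) \<le> inverse (M k) ^ 4"
    "\<And>x. x \<notin> K \<Longrightarrow> (\<lambda>k. \<phi> k x) \<longlonglongrightarrow> 1"
    by (rule zero_capacity_cutoffs[OF cap compact_imp_closed[OF K(1)] K(3) M4], rule that)
  define S where "S k x = trunc_sq (M k) (u x)" for k x
  define S' where "S' k x = trunc_sq' (M k) (u x)" for k x
  have S: "0 \<le> S k x" "S k x \<le> (u x)\<^sup>2" "S k x \<le> (M k)\<^sup>2" "(S' k x)\<^sup>2 \<le> 4 * S k x" "\<bar>S' k x\<bar> \<le> 2 * \<bar>u x\<bar>" for k x
    unfolding S_def S'_def by (rule trunc_sq_nonneg trunc_sq_le trunc_sq_bounded[OF M] trunc_sq'_sq trunc_sq'_le)+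
  have SC: "continuous_on UNIV (trunc_sq (M k))" for k
    using DERIV_isCont[OF trunc_sq_deriv[OF M]] by (simp add: continuous_at_imp_continuous_on)
  have Sm: "S k \<in> borel_measurable dom_leb" "S' k \<in> borel_measurable dom_leb" for k
    unfolding S_def S'_def
    by (rule borel_measurable_continuous_on[OF SC um], rule borel_measurable_continuous_on[OF trunc_sq'_continuous um])
  have wS: "has_weak_gradient (\<Omega> - K) (S k) (\<lambda>x. S' k x *\<^sub>R g x)" for k
    unfolding S_def S'_def
    by (rule has_weak_gradient_chain[OF open_punctured w trunc_sq_deriv[OF M] trunc_sq'_continuous trunc_sq'_bounded[OF M]])
  have \<phi>m: "\<phi> k \<in> borel_measurable dom_leb" "grad (\<phi> k) \<in> borel_measurable dom_leb" for k
    unfolding measurable_dom_leb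
    by (rule set_borel_measurable_continuous_lebesgue[OF _ continuous_on_subset[OF smooth_on_continuous[OF \<phi>(2)] subset_UNIV]], simp add: open_dom,
        rule set_borel_measurable_continuous_lebesgue[OF _ continuous_on_subset[OF smooth_on_continuous_grad[OF \<phi>(2)] subset_UNIV]], simp add: open_dom)
  have \<phi>1: "\<bar>\<phi> k x\<bar> \<le> 1" "(\<phi> k x)\<^sup>2 \<le> 1" "0 \<le> (\<phi> k x)\<^sup>2" for k x
    using \<phi>(3,4)[of k x] by (auto intro: power_le_one)
  let ?L = log_grad and ?\<nu> = hardy_weight
  have gradS: "integrable dom_leb (S k)" for k
    by (rule Bochner_Integration.integrable_bound[OF u2 Sm(1)]) (use S in auto)
  have gN: "integrable dom_leb (\<lambda>x. form x (g x) (g x))" by (rule integrable_form[OF gm g2])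
  have ug: "integrable dom_leb (\<lambda>x. S' k x *\<^sub>R g x)" for k
  proof (rule Bochner_Integration.integrable_bound[where f = "\<lambda>x. (u x)\<^sup>2 + (norm (g x))\<^sup>2"])
    show "integrable dom_leb (\<lambda>x. (u x)\<^sup>2 + (norm (g x))\<^sup>2)" using u2 g2 by (rule Bochner_Integration.integrable_add)
    show "(\<lambda>x. S' k x *\<^sub>R g x) \<in> borel_measurable dom_leb" using Sm(2) gm by (rule borel_measurable_scaleR)
    have "norm (S' k x *\<^sub>R g x) \<le> norm ((u x)\<^sup>2 + (norm (g x))\<^sup>2)" for x
    proof -
      have "norm (S' k x *\<^sub>R g x) \<le> 2 * \<bar>u x\<bar> * norm (g x)" using S(5)[of k x] by (simp add: mult_right_mono)
      also have "\<dots> \<le> (u x)\<^sup>2 + (norm (g x))\<^sup>2" using sum_squares_bound[of "\<bar>u x\<bar>" "norm (g x)"] by simp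
      finally show ?thesis by simp
    qed
    then show "AE x in dom_leb. norm (S' k x *\<^sub>R g x) \<le> norm ((u x)\<^sup>2 + (norm (g x))\<^sup>2)" by simp
  qed
  define f where "f k x = \<phi> k x * \<phi> k x * inverse (e x)" for k x
  have OW: "\<Omega> - K \<subseteq> W" by (rule punctured_subset)
  have fs: "smooth_on (\<Omega> - K) (f k)" for k
    unfolding f_def
    by (intro smooth_on_mult smooth_on_inverse open_punctured smooth_on_subset[OF \<phi>(2) subset_UNIV]
        smooth_on_subset[OF e OW] weight_pos)
  have fg: "grad (f k) x = (2 * \<phi> k x / e x) *\<^sub>R grad (\<phi> k) x - ((\<phi> k x)\<^sup>2 / e x) *\<^sub>R ?L x" if x: "x \<in> \<Omega> - K" for k x
  proof -
    have d: "\<phi> k differentiable (at x)" "e differentiable (at x)"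
      using smooth_on_differentiable[OF \<phi>(2)] smooth_on_differentiable[OF e] x OW by auto
    have e0: "e x \<noteq> 0" using weight_pos[OF x] by simp
    have ie: "((\<lambda>x. inverse (e x)) has_derivative (\<lambda>h. - (inverse (e x) * (grad e x \<bullet> h) * inverse (e x)))) (at x)"
      by (rule Deriv.has_derivative_inverse[OF e0 has_derivative_grad[OF d(2)]])
    have "(f k has_derivative (\<lambda>h. \<phi> k x * \<phi> k x * (- (inverse (e x) * (grad e x \<bullet> h) * inverse (e x)))
        + (\<phi> k x * (grad (\<phi> k) x \<bullet> h) + (grad (\<phi> k) x \<bullet> h) * \<phi> k x) * inverse (e x))) (at x)"
      unfolding f_def
      by (intro has_derivative_mult ie has_derivative_grad d)
    then have "(f k has_derivative (\<lambda>h. ((2 * \<phi> k x / e x) *\<^sub>R grad (\<phi> k) x - ((\<phi> k x)\<^sup>2 / e x) *\<^sub>R ?L x) \<bullet> h)) (at x)"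
      by (rule has_derivative_eq_rhs)
        (simp add: fun_eq_iff log_grad_def inner_diff_left divide_inverse power2_eq_square algebra_simps)
    then show ?thesis by (rule grad_unique)
  qed
  define wk where "wk k x = f k x * S k x" for k x
  define gk where "gk k x = f k x *\<^sub>R (S' k x *\<^sub>R g x) + S k x *\<^sub>R grad (f k) x" for k x
  have wwk: "has_weak_gradient (\<Omega> - K) (wk k) (gk k)" for k
    unfolding wk_def gk_def by (rule has_weak_gradient_mult[OF open_punctured wS fs])
  \<comment> \<open>The bounds on the factor and its gradient hold off \<open>K\<close>. On
    \<open>K\<close>, where \<open>e\<close> is unspecified, both are set to 0 so that the bounds
    hold on all of \<open>\<Omega>\<close>; the change affects a null set only.\<close>
  define f0 where "f0 k x = (if x \<in> \<Omega> - K then f k x else 0)" for k x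
  define f1 where "f1 k x = (if x \<in> \<Omega> - K then grad (f k) x else 0)" for k x
  have fm: "set_borel_measurable lebesgue \<Omega> (f k)" "set_borel_measurable lebesgue \<Omega> (grad (f k))" for k
    by (rule measurable_punctured[OF smooth_on_continuous[OF fs]], rule measurable_punctured[OF smooth_on_continuous_grad[OF fs]])
  have fb: "\<bar>f k x\<bar> \<le> 1 / m" if x: "x \<in> \<Omega> - K" for k x
  proof -
    have "\<bar>f k x\<bar> = (\<phi> k x)\<^sup>2 * inverse (e x)" using weight_pos[OF x] by (simp add: f_def abs_mult power2_eq_square)
    also have "\<dots> \<le> 1 * inverse m"
      using \<phi>1[of k x] em[OF x] m by (intro mult_mono le_imp_inverse_le) auto
    finally show ?thesis by (simp add: divide_inverse)
  qed
  have near: "\<phi> k x = 0" "grad (\<phi> k) x = 0" if "infdist x K < r k" for k x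
  proof -
    show "\<phi> k x = 0" by (rule \<phi>(6)[OF that])
    have "open {y. infdist y K < r k}" by (intro open_Collect_less continuous_intros)
    then have "grad (\<phi> k) x = grad (\<lambda>_. 0) x" by (rule grad_cong) (use that \<phi>(6) in auto)
    then show "grad (\<phi> k) x = 0" by simp
  qed
  have fgb: "\<exists>P. \<forall>x\<in>\<Omega> - K. norm (grad (f k) x) \<le> P" for k
  proof -
    obtain P where P: "P > 0" "\<And>x. x \<in> \<Omega> \<Longrightarrow> infdist x K \<ge> r k \<Longrightarrow> norm (grad e x) \<le> P"
      by (rule bounded_away[OF smooth_on_continuous_grad[OF e] \<phi>(1)]) blast
    have "norm (grad (f k) x) \<le> 2 / m * \<bar>B k\<bar> + 1 / m * (P / m)" if x: "x \<in> \<Omega> - K" for x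
    proof (cases "infdist x K < r k")
      case True
      then show ?thesis using near[OF True] m P(1) unfolding fg[OF x] by simp
    next
      case False
      then have Pe: "norm (grad e x) \<le> P" using P(2) x by simp
      have e0: "e x > 0" "inverse (e x) \<le> inverse m" using weight_pos[OF x] em[OF x] m by (auto intro: le_imp_inverse_le)
      have L: "norm (?L x) \<le> P / m"
      proof -
        have "norm (?L x) = inverse (e x) * norm (grad e x)" using e0 by (simp add: log_grad_def)
        also have "\<dots> \<le> inverse m * P" using e0 Pe m by (intro mult_mono) auto
        finally show ?thesis by (simp add: divide_inverse mult.commute)
      qed
      have "norm (grad (f k) x) \<le> norm ((2 * \<phi> k x / e x) *\<^sub>R grad (\<phi> k) x) + norm (((\<phi> k x)\<^sup>2 / e x) *\<^sub>R ?L x)"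
        unfolding fg[OF x] by (rule norm_triangle_ineq4)
      also have "norm ((2 * \<phi> k x / e x) *\<^sub>R grad (\<phi> k) x) \<le> 2 / m * \<bar>B k\<bar>"
        unfolding norm_scaleR
      proof (rule mult_mono)
        have "2 * \<phi> k x * inverse (e x) \<le> 2 * 1 * inverse m"
          using \<phi>(3,4)[of k x] e0 m by (intro mult_mono) auto
        then show "\<bar>2 * \<phi> k x / e x\<bar> \<le> 2 / m" using \<phi>(3)[of k x] e0 by (simp add: divide_inverse)
        show "norm (grad (\<phi> k) x) \<le> \<bar>B k\<bar>" using \<phi>(5)[of k x] by linarith
      qed (use m in auto)
      also have "norm (((\<phi> k x)\<^sup>2 / e x) *\<^sub>R ?L x) \<le> 1 / m * (P / m)"
        unfolding norm_scaleR
      proof (rule mult_mono[OF _ L])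
        have "(\<phi> k x)\<^sup>2 * inverse (e x) \<le> 1 * inverse m" using \<phi>1[of k x] e0 m by (intro mult_mono) auto
        then show "\<bar>(\<phi> k x)\<^sup>2 / e x\<bar> \<le> 1 / m" using e0 by (simp add: divide_inverse)
      qed (use m in auto)
      finally show ?thesis by simp
    qed
    then show ?thesis by blast
  qed
  have null_cong: "set_integrable lebesgue \<Omega> h1 \<Longrightarrow> (\<And>x. x \<in> \<Omega> - K \<Longrightarrow> h1 x = h2 x) \<Longrightarrow> set_integrable lebesgue \<Omega> h2"
    for h1 h2 :: "real^'n \<Rightarrow> 'b::euclidean_space"
  proof (rule set_integrable_cong_AE_on)
    assume *: "\<And>x. x \<in> \<Omega> - K \<Longrightarrow> h1 x = h2 x"
    show "AE x in lebesgue. x \<in> \<Omega> \<longrightarrow> h1 x = h2 x"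
      using AE_not_singular unfolding AE_dom_leb by eventually_elim (use * in blast)
  qed
  have meas0: "set_borel_measurable lebesgue \<Omega> (f0 k)" "set_borel_measurable lebesgue \<Omega> (f1 k)" for k
  proof -
    have "continuous_on (\<Omega> - K) (f0 k)"
      by (rule continuous_on_eq[OF smooth_on_continuous[OF fs]]) (simp add: f0_def)
    then show "set_borel_measurable lebesgue \<Omega> (f0 k)" by (rule measurable_punctured)
    have "continuous_on (\<Omega> - K) (f1 k)"
      by (rule continuous_on_eq[OF smooth_on_continuous_grad[OF fs]]) (simp add: f1_def)
    then show "set_borel_measurable lebesgue \<Omega> (f1 k)" by (rule measurable_punctured)
  qed
  have fb0: "\<bar>f0 k x\<bar> \<le> 1 / m" for k x using fb[of x k] m by (simp add: f0_def)
  have wki: "set_integrable lebesgue \<Omega> (wk k)" for k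
  proof -
    have "set_integrable lebesgue \<Omega> (\<lambda>x. f0 k x *\<^sub>R S k x)"
      by (rule set_integrable_scaleR_bounded[where B = "1 / m", OF gradS[unfolded integrable_dom_leb] meas0(1) fb0])
    then show ?thesis by (rule null_cong) (simp add: f0_def wk_def)
  qed
  have gki: "set_integrable lebesgue \<Omega> (gk k)" for k
  proof -
    obtain P where P: "\<forall>x\<in>\<Omega> - K. norm (grad (f k) x) \<le> P" using fgb by blast
    have "set_integrable lebesgue \<Omega> (\<lambda>x. f0 k x *\<^sub>R (S' k x *\<^sub>R g x))"
      by (rule set_integrable_scaleR_bounded[where B = "1 / m", OF ug[unfolded integrable_dom_leb] meas0(1) fb0])
    moreover have "set_integrable lebesgue \<Omega> (\<lambda>x. S k x *\<^sub>R f1 k x)"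
    proof (rule set_integrable_scaleR_bounded'[where B = "\<bar>P\<bar>"])
      show "norm (f1 k x) \<le> \<bar>P\<bar>" for x using P by (auto simp: f1_def intro: order_trans[OF _ abs_ge_self])
    qed (use gradS[unfolded integrable_dom_leb] meas0 in auto)
    ultimately have "set_integrable lebesgue \<Omega> (\<lambda>x. f0 k x *\<^sub>R (S' k x *\<^sub>R g x) + S k x *\<^sub>R f1 k x)"
      by (rule set_integral_add(1))
    then show ?thesis by (rule null_cong) (simp add: f0_def f1_def gk_def)
  qed
  have zero: "wk k x = 0 \<and> gk k x = 0" if "x \<in> \<Omega>" "infdist x K < r k" for k x
  proof -
    have f0: "f k y = 0" if "infdist y K < r k" for y using \<phi>(6)[OF that] by (simp add: f_def)
    have "open {y. infdist y K < r k}" by (intro open_Collect_less continuous_intros)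
    then have "grad (f k) x = grad (\<lambda>_. 0) x" by (rule grad_cong) (use that(2) f0 in auto)
    then show ?thesis using f0[OF that(2)] by (simp add: wk_def gk_def)
  qed
  note WF = weak_form[OF wwk wki gki \<phi>(1) zero]
  \<comment> \<open>\<open>a\<close> pairs the logarithmic gradient of the weight with the gradient
    of \<open>u\<close>, and \<open>b\<close> pairs it with the gradient of the cutoff.
    \<open>d\<close> is the localized Hardy term and \<open>s\<close> the localized mass.\<close>
  define a where "a k x = (\<phi> k x)\<^sup>2 * S' k x * form x (?L x) (g x)" for k x
  define b where "b k x = 2 * \<phi> k x * S k x * form x (?L x) (grad (\<phi> k) x)" for k x
  define d where "d k x = (\<phi> k x)\<^sup>2 * S k x * ?\<nu> x" for k x
  define s where "s k x = (\<phi> k x)\<^sup>2 * S k x" for k x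
  have pt: "gk k x \<bullet> flux x + e x * wk k x = a k x + b k x - d k x + s k x" if x: "x \<in> \<Omega> - K" for k x
  proof -
    have e0: "e x \<noteq> 0" using weight_pos[OF x] by simp
    have "gk k x \<bullet> flux x = flux x \<bullet> gk k x" by (rule inner_commute)
    also have "\<dots> = e x * form x (?L x) (gk k x)" by (rule flux_log_grad[OF x])
    also have "form x (?L x) (gk k x) = f k x * S' k x * form x (?L x) (g x)
        + S k x * ((2 * \<phi> k x / e x) * form x (?L x) (grad (\<phi> k) x) - ((\<phi> k x)\<^sup>2 / e x) * form x (?L x) (?L x))"
      unfolding gk_def fg[OF x] diff_conv_add_uminus scaleR_minus_left[symmetric] form_add form_scale by (simp add: algebra_simps)
    finally have "gk k x \<bullet> flux x = e x * f k x * (S' k x * form x (?L x) (g x))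
        + e x * inverse (e x) * (b k x - d k x)"
      by (simp add: b_def d_def hardy_weight_def divide_inverse algebra_simps)
    moreover have "e x * inverse (e x) = 1" using e0 by simp
    moreover have "e x * f k x = (\<phi> k x)\<^sup>2" using e0 by (simp add: f_def power2_eq_square)
    ultimately show ?thesis by (simp add: wk_def a_def s_def mult.assoc[symmetric])
  qed
  have ai: "integrable dom_leb (\<lambda>x. gk k x \<bullet> flux x + e x * wk k x)" for k
    using WF(1)[of k] by (simp add: integrable_dom_leb set_integrable_def)
  have am: "a k \<in> borel_measurable dom_leb" "b k \<in> borel_measurable dom_leb" "d k \<in> borel_measurable dom_leb" "s k \<in> borel_measurable dom_leb" for k
    unfolding a_def b_def d_def s_def
    by (intro borel_measurable_times borel_measurable_power borel_measurable_const \<phi>m Sm measurable_form log_grad_measurable gm hardy_weight_measurable)+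
  obtain CA where CA: "CA > 0" "\<And>x \<xi>. x \<in> \<Omega> \<Longrightarrow> form x \<xi> \<xi> \<le> CA * (norm \<xi>)\<^sup>2" using form_upper_bound by blast
  have \<phi>g2: "integrable dom_leb (\<lambda>x. (norm (grad (\<phi> k) x))\<^sup>2)" for k
  proof (rule Bochner_Integration.integrable_bound[OF integrable_const_dom_leb[of "(B k)\<^sup>2"]])
    show "(\<lambda>x. (norm (grad (\<phi> k) x))\<^sup>2) \<in> borel_measurable dom_leb"
      unfolding power2_norm_eq_inner by (intro borel_measurable_inner \<phi>m(2))
    show "AE x in dom_leb. norm ((norm (grad (\<phi> k) x))\<^sup>2) \<le> norm ((B k)\<^sup>2)"
      using power_mono[OF \<phi>(5)[of k] norm_ge_zero, of _ 2] by (intro AE_I2) simp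
  qed
  have \<phi>N: "integrable dom_leb (\<lambda>x. form x (grad (\<phi> k) x) (grad (\<phi> k) x))" for k
    by (rule integrable_form[OF \<phi>m(2) \<phi>g2])
  have \<phi>Nb: "(LINT x|dom_leb. form x (grad (\<phi> k) x) (grad (\<phi> k) x)) \<le> CA * inverse (M k) ^ 4" for k
  proof -
    have "(LINT x|dom_leb. form x (grad (\<phi> k) x) (grad (\<phi> k) x)) \<le> (LINT x|dom_leb. CA * (norm (grad (\<phi> k) x))\<^sup>2)"
      using \<phi>N \<phi>g2 CA(2) by (intro integral_mono) auto
    also have "\<dots> = CA * (LINT x|dom_leb. (norm (grad (\<phi> k) x))\<^sup>2)" by simp
    also have "\<dots> \<le> CA * inverse (M k) ^ 4"
      using \<phi>(7)[of k] CA(1) by (intro mult_left_mono) (auto simp: LINT_dom_leb set_lebesgue_integral_def)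
    finally show ?thesis .
  qed
  have di: "integrable dom_leb (d k)" for k
  proof -
    obtain P where P: "P > 0" "\<And>x. x \<in> \<Omega> \<Longrightarrow> infdist x K \<ge> r k \<Longrightarrow> norm (grad e x) \<le> P"
      by (rule bounded_away[OF smooth_on_continuous_grad[OF e] \<phi>(1)]) blast
    have "AE x in dom_leb. norm (d k x) \<le> norm ((CA * (P / m)\<^sup>2) * S k x)"
      using AE_not_singular
    proof eventually_elim
      case (elim x)
      have x: "x \<in> \<Omega>" using elim by simp
      show ?case
      proof (cases "infdist x K < r k")
        case True
        then show ?thesis using \<phi>(6) by (simp add: d_def)
      next
        case False
        have "norm (?L x) = inverse (e x) * norm (grad e x)" using weight_pos[OF elim] by (simp add: log_grad_def)
        also have "\<dots> \<le> inverse m * P"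
          using weight_pos[OF elim] em[OF elim] m P(2)[OF x] False by (intro mult_mono le_imp_inverse_le) auto
        finally have "norm (?L x) \<le> P / m" by (simp add: divide_inverse mult.commute)
        then have "?\<nu> x \<le> CA * (P / m)\<^sup>2"
          unfolding hardy_weight_def using CA(1)
          by (intro order_trans[OF CA(2)[OF x]] mult_left_mono power_mono) auto
        moreover have "0 \<le> ?\<nu> x" by (rule hardy_weight_nonneg[OF x])
        ultimately have "(\<phi> k x)\<^sup>2 * S k x * ?\<nu> x \<le> 1 * S k x * (CA * (P / m)\<^sup>2)"
          using \<phi>1[of k x] S(1)[of k x] by (intro mult_mono mult_nonneg_nonneg) auto
        then show ?thesis
          using \<open>0 \<le> ?\<nu> x\<close> S(1)[of k x] CA(1) by (simp add: d_def abs_mult mult_ac)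
      qed
    qed
    then show ?thesis by (rule Bochner_Integration.integrable_bound[OF integrable_mult_right[OF gradS[of k]] am(3)])
  qed
  have si: "integrable dom_leb (s k)" for k
  proof (rule Bochner_Integration.integrable_bound[OF u2 am(4)])
    have "norm (s k x) \<le> norm ((u x)\<^sup>2)" for x
      using mult_mono[OF \<phi>1(2)[of k x] S(2)[of k x]] S(1)[of k x] by (simp add: s_def abs_mult)
    then show "AE x in dom_leb. norm (s k x) \<le> norm ((u x)\<^sup>2)" by simp
  qed
  \<comment> \<open>Young's inequality is used with the weight \<open>1 / 16\<close>: since
    \<open>S'\<close> squared is at most \<open>4 * S\<close>, this produces exactly a quarter of
    \<open>d\<close>.\<close>
  have pa: "\<bar>a k x\<bar> \<le> d k x / 4 + 4 * form x (g x) (g x)" if x: "x \<in> \<Omega>" for k x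
  proof -
    have "\<bar>form x (S' k x *\<^sub>R ?L x) (g x)\<bar> \<le> 1 / 16 * form x (S' k x *\<^sub>R ?L x) (S' k x *\<^sub>R ?L x) + form x (g x) (g x) / (4 * (1 / 16))"
      by (rule form_Young[OF x]) simp
    then have "\<bar>S' k x * form x (?L x) (g x)\<bar> \<le> 1 / 16 * ((S' k x)\<^sup>2 * ?\<nu> x) + 4 * form x (g x) (g x)"
      unfolding form_scale hardy_weight_def by (simp add: power2_eq_square)
    moreover have "(S' k x)\<^sup>2 * ?\<nu> x \<le> 4 * S k x * ?\<nu> x"
      by (rule mult_right_mono[OF S(4) hardy_weight_nonneg[OF x]])
    ultimately have 1: "\<bar>S' k x * form x (?L x) (g x)\<bar> \<le> S k x * ?\<nu> x / 4 + 4 * form x (g x) (g x)" by linarith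
    have "\<bar>a k x\<bar> = (\<phi> k x)\<^sup>2 * \<bar>S' k x * form x (?L x) (g x)\<bar>" by (simp add: a_def abs_mult)
    also have "\<dots> \<le> (\<phi> k x)\<^sup>2 * (S k x * ?\<nu> x / 4 + 4 * form x (g x) (g x))" using 1 by (rule mult_left_mono) simp
    also have "\<dots> = d k x / 4 + (\<phi> k x)\<^sup>2 * (4 * form x (g x) (g x))" by (simp add: d_def algebra_simps)
    also have "\<dots> \<le> d k x / 4 + 1 * (4 * form x (g x) (g x))"
      using \<phi>1(2)[of k x] form_nonneg[OF x, of "g x"] by (intro add_left_mono mult_right_mono) auto
    finally show ?thesis by simp
  qed
  \<comment> \<open>One factor \<open>\<phi>\<close> is kept with the logarithmic gradient, where it
    completes \<open>d\<close>, and the remaining factor \<open>S\<close> of the other summand is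
    estimated by \<open>M\<^sup>2\<close>.\<close>
  have pb: "\<bar>b k x\<bar> \<le> t * d k x + (M k)\<^sup>2 / t * form x (grad (\<phi> k) x) (grad (\<phi> k) x)" if x: "x \<in> \<Omega>" and t: "t > 0" for k x t
  proof -
    let ?N = "form x (grad (\<phi> k) x) (grad (\<phi> k) x)"
    have "\<bar>form x (\<phi> k x *\<^sub>R ?L x) (grad (\<phi> k) x)\<bar> \<le> t / 2 * form x (\<phi> k x *\<^sub>R ?L x) (\<phi> k x *\<^sub>R ?L x) + ?N / (4 * (t / 2))"
      by (rule form_Young[OF x]) (use t in simp)
    then have 1: "\<bar>\<phi> k x * form x (?L x) (grad (\<phi> k) x)\<bar> \<le> t / 2 * ((\<phi> k x)\<^sup>2 * ?\<nu> x) + ?N / (2 * t)"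
      unfolding form_scale hardy_weight_def by (simp add: power2_eq_square)
    have "\<bar>b k x\<bar> = 2 * S k x * \<bar>\<phi> k x * form x (?L x) (grad (\<phi> k) x)\<bar>"
      using S(1)[of k x] by (simp add: b_def abs_mult)
    also have "\<dots> \<le> 2 * S k x * (t / 2 * ((\<phi> k x)\<^sup>2 * ?\<nu> x) + ?N / (2 * t))"
      using 1 S(1)[of k x] by (intro mult_left_mono) auto
    also have "\<dots> = t * d k x + S k x * (?N / t)" using t by (simp add: d_def field_simps)
    also have "\<dots> \<le> t * d k x + (M k)\<^sup>2 * (?N / t)"
      using S(3)[of k x] form_nonneg[OF x] t by (intro add_left_mono mult_right_mono) auto
    finally show ?thesis by (simp add: mult_ac)
  qed
  have a_int: "integrable dom_leb (a k)" for k
  proof (rule Bochner_Integration.integrable_bound[OF _ am(1)])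
    show "integrable dom_leb (\<lambda>x. d k x / 4 + 4 * form x (g x) (g x))"
      using di[of k] gN by (intro Bochner_Integration.integrable_add) auto
    show "AE x in dom_leb. norm (a k x) \<le> norm (d k x / 4 + 4 * form x (g x) (g x))"
      using pa[of _ k] by (intro AE_I2) (auto intro: order_trans[OF _ abs_ge_self])
  qed
  have b_int: "integrable dom_leb (b k)" for k
  proof (rule Bochner_Integration.integrable_bound[OF _ am(2)])
    show "integrable dom_leb (\<lambda>x. 1 * d k x + (M k)\<^sup>2 / 1 * form x (grad (\<phi> k) x) (grad (\<phi> k) x))"
      using di[of k] \<phi>N[of k] by (intro Bochner_Integration.integrable_add integrable_mult_right)
    show "AE x in dom_leb. norm (b k x) \<le> norm (1 * d k x + (M k)\<^sup>2 / 1 * form x (grad (\<phi> k) x) (grad (\<phi> k) x))"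
      using pb[of _ 1 k] by (intro AE_I2) (auto intro: order_trans[OF _ abs_ge_self])
  qed
  have eq: "(LINT x|dom_leb. d k x) = (LINT x|dom_leb. a k x) + (LINT x|dom_leb. b k x) + (LINT x|dom_leb. s k x)" for k
  proof -
    have "0 = (LINT x|dom_leb. gk k x \<bullet> flux x + e x * wk k x)"
      using WF(2)[of k] by (simp add: LINT_dom_leb set_lebesgue_integral_def)
    also have "\<dots> = (LINT x|dom_leb. a k x + b k x - d k x + s k x)"
    proof (rule integral_cong_AE)
      show "AE x in dom_leb. gk k x \<bullet> flux x + e x * wk k x = a k x + b k x - d k x + s k x"
        using AE_not_singular by eventually_elim (rule pt)
      show "(\<lambda>x. a k x + b k x - d k x + s k x) \<in> borel_measurable dom_leb"
        using am by (intro borel_measurable_add borel_measurable_diff)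
    qed (use ai in \<open>rule borel_measurable_integrable\<close>)
    also have "\<dots> = (LINT x|dom_leb. a k x) + (LINT x|dom_leb. b k x) - (LINT x|dom_leb. d k x) + (LINT x|dom_leb. s k x)"
      using a_int[of k] b_int[of k] di[of k] si[of k] by simp
    finally show ?thesis by simp
  qed
  define X where "X k = (LINT x|dom_leb. d k x)" for k
  define G where "G = (LINT x|dom_leb. form x (g x) (g x))"
  define U2 where "U2 = (LINT x|dom_leb. (u x)\<^sup>2)"
  have Bb: "\<bar>LINT x|dom_leb. b k x\<bar> \<le> t * X k + CA / t * inverse (M k) ^ 2" if t: "t > 0" for k t
  proof -
    have "\<bar>LINT x|dom_leb. b k x\<bar> \<le> (LINT x|dom_leb. \<bar>b k x\<bar>)" by (rule integral_abs_bound)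
    also have "\<dots> \<le> (LINT x|dom_leb. t * d k x + (M k)\<^sup>2 / t * form x (grad (\<phi> k) x) (grad (\<phi> k) x))"
      using b_int[of k] di[of k] \<phi>N[of k] pb[OF _ t, of _ k] by (intro integral_mono) auto
    also have "\<dots> = t * X k + (M k)\<^sup>2 / t * (LINT x|dom_leb. form x (grad (\<phi> k) x) (grad (\<phi> k) x))"
      using di[of k] \<phi>N[of k] by (simp add: X_def)
    also have "\<dots> \<le> t * X k + (M k)\<^sup>2 / t * (CA * inverse (M k) ^ 4)"
      using \<phi>Nb[of k] t by (intro add_left_mono mult_left_mono) auto
    also have "(M k)\<^sup>2 / t * (CA * inverse (M k) ^ 4) = CA / t * inverse (M k) ^ 2"
      using M[of k] by (simp add: field_simps eval_nat_numeral)
    finally show ?thesis .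
  qed
  have iM: "inverse (M k) ^ 2 \<le> 1" for k
    by (rule power_le_one) (auto simp: M_def field_simps)
  \<comment> \<open>A quarter of \<open>X k\<close> comes from \<open>a\<close> and a quarter from
    \<open>b\<close> with \<open>t = 1 / 4\<close>. For each \<open>k\<close> the number
    \<open>X k\<close> is a finite integral, so half of it can be moved to the left, whence the
    factor 2.\<close>
  have Xb: "X k \<le> 2 * (4 * G + 4 * CA + U2)" for k
  proof -
    have "(LINT x|dom_leb. a k x) \<le> (LINT x|dom_leb. d k x / 4 + 4 * form x (g x) (g x))"
      using a_int[of k] di[of k] gN pa[of _ k] by (intro integral_mono) (auto simp: abs_le_iff)
    also have "\<dots> = X k / 4 + 4 * G" using di[of k] gN by (simp add: X_def G_def)
    finally have 1: "(LINT x|dom_leb. a k x) \<le> X k / 4 + 4 * G" .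
    have 2: "(LINT x|dom_leb. b k x) \<le> 1 / 4 * X k + CA / (1 / 4) * inverse (M k) ^ 2"
      using Bb[of "1 / 4" k] by (simp only: abs_le_iff)
    have 3: "CA / (1 / 4) * inverse (M k) ^ 2 \<le> 4 * CA"
      using mult_left_mono[OF iM[of k], of "4 * CA"] CA(1) by simp
    have "(LINT x|dom_leb. s k x) \<le> U2"
      unfolding U2_def
    proof (rule integral_mono[OF si u2])
      show "s k x \<le> (u x)\<^sup>2" for x
        using mult_mono[OF \<phi>1(2)[of k x] S(2)[of k x]] S(1)[of k x] by (simp add: s_def)
    qed
    then show ?thesis using eq[of k] 1 order_trans[OF 2 add_left_mono[OF 3]] unfolding X_def[symmetric] by argo
  qed
  have ptlim: "(\<lambda>k. (\<phi> k x)\<^sup>2) \<longlonglongrightarrow> 1" "(\<lambda>k. S k x) \<longlonglongrightarrow> (u x)\<^sup>2" "(\<lambda>k. S' k x) \<longlonglongrightarrow> 2 * u x" if "x \<in> \<Omega> - K" for x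
  proof -
    show "(\<lambda>k. (\<phi> k x)\<^sup>2) \<longlonglongrightarrow> 1" using tendsto_power[OF \<phi>(8)[of x], of 2] that by simp
    show "(\<lambda>k. S k x) \<longlonglongrightarrow> (u x)\<^sup>2" "(\<lambda>k. S' k x) \<longlonglongrightarrow> 2 * u x"
      unfolding S_def S'_def M_def by (rule trunc_sq_tendsto trunc_sq'_tendsto)+
  qed
  have dlim: "(\<lambda>k. d k x) \<longlonglongrightarrow> ?\<nu> x * (u x)\<^sup>2" if "x \<in> \<Omega> - K" for x
    unfolding d_def using tendsto_mult[OF tendsto_mult[OF ptlim(1,2)[OF that]] tendsto_const[of "?\<nu> x"]]
    by (simp add: mult.commute)
  have d0: "d k x \<ge> 0" if "x \<in> \<Omega>" for k x
    unfolding d_def by (intro mult_nonneg_nonneg S(1) hardy_weight_nonneg that) simp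
  have hm: "(\<lambda>x. ?\<nu> x * (u x)\<^sup>2) \<in> borel_measurable dom_leb"
    by (intro borel_measurable_times borel_measurable_power hardy_weight_measurable um)
  \<comment> \<open>Fatou's lemma with the uniform bound on \<open>X\<close>. Only now is there an
    integrable majorant for the dominated convergence of \<open>d\<close> and, through Young's
    inequality, of \<open>a\<close>.\<close>
  show hi: "integrable dom_leb (\<lambda>x. ?\<nu> x * (u x)\<^sup>2)"
  proof (rule integrableI_nonneg[OF hm])
    show "AE x in dom_leb. 0 \<le> ?\<nu> x * (u x)\<^sup>2" using hardy_weight_nonneg by (intro AE_I2) simp
    have "(\<integral>\<^sup>+x. ennreal (?\<nu> x * (u x)\<^sup>2) \<partial>dom_leb) = (\<integral>\<^sup>+x. liminf (\<lambda>k. ennreal (d k x)) \<partial>dom_leb)"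
    proof (rule nn_integral_cong_AE)
      show "AE x in dom_leb. ennreal (?\<nu> x * (u x)\<^sup>2) = liminf (\<lambda>k. ennreal (d k x))"
        using AE_not_singular
        by eventually_elim (rule lim_imp_Liminf[OF sequentially_bot tendsto_ennrealI[OF dlim], symmetric])
    qed
    also have "\<dots> \<le> liminf (\<lambda>k. \<integral>\<^sup>+x. ennreal (d k x) \<partial>dom_leb)"
      using am(3) by (intro nn_integral_liminf) auto
    also have "\<dots> \<le> liminf (\<lambda>k. ennreal (2 * (4 * G + 4 * CA + U2)))"
    proof (rule Liminf_mono, rule always_eventually, rule allI)
      fix k
      have "(\<integral>\<^sup>+x. ennreal (d k x) \<partial>dom_leb) = ennreal (X k)"
        unfolding X_def using d0 by (intro nn_integral_eq_integral[OF di]) (auto intro!: AE_I2)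
      then show "(\<integral>\<^sup>+x. ennreal (d k x) \<partial>dom_leb) \<le> ennreal (2 * (4 * G + 4 * CA + U2))"
        using Xb[of k] by (simp add: ennreal_leI)
    qed
    also have "\<dots> = ennreal (2 * (4 * G + 4 * CA + U2))" by (rule Liminf_const) simp
    also have "\<dots> < \<infinity>" by simp
    finally show "(\<integral>\<^sup>+x. ennreal (?\<nu> x * (u x)\<^sup>2) \<partial>dom_leb) < \<infinity>" .
  qed
  have crossm: "(\<lambda>x. u x * form x (?L x) (g x)) \<in> borel_measurable dom_leb"
    by (intro borel_measurable_times um measurable_form log_grad_measurable gm)
  have crossb: "2 * \<bar>u x * form x (?L x) (g x)\<bar> \<le> ?\<nu> x * (u x)\<^sup>2 + form x (g x) (g x)" if x: "x \<in> \<Omega>" for x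
  proof -
    have "\<bar>form x (u x *\<^sub>R ?L x) (g x)\<bar> \<le> 1 / 2 * form x (u x *\<^sub>R ?L x) (u x *\<^sub>R ?L x) + form x (g x) (g x) / (4 * (1 / 2))"
      by (rule form_Young[OF x]) simp
    then show ?thesis unfolding form_scale hardy_weight_def by (simp add: power2_eq_square mult_ac)
  qed
  show crossi: "integrable dom_leb (\<lambda>x. u x * form x (?L x) (g x))"
  proof (rule Bochner_Integration.integrable_bound[OF Bochner_Integration.integrable_add[OF hi gN] crossm])
    show "AE x in dom_leb. norm (u x * form x (?L x) (g x)) \<le> norm (?\<nu> x * (u x)\<^sup>2 + form x (g x) (g x))"
    proof (rule AE_I2)
      fix x assume "x \<in> space dom_leb"
      then have "2 * \<bar>u x * form x (?L x) (g x)\<bar> \<le> ?\<nu> x * (u x)\<^sup>2 + form x (g x) (g x)" using crossb by simp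
      then show "norm (u x * form x (?L x) (g x)) \<le> norm (?\<nu> x * (u x)\<^sup>2 + form x (g x) (g x))"
        unfolding real_norm_def by linarith
    qed
  qed
  have D: "X \<longlonglongrightarrow> (LINT x|dom_leb. ?\<nu> x * (u x)\<^sup>2)"
    unfolding X_def
  proof (rule integral_dominated_convergence[OF hm am(3) hi])
    show "AE x in dom_leb. (\<lambda>k. d k x) \<longlonglongrightarrow> ?\<nu> x * (u x)\<^sup>2"
      using AE_not_singular by eventually_elim (rule dlim)
    show "AE x in dom_leb. norm (d k x) \<le> ?\<nu> x * (u x)\<^sup>2" for k
    proof (rule AE_I2)
      fix x assume "x \<in> space dom_leb"
      then have x: "x \<in> \<Omega>" by simp
      have "(\<phi> k x)\<^sup>2 * S k x * ?\<nu> x \<le> 1 * (u x)\<^sup>2 * ?\<nu> x"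
        using \<phi>1[of k x] S(1,2)[of k x] hardy_weight_nonneg[OF x] by (intro mult_mono mult_nonneg_nonneg) auto
      then show "norm (d k x) \<le> ?\<nu> x * (u x)\<^sup>2" using d0[OF x, of k] by (simp add: d_def mult.commute)
    qed
  qed
  have Al: "(\<lambda>k. LINT x|dom_leb. a k x) \<longlonglongrightarrow> (LINT x|dom_leb. 2 * (u x * form x (?L x) (g x)))"
  proof (rule integral_dominated_convergence[OF _ am(1)])
    show "(\<lambda>x. 2 * (u x * form x (?L x) (g x))) \<in> borel_measurable dom_leb"
      by (rule borel_measurable_times[OF borel_measurable_const crossm])
    show "integrable dom_leb (\<lambda>x. 2 * \<bar>u x * form x (?L x) (g x)\<bar>)" using crossi by simp
    show "AE x in dom_leb. (\<lambda>k. a k x) \<longlonglongrightarrow> 2 * (u x * form x (?L x) (g x))"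
      using AE_not_singular
    proof eventually_elim
      case (elim x)
      from tendsto_mult[OF tendsto_mult[OF ptlim(1,3)[OF elim]] tendsto_const[of "form x (?L x) (g x)"]]
      show ?case by (simp add: a_def mult.assoc)
    qed
    show "AE x in dom_leb. norm (a k x) \<le> 2 * \<bar>u x * form x (?L x) (g x)\<bar>" for k
    proof (rule AE_I2)
      fix x
      have "(\<phi> k x)\<^sup>2 * \<bar>S' k x\<bar> * \<bar>form x (?L x) (g x)\<bar> \<le> 1 * (2 * \<bar>u x\<bar>) * \<bar>form x (?L x) (g x)\<bar>"
        using \<phi>1[of k x] S(5)[of k x] by (intro mult_mono mult_nonneg_nonneg) auto
      then show "norm (a k x) \<le> 2 * \<bar>u x * form x (?L x) (g x)\<bar>" by (simp add: a_def abs_mult mult.assoc)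
    qed
  qed
  have Sl: "(\<lambda>k. LINT x|dom_leb. s k x) \<longlonglongrightarrow> U2"
    unfolding U2_def
  proof (rule integral_dominated_convergence[OF _ am(4) u2])
    show "(\<lambda>x. (u x)\<^sup>2) \<in> borel_measurable dom_leb" using u2 by (rule borel_measurable_integrable)
    show "AE x in dom_leb. (\<lambda>k. s k x) \<longlonglongrightarrow> (u x)\<^sup>2"
      using AE_not_singular
    proof eventually_elim
      case (elim x)
      from tendsto_mult[OF ptlim(1,2)[OF elim]] show ?case by (simp add: s_def)
    qed
    have "norm (s k x) \<le> (u x)\<^sup>2" for k x
      using mult_mono[OF \<phi>1(2)[of k x] S(2)[of k x]] S(1)[of k x] by (simp add: s_def abs_mult)
    then show "AE x in dom_leb. norm (s k x) \<le> (u x)\<^sup>2" for k by simp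
  qed
  have Bl: "(\<lambda>k. LINT x|dom_leb. b k x) \<longlonglongrightarrow> 0"
  proof (rule Lim_null_comparison)
    define Q where "Q = 2 * (4 * G + 4 * CA + U2)"
    have iM0: "inverse (M k) > 0" for k using M[of k] by simp
    have "norm (LINT x|dom_leb. b k x) \<le> inverse (M k) * (Q + CA)" for k
    proof -
      have "norm (LINT x|dom_leb. b k x) \<le> inverse (M k) * X k + CA / inverse (M k) * inverse (M k) ^ 2"
        using Bb[OF iM0[of k], of k] by simp
      also have "CA / inverse (M k) * inverse (M k) ^ 2 = inverse (M k) * CA"
        using M[of k] by (simp add: power2_eq_square)
      also have "inverse (M k) * X k \<le> inverse (M k) * Q"
        using Xb[of k] iM0[of k] by (intro mult_left_mono) (auto simp: Q_def)
      finally show ?thesis by (simp add: distrib_left)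
    qed
    then show "\<forall>\<^sub>F k in sequentially. norm (LINT x|dom_leb. b k x) \<le> inverse (M k) * (Q + CA)" by simp
    show "(\<lambda>k. inverse (M k) * (Q + CA)) \<longlonglongrightarrow> 0"
      unfolding M_def by (rule tendsto_mult_left_zero[OF LIMSEQ_inverse_real_of_nat])
  qed
  have "X \<longlonglongrightarrow> (LINT x|dom_leb. 2 * (u x * form x (?L x) (g x))) + 0 + U2"
    unfolding X_def eq by (intro tendsto_add Al Bl Sl)
  from LIMSEQ_unique[OF D this]
  show "2 * (LINT x|dom_leb. u x * form x (?L x) (g x)) = (LINT x|dom_leb. ?\<nu> x * (u x)\<^sup>2) - (LINT x|dom_leb. (u x)\<^sup>2)"
    using crossi by (simp add: U2_def)
qed

end

subsection \<open>The energy identity and the optimality of the constants\<close>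

context interior_weight
begin

lemma square_integrable_dom_leb:
  fixes f :: "real^'n \<Rightarrow> 'b::euclidean_space"
  shows "square_integrable \<Omega> f \<longleftrightarrow> f \<in> borel_measurable dom_leb \<and> integrable dom_leb (\<lambda>x. (norm (f x))\<^sup>2)"
  unfolding square_integrable_def measurable_dom_leb integrable_dom_leb ..

lemma LINT_cong_AE_integrable:
  fixes f g :: "real^'n \<Rightarrow> real"
  assumes f: "integrable dom_leb f" and ae: "AE x in dom_leb. f x = g x"
  shows "integrable dom_leb g" "(LINT x|dom_leb. f x) = (LINT x|dom_leb. g x)"
proof -
  show g: "integrable dom_leb g"
    unfolding integrable_dom_leb
    by (rule set_integrable_cong_AE_on[OF f[unfolded integrable_dom_leb] ae[unfolded AE_dom_leb]])
  show "(LINT x|dom_leb. f x) = (LINT x|dom_leb. g x)"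
    by (rule integral_cong_AE[OF borel_measurable_integrable[OF f] borel_measurable_integrable[OF g] ae])
qed

lemma integrable_square_integrable:
  fixes f :: "real^'n \<Rightarrow> 'b::euclidean_space"
  assumes "f \<in> borel_measurable dom_leb" "integrable dom_leb (\<lambda>x. (norm (f x))\<^sup>2)"
  shows "integrable dom_leb f"
proof (rule Bochner_Integration.integrable_bound[OF Bochner_Integration.integrable_add[OF integrable_const_dom_leb[of 1] assms(2)] assms(1)])
  have "norm (f x) \<le> norm (1 + (norm (f x))\<^sup>2)" for x
  proof -
    have "2 * norm (f x) \<le> 1 + (norm (f x))\<^sup>2" using sum_squares_bound[of 1 "norm (f x)"] by simp
    then show ?thesis using norm_ge_zero[of "f x"] unfolding real_norm_def by linarith
  qed
  then show "AE x in dom_leb. norm (f x) \<le> norm (1 + (norm (f x))\<^sup>2)" by simp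
qed

lemma has_weak_gradient_across:
  fixes v :: "real^'n \<Rightarrow> real"
  assumes "has_weak_gradient (\<Omega> - K) v h"
    and v: "v \<in> borel_measurable dom_leb" "integrable dom_leb (\<lambda>x. (v x)\<^sup>2)"
    and h: "h \<in> borel_measurable dom_leb" "integrable dom_leb (\<lambda>x. (norm (h x))\<^sup>2)"
  shows "has_weak_gradient \<Omega> v h"
proof (rule has_weak_gradient_removable[OF open_dom K(1,3,4) cap assms(1)])
  show "locally_integrable \<Omega> v"
    using integrable_square_integrable[OF v(1)] v(2) by (simp add: integrable_dom_leb set_integrable_locally_integrable)
  show "locally_integrable \<Omega> h"
    using integrable_square_integrable[OF h] by (simp add: integrable_dom_leb set_integrable_locally_integrable)
  show "set_integrable lebesgue \<Omega> (\<lambda>x. (v x)\<^sup>2)" using v(2) by (simp add: integrable_dom_leb)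
qed (rule dom_measure)

text \<open>As soon as some weak gradient exists, the chosen one is a weak gradient as well, and
  uniqueness identifies the two almost everywhere.\<close>

lemma weak_gradient_AE:
  assumes "has_weak_gradient \<Omega> u g"
  shows "AE x in dom_leb. g x = weak_gradient \<Omega> u x"
proof -
  have "has_weak_gradient \<Omega> u (weak_gradient \<Omega> u)"
    unfolding weak_gradient_def by (rule someI[of "has_weak_gradient \<Omega> u", OF assms])
  then show ?thesis unfolding AE_dom_leb by (rule has_weak_gradient_unique[OF open_dom assms])
qed

lemma dirichlet_integral_eq:
  assumes w: "has_weak_gradient \<Omega> u g" and g: "g \<in> borel_measurable dom_leb" "integrable dom_leb (\<lambda>x. (norm (g x))\<^sup>2)"
  shows "dirichlet_integral \<Omega> A u = (LINT x|dom_leb. form x (g x) (g x))"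
proof -
  have "AE x in dom_leb. form x (g x) (g x) = norm_sq A x (weak_gradient \<Omega> u x)"
    using weak_gradient_AE[OF w] by eventually_elim (simp add: norm_sq_form)
  from LINT_cong_AE_integrable(2)[OF integrable_form[OF g] this]
  show ?thesis by (simp add: dirichlet_integral_def LINT_dom_leb)
qed

text \<open>The vector \<open>g - (u / 2) \<nabla>e / e\<close> is \<open>sqrt e \<nabla>(u / sqrt e)\<close>.\<close>

definition ground_grad :: "(real^'n \<Rightarrow> real) \<Rightarrow> (real^'n \<Rightarrow> real^'n) \<Rightarrow> real^'n \<Rightarrow> real^'n" where
  "ground_grad u g x = g x - (u x / 2) *\<^sub>R log_grad x"

lemma form_ground_grad:
  assumes "x \<in> \<Omega>"
  shows "form x (ground_grad u g x) (ground_grad u g x)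
    = form x (g x) (g x) - u x * form x (log_grad x) (g x) + 1/4 * (hardy_weight x * (u x)\<^sup>2)"
proof -
  have g: "ground_grad u g x = g x + (- u x / 2) *\<^sub>R log_grad x" by (simp add: ground_grad_def)
  have "form x (g x) (log_grad x) = form x (log_grad x) (g x)"
    by (rule form_commute[OF closureI[OF assms]])
  then show ?thesis
    unfolding hardy_weight_def g form_add form_scale by (simp add: power2_eq_square algebra_simps)
qed

text \<open>Expanding the square leaves the cross term, which by the logarithmic identity is half of
  the Hardy integral minus half of the mass. The Hardy integral then has the coefficient
  \<open>1/2 - 1/4 = 1/4\<close>, and the mass has \<open>1/2\<close>.\<close>

lemma energy_identity:
  assumes w: "has_weak_gradient (\<Omega> - K) u g"
    and u: "u \<in> borel_measurable dom_leb" "integrable dom_leb (\<lambda>x. (u x)\<^sup>2)"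
    and g: "g \<in> borel_measurable dom_leb" "integrable dom_leb (\<lambda>x. (norm (g x))\<^sup>2)"
  shows "integrable dom_leb (\<lambda>x. form x (ground_grad u g x) (ground_grad u g x))"
    and "(LINT x|dom_leb. form x (g x) (g x)) + 1/2 * (LINT x|dom_leb. (u x)\<^sup>2)
      = 1/4 * (LINT x|dom_leb. hardy_weight x * (u x)\<^sup>2)
        + (LINT x|dom_leb. form x (ground_grad u g x) (ground_grad u g x))"
proof -
  note L = log_identity[OF w u g]
  note gi = integrable_form[OF g]
  let ?f = "\<lambda>x. form x (g x) (g x) - u x * form x (log_grad x) (g x) + 1/4 * (hardy_weight x * (u x)\<^sup>2)"
  have i: "integrable dom_leb ?f"
    by (intro Bochner_Integration.integrable_add Bochner_Integration.integrable_diff integrable_mult_right gi L(1,2))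
  have eq: "AE x in dom_leb. ?f x = form x (ground_grad u g x) (ground_grad u g x)"
    by (rule AE_I2) (simp add: form_ground_grad)
  note C = LINT_cong_AE_integrable[OF i eq]
  show "integrable dom_leb (\<lambda>x. form x (ground_grad u g x) (ground_grad u g x))" by (rule C(1))
  have "(LINT x|dom_leb. ?f x) = (LINT x|dom_leb. form x (g x) (g x)) - (LINT x|dom_leb. u x * form x (log_grad x) (g x))
      + 1/4 * (LINT x|dom_leb. hardy_weight x * (u x)\<^sup>2)"
    using L(1,2) gi by simp
  with C(2) L(3) show "(LINT x|dom_leb. form x (g x) (g x)) + 1/2 * (LINT x|dom_leb. (u x)\<^sup>2)
      = 1/4 * (LINT x|dom_leb. hardy_weight x * (u x)\<^sup>2)
        + (LINT x|dom_leb. form x (ground_grad u g x) (ground_grad u g x))" by argo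
qed

lemma ground_form_nonneg: "(LINT x|dom_leb. form x (ground_grad u g x) (ground_grad u g x)) \<ge> 0"
  by (rule integral_nonneg_AE, rule AE_I2) (simp add: form_nonneg)

lemma ground_grad_measurable:
  "u \<in> borel_measurable dom_leb \<Longrightarrow> g \<in> borel_measurable dom_leb \<Longrightarrow> ground_grad u g \<in> borel_measurable dom_leb"
  unfolding ground_grad_def by (intro borel_measurable_diff borel_measurable_scaleR borel_measurable_divide log_grad_measurable) auto

lemma H1E:
  assumes "u \<in> H1 \<Omega>"
  obtains g where "has_weak_gradient \<Omega> u g" "has_weak_gradient (\<Omega> - K) u g"
    "u \<in> borel_measurable dom_leb" "integrable dom_leb (\<lambda>x. (u x)\<^sup>2)"
    "g \<in> borel_measurable dom_leb" "integrable dom_leb (\<lambda>x. (norm (g x))\<^sup>2)"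
proof -
  from assms obtain g where g: "has_weak_gradient \<Omega> u g" "square_integrable \<Omega> g" and u: "square_integrable \<Omega> u"
    unfolding H1_def by blast
  have "has_weak_gradient (\<Omega> - K) u g" by (rule has_weak_gradient_mono[OF g(1)]) blast
  then show thesis
    using that[of g] g u by (simp add: square_integrable_dom_leb)
qed

lemma H1I:
  assumes "has_weak_gradient \<Omega> u g" "u \<in> borel_measurable dom_leb" "integrable dom_leb (\<lambda>x. (u x)\<^sup>2)"
    "g \<in> borel_measurable dom_leb" "integrable dom_leb (\<lambda>x. (norm (g x))\<^sup>2)"
  shows "u \<in> H1 \<Omega>"
  using assms unfolding H1_def by (auto simp: square_integrable_dom_leb)

theorem hardy_inequality:
  assumes "u \<in> H1 \<Omega>"
  shows "integrable dom_leb (\<lambda>x. hardy_weight x * (u x)\<^sup>2)"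
    and "dirichlet_integral \<Omega> A u + 1/2 * (LINT x|dom_leb. (u x)\<^sup>2) \<ge> 1/4 * (LINT x|dom_leb. hardy_weight x * (u x)\<^sup>2)"
proof -
  obtain g where w: "has_weak_gradient \<Omega> u g" and H: "has_weak_gradient (\<Omega> - K) u g"
    "u \<in> borel_measurable dom_leb" "integrable dom_leb (\<lambda>x. (u x)\<^sup>2)"
    "g \<in> borel_measurable dom_leb" "integrable dom_leb (\<lambda>x. (norm (g x))\<^sup>2)" using H1E[OF assms] by blast
  show "integrable dom_leb (\<lambda>x. hardy_weight x * (u x)\<^sup>2)" by (rule log_identity(1)[OF H])
  show "dirichlet_integral \<Omega> A u + 1/2 * (LINT x|dom_leb. (u x)\<^sup>2) \<ge> 1/4 * (LINT x|dom_leb. hardy_weight x * (u x)\<^sup>2)"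
    unfolding dirichlet_integral_eq[OF w H(4,5)] energy_identity(2)[OF H] using ground_form_nonneg[of u g] by linarith
qed

theorem hardy_not_attained:
  assumes "u \<in> H1 \<Omega>"
    and eq: "dirichlet_integral \<Omega> A u + 1/2 * (LINT x|dom_leb. (u x)\<^sup>2) = 1/4 * (LINT x|dom_leb. hardy_weight x * (u x)\<^sup>2)"
  shows "AE x in dom_leb. u x = 0"
proof -
  obtain g where w: "has_weak_gradient \<Omega> u g" and H: "has_weak_gradient (\<Omega> - K) u g"
    "u \<in> borel_measurable dom_leb" "integrable dom_leb (\<lambda>x. (u x)\<^sup>2)"
    "g \<in> borel_measurable dom_leb" "integrable dom_leb (\<lambda>x. (norm (g x))\<^sup>2)" using H1E[OF assms(1)] by blast
  note L = log_identity[OF H] and En = energy_identity[OF H]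
  have "(LINT x|dom_leb. form x (ground_grad u g x) (ground_grad u g x)) = 0"
    using eq En(2) unfolding dirichlet_integral_eq[OF w H(4,5)] by linarith
  then have ae: "AE x in dom_leb. form x (ground_grad u g x) (ground_grad u g x) = 0"
    using integral_nonneg_eq_0_iff_AE[OF En(1) AE_I2] form_nonneg by simp
  have "AE x in dom_leb. u x * form x (log_grad x) (g x) = 1/2 * (hardy_weight x * (u x)\<^sup>2)"
    using ae AE_not_singular
  proof eventually_elim
    case (elim x)
    then have x: "x \<in> \<Omega>" by simp
    have "c * (norm (ground_grad u g x))\<^sup>2 \<le> 0" using form_ge[OF x, of "ground_grad u g x"] elim by simp
    then have "g x = (u x / 2) *\<^sub>R log_grad x" using c by (simp add: ground_grad_def mult_le_0_iff)
    then show ?case by (simp add: form_scale hardy_weight_def power2_eq_square)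
  qed
  from LINT_cong_AE_integrable(2)[OF L(2) this]
  have "(LINT x|dom_leb. u x * form x (log_grad x) (g x)) = 1/2 * (LINT x|dom_leb. hardy_weight x * (u x)\<^sup>2)" by simp
  with L(3) have "(LINT x|dom_leb. (u x)\<^sup>2) = 0" by argo
  then show ?thesis using integral_nonneg_eq_0_iff_AE[OF H(3)] by simp
qed

section \<open>Powers of the weight: the ground state substitution and near extremals\<close>

lemma grad_weight_powr:
  assumes x: "x \<in> \<Omega> - K"
  shows "grad (\<lambda>x. e x powr a) x = (a * e x powr a) *\<^sub>R log_grad x"
proof -
  have e0: "e x > 0" by (rule weight_pos[OF x])
  have "e differentiable (at x)" using smooth_on_differentiable[OF e] x punctured_subset by auto
  moreover have "((\<lambda>t. t powr a) has_field_derivative a * e x powr (a - 1)) (at (e x))"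
    using has_real_derivative_powr[OF e0, of a] by simp
  ultimately have "grad (\<lambda>x. e x powr a) x = (a * e x powr (a - 1)) *\<^sub>R grad e x" by (rule grad_compose)
  also have "e x powr (a - 1) = e x powr a * inverse (e x)"
    using e0 by (simp add: powr_diff divide_inverse)
  finally show ?thesis by (simp add: log_grad_def mult.assoc)
qed

lemma smooth_weight_powr: "smooth_on (\<Omega> - K) (\<lambda>x. e x powr a)"
  by (intro smooth_on_powr open_punctured smooth_on_subset[OF e punctured_subset] weight_pos)

lemma smooth_measurable:
  assumes "smooth_on (\<Omega> - K) f" shows "f \<in> borel_measurable dom_leb"
  unfolding measurable_dom_leb by (rule measurable_punctured[OF smooth_on_continuous[OF assms]])

text \<open>Off \<open>K\<close> the product rule gives \<open>e powr (-1/2)\<close> times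
  \<open>ground_grad u g\<close> as the gradient of \<open>v\<close>. The statement concerns the
  weak gradient on all of \<open>\<Omega>\<close>, so this field has to be continued across
  \<open>K\<close>: the lower bound \<open>m\<close> of the weight and the ellipticity constant make
  both \<open>v\<close> and the field square integrable, which removability requires.\<close>

theorem ground_state_representation:
  assumes H: "has_weak_gradient (\<Omega> - K) u g"
    "u \<in> borel_measurable dom_leb" "integrable dom_leb (\<lambda>x. (u x)\<^sup>2)"
    "g \<in> borel_measurable dom_leb" "integrable dom_leb (\<lambda>x. (norm (g x))\<^sup>2)"
    and v: "\<And>x. x \<in> \<Omega> - K \<Longrightarrow> v x = e x powr (-1/2) * u x"
  shows "AE x in dom_leb. form x (ground_grad u g x) (ground_grad u g x) = e x * norm_sq A x (weak_gradient \<Omega> v x)"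
proof -
  let ?p = "\<lambda>x. e x powr (-1/2)"
  define h where "h x = ?p x *\<^sub>R ground_grad u g x" for x
  define v0 where "v0 x = ?p x * u x" for x
  have pm: "?p \<in> borel_measurable dom_leb" by (rule smooth_measurable[OF smooth_weight_powr])
  have p: "(?p x)\<^sup>2 \<le> inverse m" "e x * (?p x)\<^sup>2 = 1" if x: "x \<in> \<Omega> - K" for x
  proof -
    have "(?p x)\<^sup>2 = inverse (e x)"
      using weight_pos[OF x] powr_add[of "e x" "-1/2" "-1/2"] by (simp add: power2_eq_square powr_minus)
    then show "(?p x)\<^sup>2 \<le> inverse m" "e x * (?p x)\<^sup>2 = 1" using em[OF x] m by (auto intro: le_imp_inverse_le)
  qed
  have "AE x in lebesgue. x \<in> \<Omega> - K \<longrightarrow> ?p x *\<^sub>R g x + u x *\<^sub>R grad ?p x = h x"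
    by (rule AE_I2) (simp add: h_def ground_grad_def grad_weight_powr scaleR_diff_right mult.commute)
  then have w0: "has_weak_gradient (\<Omega> - K) v0 h"
    unfolding v0_def
    by (rule has_weak_gradient_cong_AE[OF has_weak_gradient_mult[OF open_punctured H(1) smooth_weight_powr], rotated]) simp
  have gm: "ground_grad u g \<in> borel_measurable dom_leb" by (rule ground_grad_measurable[OF H(2,4)])
  have hm: "h \<in> borel_measurable dom_leb" unfolding h_def by (rule borel_measurable_scaleR[OF pm gm])
  have vm: "v0 \<in> borel_measurable dom_leb" unfolding v0_def by (rule borel_measurable_times[OF pm H(2)])
  have v2: "integrable dom_leb (\<lambda>x. (v0 x)\<^sup>2)"
  proof (rule Bochner_Integration.integrable_bound[OF integrable_mult_right[OF H(3), of "inverse m"]])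
    show "(\<lambda>x. (v0 x)\<^sup>2) \<in> borel_measurable dom_leb" by (rule borel_measurable_power[OF vm])
    show "AE x in dom_leb. norm ((v0 x)\<^sup>2) \<le> norm (inverse m * (u x)\<^sup>2)"
      using AE_not_singular
    proof eventually_elim
      case (elim x)
      from mult_right_mono[OF p(1)[OF elim] zero_le_power2[of "u x"]] m
      show ?case by (simp add: v0_def power_mult_distrib)
    qed
  qed
  have h2: "integrable dom_leb (\<lambda>x. (norm (h x))\<^sup>2)"
  proof (rule Bochner_Integration.integrable_bound[OF integrable_mult_right[OF energy_identity(1)[OF H], of "inverse m * inverse c"]])
    show "(\<lambda>x. (norm (h x))\<^sup>2) \<in> borel_measurable dom_leb"
      unfolding power2_norm_eq_inner by (intro borel_measurable_inner hm)
    show "AE x in dom_leb. norm ((norm (h x))\<^sup>2) \<le> norm (inverse m * inverse c * form x (ground_grad u g x) (ground_grad u g x))"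
      using AE_not_singular
    proof eventually_elim
      case (elim x)
      then have x: "x \<in> \<Omega>" by simp
      have "(norm (h x))\<^sup>2 = (?p x)\<^sup>2 * (norm (ground_grad u g x))\<^sup>2" by (simp add: h_def power_mult_distrib)
      also have "\<dots> \<le> inverse m * (inverse c * form x (ground_grad u g x) (ground_grad u g x))"
        using p(1)[OF elim] m c form_ge[OF x, of "ground_grad u g x"]
        by (intro mult_mono) (auto simp: field_simps)
      finally show ?case using m c form_nonneg[OF x] by (simp add: abs_mult mult.assoc)
    qed
  qed
  have w1: "has_weak_gradient \<Omega> v0 h" by (rule has_weak_gradient_across[OF w0 vm v2 hm h2])
  have "AE x in lebesgue. x \<in> \<Omega> \<longrightarrow> v0 x = v x"
    using AE_not_singular unfolding AE_dom_leb by eventually_elim (simp add: v0_def v)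
  then have "has_weak_gradient \<Omega> v h" by (rule has_weak_gradient_cong_AE[OF w1]) simp
  from weak_gradient_AE[OF this] AE_not_singular show ?thesis
  proof eventually_elim
    case (elim x)
    from elim(1) have "e x * norm_sq A x (weak_gradient \<Omega> v x) = e x * form x (h x) (h x)" by (simp add: norm_sq_form)
    also have "\<dots> = e x * (?p x)\<^sup>2 * form x (ground_grad u g x) (ground_grad u g x)"
      unfolding h_def form_scale by (simp add: power2_eq_square mult.assoc)
    finally show ?case unfolding p(2)[OF elim(2)] by simp
  qed
qed

lemma dom_measure_pos: "measure lebesgue \<Omega> > 0"
proof -
  have "emeasure lebesgue \<Omega> \<noteq> 0"
    using open_dom nonempty_dom by (metis open_not_negligible null_setsI negligible_iff_null_sets dom_measure(1))
  then show ?thesis using dom_measure(2) by (simp add: measure_def enn2real_positive_iff zero_less_iff_neq_zero less_top)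
qed

text \<open>As \<open>0 < 2 * s < 1\<close>, the power is at most 1 for \<open>e x \<le> 1\<close>
  and at most \<open>e x\<close> otherwise. Together with the integrability of \<open>e\<close> this
  puts \<open>e powr s\<close> into the square integrable functions.\<close>

lemma weight_powr_bound:
  assumes "x \<in> \<Omega> - K" "0 < s" "s < 1/2"
  shows "(e x powr s)\<^sup>2 \<le> 1 + e x"
proof -
  have e0: "e x > 0" by (rule weight_pos[OF assms(1)])
  have sq: "(e x powr s)\<^sup>2 = e x powr (2 * s)" by (simp add: power2_eq_square powr_add[symmetric])
  show ?thesis
  proof (cases "e x \<le> 1")
    case True
    then have "e x powr (2 * s) \<le> 1 powr (2 * s)" using e0 assms by (intro powr_mono2) auto
    then show ?thesis using sq e0 by simp
  next
    case False
    then have "e x powr (2 * s) \<le> e x powr 1" using assms by (intro powr_mono) auto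
    then show ?thesis using sq e0 by simp
  qed
qed

text \<open>The energy identity cannot be applied to \<open>e powr s\<close> before its gradient is
  known to be square integrable, and that is the claim. It is applied to the bounded functions
  \<open>F k\<close> instead. Their energy is at most \<open>s\<^sup>2\<close> times their Hardy
  integral, so \<open>1/4 - s\<^sup>2\<close> times the Hardy integral is at most half of the mass,
  which is at most half of the integral of \<open>1 + e\<close>. Fatou's lemma concludes.\<close>

lemma hardy_weight_powr_integrable:
  assumes s: "0 < s" "s < 1/2"
  shows "integrable dom_leb (\<lambda>x. hardy_weight x * (e x powr s)\<^sup>2)"
proof -
  have ei': "integrable dom_leb e" using ei by (simp add: integrable_dom_leb)
  \<comment> \<open>The logarithmic identity for the constant 1 shows that the Hardy weight itself
    is integrable. So the Hardy integrals of the bounded functions \<open>F k\<close> are finite,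
    and subtracting them below is legitimate.\<close>
  have "has_weak_gradient (\<Omega> - K) (\<lambda>_. 1) (\<lambda>_. 0)"
    using has_weak_gradient_smooth[OF open_punctured smooth_on_const[of "\<Omega> - K" 1]] by (simp add: grad_const[abs_def])
  from log_identity(1)[OF this] have \<nu>i: "integrable dom_leb hardy_weight"
    using integrable_const_dom_leb by simp
  \<comment> \<open>\<open>F k\<close> increases to \<open>e powr s\<close>; it is bounded, and \<open>|\<nabla>F k| \<le> s F k |\<nabla>e| / e\<close>.\<close>
  define q where "q k x = inverse (e x) + inverse (real (Suc k))" for k x
  define F where "F k x = q k x powr - s" for k x
  define \<theta> where "\<theta> k x = inverse (e x) / q k x" for k x
  have q: "q k x > 0" "q k x \<ge> inverse (real (Suc k))" "q k x \<ge> inverse (e x)" "0 \<le> \<theta> k x" "\<theta> k x \<le> 1" if x: "x \<in> \<Omega> - K" for k x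
  proof -
    have i: "inverse (e x) > 0" "inverse (real (Suc k)) > 0" using weight_pos[OF x] by auto
    then show "q k x > 0" "q k x \<ge> inverse (real (Suc k))" "q k x \<ge> inverse (e x)" unfolding q_def by linarith+
    then show "0 \<le> \<theta> k x" "\<theta> k x \<le> 1" using i unfolding \<theta>_def
      by (auto intro: divide_nonneg_pos simp only: pos_divide_le_eq mult_1_left less_imp_le)
  qed
  have qs: "smooth_on (\<Omega> - K) (q k)" for k
    unfolding q_def
    by (intro smooth_on_add smooth_on_inverse smooth_on_const open_punctured smooth_on_subset[OF e punctured_subset] weight_pos)
  have Fs: "smooth_on (\<Omega> - K) (F k)" for k
    unfolding F_def by (intro smooth_on_powr open_punctured qs q)
  have qg: "grad (q k) x = - inverse (e x) *\<^sub>R log_grad x" if x: "x \<in> \<Omega> - K" for k x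
  proof -
    have d: "e differentiable (at x)" using smooth_on_differentiable[OF e] x punctured_subset by auto
    have e0: "e x \<noteq> 0" using weight_pos[OF x] by simp
    have "(q k has_derivative (\<lambda>h. - (inverse (e x) * (grad e x \<bullet> h) * inverse (e x)) + 0)) (at x)"
      unfolding q_def
      by (intro has_derivative_add Deriv.has_derivative_inverse[OF e0 has_derivative_grad[OF d]] has_derivative_const)
    then have "(q k has_derivative (\<lambda>h. (- inverse (e x) *\<^sub>R log_grad x) \<bullet> h)) (at x)"
      by (rule has_derivative_eq_rhs) (simp add: log_grad_def fun_eq_iff)
    then show ?thesis by (rule grad_unique)
  qed
  have Fg: "grad (F k) x = (s * F k x * \<theta> k x) *\<^sub>R log_grad x" if x: "x \<in> \<Omega> - K" for k x
  proof -
    have d: "q k differentiable (at x)" using smooth_on_differentiable[OF qs] x by auto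
    have "((\<lambda>t. t powr - s) has_field_derivative - s * q k x powr (- s - 1)) (at (q k x))"
      using has_real_derivative_powr[OF q(1)[OF x], of "- s"] by simp
    from grad_compose[OF d this]
    have "grad (F k) x = (- s * q k x powr (- s - 1)) *\<^sub>R grad (q k) x" by (simp add: F_def[abs_def])
    also have "q k x powr (- s - 1) = F k x * inverse (q k x)"
      using q(1)[OF x, of k] by (simp add: F_def powr_diff divide_inverse)
    finally show ?thesis by (simp add: qg[OF x] \<theta>_def divide_inverse mult_ac)
  qed
  have Fm: "F k \<in> borel_measurable dom_leb" for k by (rule smooth_measurable[OF Fs])
  have gm: "grad (F k) \<in> borel_measurable dom_leb" for k
    unfolding measurable_dom_leb by (rule measurable_punctured[OF smooth_on_continuous_grad[OF Fs]])
  have Fp: "F k x \<ge> 0" for k x by (simp add: F_def)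
  have Fb: "F k x \<le> real (Suc k) powr s" "F k x \<le> e x powr s" if x: "x \<in> \<Omega> - K" for k x
  proof -
    have anti: "F k x \<le> y powr s" if y: "y > 0" "q k x \<ge> inverse y" for y
    proof -
      have "q k x powr - s \<le> inverse y powr - s" using y s by (intro powr_mono2') auto
      also have "inverse y powr - s = y powr s" using y by (simp add: powr_minus inverse_powr)
      finally show ?thesis by (simp add: F_def)
    qed
    show "F k x \<le> real (Suc k) powr s" by (rule anti) (use q(2)[OF x] in auto)
    show "F k x \<le> e x powr s" by (rule anti) (use weight_pos[OF x] q(3)[OF x] in auto)
  qed
  have F2: "integrable dom_leb (\<lambda>x. (F k x)\<^sup>2)" for k
  proof (rule Bochner_Integration.integrable_bound[OF integrable_const_dom_leb[of "(real (Suc k) powr s)\<^sup>2"]])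
    show "(\<lambda>x. (F k x)\<^sup>2) \<in> borel_measurable dom_leb" by (rule borel_measurable_power[OF Fm])
    show "AE x in dom_leb. norm ((F k x)\<^sup>2) \<le> norm ((real (Suc k) powr s)\<^sup>2)"
      using AE_not_singular by eventually_elim (use Fb(1) Fp in \<open>auto intro: power_mono\<close>)
  qed
  have gform: "form x (grad (F k) x) (grad (F k) x) \<le> s\<^sup>2 * (hardy_weight x * (F k x)\<^sup>2)" if x: "x \<in> \<Omega> - K" for k x
  proof -
    have "form x (grad (F k) x) (grad (F k) x) = s\<^sup>2 * (hardy_weight x * (F k x)\<^sup>2) * (\<theta> k x)\<^sup>2"
      unfolding Fg[OF x] form_scale hardy_weight_def by (simp add: power2_eq_square mult_ac)
    also have "\<dots> \<le> s\<^sup>2 * (hardy_weight x * (F k x)\<^sup>2) * 1"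
      using q(4,5)[OF x, of k] hardy_weight_nonneg[of x] x
      by (intro mult_left_mono mult_nonneg_nonneg power_le_one) auto
    finally show ?thesis by simp
  qed
  have \<nu>F: "integrable dom_leb (\<lambda>x. hardy_weight x * (F k x)\<^sup>2)" for k
  proof (rule Bochner_Integration.integrable_bound[OF integrable_mult_left[OF \<nu>i, of "(real (Suc k) powr s)\<^sup>2"]])
    show "(\<lambda>x. hardy_weight x * (F k x)\<^sup>2) \<in> borel_measurable dom_leb"
      by (intro borel_measurable_times borel_measurable_power hardy_weight_measurable Fm)
    show "AE x in dom_leb. norm (hardy_weight x * (F k x)\<^sup>2) \<le> norm (hardy_weight x * (real (Suc k) powr s)\<^sup>2)"
      using AE_not_singular
    proof eventually_elim
      case (elim x)
      have "(F k x)\<^sup>2 \<le> (real (Suc k) powr s)\<^sup>2" by (rule power_mono[OF Fb(1)[OF elim] Fp])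
      then show ?case by (simp add: abs_mult mult_left_mono)
    qed
  qed
  have g2: "integrable dom_leb (\<lambda>x. (norm (grad (F k) x))\<^sup>2)" for k
  proof (rule Bochner_Integration.integrable_bound[OF integrable_mult_right[OF \<nu>F[of k], of "inverse c * s\<^sup>2"]])
    show "(\<lambda>x. (norm (grad (F k) x))\<^sup>2) \<in> borel_measurable dom_leb"
      unfolding power2_norm_eq_inner by (intro borel_measurable_inner gm)
    show "AE x in dom_leb. norm ((norm (grad (F k) x))\<^sup>2) \<le> norm (inverse c * s\<^sup>2 * (hardy_weight x * (F k x)\<^sup>2))"
      using AE_not_singular
    proof eventually_elim
      case (elim x)
      then have x: "x \<in> \<Omega>" by simp
      have "c * (norm (grad (F k) x))\<^sup>2 \<le> s\<^sup>2 * (hardy_weight x * (F k x)\<^sup>2)"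
        by (rule order_trans[OF form_ge[OF x] gform[OF elim]])
      then have "inverse c * (c * (norm (grad (F k) x))\<^sup>2) \<le> inverse c * (s\<^sup>2 * (hardy_weight x * (F k x)\<^sup>2))"
        using c by (intro mult_left_mono) auto
      then have "(norm (grad (F k) x))\<^sup>2 \<le> inverse c * s\<^sup>2 * (hardy_weight x * (F k x)\<^sup>2)"
        using c by (simp add: mult.assoc[symmetric])
      then show ?case by (simp add: order_trans[OF _ abs_ge_self])
    qed
  qed
  define R where "R = (LINT x|dom_leb. 1 + e x)"
  have Xb: "(LINT x|dom_leb. hardy_weight x * (F k x)\<^sup>2) \<le> 1/2 * R / (1/4 - s\<^sup>2)" for k
  proof -
    let ?X = "LINT x|dom_leb. hardy_weight x * (F k x)\<^sup>2"
    note H = has_weak_gradient_smooth[OF open_punctured Fs[of k]] Fm[of k] F2[of k] gm[of k] g2[of k]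
    have 1: "1/4 * ?X \<le> (LINT x|dom_leb. form x (grad (F k) x) (grad (F k) x)) + 1/2 * (LINT x|dom_leb. (F k x)\<^sup>2)"
      unfolding energy_identity(2)[OF H] using ground_form_nonneg[of "F k" "grad (F k)"] by linarith
    have "(LINT x|dom_leb. form x (grad (F k) x) (grad (F k) x)) \<le> (LINT x|dom_leb. s\<^sup>2 * (hardy_weight x * (F k x)\<^sup>2))"
    proof (rule integral_mono_AE[OF integrable_form[OF H(4,5)] integrable_mult_right[OF \<nu>F]])
      show "AE x in dom_leb. form x (grad (F k) x) (grad (F k) x) \<le> s\<^sup>2 * (hardy_weight x * (F k x)\<^sup>2)"
        using AE_not_singular by eventually_elim (rule gform)
    qed
    then have 2: "(LINT x|dom_leb. form x (grad (F k) x) (grad (F k) x)) \<le> s\<^sup>2 * ?X" by simp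
    have 3: "(LINT x|dom_leb. (F k x)\<^sup>2) \<le> R"
      unfolding R_def
    proof (rule integral_mono_AE[OF F2])
      show "integrable dom_leb (\<lambda>x. 1 + e x)" by (intro Bochner_Integration.integrable_add integrable_const_dom_leb ei')
      show "AE x in dom_leb. (F k x)\<^sup>2 \<le> 1 + e x"
        using AE_not_singular
      proof eventually_elim
        case (elim x)
        show ?case
          by (rule order_trans[OF power_mono[OF Fb(2)[OF elim] Fp] weight_powr_bound[OF elim s]])
      qed
    qed
    from 1 2 3 have 4: "(1/4 - s\<^sup>2) * ?X \<le> 1/2 * R" by (simp add: left_diff_distrib)
    have "s\<^sup>2 < 1/4" using power_strict_mono[of s "1/2" 2] s by (simp add: power2_eq_square)
    then show ?thesis using 4 by (subst pos_le_divide_eq) (simp_all add: mult.commute)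
  qed
  have lim: "(\<lambda>k. hardy_weight x * (F k x)\<^sup>2) \<longlonglongrightarrow> hardy_weight x * (e x powr s)\<^sup>2" if x: "x \<in> \<Omega> - K" for x
  proof -
    have "(\<lambda>k. q k x) \<longlonglongrightarrow> inverse (e x) + 0"
      unfolding q_def by (intro tendsto_add tendsto_const LIMSEQ_inverse_real_of_nat)
    then have "(\<lambda>k. F k x) \<longlonglongrightarrow> inverse (e x) powr - s"
      unfolding F_def using weight_pos[OF x] by (intro tendsto_powr tendsto_const) auto
    also have "inverse (e x) powr - s = e x powr s" using weight_pos[OF x] by (simp add: powr_minus inverse_powr)
    finally show ?thesis by (intro tendsto_mult tendsto_const tendsto_power)
  qed
  show ?thesis
  proof (rule integrableI_nonneg)
    show hm: "(\<lambda>x. hardy_weight x * (e x powr s)\<^sup>2) \<in> borel_measurable dom_leb"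
      by (intro borel_measurable_times borel_measurable_power hardy_weight_measurable smooth_measurable smooth_weight_powr)
    show "AE x in dom_leb. 0 \<le> hardy_weight x * (e x powr s)\<^sup>2" using hardy_weight_nonneg by (intro AE_I2) simp
    have "(\<integral>\<^sup>+x. ennreal (hardy_weight x * (e x powr s)\<^sup>2) \<partial>dom_leb)
        = (\<integral>\<^sup>+x. liminf (\<lambda>k. ennreal (hardy_weight x * (F k x)\<^sup>2)) \<partial>dom_leb)"
    proof (rule nn_integral_cong_AE)
      show "AE x in dom_leb. ennreal (hardy_weight x * (e x powr s)\<^sup>2) = liminf (\<lambda>k. ennreal (hardy_weight x * (F k x)\<^sup>2))"
        using AE_not_singular
        by eventually_elim (rule lim_imp_Liminf[OF sequentially_bot tendsto_ennrealI[OF lim], symmetric])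
    qed
    also have "\<dots> \<le> liminf (\<lambda>k. \<integral>\<^sup>+x. ennreal (hardy_weight x * (F k x)\<^sup>2) \<partial>dom_leb)"
      by (rule nn_integral_liminf) (rule measurable_compose[OF borel_measurable_integrable[OF \<nu>F] measurable_ennreal])
    also have "\<dots> \<le> liminf (\<lambda>k::nat. ennreal (1/2 * R / (1/4 - s\<^sup>2)))"
    proof (rule Liminf_mono, rule always_eventually, rule allI)
      fix k
      have "(\<integral>\<^sup>+x. ennreal (hardy_weight x * (F k x)\<^sup>2) \<partial>dom_leb) = ennreal (LINT x|dom_leb. hardy_weight x * (F k x)\<^sup>2)"
        using hardy_weight_nonneg by (intro nn_integral_eq_integral[OF \<nu>F] AE_I2) simp
      then show "(\<integral>\<^sup>+x. ennreal (hardy_weight x * (F k x)\<^sup>2) \<partial>dom_leb) \<le> ennreal (1/2 * R / (1/4 - s\<^sup>2))"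
        using Xb[of k] by (simp add: ennreal_leI)
    qed
    also have "\<dots> = ennreal (1/2 * R / (1/4 - s\<^sup>2))" by (rule Liminf_const) simp
    also have "\<dots> < \<infinity>" by simp
    finally show "(\<integral>\<^sup>+x. ennreal (hardy_weight x * (e x powr s)\<^sup>2) \<partial>dom_leb) < \<infinity>" .
  qed
qed

text \<open>For \<open>u = e powr s\<close> the gradient is \<open>s * u\<close> times the
  logarithmic gradient of the weight, so both the energy density and the cross term are multiples of
  the Hardy density, with factors \<open>s\<^sup>2\<close> and \<open>s\<close>. The logarithmic
  identity then reads \<open>2 * s * I = I - J\<close> for the mass \<open>J\<close>.\<close>

theorem weight_powr_energy:
  assumes s: "0 < s" "s < 1/2"
  defines "I \<equiv> LINT x|dom_leb. hardy_weight x * (e x powr s)\<^sup>2"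
  shows "(\<lambda>x. e x powr s) \<in> H1 \<Omega>" "I > 0" "dirichlet_integral \<Omega> A (\<lambda>x. e x powr s) = s\<^sup>2 * I"
    "(LINT x|dom_leb. (e x powr s)\<^sup>2) = (1 - 2 * s) * I"
proof -
  have ei': "integrable dom_leb e" using ei by (simp add: integrable_dom_leb)
  note \<nu>i = hardy_weight_powr_integrable[OF s]
  let ?u = "\<lambda>x. e x powr s"
  define g where "g x = (s * ?u x) *\<^sub>R log_grad x" for x
  have um: "?u \<in> borel_measurable dom_leb" by (rule smooth_measurable[OF smooth_weight_powr])
  have gm: "g \<in> borel_measurable dom_leb"
    unfolding g_def by (intro borel_measurable_scaleR borel_measurable_times borel_measurable_const um log_grad_measurable)
  have "AE x in lebesgue. x \<in> \<Omega> - K \<longrightarrow> grad ?u x = g x" by (rule AE_I2) (simp add: g_def grad_weight_powr)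
  then have w: "has_weak_gradient (\<Omega> - K) ?u g"
    by (rule has_weak_gradient_cong_AE[OF has_weak_gradient_smooth[OF open_punctured smooth_weight_powr], rotated]) simp
  have u2: "integrable dom_leb (\<lambda>x. (?u x)\<^sup>2)"
  proof (rule Bochner_Integration.integrable_bound[OF Bochner_Integration.integrable_add[OF integrable_const_dom_leb[of 1] ei']])
    show "(\<lambda>x. (?u x)\<^sup>2) \<in> borel_measurable dom_leb" by (rule borel_measurable_power[OF um])
    show "AE x in dom_leb. norm ((?u x)\<^sup>2) \<le> norm (1 + e x)"
      using AE_not_singular by eventually_elim (use weight_powr_bound[OF _ s] in \<open>simp add: order_trans[OF _ abs_ge_self]\<close>)
  qed
  have gform: "form x (g x) (g x) = s\<^sup>2 * (hardy_weight x * (?u x)\<^sup>2)" for x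
    unfolding g_def form_scale hardy_weight_def by (simp add: power2_eq_square mult_ac)
  have g2: "integrable dom_leb (\<lambda>x. (norm (g x))\<^sup>2)"
  proof (rule Bochner_Integration.integrable_bound[OF integrable_mult_right[OF \<nu>i, of "inverse c * s\<^sup>2"]])
    show "(\<lambda>x. (norm (g x))\<^sup>2) \<in> borel_measurable dom_leb"
      unfolding power2_norm_eq_inner by (intro borel_measurable_inner gm)
    show "AE x in dom_leb. norm ((norm (g x))\<^sup>2) \<le> norm (inverse c * s\<^sup>2 * (hardy_weight x * (?u x)\<^sup>2))"
    proof (rule AE_I2)
      fix x assume "x \<in> space dom_leb"
      then have x: "x \<in> \<Omega>" by simp
      have "inverse c * (c * (norm (g x))\<^sup>2) \<le> inverse c * (s\<^sup>2 * (hardy_weight x * (?u x)\<^sup>2))"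
        using form_ge[OF x, of "g x"] c unfolding gform by (intro mult_left_mono) auto
      then have "(norm (g x))\<^sup>2 \<le> inverse c * s\<^sup>2 * (hardy_weight x * (?u x)\<^sup>2)"
        using c by (simp add: mult.assoc[symmetric])
      then show "norm ((norm (g x))\<^sup>2) \<le> norm (inverse c * s\<^sup>2 * (hardy_weight x * (?u x)\<^sup>2))"
        by (simp add: order_trans[OF _ abs_ge_self])
    qed
  qed
  have w': "has_weak_gradient \<Omega> ?u g" by (rule has_weak_gradient_across[OF w um u2 gm g2])
  show "?u \<in> H1 \<Omega>" by (rule H1I[OF w' um u2 gm g2])
  show "dirichlet_integral \<Omega> A ?u = s\<^sup>2 * I"
    unfolding dirichlet_integral_eq[OF w' gm g2] gform I_def by simp
  have "?u x * form x (log_grad x) (g x) = s * (hardy_weight x * (?u x)\<^sup>2)" for x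
    unfolding g_def form_scale hardy_weight_def by (simp add: power2_eq_square mult_ac)
  then have "(LINT x|dom_leb. ?u x * form x (log_grad x) (g x)) = s * I" by (simp add: I_def)
  with log_identity(3)[OF w um u2 gm g2]
  show J: "(LINT x|dom_leb. (?u x)\<^sup>2) = (1 - 2 * s) * I" unfolding I_def by (simp add: algebra_simps)
  \<comment> \<open>The sign of \<open>I\<close> is read off from the mass
    \<open>(1 - 2 * s) * I\<close>, which is at least that of the constant
    \<open>m powr s\<close>.\<close>
  have "0 < (m powr s)\<^sup>2 * measure lebesgue \<Omega>" using m dom_measure_pos by simp
  also have "\<dots> = (LINT x|dom_leb. (m powr s)\<^sup>2)"
    using dom_measure by (simp add: measure_restrict_space)
  also have "\<dots> \<le> (LINT x|dom_leb. (?u x)\<^sup>2)"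
  proof (rule integral_mono_AE[OF integrable_const_dom_leb u2])
    show "AE x in dom_leb. (m powr s)\<^sup>2 \<le> (?u x)\<^sup>2"
      using AE_not_singular by eventually_elim (use em m s in \<open>auto intro!: power_mono powr_mono2\<close>)
  qed
  finally show "I > 0" using s unfolding J by (simp add: zero_less_mult_iff)
qed

theorem hardy_half_optimal:
  assumes "a < 1/2"
  shows "\<exists>u\<in>H1 \<Omega>. dirichlet_integral \<Omega> A u + a * (LINT x|dom_leb. (u x)\<^sup>2) < 1/4 * (LINT x|dom_leb. hardy_weight x * (u x)\<^sup>2)"
proof -
  \<comment> \<open>The requirement is \<open>s\<^sup>2 + a * (1 - 2 * s) < 1/4\<close>. The
    difference of the two sides is half of \<open>(1 - 2 * s) * (1/2 + s - 2 * a)\<close>, so every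
    \<open>s\<close> between \<open>2 * a - 1/2\<close> and \<open>1/2\<close> that is positive will
    do.\<close>
  have "max 0 (2 * a - 1/2) < 1/2" using assms by (simp add: max_def)
  then obtain s :: real where s: "max 0 (2 * a - 1/2) < s" "s < 1/2" by (rule dense[THEN exE]) blast
  then have s0: "0 < s" "s < 1/2" by auto
  note P = weight_powr_energy[OF s0]
  let ?I = "LINT x|dom_leb. hardy_weight x * (e x powr s)\<^sup>2"
  have "0 < (1 - 2 * s) * (1/2 + s - 2 * a)" using s by (intro mult_pos_pos) auto
  then have "s\<^sup>2 + a * (1 - 2 * s) < 1/4" by (simp add: power2_eq_square algebra_simps)
  from mult_strict_right_mono[OF this P(2)]
  have "dirichlet_integral \<Omega> A (\<lambda>x. e x powr s) + a * (LINT x|dom_leb. (e x powr s)\<^sup>2) < 1/4 * ?I"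
    unfolding P(3,4) by (simp add: algebra_simps)
  then show ?thesis by (rule bexI[OF _ P(1)])
qed

theorem hardy_quarter_optimal:
  assumes "a > 1/4"
  shows "\<exists>u\<in>H1 \<Omega>. dirichlet_integral \<Omega> A u + 1/2 * (LINT x|dom_leb. (u x)\<^sup>2) < a * (LINT x|dom_leb. hardy_weight x * (u x)\<^sup>2)"
proof -
  \<comment> \<open>For \<open>s = 1/2 - d\<close> the left side has the factor
    \<open>s\<^sup>2 + 1/2 * (1 - 2 * s) = 1/4 + d\<^sup>2\<close>. The bound
    \<open>d \<le> 1/4\<close> keeps \<open>s\<close> positive and gives
    \<open>d\<^sup>2 \<le> d / 4 < a - 1/4\<close>.\<close>
  define d where "d = min (1/4) (a - 1/4)"
  have d: "0 < d" "d \<le> 1/4" "d \<le> a - 1/4" using assms by (auto simp: d_def min_def)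
  define s where "s = 1/2 - d"
  have s0: "0 < s" "s < 1/2" using d by (auto simp: s_def)
  note P = weight_powr_energy[OF s0]
  let ?I = "LINT x|dom_leb. hardy_weight x * (e x powr s)\<^sup>2"
  have "d * d \<le> 1/4 * d" using d by (intro mult_right_mono) auto
  then have "s\<^sup>2 + 1/2 * (1 - 2 * s) < a" using d unfolding s_def power2_eq_square left_diff_distrib right_diff_distrib by linarith
  from mult_strict_right_mono[OF this P(2)]
  have "dirichlet_integral \<Omega> A (\<lambda>x. e x powr s) + 1/2 * (LINT x|dom_leb. (e x powr s)\<^sup>2) < a * ?I"
    unfolding P(3,4) by (simp add: algebra_simps)
  then show ?thesis by (rule bexI[OF _ P(1)])
qed

text \<open>The values of \<open>u\<close> on \<open>K\<close> are arbitrary; set to 0 there,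
  \<open>u\<close> is Lipschitz on all of \<open>\<Omega>\<close>. The support \<open>C\<close> has
  a positive distance \<open>\<delta>\<close> from \<open>K\<close>, so between a point of
  \<open>C\<close> and a point of \<open>K\<close> the jump of at most \<open>B\<close> is bounded
  by \<open>B / \<delta>\<close> times their distance.\<close>

lemma Lipschitz_H1:
  assumes "u \<in> lipschitz_compact_support \<Omega> K"
  shows "u \<in> H1 \<Omega>"
proof -
  obtain L where L: "L-lipschitz_on (closure \<Omega> - K) u"
    and Cc: "compact (closure {x\<in>closure \<Omega> - K. u x \<noteq> 0})"
    and Cs: "closure {x\<in>closure \<Omega> - K. u x \<noteq> 0} \<subseteq> closure \<Omega> - K"
    using assms unfolding lipschitz_compact_support_def by blast
  define C where "C = closure {x\<in>closure \<Omega> - K. u x \<noteq> 0}"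
  have uc: "continuous_on (closure \<Omega> - K) u" by (rule lipschitz_on_continuous_on[OF L])
  have L0: "L \<ge> 0" by (rule lipschitz_on_nonneg[OF L])
  have out: "u x = 0" if "x \<in> closure \<Omega> - K" "x \<notin> C" for x
  proof (rule ccontr)
    assume "u x \<noteq> 0"
    then have "x \<in> {x\<in>closure \<Omega> - K. u x \<noteq> 0}" using that by blast
    then have "x \<in> C" unfolding C_def by (rule subsetD[OF closure_subset])
    with that show False by blast
  qed
  have "bounded (u ` C)"
    by (rule compact_imp_bounded, rule compact_continuous_image) (use continuous_on_subset[OF uc Cs] Cc in \<open>auto simp: C_def\<close>)
  then obtain B where B: "B > 0" "\<forall>y\<in>u ` C. norm y \<le> B" unfolding bounded_pos by blast
  have ub: "\<bar>u x\<bar> \<le> B" if "x \<in> closure \<Omega> - K" for x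
    using B out[OF that] by (cases "x \<in> C") auto
  have "C \<inter> K = {}" using Cs unfolding C_def by blast
  then obtain \<delta> where \<delta>: "\<delta> > 0" "\<And>x y. x \<in> C \<Longrightarrow> y \<in> K \<Longrightarrow> \<delta> \<le> dist x y"
    using separate_compact_closed[OF Cc[folded C_def] compact_imp_closed[OF K(1)]] by blast
  define u0 where "u0 x = (if x \<in> K then 0 else u x)" for x
  have far: "\<bar>u x\<bar> \<le> (L + B / \<delta>) * norm (x - y)" if "x \<in> \<Omega>" "x \<notin> K" "y \<in> K" for x y
  proof (cases "x \<in> C")
    case True
    have x: "x \<in> closure \<Omega> - K" using that closureI by blast
    have "1 \<le> norm (x - y) / \<delta>" using \<delta>(2)[OF True that(3)] \<delta>(1) by (simp add: dist_norm)
    then have "B * 1 \<le> B * (norm (x - y) / \<delta>)" using B(1) by (intro mult_left_mono) auto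
    moreover have "0 \<le> L * norm (x - y)" using L0 by simp
    ultimately show ?thesis using ub[OF x] by (simp add: distrib_right)
  next
    case False
    then have "u x = 0" using that closureI by (intro out) blast+
    then show ?thesis using L0 B(1) \<delta>(1) by simp
  qed
  have "\<bar>u0 x - u0 y\<bar> \<le> (L + B / \<delta>) * norm (x - y)" if xy: "x \<in> \<Omega>" "y \<in> \<Omega>" for x y
  proof -
    consider "x \<in> K" "y \<in> K" | "x \<in> K" "y \<notin> K" | "x \<notin> K" "y \<in> K" | "x \<notin> K" "y \<notin> K" by blast
    then show ?thesis
    proof cases
      case 1 then show ?thesis using L0 B(1) \<delta>(1) by (simp add: u0_def)
    next
      case 2 then show ?thesis using far[OF xy(2) 2(2,1)] by (simp add: u0_def norm_minus_commute)
    next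
      case 3 then show ?thesis using far[OF xy(1) 3] by (simp add: u0_def)
    next
      case 4
      have "dist (u x) (u y) \<le> L * dist x y"
        by (rule lipschitz_onD[OF L]) (use xy 4 closureI in blast)+
      also have "\<dots> \<le> (L + B / \<delta>) * dist x y" using B(1) \<delta>(1) by (intro mult_right_mono) auto
      finally show ?thesis using 4 by (simp add: u0_def dist_norm)
    qed
  qed
  then obtain g P where g: "g \<in> borel_measurable lebesgue" "\<And>x. norm (g x) \<le> P" "has_weak_gradient \<Omega> u0 g"
    using Lipschitz_has_weak_gradient[OF open_dom bounded_dom nonempty_dom, of u0] by metis
  have "AE x in lebesgue. x \<in> \<Omega> \<longrightarrow> u0 x = u x"
    using AE_not_singular unfolding AE_dom_leb by eventually_elim (simp add: u0_def)
  then have w: "has_weak_gradient \<Omega> u g" by (rule has_weak_gradient_cong_AE[OF g(3)]) simp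
  have um: "u \<in> borel_measurable dom_leb"
    unfolding measurable_dom_leb
    by (rule measurable_punctured, rule continuous_on_subset[OF uc]) (use closureI in blast)
  have gm: "g \<in> borel_measurable dom_leb" by (rule measurable_restrict_space1[OF g(1)])
  show ?thesis
  proof (rule H1I[OF w um _ gm])
    show "integrable dom_leb (\<lambda>x. (u x)\<^sup>2)"
    proof (rule Bochner_Integration.integrable_bound[OF integrable_const_dom_leb[of "B\<^sup>2"] borel_measurable_power[OF um]])
      show "AE x in dom_leb. norm ((u x)\<^sup>2) \<le> norm (B\<^sup>2)"
        using AE_not_singular
      proof eventually_elim
        case (elim x)
        then have "\<bar>u x\<bar> \<le> B" using closureI by (intro ub) blast
        then have "\<bar>u x\<bar>\<^sup>2 \<le> B\<^sup>2" by (rule power_mono) simp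
        then show ?case by simp
      qed
    qed
    show "integrable dom_leb (\<lambda>x. (norm (g x))\<^sup>2)"
    proof (rule Bochner_Integration.integrable_bound[OF integrable_const_dom_leb[of "P\<^sup>2"]])
      show "(\<lambda>x. (norm (g x))\<^sup>2) \<in> borel_measurable dom_leb"
        unfolding power2_norm_eq_inner by (intro borel_measurable_inner gm)
      show "AE x in dom_leb. norm ((norm (g x))\<^sup>2) \<le> norm (P\<^sup>2)"
        using power_mono[OF g(2) norm_ge_zero, of _ 2] by (intro AE_I2) simp
    qed
  qed
qed

theorem hardy_ground_state:
  assumes "u \<in> H1 \<Omega>" and v: "\<And>x. x \<in> \<Omega> - K \<Longrightarrow> v x = e x powr (-1/2) * u x"
  shows "integrable dom_leb (\<lambda>x. e x * norm_sq A x (weak_gradient \<Omega> v x))"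
    and "dirichlet_integral \<Omega> A u + 1/2 * (LINT x|dom_leb. (u x)\<^sup>2)
      = 1/4 * (LINT x|dom_leb. hardy_weight x * (u x)\<^sup>2) + (LINT x|dom_leb. e x * norm_sq A x (weak_gradient \<Omega> v x))"
proof -
  obtain g where w: "has_weak_gradient \<Omega> u g" and H: "has_weak_gradient (\<Omega> - K) u g"
    "u \<in> borel_measurable dom_leb" "integrable dom_leb (\<lambda>x. (u x)\<^sup>2)"
    "g \<in> borel_measurable dom_leb" "integrable dom_leb (\<lambda>x. (norm (g x))\<^sup>2)" using H1E[OF assms(1)] by blast
  have "AE x in dom_leb. form x (ground_grad u g x) (ground_grad u g x) = e x * norm_sq A x (weak_gradient \<Omega> v x)"
    by (rule ground_state_representation[OF H]) (rule v)
  note C = LINT_cong_AE_integrable[OF energy_identity(1)[OF H] this]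
  show "integrable dom_leb (\<lambda>x. e x * norm_sq A x (weak_gradient \<Omega> v x))" by (rule C(1))
  show "dirichlet_integral \<Omega> A u + 1/2 * (LINT x|dom_leb. (u x)\<^sup>2)
      = 1/4 * (LINT x|dom_leb. hardy_weight x * (u x)\<^sup>2) + (LINT x|dom_leb. e x * norm_sq A x (weak_gradient \<Omega> v x))"
    using energy_identity(2)[OF H] C(2) unfolding dirichlet_integral_eq[OF w H(4,5)] by argo
qed

end

section \<open>From the definition of a weight to smooth representatives\<close>

lemma measure_support_null:
  fixes \<mu> :: "(real^'n) measure"
  assumes \<mu>: "sets \<mu> = sets borel" and C: "compact C" "C \<inter> measure_support \<mu> = {}"
  shows "C \<in> null_sets \<mu>"
proof -
  let ?T = "{U. open U \<and> emeasure \<mu> U = 0}"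
  have "C \<subseteq> \<Union>?T"
  proof
    fix x assume "x \<in> C"
    then have "x \<notin> measure_support \<mu>" using C(2) by blast
    then show "x \<in> \<Union>?T" by (auto simp: measure_support_def not_gr_zero)
  qed
  then obtain T where T: "T \<subseteq> ?T" "finite T" "C \<subseteq> \<Union>T" by (rule compactE[OF C(1)]) blast
  have "U \<in> null_sets \<mu>" if "U \<in> T" for U
    using T(1) that by (intro null_setsI) (auto simp: \<mu>)
  then have "\<Union>T \<in> null_sets \<mu>" using T(2) by (intro null_sets.finite_Union) auto
  then show ?thesis
    by (rule null_sets_subset) (use T(3) C(1) in \<open>auto simp: \<mu> intro: borel_compact\<close>)
qed

lemma elliptic_op_cong:
  assumes "open U" "x \<in> U" "\<And>y. y \<in> U \<Longrightarrow> A y = B y"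
  shows "elliptic_op A \<phi> x = elliptic_op B \<phi> x"
proof -
  have "grad (\<lambda>y. (A y *v grad \<phi> y) $ i) x = grad (\<lambda>y. (B y *v grad \<phi> y) $ i) x" for i
    by (rule grad_cong[OF assms(1,2)]) (simp add: assms(3))
  then show ?thesis by (simp add: elliptic_op_def divergence_def)
qed

lemma elliptic_op_eq_0:
  assumes "open U" "x \<in> U" "\<And>y. y \<in> U \<Longrightarrow> grad \<phi> y = 0"
  shows "elliptic_op A \<phi> x = 0"
proof -
  have "grad (\<lambda>y. (A y *v grad \<phi> y) $ i) x = grad (\<lambda>y. 0) x" for i
    by (rule grad_cong[OF assms(1,2)]) (simp add: assms(3))
  then show ?thesis by (simp add: elliptic_op_def divergence_def)
qed

text \<open>The hypotheses fix \<open>A\<close> and \<open>E\<close> only on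
  \<open>closure \<Omega>\<close>, and \<open>E\<close> takes extended real values. Smooth
  extensions replace them; for the entries of \<open>A\<close> the finitely many open sets are
  intersected. Interior derivatives, and the Neumann condition on the boundary, carry over because
  the functions agree on \<open>closure \<Omega>\<close> and on
  \<open>closure \<Omega> - K\<close>.\<close>

lemma neumann_interior_weight_representative:
  fixes \<Omega> K :: "(real^'n) set" and A :: "real^'n \<Rightarrow> real^'n^'n" and E :: "real^'n \<Rightarrow> ereal"
  assumes dom: "smooth_bounded_domain \<Omega>" and ell: "elliptic_coefficients \<Omega> A"
    and wt: "neumann_interior_weight \<Omega> A K E"
  obtains V W B e c m where "interior_weight \<Omega> K V W B e c m"
    "\<And>x. x \<in> closure \<Omega> \<Longrightarrow> A x = B x" "\<And>x. x \<in> closure \<Omega> - K \<Longrightarrow> real_of_ereal (E x) = e x"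
proof -
  let ?E = "\<lambda>x. real_of_ereal (E x)"
  have O: "open \<Omega>" "bounded \<Omega>" "\<Omega> \<noteq> {}" using dom by (auto simp: smooth_bounded_domain_def)
  have cl: "\<Omega> \<subseteq> closure \<Omega>" by (rule closure_subset)
  have "\<forall>i j. \<exists>U g. open U \<and> closure \<Omega> \<subseteq> U \<and> smooth_on U g \<and> (\<forall>x\<in>closure \<Omega>. A x $ i $ j = g x)"
    and symA: "\<And>x. x \<in> closure \<Omega> \<Longrightarrow> transpose (A x) = A x"
    and "\<exists>c>0. \<forall>x\<in>closure \<Omega>. \<forall>\<xi>. (A x *v \<xi>) \<bullet> \<xi> \<ge> c * (norm \<xi>)\<^sup>2"
    using ell unfolding elliptic_coefficients_def smooth_upto_def by blast+
  then obtain Y G c where Y: "\<And>i j. open (Y i j)" "\<And>i j. closure \<Omega> \<subseteq> Y i j" "\<And>i j. smooth_on (Y i j) (G i j)"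
    "\<And>i j x. x \<in> closure \<Omega> \<Longrightarrow> A x $ i $ j = G i j x"
    and c: "c > 0" "\<And>x \<xi>. x \<in> closure \<Omega> \<Longrightarrow> (A x *v \<xi>) \<bullet> \<xi> \<ge> c * (norm \<xi>)\<^sup>2"
    by metis
  define V where "V = (\<Inter>i. \<Inter>j. Y i j)"
  define B where "B x = (\<chi> i j. G i j x)" for x
  have V: "open V" unfolding V_def by (intro open_INT finite ballI Y(1))
  have clV: "closure \<Omega> \<subseteq> V" unfolding V_def using Y(2) by blast
  have AB: "A x = B x" if "x \<in> closure \<Omega>" for x using Y(4)[OF that] by (simp add: B_def vec_eq_iff)
  have Bs: "smooth_on V (\<lambda>x. B x $ i $ j)" for i j
    unfolding B_def vec_lambda_beta by (rule smooth_on_subset[OF Y(3)]) (auto simp: V_def)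
  have K: "compact K" "K \<subseteq> \<Omega>"
    and fin: "\<forall>x\<in>closure \<Omega> - K. \<bar>E x\<bar> \<noteq> \<infinity>"
    and sm: "smooth_upto (closure \<Omega> - K) ?E"
    and pos: "(INF x\<in>\<Omega>. E x) > 0"
    and nc: "\<forall>x\<in>frontier \<Omega>. \<forall>p \<nu>. (?E has_derivative (\<lambda>h. p \<bullet> h)) (at x within closure \<Omega>) \<and>
        outward_unit_normal \<Omega> x \<nu> \<longrightarrow> (A x *v p) \<bullet> \<nu> = 0"
    using wt unfolding neumann_interior_weight_def by - (elim conjE, assumption)+
  obtain d where d: "has_box_dim \<Omega> K d" "d < real CARD('n) - 2"
    using wt unfolding neumann_interior_weight_def by blast
  obtain \<mu> where de: "distributional_eq \<Omega> A ?E \<mu>" and supp: "measure_support \<mu> = K"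
    using wt unfolding neumann_interior_weight_def by blast
  note cap = box_dim_zero_capacity[OF O(1,3) K d]
  obtain U e where U: "open U" "closure \<Omega> - K \<subseteq> U" "smooth_on U e" and Ee: "\<And>x. x \<in> closure \<Omega> - K \<Longrightarrow> ?E x = e x"
    using sm unfolding smooth_upto_def by blast
  define W where "W = U \<inter> V"
  have W: "open W" "closure \<Omega> - K \<subseteq> W" "W \<subseteq> V" unfolding W_def using U V clV by auto
  have es: "smooth_on W e" by (rule smooth_on_subset[OF U(3)]) (simp add: W_def)
  obtain m where m: "0 < m" "ereal m < (INF x\<in>\<Omega>. E x)" using ereal_dense2[OF pos] by (auto simp: zero_ereal_def)
  have em: "m \<le> e x" if x: "x \<in> \<Omega> - K" for x
  proof -
    have "ereal m < E x" using m(2) INF_lower[of x \<Omega> E] x by (simp add: less_le_trans)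
    moreover have "E x = ereal (e x)" using bspec[OF fin, of x] Ee[of x] x cl by (cases "E x") auto
    ultimately show ?thesis by simp
  qed
  have li: "locally_integrable \<Omega> ?E" and \<mu>: "sets \<mu> = sets borel"
    and deq: "\<And>\<phi>. \<phi> \<in> test_functions \<Omega> \<Longrightarrow> (LINT x:\<Omega>|lebesgue. ?E x * (elliptic_op A \<phi> x + \<phi> x)) = (LINT x|\<mu>. \<phi> x)"
    using de unfolding distributional_eq_def by blast+
  \<comment> \<open>The distributional equation provides integrability on compact subsets of
    \<open>\<Omega>\<close>, here on a neighbourhood of \<open>K\<close>. Away from \<open>K\<close>
    the representative is continuous up to the boundary.\<close>
  have ei: "set_integrable lebesgue \<Omega> e"
  proof -
    obtain \<delta> where \<delta>: "\<delta> > 0" "{x. infdist x K \<le> \<delta>} \<subseteq> \<Omega>"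
      by (rule compact_infdist_subset[OF K(1) cap(1) O(1) K(2)])
    let ?N = "{x. infdist x K \<le> \<delta>}" and ?F = "closure \<Omega> \<inter> {x. \<delta> \<le> infdist x K}"
    have N: "compact ?N"
      using infdist_neighbourhood_bounded[OF K(1) cap(1)]
      by (auto simp: compact_eq_bounded_closed intro!: closed_Collect_le continuous_intros)
    have F: "compact ?F"
      using O(2) by (intro compact_Int_closed closed_Collect_le continuous_intros) (simp add: compact_closure)
    have "AE x in lebesgue. x \<in> ?N \<longrightarrow> ?E x = e x"
      using AE_not_in[OF cap(2)] by eventually_elim (use \<delta>(2) cl Ee in blast)
    then have 1: "set_integrable lebesgue ?N e"
      by (rule set_integrable_cong_AE_on[OF locally_integrableD[OF li N \<delta>(2)]])
    have "?F \<subseteq> closure \<Omega> - K" using \<delta>(1) by auto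
    then have "?F \<subseteq> W" using W(2) by blast
    then have 2: "set_integrable lebesgue ?F e"
      by (rule locally_integrableD[OF locally_integrable_continuous[OF smooth_on_continuous[OF es]] F])
    have s: "?N \<in> sets lebesgue" "?F \<in> sets lebesgue" using lmeasurable_compact N F by blast+
    have "set_integrable lebesgue (?N \<union> ?F) e" by (rule set_integrable_Un[OF 1 2 s])
    then show ?thesis
      by (rule set_integrable_subset) (use O(1,2) cl lmeasurable_open in \<open>auto intro: fmeasurableD\<close>)
  qed
  have "interior_weight \<Omega> K V W B e c m"
  proof (unfold_locales)
    show "c * (norm \<xi>)\<^sup>2 \<le> (B x *v \<xi>) \<bullet> \<xi>" if "x \<in> closure \<Omega>" for x \<xi> using c(2)[OF that] AB[OF that] by simp
    show "transpose (B x) = B x" if "x \<in> closure \<Omega>" for x using symA[OF that] AB[OF that] by simp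
    fix \<phi> assume \<phi>: "\<phi> \<in> test_functions (\<Omega> - K)"
    obtain C where C: "compact C" "C \<subseteq> \<Omega> - K" "\<And>x. x \<notin> C \<Longrightarrow> \<phi> x = 0" "\<And>x. x \<notin> C \<Longrightarrow> grad \<phi> x = 0"
      by (rule test_functionsD[OF \<phi>]) blast
    have "\<phi> \<in> test_functions \<Omega>" by (rule test_functions_mono[OF Diff_subset \<phi>])
    note D = deq[OF this]
    \<comment> \<open>The compact set \<open>C\<close> misses the support of \<open>\<mu>\<close>,
      so finitely many open sets of measure zero cover it. Hence \<open>\<mu>\<close> does not see
      test functions carried by \<open>C\<close>, and the equation becomes homogeneous.\<close>
    have "C \<in> null_sets \<mu>" using C(1,2) supp by (intro measure_support_null \<mu>) auto
    then have "AE x in \<mu>. \<phi> x = 0" using AE_not_in[of C \<mu>] C(3) by (auto elim: eventually_mono)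
    then have "(LINT x|\<mu>. \<phi> x) = 0" by (rule integral_eq_zero_AE)
    moreover have "indicator \<Omega> x *\<^sub>R (?E x * (elliptic_op A \<phi> x + \<phi> x)) = e x * (elliptic_op B \<phi> x + \<phi> x)" for x
    proof (cases "x \<in> C")
      case True
      then have x: "x \<in> \<Omega>" "x \<in> closure \<Omega> - K" using C(2) cl by auto
      have "elliptic_op A \<phi> x = elliptic_op B \<phi> x" by (rule elliptic_op_cong[OF O(1) x(1)]) (use AB cl in blast)
      then show ?thesis using x Ee by simp
    next
      case False
      have "open (- C)" using C(1) by (simp add: compact_imp_closed open_Compl)
      then have "elliptic_op A \<phi> x = 0" "elliptic_op B \<phi> x = 0"
        using False C(4) by (auto intro!: elliptic_op_eq_0[where U = "- C"])
      then show ?thesis using C(3)[OF False] by simp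
    qed
    ultimately show "(LINT x|lebesgue. e x * (elliptic_op B \<phi> x + \<phi> x)) = 0"
      using D by (simp add: set_lebesgue_integral_def)
  next
    fix x \<nu> assume x: "x \<in> frontier \<Omega>" and \<nu>: "outward_unit_normal \<Omega> x \<nu>"
    have xc: "x \<in> closure \<Omega>" and xO: "x \<notin> \<Omega>" using x O(1) by (auto simp: frontier_def interior_open)
    then have xK: "x \<in> - K" using K(2) by blast
    have "open (- K)" using K(1) by (simp add: compact_imp_closed open_Compl)
    then obtain \<delta> where \<delta>: "\<delta> > 0" "ball x \<delta> \<subseteq> - K" using xK by (meson open_contains_ball)
    have "e differentiable (at x)" by (rule smooth_on_differentiable[OF es]) (use W(2) xc xK in blast)
    then have "(e has_derivative (\<lambda>h. grad e x \<bullet> h)) (at x within closure \<Omega>)"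
      by (rule has_derivative_at_withinI[OF has_derivative_grad])
    \<comment> \<open>The Neumann condition is stated for derivatives relative to
      \<open>closure \<Omega>\<close>. Near \<open>x\<close> the representative coincides with the
      weight on that set, so its ordinary gradient is such a derivative.\<close>
    then have "(?E has_derivative (\<lambda>h. grad e x \<bullet> h)) (at x within closure \<Omega>)"
    proof (rule has_derivative_transform_within[OF _ \<delta>(1) xc])
      fix y assume "y \<in> closure \<Omega>" "dist y x < \<delta>"
      moreover from this have "y \<in> ball x \<delta>" by (simp add: dist_commute)
      ultimately show "e y = ?E y" using \<delta>(2) Ee by auto
    qed
    from nc[rule_format, OF x conjI[OF this \<nu>]] have "(A x *v grad e x) \<bullet> \<nu> = 0" .
    then show "(B x *v grad e x) \<bullet> \<nu> = 0" using AB[OF xc] by simp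
  qed (fact dom c(1) V clV Bs W es K cap m(1) em ei)+
  then show thesis by (rule that[OF _ AB Ee])
qed

theorem theorem2p13:
  fixes \<Omega> K :: "(real^'n) set" and A :: "real^'n \<Rightarrow> real^'n^'n" and E :: "real^'n \<Rightarrow> ereal"
  assumes "smooth_bounded_domain \<Omega>"
    and "elliptic_coefficients \<Omega> A"
    and "neumann_interior_weight \<Omega> A K E"
  shows
    "(\<forall>u\<in>lipschitz_compact_support \<Omega> K. \<forall>v.
        v = (\<lambda>x. real_of_ereal (E x) powr (-1/2) * u x) \<longrightarrow>
        set_integrable lebesgue \<Omega> (hardy_integrand A E u) \<and>
        set_integrable lebesgue \<Omega> (\<lambda>x. real_of_ereal (E x) * norm_sq A x (weak_gradient \<Omega> v x)) \<and>
        dirichlet_integral \<Omega> A u + 1/2 * (LINT x:\<Omega>|lebesgue. (u x)\<^sup>2)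
          \<ge> 1/4 * (LINT x:\<Omega>|lebesgue. hardy_integrand A E u x)
            + (LINT x:\<Omega>|lebesgue. real_of_ereal (E x) * norm_sq A x (weak_gradient \<Omega> v x)))
     \<and> (\<forall>u\<in>H1 \<Omega>.
          set_integrable lebesgue \<Omega> (hardy_integrand A E u) \<and>
          dirichlet_integral \<Omega> A u + 1/2 * (LINT x:\<Omega>|lebesgue. (u x)\<^sup>2)
            \<ge> 1/4 * (LINT x:\<Omega>|lebesgue. hardy_integrand A E u x))
     \<and> (\<forall>c<1/2. \<not> (\<forall>u\<in>H1 \<Omega>.
          dirichlet_integral \<Omega> A u + c * (LINT x:\<Omega>|lebesgue. (u x)\<^sup>2)
            \<ge> 1/4 * (LINT x:\<Omega>|lebesgue. hardy_integrand A E u x)))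
     \<and> (\<forall>c>1/4. \<not> (\<forall>u\<in>H1 \<Omega>.
          dirichlet_integral \<Omega> A u + 1/2 * (LINT x:\<Omega>|lebesgue. (u x)\<^sup>2)
            \<ge> c * (LINT x:\<Omega>|lebesgue. hardy_integrand A E u x)))
     \<and> (\<forall>u\<in>H1 \<Omega>. \<not> (AE x in lebesgue. x \<in> \<Omega> \<longrightarrow> u x = 0) \<longrightarrow>
          dirichlet_integral \<Omega> A u + 1/2 * (LINT x:\<Omega>|lebesgue. (u x)\<^sup>2)
            \<noteq> 1/4 * (LINT x:\<Omega>|lebesgue. hardy_integrand A E u x))"
proof -
  let ?E = "\<lambda>x. real_of_ereal (E x)"
  obtain V W B e c0 m where iw: "interior_weight \<Omega> K V W B e c0 m"
    and AB: "\<And>x. x \<in> closure \<Omega> \<Longrightarrow> A x = B x" and Ee: "\<And>x. x \<in> closure \<Omega> - K \<Longrightarrow> ?E x = e x"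
    by (rule neumann_interior_weight_representative[OF assms]) blast
  interpret interior_weight \<Omega> K V W B e c0 m by (rule iw)
  have Ee': "?E x = e x" if "x \<in> \<Omega> - K" for x using Ee closureI that by blast
  have nB: "norm_sq A x \<xi> = norm_sq B x \<xi>" if "x \<in> \<Omega>" for x \<xi> using AB[OF closureI[OF that]] by (simp add: norm_sq_def)
  have dirB: "dirichlet_integral \<Omega> A u = dirichlet_integral \<Omega> B u" for u
    unfolding dirichlet_integral_def by (rule set_lebesgue_integral_cong) (use dom_measure nB in auto)
  have hw: "hardy_weight x * (u x)\<^sup>2 = hardy_integrand A E u x" if x: "x \<in> \<Omega> - K" for u x
  proof -
    have "grad ?E x = grad e x" by (rule grad_cong[OF open_punctured x Ee'])
    then show ?thesis
      using x by (simp add: hardy_integrand_def Ee' nB norm_sq_form hardy_weight_def log_grad_def form_scale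
          power2_eq_square divide_inverse mult_ac)
  qed
  have Hi: "integrable dom_leb (hardy_integrand A E u)"
    and HI: "(LINT x|dom_leb. hardy_integrand A E u x) = (LINT x|dom_leb. hardy_weight x * (u x)\<^sup>2)"
    if u: "u \<in> H1 \<Omega>" for u
  proof -
    have "AE x in dom_leb. hardy_weight x * (u x)\<^sup>2 = hardy_integrand A E u x"
      using AE_not_singular by eventually_elim (rule hw)
    note C = LINT_cong_AE_integrable[OF hardy_inequality(1)[OF u] this]
    show "integrable dom_leb (hardy_integrand A E u)" by (rule C(1))
    show "(LINT x|dom_leb. hardy_integrand A E u x) = (LINT x|dom_leb. hardy_weight x * (u x)\<^sup>2)"
      by (rule C(2)[symmetric])
  qed
  \<comment> \<open>For every \<open>u\<close> in \<open>H1 \<Omega>\<close> this is an equality;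
    the Lipschitz case is obtained by showing that such functions belong to
    \<open>H1 \<Omega>\<close>.\<close>
  have one: "set_integrable lebesgue \<Omega> (\<lambda>x. ?E x * norm_sq A x (weak_gradient \<Omega> v x))"
    "dirichlet_integral \<Omega> A u + 1/2 * (LINT x:\<Omega>|lebesgue. (u x)\<^sup>2)
       = 1/4 * (LINT x:\<Omega>|lebesgue. hardy_integrand A E u x)
         + (LINT x:\<Omega>|lebesgue. ?E x * norm_sq A x (weak_gradient \<Omega> v x))"
    if u: "u \<in> H1 \<Omega>" and v: "v = (\<lambda>x. ?E x powr (-1/2) * u x)" for u v
  proof -
    have vv: "v x = e x powr (-1/2) * u x" if "x \<in> \<Omega> - K" for x using Ee'[OF that] v by simp
    have G1: "integrable dom_leb (\<lambda>x. e x * norm_sq B x (weak_gradient \<Omega> v x))"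
      by (rule hardy_ground_state(1)[OF u]) (rule vv)
    have G2: "dirichlet_integral \<Omega> B u + 1/2 * (LINT x|dom_leb. (u x)\<^sup>2)
      = 1/4 * (LINT x|dom_leb. hardy_weight x * (u x)\<^sup>2) + (LINT x|dom_leb. e x * norm_sq B x (weak_gradient \<Omega> v x))"
      by (rule hardy_ground_state(2)[OF u]) (rule vv)
    have "AE x in dom_leb. e x * norm_sq B x (weak_gradient \<Omega> v x) = ?E x * norm_sq A x (weak_gradient \<Omega> v x)"
      using AE_not_singular by eventually_elim (simp add: Ee' nB)
    note C = LINT_cong_AE_integrable[OF G1 this]
    show "set_integrable lebesgue \<Omega> (\<lambda>x. ?E x * norm_sq A x (weak_gradient \<Omega> v x))"
      using C(1) by (simp add: integrable_dom_leb)
    show "dirichlet_integral \<Omega> A u + 1/2 * (LINT x:\<Omega>|lebesgue. (u x)\<^sup>2)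
       = 1/4 * (LINT x:\<Omega>|lebesgue. hardy_integrand A E u x)
         + (LINT x:\<Omega>|lebesgue. ?E x * norm_sq A x (weak_gradient \<Omega> v x))"
      using G2 C(2) unfolding LINT_dom_leb[symmetric] HI[OF u] dirB by argo
  qed
  show ?thesis
  proof (intro conjI ballI allI impI)
    fix u v assume u: "u \<in> lipschitz_compact_support \<Omega> K" and v: "v = (\<lambda>x. ?E x powr (-1/2) * u x)"
    note uH = Lipschitz_H1[OF u]
    show "set_integrable lebesgue \<Omega> (hardy_integrand A E u)" using Hi[OF uH] by (simp add: integrable_dom_leb)
    show "set_integrable lebesgue \<Omega> (\<lambda>x. ?E x * norm_sq A x (weak_gradient \<Omega> v x))" by (rule one(1)[OF uH v])
    show "1/4 * (LINT x:\<Omega>|lebesgue. hardy_integrand A E u x)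
        + (LINT x:\<Omega>|lebesgue. ?E x * norm_sq A x (weak_gradient \<Omega> v x))
      \<le> dirichlet_integral \<Omega> A u + 1/2 * (LINT x:\<Omega>|lebesgue. (u x)\<^sup>2)"
      unfolding one(2)[OF uH v] by (rule order_refl)
  next
    fix u assume u: "u \<in> H1 \<Omega>"
    show "set_integrable lebesgue \<Omega> (hardy_integrand A E u)" using Hi[OF u] by (simp add: integrable_dom_leb)
    show "1/4 * (LINT x:\<Omega>|lebesgue. hardy_integrand A E u x)
      \<le> dirichlet_integral \<Omega> A u + 1/2 * (LINT x:\<Omega>|lebesgue. (u x)\<^sup>2)"
      using hardy_inequality(2)[OF u] unfolding LINT_dom_leb[symmetric] HI[OF u] dirB .
  next
    fix a :: real assume "a < 1/2"
    from hardy_half_optimal[OF this] obtain u where u: "u \<in> H1 \<Omega>"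
      "dirichlet_integral \<Omega> B u + a * (LINT x|dom_leb. (u x)\<^sup>2) < 1/4 * (LINT x|dom_leb. hardy_weight x * (u x)\<^sup>2)" by blast
    then have "dirichlet_integral \<Omega> A u + a * (LINT x:\<Omega>|lebesgue. (u x)\<^sup>2) < 1/4 * (LINT x:\<Omega>|lebesgue. hardy_integrand A E u x)"
      unfolding LINT_dom_leb[symmetric] HI[OF u(1)] dirB by simp
    then show "\<not> (\<forall>u\<in>H1 \<Omega>. 1/4 * (LINT x:\<Omega>|lebesgue. hardy_integrand A E u x)
        \<le> dirichlet_integral \<Omega> A u + a * (LINT x:\<Omega>|lebesgue. (u x)\<^sup>2))"
      using u(1) by (metis not_le)
  next
    fix a :: real assume "a > 1/4"
    from hardy_quarter_optimal[OF this] obtain u where u: "u \<in> H1 \<Omega>"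
      "dirichlet_integral \<Omega> B u + 1/2 * (LINT x|dom_leb. (u x)\<^sup>2) < a * (LINT x|dom_leb. hardy_weight x * (u x)\<^sup>2)" by blast
    then have "dirichlet_integral \<Omega> A u + 1/2 * (LINT x:\<Omega>|lebesgue. (u x)\<^sup>2) < a * (LINT x:\<Omega>|lebesgue. hardy_integrand A E u x)"
      unfolding LINT_dom_leb[symmetric] HI[OF u(1)] dirB by simp
    then show "\<not> (\<forall>u\<in>H1 \<Omega>. a * (LINT x:\<Omega>|lebesgue. hardy_integrand A E u x)
        \<le> dirichlet_integral \<Omega> A u + 1/2 * (LINT x:\<Omega>|lebesgue. (u x)\<^sup>2))"
      using u(1) by (metis not_le)
  next
    fix u assume u: "u \<in> H1 \<Omega>" and nz: "\<not> (AE x in lebesgue. x \<in> \<Omega> \<longrightarrow> u x = 0)"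
    show "dirichlet_integral \<Omega> A u + 1/2 * (LINT x:\<Omega>|lebesgue. (u x)\<^sup>2) \<noteq> 1/4 * (LINT x:\<Omega>|lebesgue. hardy_integrand A E u x)"
      using hardy_not_attained[OF u] nz unfolding LINT_dom_leb[symmetric] HI[OF u] dirB AE_dom_leb by blast
  qed
qed

end
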